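(* Let $x$ be an object of $\mathcal A$ and $\chi$ an irreducible character of $A=\mathrm{Aut}_{\mathcal A}(x)$. Then $$\dim_{\mathcal T}[x]^0_\chi=\langle\chi_{[x]^0}\mid\chi\rangle_A ,$$ where the class function $\chi_{[x]^0}:A\to\mathbb K$ is defined by $$\chi_{[x]^0}(g):=\sum_{z\in\mathrm q(x)^g,\ x_g\le z\le\hat x_g}\mu_{\mathrm q(x)^g}(x,z)\,\omega_z .$$ Here $\langle\cdot\mid\cdot\rangle_A$ is the usual pairing, so that explicitly $$\dim_{\mathcal T}[x]^0_\chi=\frac1{|A|}\sum_{g\in A}\chi(g)\sum_{z\in\mathrm q(x)^g,\ x_g\le z\le\hat x_g}\mu_{\mathrm q(x)^g}(x,z)\,\omega_z .$$
   Context: Standing assumptions. $\mathbb K$ is an algebraically closed field of characteristic $0$. $\mathcal A$ is a finitely complete category with terminal object $\ast$. Monomorphisms are called injective ($\hookrightarrow$) and define subobjects of their target; the image of a morphism $y\to x$ is the smallest subobject of $x$ through which it factors; a morphism is surjective ($\twoheadrightarrow$) if its image is its whole target. $\mathcal A$ is assumed regular (every morphism has an image and surjectivity is preserved under pullback), subobject finite (each object has finitely many subobjects), exact (every equivalence relation $r\subseteq x\times x$ is effective, i.e. is the kernel pair of a surjective $x\twoheadrightarrow x/r$), Mal'cev (every reflexive relation $r\subseteq x\times x$ is an equivalence relation), and $\ast$ has no proper subobject. A degree function $\delta$ assigns to each surjective morphism $e$ an element $\delta(e)\in\mathbb K$ with $\delta(\mathrm{id}_x)=1$, $\delta(e')=\delta(e)$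 whenever $e'$ is a pullback of $e$, and $\delta(ef)=\delta(e)\delta(f)$ for composable surjective $e,f$. For surjective $e:x\twoheadrightarrow z$ put $\omega_e:=\sum_{y\subseteq x,\ e(y)=z}\mu_{\mathrm s}(y,x)\,\delta(e|_y)$, where $\mu_{\mathrm s}$ is the Möbius function of the finite poset $\mathrm s(x)$ of subobjects of $x$ ordered by inclusion; $\omega_x:=\omega_{x\twoheadrightarrow\ast}=\sum_{y\in\mathrm s(x)}\mu_{\mathrm s}(y,x)\,\delta(y\twoheadrightarrow\ast)$. $\delta$ is assumed non-degenerate: $\omega_e\neq0$ for all surjective $e$. The category $\mathcal T=\mathcal T(\mathcal A,\delta)$. Let $\mathcal T^0$ have objects $[x]$, $x\in\mathcal A$, where $\mathrm{Hom}([x],[y])$ is the $\mathbb K$-vector space with basis $\langle r\rangle$, $r\subseteq x\times y$ a subobject; $\langle r\rangle:[x]\to[y]$ followed by $\langle s\rangle:[y]\to[z]$ is $\delta(r\times_ys\twoheadrightarrow r\circ s)\langle r\circ s\rangle$ with $r\circ s=\mathrm{image}(r\times_ys\to x\times z)$. $\mathcal T$ is the pseudo-abelian (idempotent) completion of the additive completion of $\mathcal T^0$. It is a semisimple rigid symmetric monoidal category with $[x]\otimes[y]=[x\times y]$, unit $I=[\ast]$, $\mathrm{End}(I)=\mathbb K$, $[x]^\vee=[x]$ and $\langle r\rangle^\vee=\langle r^\vee\rangle$ (factors swapped). A morphism $f:x\to y$ gives $[f]=\langle\Gamma_f\rangle:[x]\to[y]$ with $\Gamma_f$ its graph. The finite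 group $\mathrm{Aut}_{\mathcal A}(x)$ acts on $[x]$ by $g\mapsto[g]$. $\dim_{\mathcal T}X\in\mathbb K$ is the internal (categorical) dimension, i.e. the categorical trace of $\mathrm{id}_X$. Simple objects. $z$ is a subquotient of $x$ if there are a subobject $y\subseteq x$ and a surjection $y\twoheadrightarrow z$; it is proper if $z\not\cong x$. $[x]^1$ denotes the unique direct summand of $[x]$ which is isomorphic to a direct summand of a finite direct sum $\bigoplus[z_i]$ with all $z_i$ proper subquotients of $x$, and such that every morphism $[z]\to[x]$ with $z$ a proper subquotient of $x$ factors through $[x]^1$. It has a unique complement $[x]^0$ in $[x]$, and $\mathbb K[\mathrm{Aut}_{\mathcal A}(x)]\to\mathrm{End}_{\mathcal T}([x]^0)$ is an isomorphism. Hence $[x]^0=\bigoplus_\chi V_\chi\otimes_{\mathbb K}[x]^0_\chi$ ($\chi$ over the irreducible characters of $\mathrm{Aut}_{\mathcal A}(x)$, $V_\chi$ the irreducible module with character $\chi$) with $[x]^0_\chi$ simple. Quotient lattice. $\mathrm q(x)$ is the set of quotient objects of $x$ (equivalence classes of surjective $x\twoheadrightarrow z$), ordered by $z\le z'$ if $x\twoheadrightarrow z'$ factors as $x\twoheadrightarrow z\twoheadrightarrow z'$; thus $x$ is the minimum. It is a finite modular lattice on which $\mathrm{Aut}_{\mathcal A}(x)$ acts. For $g\in\mathrm{Aut}_{\mathcal A}(x)$, $\mathrm q(x)^g=\{z\in\mathrm q(x)\mid gz=z\}$ is the fixed point sublattice and $\mu_{\mathrm q(x)^g}$ its Möbius function.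 For $z\in\mathrm q(x)^g$, $g|_z$ denotes the induced automorphism of $z$. $x_g\in\mathrm q(x)^g$ is the minimal element $z$ with $g|_z=\mathrm{id}_z$ (for $z\in\mathrm q(x)^g$, $g|_z=\mathrm{id}_z$ iff $z\ge x_g$). $\hat x_g\in\mathrm q(x)^g$ is the join of all atoms of $\mathrm q(x)^g$. *)

theory Defs
  imports
    "HOL-Computational_Algebra.Polynomial"
    "HOL-Algebra.Group"
    "Jordan_Normal_Form.Matrix"
begin

section \<open>Categories\<close>

record ('o, 'm) cat =
  Obj :: "'o set"
  Arr :: "'m set"
  Dom :: "'m \<Rightarrow> 'o"
  Cod :: "'m \<Rightarrow> 'o"
  Ident :: "'o \<Rightarrow> 'm"
  Comp :: "'m \<Rightarrow> 'm \<Rightarrow> 'm"  (infixl "\<cdot>\<index>" 75)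

text \<open>\<open>g \<cdot> f\<close> is \<open>f\<close> followed by \<open>g\<close>; it is meaningful only if the codomain of \<open>f\<close>
  is the domain of \<open>g\<close>.\<close>

definition Hom :: "('o, 'm, 'e) cat_scheme \<Rightarrow> 'o \<Rightarrow> 'o \<Rightarrow> 'm set" where
  "Hom C x y = {f \<in> Arr C. Dom C f = x \<and> Cod C f = y}"

locale category =
  fixes C :: "('o, 'm, 'e) cat_scheme" (structure)
  assumes dom_obj: "f \<in> Arr C \<Longrightarrow> Dom C f \<in> Obj C"
    and cod_obj: "f \<in> Arr C \<Longrightarrow> Cod C f \<in> Obj C"
    and ident_hom: "x \<in> Obj C \<Longrightarrow> Ident C x \<in> Hom C x x"
    and comp_hom: "\<lbrakk>f \<in> Hom C x y; g \<in> Hom C y z\<rbrakk> \<Longrightarrow> g \<cdot> f \<in> Hom C x z"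
    and comp_ident: "f \<in> Hom C x y \<Longrightarrow> f \<cdot> Ident C x = f"
    and ident_comp: "f \<in> Hom C x y \<Longrightarrow> Ident C y \<cdot> f = f"
    and comp_assoc: "\<lbrakk>f \<in> Hom C w x; g \<in> Hom C x y; h \<in> Hom C y z\<rbrakk> \<Longrightarrow> h \<cdot> (g \<cdot> f) = (h \<cdot> g) \<cdot> f"

definition is_mono :: "('o, 'm, 'e) cat_scheme \<Rightarrow> 'm \<Rightarrow> bool" where
  "is_mono C f \<longleftrightarrow> f \<in> Arr C \<and>
    (\<forall>t. \<forall>g\<in>Hom C t (Dom C f). \<forall>h\<in>Hom C t (Dom C f). f \<cdot>\<^bsub>C\<^esub> g = f \<cdot>\<^bsub>C\<^esub> h \<longrightarrow> g = h)"

definition is_iso :: "('o, 'm, 'e) cat_scheme \<Rightarrow> 'm \<Rightarrow> bool" where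
  "is_iso C f \<longleftrightarrow> f \<in> Arr C \<and>
    (\<exists>g\<in>Hom C (Cod C f) (Dom C f).
       g \<cdot>\<^bsub>C\<^esub> f = Ident C (Dom C f) \<and> f \<cdot>\<^bsub>C\<^esub> g = Ident C (Cod C f))"

definition isomorphic :: "('o, 'm, 'e) cat_scheme \<Rightarrow> 'o \<Rightarrow> 'o \<Rightarrow> bool" where
  "isomorphic C x y \<longleftrightarrow> (\<exists>f\<in>Hom C x y. is_iso C f)"


subsection \<open>Finite completeness\<close>

definition is_diagram ::
  "('j, 'u) cat \<Rightarrow> ('o, 'm, 'e) cat_scheme \<Rightarrow> ('j \<Rightarrow> 'o) \<Rightarrow> ('u \<Rightarrow> 'm) \<Rightarrow> bool" where
  "is_diagram J C Fo Fa \<longleftrightarrow>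
    (\<forall>j\<in>Obj J. Fo j \<in> Obj C \<and> Fa (Ident J j) = Ident C (Fo j)) \<and>
    (\<forall>u\<in>Arr J. Fa u \<in> Hom C (Fo (Dom J u)) (Fo (Cod J u))) \<and>
    (\<forall>u\<in>Arr J. \<forall>v\<in>Arr J. Dom J v = Cod J u \<longrightarrow> Fa (v \<cdot>\<^bsub>J\<^esub> u) = Fa v \<cdot>\<^bsub>C\<^esub> Fa u)"

definition is_cone ::
  "('j, 'u) cat \<Rightarrow> ('o, 'm, 'e) cat_scheme \<Rightarrow> ('j \<Rightarrow> 'o) \<Rightarrow> ('u \<Rightarrow> 'm) \<Rightarrow> 'o \<Rightarrow> ('j \<Rightarrow> 'm) \<Rightarrow> bool"
  where
  "is_cone J C Fo Fa l c \<longleftrightarrow> l \<in> Obj C \<and>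
    (\<forall>j\<in>Obj J. c j \<in> Hom C l (Fo j)) \<and>
    (\<forall>u\<in>Arr J. Fa u \<cdot>\<^bsub>C\<^esub> c (Dom J u) = c (Cod J u))"

definition is_limit ::
  "('j, 'u) cat \<Rightarrow> ('o, 'm, 'e) cat_scheme \<Rightarrow> ('j \<Rightarrow> 'o) \<Rightarrow> ('u \<Rightarrow> 'm) \<Rightarrow> 'o \<Rightarrow> ('j \<Rightarrow> 'm) \<Rightarrow> bool"
  where
  "is_limit J C Fo Fa l c \<longleftrightarrow> is_cone J C Fo Fa l c \<and>
    (\<forall>l' c'. is_cone J C Fo Fa l' c' \<longrightarrow>
       (\<exists>!h. h \<in> Hom C l' l \<and> (\<forall>j\<in>Obj J. c j \<cdot>\<^bsub>C\<^esub> h = c' j)))"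

text \<open>Every finite category is isomorphic to one whose objects and arrows are natural numbers,
  so these shapes exhaust all finite diagrams.\<close>

definition finitely_complete :: "('o, 'm, 'e) cat_scheme \<Rightarrow> bool" where
  "finitely_complete C \<longleftrightarrow>
    (\<forall>(J :: (nat, nat) cat) Fo Fa.
       category J \<and> finite (Obj J) \<and> finite (Arr J) \<and> is_diagram J C Fo Fa \<longrightarrow>
       (\<exists>l c. is_limit J C Fo Fa l c))"

definition is_terminal :: "('o, 'm, 'e) cat_scheme \<Rightarrow> 'o \<Rightarrow> bool" where
  "is_terminal C t \<longleftrightarrow> t \<in> Obj C \<and> (\<forall>x\<in>Obj C. \<exists>!f. f \<in> Hom C x t)"

definition is_product :: "('o, 'm, 'e) cat_scheme \<Rightarrow> 'o \<Rightarrow> 'o \<Rightarrow> 'o \<Rightarrow> 'm \<Rightarrow> 'm \<Rightarrow> bool" where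
  "is_product C x y p a b \<longleftrightarrow> a \<in> Hom C p x \<and> b \<in> Hom C p y \<and>
    (\<forall>t. \<forall>f\<in>Hom C t x. \<forall>g\<in>Hom C t y. \<exists>!h. h \<in> Hom C t p \<and> a \<cdot>\<^bsub>C\<^esub> h = f \<and> b \<cdot>\<^bsub>C\<^esub> h = g)"

text \<open>\<open>is_pullback C f g p q\<close>: the square \<open>f p = g q\<close> is cartesian; \<open>q\<close> is the pullback of \<open>f\<close>
  along \<open>g\<close>.\<close>

definition is_pullback :: "('o, 'm, 'e) cat_scheme \<Rightarrow> 'm \<Rightarrow> 'm \<Rightarrow> 'm \<Rightarrow> 'm \<Rightarrow> bool" where
  "is_pullback C f g p q \<longleftrightarrow>
    f \<in> Arr C \<and> g \<in> Arr C \<and> Cod C f = Cod C g \<and>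
    p \<in> Hom C (Dom C p) (Dom C f) \<and> q \<in> Hom C (Dom C p) (Dom C g) \<and> f \<cdot>\<^bsub>C\<^esub> p = g \<cdot>\<^bsub>C\<^esub> q \<and>
    (\<forall>t. \<forall>p'\<in>Hom C t (Dom C f). \<forall>q'\<in>Hom C t (Dom C g). f \<cdot>\<^bsub>C\<^esub> p' = g \<cdot>\<^bsub>C\<^esub> q' \<longrightarrow>
       (\<exists>!h. h \<in> Hom C t (Dom C p) \<and> p \<cdot>\<^bsub>C\<^esub> h = p' \<and> q \<cdot>\<^bsub>C\<^esub> h = q'))"

text \<open>Chosen limits.\<close>

definition term_obj :: "('o, 'm, 'e) cat_scheme \<Rightarrow> 'o" where
  "term_obj C = (SOME t. is_terminal C t)"

definition to_term :: "('o, 'm, 'e) cat_scheme \<Rightarrow> 'o \<Rightarrow> 'm" where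
  "to_term C x = (THE f. f \<in> Hom C x (term_obj C))"

definition prd_cone :: "('o, 'm, 'e) cat_scheme \<Rightarrow> 'o \<Rightarrow> 'o \<Rightarrow> 'o \<times> 'm \<times> 'm" where
  "prd_cone C x y = (SOME (p, a, b). is_product C x y p a b)"

definition prd :: "('o, 'm, 'e) cat_scheme \<Rightarrow> 'o \<Rightarrow> 'o \<Rightarrow> 'o" where
  "prd C x y = fst (prd_cone C x y)"

definition pr1 :: "('o, 'm, 'e) cat_scheme \<Rightarrow> 'o \<Rightarrow> 'o \<Rightarrow> 'm" where
  "pr1 C x y = fst (snd (prd_cone C x y))"

definition pr2 :: "('o, 'm, 'e) cat_scheme \<Rightarrow> 'o \<Rightarrow> 'o \<Rightarrow> 'm" where
  "pr2 C x y = snd (snd (prd_cone C x y))"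

definition pairing :: "('o, 'm, 'e) cat_scheme \<Rightarrow> 'm \<Rightarrow> 'm \<Rightarrow> 'm" where
  "pairing C f g = (THE h. h \<in> Hom C (Dom C f) (prd C (Cod C f) (Cod C g)) \<and>
     pr1 C (Cod C f) (Cod C g) \<cdot>\<^bsub>C\<^esub> h = f \<and> pr2 C (Cod C f) (Cod C g) \<cdot>\<^bsub>C\<^esub> h = g)"

definition pb :: "('o, 'm, 'e) cat_scheme \<Rightarrow> 'm \<Rightarrow> 'm \<Rightarrow> 'm \<times> 'm" where
  "pb C f g = (SOME (p, q). is_pullback C f g p q)"


subsection \<open>Subobjects, images, surjective morphisms\<close>

definition factors_through :: "('o, 'm, 'e) cat_scheme \<Rightarrow> 'm \<Rightarrow> 'm \<Rightarrow> bool" where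
  "factors_through C f m \<longleftrightarrow> (\<exists>h\<in>Hom C (Dom C f) (Dom C m). f = m \<cdot>\<^bsub>C\<^esub> h)"

text \<open>A subobject is the equivalence class of a monomorphism.\<close>

definition sub_class :: "('o, 'm, 'e) cat_scheme \<Rightarrow> 'm \<Rightarrow> 'm set" where
  "sub_class C m = {n. is_mono C n \<and> Cod C n = Cod C m \<and> factors_through C n m \<and> factors_through C m n}"

definition Sub :: "('o, 'm, 'e) cat_scheme \<Rightarrow> 'o \<Rightarrow> 'm set set" where
  "Sub C x = sub_class C ` {m. is_mono C m \<and> Cod C m = x}"

definition sub_top :: "('o, 'm, 'e) cat_scheme \<Rightarrow> 'o \<Rightarrow> 'm set" where
  "sub_top C x = sub_class C (Ident C x)"

definition incl :: "'m set \<Rightarrow> 'm" where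
  "incl S = (SOME m. m \<in> S)"

definition factors_sub :: "('o, 'm, 'e) cat_scheme \<Rightarrow> 'm \<Rightarrow> 'm set \<Rightarrow> bool" where
  "factors_sub C f S \<longleftrightarrow> (\<exists>m\<in>S. factors_through C f m)"

definition sub_le :: "('o, 'm, 'e) cat_scheme \<Rightarrow> 'm set \<Rightarrow> 'm set \<Rightarrow> bool" where
  "sub_le C S T \<longleftrightarrow> (\<exists>m\<in>S. factors_sub C m T)"

definition sub_order :: "('o, 'm, 'e) cat_scheme \<Rightarrow> 'o \<Rightarrow> ('m set \<times> 'm set) set" where
  "sub_order C x = {(S, T). S \<in> Sub C x \<and> T \<in> Sub C x \<and> sub_le C S T}"

definition is_image :: "('o, 'm, 'e) cat_scheme \<Rightarrow> 'm \<Rightarrow> 'm set \<Rightarrow> bool" where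
  "is_image C f S \<longleftrightarrow> S \<in> Sub C (Cod C f) \<and> factors_sub C f S \<and>
     (\<forall>T\<in>Sub C (Cod C f). factors_sub C f T \<longrightarrow> sub_le C S T)"

definition image_sub :: "('o, 'm, 'e) cat_scheme \<Rightarrow> 'm \<Rightarrow> 'm set" where
  "image_sub C f = (THE S. is_image C f S)"

text \<open>The factor \<open>e\<close> in \<open>f = incl (image_sub C f) \<cdot> e\<close>.\<close>

definition image_surj :: "('o, 'm, 'e) cat_scheme \<Rightarrow> 'm \<Rightarrow> 'm" where
  "image_surj C f = (THE e. e \<in> Hom C (Dom C f) (Dom C (incl (image_sub C f))) \<and>
     f = incl (image_sub C f) \<cdot>\<^bsub>C\<^esub> e)"

definition is_surj :: "('o, 'm, 'e) cat_scheme \<Rightarrow> 'm \<Rightarrow> bool" where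
  "is_surj C f \<longleftrightarrow> f \<in> Arr C \<and> is_image C f (sub_top C (Cod C f))"


subsection \<open>The standing assumptions on the category\<close>

definition regular_cat :: "('o, 'm, 'e) cat_scheme \<Rightarrow> bool" where
  "regular_cat C \<longleftrightarrow> (\<forall>f\<in>Arr C. \<exists>S. is_image C f S) \<and>
     (\<forall>f g p q. is_surj C f \<and> is_pullback C f g p q \<longrightarrow> is_surj C q)"

definition subobject_finite :: "('o, 'm, 'e) cat_scheme \<Rightarrow> bool" where
  "subobject_finite C \<longleftrightarrow> (\<forall>x\<in>Obj C. finite (Sub C x))"

text \<open>Relations \<open>r \<subseteq> x \<times> x\<close> are treated through generalized elements: \<open>f\<close> and \<open>g\<close>, both \<open>t \<rightarrow> x\<close>,
  are related if \<open>(f, g) : t \<rightarrow> x \<times> x\<close> factors through \<open>r\<close>.\<close>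

definition related :: "('o, 'm, 'e) cat_scheme \<Rightarrow> 'm set \<Rightarrow> 'm \<Rightarrow> 'm \<Rightarrow> bool" where
  "related C r f g \<longleftrightarrow> factors_sub C (pairing C f g) r"

definition reflexive_rel :: "('o, 'm, 'e) cat_scheme \<Rightarrow> 'o \<Rightarrow> 'm set \<Rightarrow> bool" where
  "reflexive_rel C x r \<longleftrightarrow> r \<in> Sub C (prd C x x) \<and> (\<forall>t. \<forall>f\<in>Hom C t x. related C r f f)"

definition equivalence_rel :: "('o, 'm, 'e) cat_scheme \<Rightarrow> 'o \<Rightarrow> 'm set \<Rightarrow> bool" where
  "equivalence_rel C x r \<longleftrightarrow> reflexive_rel C x r \<and>
     (\<forall>t. \<forall>f\<in>Hom C t x. \<forall>g\<in>Hom C t x. related C r f g \<longrightarrow> related C r g f) \<and>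
     (\<forall>t. \<forall>f\<in>Hom C t x. \<forall>g\<in>Hom C t x. \<forall>h\<in>Hom C t x.
        related C r f g \<and> related C r g h \<longrightarrow> related C r f h)"

definition exact_cat :: "('o, 'm, 'e) cat_scheme \<Rightarrow> bool" where
  "exact_cat C \<longleftrightarrow> (\<forall>x\<in>Obj C. \<forall>r. equivalence_rel C x r \<longrightarrow>
     (\<exists>e. is_surj C e \<and> Dom C e = x \<and>
        is_pullback C e e (pr1 C x x \<cdot>\<^bsub>C\<^esub> incl r) (pr2 C x x \<cdot>\<^bsub>C\<^esub> incl r)))"

definition malcev_cat :: "('o, 'm, 'e) cat_scheme \<Rightarrow> bool" where
  "malcev_cat C \<longleftrightarrow> (\<forall>x\<in>Obj C. \<forall>r. reflexive_rel C x r \<longrightarrow> equivalence_rel C x r)"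

definition no_proper_subobject :: "('o, 'm, 'e) cat_scheme \<Rightarrow> 'o \<Rightarrow> bool" where
  "no_proper_subobject C x \<longleftrightarrow> Sub C x = {sub_top C x}"


section \<open>Degree functions\<close>

text \<open>Moebius function of a finite partial order, given as a reflexive relation on its carrier.\<close>

function moebius :: "('a \<times> 'a) set \<Rightarrow> 'a \<Rightarrow> 'a \<Rightarrow> int" where
  "moebius r a b =
    (if finite r \<and> Partial_order r \<and> (a, b) \<in> r
     then if a = b then 1
          else - (\<Sum>c\<in>{c. (a, c) \<in> r \<and> (c, b) \<in> r \<and> c \<noteq> b}. moebius r a c)
     else 0)"
  by pat_completeness auto
termination
proof (relation "measure (\<lambda>(r, a, b). card {c. (a, c) \<in> r \<and> (c, b) \<in> r})", goal_cases)
  case 1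
  show ?case by simp
next
  case (2 r a b c)
  then have fin: "finite r" and po: "Partial_order r" and ab: "(a, b) \<in> r" by auto
  from 2 have c: "(a, c) \<in> r" "(c, b) \<in> r" "c \<noteq> b" by auto
  from po have tr: "trans r" and an: "antisym r" and re: "Refl r"
    by (auto simp: partial_order_on_def preorder_on_def)
  have "{d. (a, d) \<in> r \<and> (d, b) \<in> r} \<subseteq> snd ` r"
  proof
    fix d assume "d \<in> {d. (a, d) \<in> r \<and> (d, b) \<in> r}"
    then have "(a, d) \<in> r" by simp
    then show "d \<in> snd ` r" by (rule image_eqI[rotated]) simp
  qed
  then have "finite {d. (a, d) \<in> r \<and> (d, b) \<in> r}" using fin finite_imageI finite_subset by blast
  moreover have "{d. (a, d) \<in> r \<and> (d, c) \<in> r} \<subset> {d. (a, d) \<in> r \<and> (d, b) \<in> r}"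
  proof (rule psubsetI)
    show "{d. (a, d) \<in> r \<and> (d, c) \<in> r} \<subseteq> {d. (a, d) \<in> r \<and> (d, b) \<in> r}"
      using c(2) transD[OF tr, of _ c b] by blast
    have "(b, b) \<in> r" using ab re unfolding refl_on_def Field_def by blast
    moreover have "(b, c) \<notin> r" using c antisymD[OF an, of b c] by blast
    ultimately show "{d. (a, d) \<in> r \<and> (d, c) \<in> r} \<noteq> {d. (a, d) \<in> r \<and> (d, b) \<in> r}"
      using ab by blast
  qed
  ultimately have "card {d. (a, d) \<in> r \<and> (d, c) \<in> r} < card {d. (a, d) \<in> r \<and> (d, b) \<in> r}"
    by (rule psubset_card_mono)
  then show ?case by simp
qed
declare moebius.simps [simp del]

definition degree_function :: "('o, 'm, 'e) cat_scheme \<Rightarrow> ('m \<Rightarrow> 'k::field) \<Rightarrow> bool" where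
  "degree_function C \<delta> \<longleftrightarrow>
     (\<forall>x\<in>Obj C. \<delta> (Ident C x) = 1) \<and>
     (\<forall>e g p e'. is_surj C e \<and> is_pullback C e g p e' \<longrightarrow> \<delta> e' = \<delta> e) \<and>
     (\<forall>e f. is_surj C e \<and> is_surj C f \<and> Dom C e = Cod C f \<longrightarrow> \<delta> (e \<cdot>\<^bsub>C\<^esub> f) = \<delta> e * \<delta> f)"

text \<open>The restriction \<open>e|\<^sub>y\<close> is \<open>e \<cdot> incl y\<close>, and \<open>e(y) = z\<close> says that it is surjective.\<close>

definition omega :: "('o, 'm, 'e) cat_scheme \<Rightarrow> ('m \<Rightarrow> 'k::field) \<Rightarrow> 'm \<Rightarrow> 'k" where
  "omega C \<delta> e = (\<Sum>y\<in>{y \<in> Sub C (Dom C e). is_surj C (e \<cdot>\<^bsub>C\<^esub> incl y)}.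
     of_int (moebius (sub_order C (Dom C e)) y (sub_top C (Dom C e))) * \<delta> (e \<cdot>\<^bsub>C\<^esub> incl y))"

definition omega_obj :: "('o, 'm, 'e) cat_scheme \<Rightarrow> ('m \<Rightarrow> 'k::field) \<Rightarrow> 'o \<Rightarrow> 'k" where
  "omega_obj C \<delta> x = omega C \<delta> (to_term C x)"

definition nondegenerate :: "('o, 'm, 'e) cat_scheme \<Rightarrow> ('m \<Rightarrow> 'k::field) \<Rightarrow> bool" where
  "nondegenerate C \<delta> \<longleftrightarrow> (\<forall>e. is_surj C e \<longrightarrow> omega C \<delta> e \<noteq> 0)"


section \<open>Linear tensor categories and their completions\<close>

text \<open>The structure maps of a linear symmetric monoidal category with duals. Associators and
  unitors are not recorded; they do not enter the trace.\<close>

record ('o, 'm, 'k) tcat = "('o, 'm) cat" +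
  Zero :: "'o \<Rightarrow> 'o \<Rightarrow> 'm"
  Plus :: "'m \<Rightarrow> 'm \<Rightarrow> 'm"
  Scale :: "'k \<Rightarrow> 'm \<Rightarrow> 'm"
  UnitO :: "'o"
  TenO :: "'o \<Rightarrow> 'o \<Rightarrow> 'o"
  TenA :: "'m \<Rightarrow> 'm \<Rightarrow> 'm"
  Braid :: "'o \<Rightarrow> 'o \<Rightarrow> 'm"
  DualO :: "'o \<Rightarrow> 'o"
  DualA :: "'m \<Rightarrow> 'm"
  Ev :: "'o \<Rightarrow> 'm"
  Coev :: "'o \<Rightarrow> 'm"

text \<open>\<open>Braid x y : x \<otimes> y \<rightarrow> y \<otimes> x\<close>, \<open>Ev x : x\<^sup>\<or> \<otimes> x \<rightarrow> 1\<close>, \<open>Coev x : 1 \<rightarrow> x \<otimes> x\<^sup>\<or>\<close>.\<close>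

definition lsum :: "('o, 'm, 'k, 'e) tcat_scheme \<Rightarrow> 'o \<Rightarrow> 'o \<Rightarrow> 'm list \<Rightarrow> 'm" where
  "lsum L x y fs = foldr (Plus L) fs (Zero L x y)"

definition cat_trace :: "('o, 'm, 'k, 'e) tcat_scheme \<Rightarrow> 'm \<Rightarrow> 'k" where
  "cat_trace L f = (let x = Dom L f; x' = DualO L x in
     THE k. Ev L x \<cdot>\<^bsub>L\<^esub> (Braid L x x' \<cdot>\<^bsub>L\<^esub> (TenA L f (Ident L x') \<cdot>\<^bsub>L\<^esub> Coev L x))
            = Scale L k (Ident L (UnitO L)))"

definition cat_dim :: "('o, 'm, 'k, 'e) tcat_scheme \<Rightarrow> 'o \<Rightarrow> 'k" where
  "cat_dim L x = cat_trace L (Ident L x)"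


subsection \<open>Additive completion\<close>

text \<open>Objects are finite families \<open>xs\<close>, standing for the direct sum of their members. An arrow
  \<open>xs \<rightarrow> ys\<close> is a matrix whose entry in row \<open>j\<close> and column \<open>i\<close> is an arrow \<open>xs ! i \<rightarrow> ys ! j\<close>.
  The summand \<open>xs ! i \<otimes> ys ! j\<close> of a tensor product has index \<open>i * length ys + j\<close>.\<close>

type_synonym ('o, 'm) add_arr = "'o list \<times> 'm mat \<times> 'o list"

definition add_ten :: "('o, 'm, 'k, 'e) tcat_scheme \<Rightarrow> 'o list \<Rightarrow> 'o list \<Rightarrow> 'o list" where
  "add_ten L xs ys = concat (map (\<lambda>x. map (\<lambda>y. TenO L x y) ys) xs)"

definition add_compl ::
  "('o, 'm, 'k, 'e) tcat_scheme \<Rightarrow> ('o list, ('o, 'm) add_arr, 'k) tcat" where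
  "add_compl L = \<lparr>
     Obj = {xs. set xs \<subseteq> Obj L},
     Arr = {(xs, M, ys). set xs \<subseteq> Obj L \<and> set ys \<subseteq> Obj L \<and>
              M \<in> carrier_mat (length ys) (length xs) \<and>
              (\<forall>i<length xs. \<forall>j<length ys. M $$ (j, i) \<in> Hom L (xs ! i) (ys ! j))},
     Dom = (\<lambda>(xs, M, ys). xs),
     Cod = (\<lambda>(xs, M, ys). ys),
     Ident = (\<lambda>xs. (xs, mat (length xs) (length xs)
        (\<lambda>(j, i). if i = j then Ident L (xs ! i) else Zero L (xs ! i) (xs ! j)), xs)),
     Comp = (\<lambda>(ys', N, zs) (xs, M, ys). (xs, mat (length zs) (length xs)
        (\<lambda>(k, i). lsum L (xs ! i) (zs ! k)
                    (map (\<lambda>j. N $$ (k, j) \<cdot>\<^bsub>L\<^esub> M $$ (j, i)) [0..<length ys])), zs)),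
     Zero = (\<lambda>xs ys. (xs, mat (length ys) (length xs) (\<lambda>(j, i). Zero L (xs ! i) (ys ! j)), ys)),
     Plus = (\<lambda>(xs, M, ys) (xs', N, ys'). (xs, mat (length ys) (length xs)
        (\<lambda>(j, i). Plus L (M $$ (j, i)) (N $$ (j, i))), ys)),
     Scale = (\<lambda>k (xs, M, ys). (xs, mat (length ys) (length xs)
        (\<lambda>(j, i). Scale L k (M $$ (j, i))), ys)),
     UnitO = [UnitO L],
     TenO = add_ten L,
     TenA = (\<lambda>(xs, M, ys) (xs', M', ys'). (add_ten L xs xs',
        mat (length ys * length ys') (length xs * length xs')
          (\<lambda>(j, i). TenA L (M $$ (j div length ys', i div length xs'))
                             (M' $$ (j mod length ys', i mod length xs'))),
        add_ten L ys ys')),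
     Braid = (\<lambda>xs ys. (add_ten L xs ys,
        mat (length ys * length xs) (length xs * length ys)
          (\<lambda>(j, i). if i div length ys = j mod length xs \<and> i mod length ys = j div length xs
                     then Braid L (xs ! (i div length ys)) (ys ! (i mod length ys))
                     else Zero L (add_ten L xs ys ! i) (add_ten L ys xs ! j)),
        add_ten L ys xs)),
     DualO = map (DualO L),
     DualA = (\<lambda>(xs, M, ys). (map (DualO L) ys,
        mat (length xs) (length ys) (\<lambda>(i, j). DualA L (M $$ (j, i))), map (DualO L) xs)),
     Ev = (\<lambda>xs. let ds = add_ten L (map (DualO L) xs) xs; n = length xs in
        (ds, mat 1 (n * n) (\<lambda>(_, i). if i div n = i mod n then Ev L (xs ! (i mod n))
                                      else Zero L (ds ! i) (UnitO L)), [UnitO L])),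
     Coev = (\<lambda>xs. let ds = add_ten L xs (map (DualO L) xs); n = length xs in
        ([UnitO L], mat (n * n) 1 (\<lambda>(j, _). if j div n = j mod n then Coev L (xs ! (j mod n))
                                      else Zero L (UnitO L) (ds ! j)), ds)) \<rparr>"


subsection \<open>Idempotent completion\<close>

text \<open>An object is a pair of an object and an idempotent on it; an arrow \<open>(x, e) \<rightarrow> (y, e')\<close> is an
  arrow \<open>f : x \<rightarrow> y\<close> with \<open>e' f e = f\<close>.\<close>

type_synonym ('o, 'm) kar_arr = "('o \<times> 'm) \<times> 'm \<times> ('o \<times> 'm)"

definition kar_objs :: "('o, 'm, 'k, 'e) tcat_scheme \<Rightarrow> ('o \<times> 'm) set" where
  "kar_objs L = {(x, e). x \<in> Obj L \<and> e \<in> Hom L x x \<and> e \<cdot>\<^bsub>L\<^esub> e = e}"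

definition kar_ten :: "('o, 'm, 'k, 'e) tcat_scheme \<Rightarrow> 'o \<times> 'm \<Rightarrow> 'o \<times> 'm \<Rightarrow> 'o \<times> 'm" where
  "kar_ten L X Y = (TenO L (fst X) (fst Y), TenA L (snd X) (snd Y))"

definition kar_dual :: "('o, 'm, 'k, 'e) tcat_scheme \<Rightarrow> 'o \<times> 'm \<Rightarrow> 'o \<times> 'm" where
  "kar_dual L X = (DualO L (fst X), DualA L (snd X))"

definition kar_unit :: "('o, 'm, 'k, 'e) tcat_scheme \<Rightarrow> 'o \<times> 'm" where
  "kar_unit L = (UnitO L, Ident L (UnitO L))"

definition kar_compl ::
  "('o, 'm, 'k, 'e) tcat_scheme \<Rightarrow> ('o \<times> 'm, ('o, 'm) kar_arr, 'k) tcat" where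
  "kar_compl L = \<lparr>
     Obj = kar_objs L,
     Arr = {(X, f, Y). X \<in> kar_objs L \<and> Y \<in> kar_objs L \<and> f \<in> Hom L (fst X) (fst Y) \<and>
              snd Y \<cdot>\<^bsub>L\<^esub> (f \<cdot>\<^bsub>L\<^esub> snd X) = f},
     Dom = (\<lambda>(X, f, Y). X),
     Cod = (\<lambda>(X, f, Y). Y),
     Ident = (\<lambda>X. (X, snd X, X)),
     Comp = (\<lambda>(Y', g, Z) (X, f, Y). (X, g \<cdot>\<^bsub>L\<^esub> f, Z)),
     Zero = (\<lambda>X Y. (X, Zero L (fst X) (fst Y), Y)),
     Plus = (\<lambda>(X, f, Y) (X', g, Y'). (X, Plus L f g, Y)),
     Scale = (\<lambda>k (X, f, Y). (X, Scale L k f, Y)),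
     UnitO = kar_unit L,
     TenO = kar_ten L,
     TenA = (\<lambda>(X, f, Y) (X', f', Y'). (kar_ten L X X', TenA L f f', kar_ten L Y Y')),
     Braid = (\<lambda>X Y. (kar_ten L X Y,
        TenA L (snd Y) (snd X) \<cdot>\<^bsub>L\<^esub> (Braid L (fst X) (fst Y) \<cdot>\<^bsub>L\<^esub> TenA L (snd X) (snd Y)),
        kar_ten L Y X)),
     DualO = kar_dual L,
     DualA = (\<lambda>(X, f, Y). (kar_dual L Y, DualA L f, kar_dual L X)),
     Ev = (\<lambda>X. (kar_ten L (kar_dual L X) X,
        Ev L (fst X) \<cdot>\<^bsub>L\<^esub> TenA L (DualA L (snd X)) (snd X), kar_unit L)),
     Coev = (\<lambda>X. (kar_unit L,
        TenA L (snd X) (DualA L (snd X)) \<cdot>\<^bsub>L\<^esub> Coev L (fst X), kar_ten L X (kar_dual L X))) \<rparr>"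


section \<open>The tensor category of a regular category with a degree function\<close>

subsection \<open>Calculus of relations\<close>

definition graph :: "('o, 'm, 'e) cat_scheme \<Rightarrow> 'm \<Rightarrow> 'm set" where
  "graph C f = sub_class C (pairing C (Ident C (Dom C f)) f)"

text \<open>The morphism \<open>r \<times>\<^sub>y s \<rightarrow> x \<times> z\<close> for \<open>r \<subseteq> x \<times> y\<close> and \<open>s \<subseteq> y \<times> z\<close>.\<close>

definition rel_span ::
  "('o, 'm, 'e) cat_scheme \<Rightarrow> 'o \<Rightarrow> 'o \<Rightarrow> 'o \<Rightarrow> 'm set \<Rightarrow> 'm set \<Rightarrow> 'm" where
  "rel_span C x y z r s =
     (case pb C (pr2 C x y \<cdot>\<^bsub>C\<^esub> incl r) (pr1 C y z \<cdot>\<^bsub>C\<^esub> incl s) of (p, q) \<Rightarrow>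
        pairing C ((pr1 C x y \<cdot>\<^bsub>C\<^esub> incl r) \<cdot>\<^bsub>C\<^esub> p) ((pr2 C y z \<cdot>\<^bsub>C\<^esub> incl s) \<cdot>\<^bsub>C\<^esub> q))"

definition rel_comp ::
  "('o, 'm, 'e) cat_scheme \<Rightarrow> 'o \<Rightarrow> 'o \<Rightarrow> 'o \<Rightarrow> 'm set \<Rightarrow> 'm set \<Rightarrow> 'm set" where
  "rel_comp C x y z r s = image_sub C (rel_span C x y z r s)"

definition rel_deg ::
  "('o, 'm, 'e) cat_scheme \<Rightarrow> ('m \<Rightarrow> 'k) \<Rightarrow> 'o \<Rightarrow> 'o \<Rightarrow> 'o \<Rightarrow> 'm set \<Rightarrow> 'm set \<Rightarrow> 'k" where
  "rel_deg C \<delta> x y z r s = \<delta> (image_surj C (rel_span C x y z r s))"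

definition rel_op :: "('o, 'm, 'e) cat_scheme \<Rightarrow> 'o \<Rightarrow> 'o \<Rightarrow> 'm set \<Rightarrow> 'm set" where
  "rel_op C x y r = sub_class C (pairing C (pr2 C x y \<cdot>\<^bsub>C\<^esub> incl r) (pr1 C x y \<cdot>\<^bsub>C\<^esub> incl r))"

text \<open>For \<open>r \<subseteq> x \<times> y\<close> and \<open>s \<subseteq> x' \<times> y'\<close> the relation \<open>r \<times> s\<close>, regarded as a subobject of
  \<open>(x \<times> x') \<times> (y \<times> y')\<close>.\<close>

definition rel_ten ::
  "('o, 'm, 'e) cat_scheme \<Rightarrow> 'o \<Rightarrow> 'o \<Rightarrow> 'o \<Rightarrow> 'o \<Rightarrow> 'm set \<Rightarrow> 'm set \<Rightarrow> 'm set" where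
  "rel_ten C x y x' y' r s =
     (let p = pr1 C (Dom C (incl r)) (Dom C (incl s)); q = pr2 C (Dom C (incl r)) (Dom C (incl s)) in
      sub_class C (pairing C
        (pairing C ((pr1 C x y \<cdot>\<^bsub>C\<^esub> incl r) \<cdot>\<^bsub>C\<^esub> p) ((pr1 C x' y' \<cdot>\<^bsub>C\<^esub> incl s) \<cdot>\<^bsub>C\<^esub> q))
        (pairing C ((pr2 C x y \<cdot>\<^bsub>C\<^esub> incl r) \<cdot>\<^bsub>C\<^esub> p) ((pr2 C x' y' \<cdot>\<^bsub>C\<^esub> incl s) \<cdot>\<^bsub>C\<^esub> q))))"


subsection \<open>The category \<open>T\<^sup>0\<close>\<close>

text \<open>An arrow is \<open>(x, a, y)\<close> with \<open>a\<close> the coefficient function on the basis \<open>\<langle>r\<rangle>\<close>, \<open>r \<subseteq> x \<times> y\<close>.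
  The index set is finite in the subobject finite case, so every coefficient function occurs.\<close>

type_synonym ('o, 'm, 'k) rel_arr = "'o \<times> ('m set \<Rightarrow> 'k) \<times> 'o"

definition basis :: "'o \<Rightarrow> 'o \<Rightarrow> 'm set \<Rightarrow> ('o, 'm, 'k::field) rel_arr" where
  "basis x y r = (x, (\<lambda>t. if t = r then 1 else 0), y)"

definition br :: "('o, 'm, 'e) cat_scheme \<Rightarrow> 'm \<Rightarrow> ('o, 'm, 'k::field) rel_arr" where
  "br C f = basis (Dom C f) (Cod C f) (graph C f)"

definition T0 ::
  "('o, 'm, 'e) cat_scheme \<Rightarrow> ('m \<Rightarrow> 'k::field) \<Rightarrow> ('o, ('o, 'm, 'k) rel_arr, 'k) tcat" where
  "T0 C \<delta> = \<lparr>
     Obj = Obj C,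
     Arr = {(x, a, y). x \<in> Obj C \<and> y \<in> Obj C \<and> (\<forall>r. r \<notin> Sub C (prd C x y) \<longrightarrow> a r = 0)},
     Dom = (\<lambda>(x, a, y). x),
     Cod = (\<lambda>(x, a, y). y),
     Ident = (\<lambda>x. br C (Ident C x)),
     Comp = (\<lambda>(y', b, z) (x, a, y). (x, (\<lambda>t.
        \<Sum>r\<in>Sub C (prd C x y). \<Sum>s\<in>Sub C (prd C y z).
          if rel_comp C x y z r s = t then a r * b s * rel_deg C \<delta> x y z r s else 0), z)),
     Zero = (\<lambda>x y. (x, (\<lambda>t. 0), y)),
     Plus = (\<lambda>(x, a, y) (x', b, y'). (x, (\<lambda>t. a t + b t), y)),
     Scale = (\<lambda>k (x, a, y). (x, (\<lambda>t. k * a t), y)),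
     UnitO = term_obj C,
     TenO = prd C,
     TenA = (\<lambda>(x, a, y) (x', b, y'). (prd C x x', (\<lambda>t.
        \<Sum>r\<in>Sub C (prd C x y). \<Sum>s\<in>Sub C (prd C x' y').
          if rel_ten C x y x' y' r s = t then a r * b s else 0), prd C y y')),
     Braid = (\<lambda>x y. br C (pairing C (pr2 C x y) (pr1 C x y))),
     DualO = (\<lambda>x. x),
     DualA = (\<lambda>(x, a, y). (y, (\<lambda>t.
        \<Sum>r\<in>Sub C (prd C x y). if rel_op C x y r = t then a r else 0), x)),
     Ev = (\<lambda>x. basis (prd C x x) (term_obj C)
        (sub_class C (pairing C (pairing C (Ident C x) (Ident C x)) (to_term C x)))),
     Coev = (\<lambda>x. basis (term_obj C) (prd C x x)
        (sub_class C (pairing C (to_term C x) (pairing C (Ident C x) (Ident C x))))) \<rparr>"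


subsection \<open>The category \<open>T\<close>\<close>

type_synonym ('o, 'm, 'k) T_obj = "'o list \<times> ('o, ('o, 'm, 'k) rel_arr) add_arr"
type_synonym ('o, 'm, 'k) T_arr = "('o list, ('o, ('o, 'm, 'k) rel_arr) add_arr) kar_arr"

definition TT :: "('o, 'm, 'e) cat_scheme \<Rightarrow> ('m \<Rightarrow> 'k::field) \<Rightarrow>
    (('o, 'm, 'k) T_obj, ('o, 'm, 'k) T_arr, 'k) tcat" where
  "TT C \<delta> = kar_compl (add_compl (T0 C \<delta>))"

definition Tsum :: "('o, 'm, 'e) cat_scheme \<Rightarrow> ('m \<Rightarrow> 'k::field) \<Rightarrow> 'o list \<Rightarrow> ('o, 'm, 'k) T_obj" where
  "Tsum C \<delta> xs = (xs, Ident (add_compl (T0 C \<delta>)) xs)"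

text \<open>The object \<open>[x]\<close> and the arrow \<open>[f]\<close> of \<open>T\<close>.\<close>

definition Tob :: "('o, 'm, 'e) cat_scheme \<Rightarrow> ('m \<Rightarrow> 'k::field) \<Rightarrow> 'o \<Rightarrow> ('o, 'm, 'k) T_obj" where
  "Tob C \<delta> x = Tsum C \<delta> [x]"

definition Tbr :: "('o, 'm, 'e) cat_scheme \<Rightarrow> ('m \<Rightarrow> 'k::field) \<Rightarrow> 'm \<Rightarrow> ('o, 'm, 'k) T_arr" where
  "Tbr C \<delta> f =
     (Tob C \<delta> (Dom C f), ([Dom C f], mat 1 1 (\<lambda>_. br C f), [Cod C f]), Tob C \<delta> (Cod C f))"


section \<open>The objects \<open>[x]\<^sup>0\<close>\<close>

definition subquotient :: "('o, 'm, 'e) cat_scheme \<Rightarrow> 'o \<Rightarrow> 'o \<Rightarrow> bool" where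
  "subquotient C z x \<longleftrightarrow>
     (\<exists>m e. is_mono C m \<and> Cod C m = x \<and> is_surj C e \<and> Dom C e = Dom C m \<and> Cod C e = z)"

definition proper_subquotient :: "('o, 'm, 'e) cat_scheme \<Rightarrow> 'o \<Rightarrow> 'o \<Rightarrow> bool" where
  "proper_subquotient C z x \<longleftrightarrow> subquotient C z x \<and> \<not> isomorphic C z x"

text \<open>\<open>Y\<close> is a direct summand of \<open>X\<close> via \<open>i : Y \<rightarrow> X\<close> and \<open>p : X \<rightarrow> Y\<close>.\<close>

definition is_summand :: "('o, 'm, 'e) cat_scheme \<Rightarrow> 'o \<Rightarrow> 'o \<Rightarrow> 'm \<Rightarrow> 'm \<Rightarrow> bool" where
  "is_summand L X Y i p \<longleftrightarrow> i \<in> Hom L Y X \<and> p \<in> Hom L X Y \<and> p \<cdot>\<^bsub>L\<^esub> i = Ident L Y"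

definition is_x1 :: "('o, 'm, 'e) cat_scheme \<Rightarrow> ('m \<Rightarrow> 'k::field) \<Rightarrow> 'o \<Rightarrow>
    ('o, 'm, 'k) T_obj \<Rightarrow> ('o, 'm, 'k) T_arr \<Rightarrow> ('o, 'm, 'k) T_arr \<Rightarrow> bool" where
  "is_x1 C \<delta> x Y i p \<longleftrightarrow>
     is_summand (TT C \<delta>) (Tob C \<delta> x) Y i p \<and>
     (\<exists>zs. (\<forall>z\<in>set zs. proper_subquotient C z x) \<and>
        (\<exists>j q. is_summand (TT C \<delta>) (Tsum C \<delta> zs) Y j q)) \<and>
     (\<forall>z. proper_subquotient C z x \<longrightarrow>
        (\<forall>f\<in>Hom (TT C \<delta>) (Tob C \<delta> z) (Tob C \<delta> x). factors_through (TT C \<delta>) f i))"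

text \<open>\<open>Z\<close> with inclusion \<open>j\<close> and projection \<open>q\<close> is the complement \<open>[x]\<^sup>0\<close> of \<open>[x]\<^sup>1\<close>.\<close>

definition is_x0 :: "('o, 'm, 'e) cat_scheme \<Rightarrow> ('m \<Rightarrow> 'k::field) \<Rightarrow> 'o \<Rightarrow>
    ('o, 'm, 'k) T_obj \<Rightarrow> ('o, 'm, 'k) T_arr \<Rightarrow> ('o, 'm, 'k) T_arr \<Rightarrow> bool" where
  "is_x0 C \<delta> x Z j q \<longleftrightarrow>
     is_summand (TT C \<delta>) (Tob C \<delta> x) Z j q \<and>
     (\<exists>Y i p. is_x1 C \<delta> x Y i p \<and>
        Plus (TT C \<delta>) (i \<cdot>\<^bsub>TT C \<delta>\<^esub> p) (j \<cdot>\<^bsub>TT C \<delta>\<^esub> q) = Ident (TT C \<delta>) (Tob C \<delta> x))"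


section \<open>Characters and isotypic decomposition\<close>

definition AutG :: "('o, 'm, 'e) cat_scheme \<Rightarrow> 'o \<Rightarrow> 'm monoid" where
  "AutG C x = \<lparr>carrier = {g \<in> Hom C x x. is_iso C g},
     monoid.mult = (\<lambda>g h. g \<cdot>\<^bsub>C\<^esub> h), one = Ident C x\<rparr>"

definition is_rep :: "('g, 'b) monoid_scheme \<Rightarrow> nat \<Rightarrow> ('g \<Rightarrow> 'k::field mat) \<Rightarrow> bool" where
  "is_rep G n \<rho> \<longleftrightarrow>
     (\<forall>g\<in>carrier G. \<rho> g \<in> carrier_mat n n) \<and> \<rho> \<one>\<^bsub>G\<^esub> = 1\<^sub>m n \<and>
     (\<forall>g\<in>carrier G. \<forall>h\<in>carrier G. \<rho> (g \<otimes>\<^bsub>G\<^esub> h) = \<rho> g * \<rho> h)"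

definition is_subspace :: "nat \<Rightarrow> 'k::field vec set \<Rightarrow> bool" where
  "is_subspace n U \<longleftrightarrow> U \<subseteq> carrier_vec n \<and> 0\<^sub>v n \<in> U \<and>
     (\<forall>u\<in>U. \<forall>v\<in>U. u + v \<in> U) \<and> (\<forall>k. \<forall>u\<in>U. k \<cdot>\<^sub>v u \<in> U)"

definition is_irrep :: "('g, 'b) monoid_scheme \<Rightarrow> nat \<Rightarrow> ('g \<Rightarrow> 'k::field mat) \<Rightarrow> bool" where
  "is_irrep G n \<rho> \<longleftrightarrow> is_rep G n \<rho> \<and> n > 0 \<and>
     (\<forall>U. is_subspace n U \<and> (\<forall>g\<in>carrier G. \<forall>u\<in>U. \<rho> g *\<^sub>v u \<in> U) \<longrightarrow>
        U = {0\<^sub>v n} \<or> U = carrier_vec n)"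

definition rep_char :: "('g, 'b) monoid_scheme \<Rightarrow> ('g \<Rightarrow> 'k::field mat) \<Rightarrow> 'g \<Rightarrow> 'k" where
  "rep_char G \<rho> = (\<lambda>g\<in>carrier G. \<Sum>i<dim_row (\<rho> g). \<rho> g $$ (i, i))"

definition irr_chars :: "('g, 'b) monoid_scheme \<Rightarrow> ('g \<Rightarrow> 'k::field) set" where
  "irr_chars G = {rep_char G \<rho> | n \<rho>. is_irrep G n \<rho>}"

text \<open>\<open>Z = \<Oplus>\<^sub>\<chi> V\<^sub>\<chi> \<otimes> W \<chi>\<close>, compatibly with the action \<open>act\<close> of \<open>G\<close>: here \<open>V\<^sub>\<chi>\<close> is given by the
  matrix representation \<open>\<rho> \<chi>\<close> of degree \<open>n \<chi>\<close>, \<open>V\<^sub>\<chi> \<otimes> W \<chi>\<close> is the direct sum of \<open>n \<chi>\<close> copies of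
  \<open>W \<chi>\<close>, indexed by the standard basis of \<open>V\<^sub>\<chi>\<close>, and \<open>\<iota> \<chi> a\<close>, \<open>\<pi> \<chi> a\<close> are the inclusion of and the
  projection to the \<open>a\<close>-th copy. The last clause says that \<open>g\<close> acts by \<open>\<rho> \<chi> g \<otimes> id\<close>.\<close>

definition isotypic_decomposition ::
  "('o, 'm, 'k::field, 'e) tcat_scheme \<Rightarrow> ('g, 'b) monoid_scheme \<Rightarrow> ('g \<Rightarrow> 'm) \<Rightarrow> 'o \<Rightarrow>
   ('g \<Rightarrow> 'k) list \<Rightarrow> (('g \<Rightarrow> 'k) \<Rightarrow> nat) \<Rightarrow> (('g \<Rightarrow> 'k) \<Rightarrow> 'g \<Rightarrow> 'k mat) \<Rightarrow>
   (('g \<Rightarrow> 'k) \<Rightarrow> 'o) \<Rightarrow> (('g \<Rightarrow> 'k) \<Rightarrow> nat \<Rightarrow> 'm) \<Rightarrow> (('g \<Rightarrow> 'k) \<Rightarrow> nat \<Rightarrow> 'm) \<Rightarrow> bool" where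
  "isotypic_decomposition L G act Z \<chi>s n \<rho> W \<iota> \<pi> \<longleftrightarrow>
     distinct \<chi>s \<and> set \<chi>s = irr_chars G \<and>
     (\<forall>\<chi>\<in>set \<chi>s. is_irrep G (n \<chi>) (\<rho> \<chi>) \<and> rep_char G (\<rho> \<chi>) = \<chi> \<and> W \<chi> \<in> Obj L) \<and>
     (\<forall>\<chi>\<in>set \<chi>s. \<forall>a<n \<chi>. \<iota> \<chi> a \<in> Hom L (W \<chi>) Z \<and> \<pi> \<chi> a \<in> Hom L Z (W \<chi>)) \<and>
     (\<forall>\<chi>\<in>set \<chi>s. \<forall>\<psi>\<in>set \<chi>s. \<forall>a<n \<chi>. \<forall>b<n \<psi>.
        \<pi> \<chi> a \<cdot>\<^bsub>L\<^esub> \<iota> \<psi> b = (if \<chi> = \<psi> \<and> a = b then Ident L (W \<chi>) else Zero L (W \<psi>) (W \<chi>))) \<and>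
     lsum L Z Z (concat (map (\<lambda>\<chi>. map (\<lambda>a. \<iota> \<chi> a \<cdot>\<^bsub>L\<^esub> \<pi> \<chi> a) [0..<n \<chi>]) \<chi>s)) = Ident L Z \<and>
     (\<forall>g\<in>carrier G. \<forall>\<chi>\<in>set \<chi>s. \<forall>a<n \<chi>.
        act g \<cdot>\<^bsub>L\<^esub> \<iota> \<chi> a =
          lsum L (W \<chi>) Z (map (\<lambda>b. Scale L (\<rho> \<chi> g $$ (b, a)) (\<iota> \<chi> b)) [0..<n \<chi>]))"

text \<open>\<open>V\<close> is (a model of) \<open>[x]\<^sup>0\<^sub>\<chi>\<close>. An automorphism \<open>g\<close> of \<open>x\<close> acts on the direct summand \<open>[x]\<^sup>0\<close>
  of \<open>[x]\<close> through \<open>[g]\<close>.\<close>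

definition is_x0_chi :: "('o, 'm, 'e) cat_scheme \<Rightarrow> ('m \<Rightarrow> 'k::field) \<Rightarrow> 'o \<Rightarrow> ('m \<Rightarrow> 'k) \<Rightarrow>
    ('o, 'm, 'k) T_obj \<Rightarrow> bool" where
  "is_x0_chi C \<delta> x \<chi> V \<longleftrightarrow> \<chi> \<in> irr_chars (AutG C x) \<and>
     (\<exists>Z j q \<chi>s n \<rho> W \<iota> \<pi>. is_x0 C \<delta> x Z j q \<and>
        isotypic_decomposition (TT C \<delta>) (AutG C x)
          (\<lambda>g. q \<cdot>\<^bsub>TT C \<delta>\<^esub> (Tbr C \<delta> g \<cdot>\<^bsub>TT C \<delta>\<^esub> j)) Z \<chi>s n \<rho> W \<iota> \<pi> \<and>
        V = W \<chi>)"


section \<open>The quotient lattice\<close>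

definition quo_class :: "('o, 'm, 'e) cat_scheme \<Rightarrow> 'm \<Rightarrow> 'm set" where
  "quo_class C e = {e'. is_surj C e' \<and>
     (\<exists>h\<in>Hom C (Cod C e) (Cod C e'). is_iso C h \<and> e' = h \<cdot>\<^bsub>C\<^esub> e)}"

definition Quo :: "('o, 'm, 'e) cat_scheme \<Rightarrow> 'o \<Rightarrow> 'm set set" where
  "Quo C x = quo_class C ` {e. is_surj C e \<and> Dom C e = x}"

definition quo_bot :: "('o, 'm, 'e) cat_scheme \<Rightarrow> 'o \<Rightarrow> 'm set" where
  "quo_bot C x = quo_class C (Ident C x)"

definition quo_map :: "'m set \<Rightarrow> 'm" where
  "quo_map z = (SOME e. e \<in> z)"

definition quo_obj :: "('o, 'm, 'e) cat_scheme \<Rightarrow> 'm set \<Rightarrow> 'o" where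
  "quo_obj C z = Cod C (quo_map z)"

text \<open>The order is the one in which \<open>x\<close> itself is the least quotient of \<open>x\<close>.\<close>

definition quo_le :: "('o, 'm, 'e) cat_scheme \<Rightarrow> 'm set \<Rightarrow> 'm set \<Rightarrow> bool" where
  "quo_le C z z' \<longleftrightarrow> (\<exists>e\<in>z. \<exists>e'\<in>z'. \<exists>h\<in>Hom C (Cod C e) (Cod C e'). e' = h \<cdot>\<^bsub>C\<^esub> e)"

definition quo_act :: "('o, 'm, 'e) cat_scheme \<Rightarrow> 'o \<Rightarrow> 'm \<Rightarrow> 'm set \<Rightarrow> 'm set" where
  "quo_act C x g z = {e \<cdot>\<^bsub>C\<^esub> inv\<^bsub>AutG C x\<^esub> g | e. e \<in> z}"

definition Quo_fix :: "('o, 'm, 'e) cat_scheme \<Rightarrow> 'o \<Rightarrow> 'm \<Rightarrow> 'm set set" where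
  "Quo_fix C x g = {z \<in> Quo C x. quo_act C x g z = z}"

definition Quo_fix_order :: "('o, 'm, 'e) cat_scheme \<Rightarrow> 'o \<Rightarrow> 'm \<Rightarrow> ('m set \<times> 'm set) set" where
  "Quo_fix_order C x g = {(z, z'). z \<in> Quo_fix C x g \<and> z' \<in> Quo_fix C x g \<and> quo_le C z z'}"

text \<open>The automorphism \<open>g|\<^sub>z\<close> induced on a fixed quotient \<open>z\<close>.\<close>

definition induced :: "('o, 'm, 'e) cat_scheme \<Rightarrow> 'm \<Rightarrow> 'm set \<Rightarrow> 'm" where
  "induced C g z = (THE h. h \<in> Hom C (quo_obj C z) (quo_obj C z) \<and>
     h \<cdot>\<^bsub>C\<^esub> quo_map z = quo_map z \<cdot>\<^bsub>C\<^esub> g)"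

definition acts_trivially :: "('o, 'm, 'e) cat_scheme \<Rightarrow> 'm \<Rightarrow> 'm set \<Rightarrow> bool" where
  "acts_trivially C g z \<longleftrightarrow> induced C g z = Ident C (quo_obj C z)"

text \<open>\<open>x\<^sub>g\<close>\<close>

definition quo_triv :: "('o, 'm, 'e) cat_scheme \<Rightarrow> 'o \<Rightarrow> 'm \<Rightarrow> 'm set" where
  "quo_triv C x g = (THE z. z \<in> Quo_fix C x g \<and> acts_trivially C g z \<and>
     (\<forall>z'\<in>Quo_fix C x g. acts_trivially C g z' \<longrightarrow> quo_le C z z'))"

definition quo_atoms :: "('o, 'm, 'e) cat_scheme \<Rightarrow> 'o \<Rightarrow> 'm \<Rightarrow> 'm set set" where
  "quo_atoms C x g = {a \<in> Quo_fix C x g. a \<noteq> quo_bot C x \<and>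
     (\<forall>b\<in>Quo_fix C x g. quo_le C b a \<longrightarrow> b = quo_bot C x \<or> b = a)}"

text \<open>The join of all atoms, which is \<open>x\<close> itself if there are none.\<close>

definition quo_hat :: "('o, 'm, 'e) cat_scheme \<Rightarrow> 'o \<Rightarrow> 'm \<Rightarrow> 'm set" where
  "quo_hat C x g = (THE z. z \<in> Quo_fix C x g \<and> (\<forall>a\<in>quo_atoms C x g. quo_le C a z) \<and>
     (\<forall>z'\<in>Quo_fix C x g. (\<forall>a\<in>quo_atoms C x g. quo_le C a z') \<longrightarrow> quo_le C z z'))"

definition chi_x0 :: "('o, 'm, 'e) cat_scheme \<Rightarrow> ('m \<Rightarrow> 'k::field) \<Rightarrow> 'o \<Rightarrow> 'm \<Rightarrow> 'k" where
  "chi_x0 C \<delta> x g =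
     (\<Sum>z\<in>{z \<in> Quo_fix C x g. quo_le C (quo_triv C x g) z \<and> quo_le C z (quo_hat C x g)}.
        of_int (moebius (Quo_fix_order C x g) (quo_bot C x) z) * omega_obj C \<delta> (quo_obj C z))"

definition char_pairing :: "('g, 'b) monoid_scheme \<Rightarrow> ('g \<Rightarrow> 'k::field) \<Rightarrow> ('g \<Rightarrow> 'k) \<Rightarrow> 'k" where
  "char_pairing G \<phi> \<chi> = 1 / of_nat (card (carrier G)) * (\<Sum>g\<in>carrier G. \<chi> g * \<phi> g)"

end

theory Submission
 imports Defs "Jordan_Normal_Form.Char_Poly"
begin

text \<open>
 The trace of an endomorphism \<open>a\<close> of \<open>[x]\<close> is computed in two ways. The categorical trace of the span
 \<open>(f, g)\<close> is the degree of the equalizer of \<open>f\<close> and \<open>g\<close>. On the other hand \<open>a\<close> acts, up to terms from smaller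
 subquotients, on the relations from \<open>z\<close> to \<open>x\<close> that present \<open>z\<close> as a quotient of a subobject of \<open>x\<close>; averaging the
 traces of these actions composed with automorphisms \<open>h\<close> of \<open>z\<close> against the Moebius sums of \<open>\<omega>\<close> over the
 \<open>h\<close>-stable quotients of \<open>z\<close>, and adding over all subquotients \<open>z\<close>, gives a second cyclic functional. By Moebius
 inversion the two agree on automorphisms, and since by Goursat's lemma every other relation factors
 through a proper subquotient, they agree everywhere by cyclicity and induction. On the summand \<open>[x]\<^sup>0\<close>
 only \<open>z = x\<close> contributes to the second one, so the trace of \<open>g\<close> on \<open>[x]\<^sup>0\<close> is the Moebius sum over \<open>q(x)\<^sup>g\<close>.
 The dimension of an isotypic component then follows from the orthogonality of characters.
\<close>

text \<open>The idempotent \<open>E\<close> of [x]^0 is known only through what it kills, whereas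
  the categorical trace can be computed on spans alone; the second functional is designed to be
  evaluable on \<open>E\<close> from its defining properties. It is a trace because a relation from
  z to x outside \<open>Q z x\<close> stays outside when composed with any relation from x to x'.
  This rests on difunctionality, hence on the Mal'cev property, and makes the coefficients on
  \<open>Q z x\<close> a representation of the endomorphisms of [x]. The weights \<open>phi\<close>
  come from a linear system. The trace of an automorphism g of x is the sum of \<omega>_y over the
  subobjects y that g fixes pointwise, while the second functional counts each y through its
  quotients. Matching the two y by y asks that the values of \<open>phi\<close> at the g-stable
  quotients of y add up to \<omega>_y if g is the identity on y and to 0 otherwise; inversion in the
  lattice of g-stable quotients solves this. Identities in \<open>T0\<close> are checked on spans
  that need not be jointly monic: these compose by pullback without any degree factor.\<close>

no_notation (ASCII) Fun.comp (infixl \<open>o\<close> 55)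

section \<open>Finite limits\<close>

context category
begin

abbreviation dom where "dom \<equiv> Dom C"
abbreviation cod where "cod \<equiv> Cod C"
abbreviation ide where "ide \<equiv> Ident C"
abbreviation arr where "arr f \<equiv> f \<in> Arr C"
abbreviation ob where "ob x \<equiv> x \<in> Obj C"
abbreviation mono where "mono \<equiv> is_mono C"
abbreviation iso where "iso \<equiv> is_iso C"
abbreviation surj where "surj \<equiv> is_surj C"
abbreviation Aut where "Aut x \<equiv> carrier (AutG C x)"
abbreviation pairing where "pairing \<equiv> Defs.pairing C"
abbreviation prd where "prd \<equiv> Defs.prd C"
abbreviation Sub where "Sub \<equiv> Defs.Sub C"
abbreviation sub_class where "sub_class \<equiv> Defs.sub_class C"
abbreviation quo_class where "quo_class \<equiv> Defs.quo_class C"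
abbreviation pr1 where "pr1 \<equiv> Defs.pr1 C"
abbreviation pr2 where "pr2 \<equiv> Defs.pr2 C"
abbreviation Quo_fix where "Quo_fix \<equiv> Defs.Quo_fix C"
abbreviation to_term where "to_term \<equiv> Defs.to_term C"
abbreviation factors_through where "factors_through \<equiv> Defs.factors_through C"
abbreviation is_pullback where "is_pullback \<equiv> Defs.is_pullback C"
abbreviation Quo where "Quo \<equiv> Defs.Quo C"
abbreviation quo_le where "quo_le \<equiv> Defs.quo_le C"
abbreviation quo_obj where "quo_obj \<equiv> Defs.quo_obj C"
abbreviation isomorphic where "isomorphic \<equiv> Defs.isomorphic C"
abbreviation term_obj where "term_obj \<equiv> Defs.term_obj C"
abbreviation related where "related \<equiv> Defs.related C"
abbreviation image_surj where "image_surj \<equiv> Defs.image_surj C"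
abbreviation quo_bot where "quo_bot \<equiv> Defs.quo_bot C"
abbreviation sub_le where "sub_le \<equiv> Defs.sub_le C"
abbreviation sub_top where "sub_top \<equiv> Defs.sub_top C"
abbreviation image_sub where "image_sub \<equiv> Defs.image_sub C"
abbreviation subquotient where "subquotient \<equiv> Defs.subquotient C"
abbreviation induced where "induced \<equiv> Defs.induced C"
abbreviation acts_trivially where "acts_trivially \<equiv> Defs.acts_trivially C"
abbreviation rel_comp where "rel_comp \<equiv> Defs.rel_comp C"
abbreviation factors_sub where "factors_sub \<equiv> Defs.factors_sub C"
abbreviation graph where "graph \<equiv> Defs.graph C"
abbreviation sub_order where "sub_order \<equiv> Defs.sub_order C"
abbreviation Quo_fix_order where "Quo_fix_order \<equiv> Defs.Quo_fix_order C"
abbreviation pb where "pb \<equiv> Defs.pb C"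
abbreviation proper_subquotient where "proper_subquotient \<equiv> Defs.proper_subquotient C"
abbreviation rel_ten where "rel_ten \<equiv> Defs.rel_ten C"
abbreviation rel_op where "rel_op \<equiv> Defs.rel_op C"
abbreviation br where "br \<equiv> Defs.br C"

lemma hom_iff [simp]: "f \<in> Hom C x y \<longleftrightarrow> arr f \<and> dom f = x \<and> cod f = y"
 by (simp add: Hom_def)

declare dom_obj [simp] cod_obj [simp]

lemma ident_arr [simp]:
 assumes "ob x"
 shows "arr (ide x)" "dom (ide x) = x" "cod (ide x) = x"
 using ident_hom[OF assms] by auto

lemma comp_arr [simp]:
 assumes "arr f" "arr g" "dom g = cod f"
 shows "arr (g \<cdot> f)" "dom (g \<cdot> f) = dom f" "cod (g \<cdot> f) = cod g"
 using comp_hom[of f "dom f" "cod f" g "cod g"] assms by auto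

lemma comp_assoc' [simp]:
 assumes "arr f" "arr g" "arr h" "dom g = cod f" "dom h = cod g"
 shows "(h \<cdot> g) \<cdot> f = h \<cdot> (g \<cdot> f)"
 using comp_assoc[of f "dom f" "cod f" g "cod g" h "cod h"] assms by simp

lemma comp_ident' [simp]: "arr f ==> dom f = x ==> f \<cdot> ide x = f"
 using comp_ident[of f x "cod f"] by simp

lemma ident_comp' [simp]: "arr f ==> cod f = x ==> ide x \<cdot> f = f"
 using ident_comp[of f "dom f" x] by simp

text \<open>Composites are normalized to right-nested form, where the left-hand side of an equation
  \<open>g \<cdot> f = k\<close> no longer occurs as a subterm; this restates it for use in front of
  a further factor.\<close>

lemma reassoc:
 assumes "g \<cdot> f = k" "arr f" "arr g" "dom g = cod f" "arr h" "cod h = dom f"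
 shows "g \<cdot> (f \<cdot> h) = k \<cdot> h"
 using assms by (metis comp_assoc')

section \<open>Monomorphisms and isomorphisms\<close>

lemma monoD:
 assumes "mono f" "f \<cdot> g = f \<cdot> h" "arr g" "arr h" "dom g = dom h"
  "cod g = dom f" "cod h = dom f"
 shows "g = h"
 using assms unfolding is_mono_def by auto

lemma mono_arr [simp]: "mono f ==> arr f"
 by (simp add: is_mono_def)

lemma monoI:
 assumes "arr f"
  "\<And>g h. [|arr g; arr h; dom g = dom h; cod g = dom f; cod h = dom f;
    f \<cdot> g = f \<cdot> h|] ==> g = h"
 shows "mono f"
 using assms unfolding is_mono_def by auto

lemma mono_comp:
 assumes "mono f" "mono g" "dom g = cod f"
 shows "mono (g \<cdot> f)"
proof (rule monoI)
 fix a b assume ab: "arr a" "arr b" "dom a = dom b" "cod a = dom (g \<cdot> f)"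
  "cod b = dom (g \<cdot> f)" "(g \<cdot> f) \<cdot> a = (g \<cdot> f) \<cdot> b"
 with assms have "g \<cdot> (f \<cdot> a) = g \<cdot> (f \<cdot> b)" by simp
 hence "f \<cdot> a = f \<cdot> b" using monoD[OF assms(2)] ab assms by simp
 thus "a = b" using monoD[OF assms(1)] ab assms by simp
qed (use assms in simp)

lemma mono_cancel:
 assumes "mono (g \<cdot> f)" "arr f" "arr g" "dom g = cod f"
 shows "mono f"
proof (rule monoI)
 fix a b assume ab: "arr a" "arr b" "dom a = dom b" "cod a = dom f"
  "cod b = dom f" "f \<cdot> a = f \<cdot> b"
 thus "a = b" using monoD[OF assms(1), of a b] assms by simp
qed (use assms in simp)

lemma isoE:
 assumes "iso f"
 obtains g where "arr f" "arr g" "dom g = cod f" "cod g = dom f"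
  "g \<cdot> f = ide (dom f)" "f \<cdot> g = ide (cod f)" "iso g"
proof -
 from assms obtain g where f: "arr f" and g: "arr g" "dom g = cod f" "cod g = dom f"
  "g \<cdot> f = ide (dom f)" "f \<cdot> g = ide (cod f)"
  unfolding is_iso_def by auto
 hence "iso g" unfolding is_iso_def by (intro conjI bexI[of _ f]) auto
 with f g show ?thesis by (rule that)
qed

lemma isoI:
 assumes "arr f" "arr g" "dom g = cod f" "cod g = dom f"
  "g \<cdot> f = ide (dom f)" "f \<cdot> g = ide (cod f)"
 shows "iso f"
 using assms unfolding is_iso_def by (intro conjI bexI[of _ g]) auto

lemma iso_arr [simp]: "iso f ==> arr f"
 by (simp add: is_iso_def)

lemma iso_ident [simp]: "ob x ==> iso (ide x)"
 by (rule isoI[of _ "ide x"]) simp_all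

lemma iso_mono [simp]:
 assumes "iso f"
 shows "mono f"
proof -
 obtain g where g: "arr f" "arr g" "dom g = cod f" "cod g = dom f"
  "g \<cdot> f = ide (dom f)"
  using isoE[OF assms] by metis
 show ?thesis
 proof (rule monoI)
  fix a b assume ab: "arr a" "arr b" "dom a = dom b" "cod a = dom f"
   "cod b = dom f" "f \<cdot> a = f \<cdot> b"
  have "a = (g \<cdot> f) \<cdot> a" using ab g(5) by simp
  also have "... = g \<cdot> (f \<cdot> a)" using ab g by (intro comp_assoc') auto
  also have "... = (g \<cdot> f) \<cdot> b" using ab g by (subst comp_assoc') auto
  also have "... = b" using ab g(5) by simp
  finally show "a = b" .
 qed (use g in simp)
qed

lemma iso_comp:
 assumes "iso f" "iso g" "dom g = cod f"
 shows "iso (g \<cdot> f)"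
proof -
 obtain f' where f': "arr f" "arr f'" "dom f' = cod f" "cod f' = dom f"
  "f' \<cdot> f = ide (dom f)" "f \<cdot> f' = ide (cod f)"
  using isoE[OF assms(1)] by metis
 obtain g' where g': "arr g" "arr g'" "dom g' = cod g" "cod g' = dom g"
  "g' \<cdot> g = ide (dom g)" "g \<cdot> g' = ide (cod g)"
  using isoE[OF assms(2)] by metis
 show ?thesis
 proof (rule isoI[of _ "f' \<cdot> g'"])
  show "(f' \<cdot> g') \<cdot> (g \<cdot> f) = ide (dom (g \<cdot> f))"
   using f' g' assms(3) by (simp add: reassoc[OF g'(5)])
  show "(g \<cdot> f) \<cdot> (f' \<cdot> g') = ide (cod (g \<cdot> f))"
   using f' g' assms(3) by (simp add: reassoc[OF f'(6)])
 qed (use f' g' assms(3) in simp_all)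
qed

lemma isomorphic_iff: "isomorphic x y \<longleftrightarrow> (\<exists>f. iso f \<and> dom f = x \<and> cod f = y)"
 unfolding isomorphic_def by auto

lemma isomorphic_refl: "ob x ==> isomorphic x x"
 unfolding isomorphic_iff by (rule exI[of _ "ide x"]) simp

lemma isomorphic_sym: "isomorphic x y ==> isomorphic y x"
 unfolding isomorphic_iff by (metis isoE)

lemma isomorphic_trans: "isomorphic x y ==> isomorphic y z ==> isomorphic x z"
 unfolding isomorphic_iff by (metis iso_comp comp_arr(2,3) iso_arr)

lemma split_mono_iso:
 assumes "mono f" "arr g" "dom g = cod f" "cod g = dom f" "f \<cdot> g = ide (cod f)"
 shows "iso f"
proof (rule isoI[of _ g])
 have "f \<cdot> (g \<cdot> f) = f \<cdot> ide (dom f)"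
  using assms by (simp add: reassoc[OF assms(5)])
 thus "g \<cdot> f = ide (dom f)"
  by (rule monoD[OF assms(1)]) (use assms in simp_all)
qed (use assms in simp_all)

text \<open>Unique existence is split into a lifting property and joint cancellation, since most
  arguments use only one of them, and cancellation often for arrows that were not obtained as
  lifts.\<close>

lemma pullbackE:
 assumes "is_pullback f g p q"
 obtains "arr f" "arr g" "cod f = cod g" "arr p" "arr q" "dom q = dom p"
  "cod p = dom f" "cod q = dom g" "f \<cdot> p = g \<cdot> q"
  "\<And>a b. [|arr a; arr b; dom a = dom b; cod a = dom f; cod b = dom g; f \<cdot> a = g \<cdot> b|]
    ==> \<exists>h. arr h \<and> dom h = dom b \<and> cod h = dom p \<and> p \<cdot> h = a \<and> q \<cdot> h = b"
  "\<And>h k. [|arr h; arr k; dom h = dom k; cod h = dom p; cod k = dom p;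
    p \<cdot> h = p \<cdot> k; q \<cdot> h = q \<cdot> k|] ==> h = k"
proof -
 have A: "arr f" "arr g" "cod f = cod g" "arr p" "arr q" "dom q = dom p"
  "cod p = dom f" "cod q = dom g" "f \<cdot> p = g \<cdot> q"
  and B: "\<And>t p' q'. p' \<in> Hom C t (dom f) ==> q' \<in> Hom C t (dom g) ==> f \<cdot> p' = g \<cdot> q' ==>
    (\<exists>!h. h \<in> Hom C t (dom p) \<and> p \<cdot> h = p' \<and> q \<cdot> h = q')"
  using assms unfolding is_pullback_def by auto
 show ?thesis
 proof (rule that[OF A])
  fix a b assume "arr a" "arr b" "dom a = dom b" "cod a = dom f" "cod b = dom g" "f \<cdot> a = g \<cdot> b"
  thus "\<exists>h. arr h \<and> dom h = dom b \<and> cod h = dom p \<and> p \<cdot> h = a \<and> q \<cdot> h = b"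
   using B[of a "dom b" b] by auto
 next
  fix h k assume hk: "arr h" "arr k" "dom h = dom k" "cod h = dom p" "cod k = dom p"
    "p \<cdot> h = p \<cdot> k" "q \<cdot> h = q \<cdot> k"
  have "f \<cdot> (p \<cdot> k) = (f \<cdot> p) \<cdot> k" using A hk by (subst comp_assoc') auto
  also have "... = g \<cdot> (q \<cdot> k)" unfolding A(9) using A hk by (subst comp_assoc') auto
  finally have "f \<cdot> (p \<cdot> k) = g \<cdot> (q \<cdot> k)" .
  hence "\<exists>!h. h \<in> Hom C (dom k) (dom p) \<and> p \<cdot> h = p \<cdot> k \<and> q \<cdot> h = q \<cdot> k"
   using A hk by (intro B) auto
  thus "h = k" using hk by auto
 qed
qed

lemma pullbackI:
 assumes "arr f" "arr g" "cod f = cod g" "arr p" "arr q" "dom q = dom p"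
  "cod p = dom f" "cod q = dom g" "f \<cdot> p = g \<cdot> q"
  "\<And>a b. [|arr a; arr b; dom a = dom b; cod a = dom f; cod b = dom g; f \<cdot> a = g \<cdot> b|]
    ==> \<exists>h. arr h \<and> dom h = dom b \<and> cod h = dom p \<and> p \<cdot> h = a \<and> q \<cdot> h = b"
  "\<And>h k. [|arr h; arr k; dom h = dom k; cod h = dom p; cod k = dom p;
    p \<cdot> h = p \<cdot> k; q \<cdot> h = q \<cdot> k|] ==> h = k"
 shows "is_pullback f g p q"
 unfolding is_pullback_def
proof (intro conjI allI ballI impI)
 fix t a b assume ab: "a \<in> Hom C t (dom f)" "b \<in> Hom C t (dom g)" "f \<cdot> a = g \<cdot> b"
 then obtain h where h: "arr h" "dom h = dom b" "cod h = dom p" "p \<cdot> h = a" "q \<cdot> h = b"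
  using assms(10)[of a b] by auto
 show "\<exists>!h. h \<in> Hom C t (dom p) \<and> p \<cdot> h = a \<and> q \<cdot> h = b"
  by (rule ex1I[of _ h]) (use ab h assms(11) in auto)
qed (use assms in auto)

lemma pullback_sym:
 assumes "is_pullback f g p q"
 shows "is_pullback g f q p"
 using assms
proof (rule pullbackE, goal_cases)
 case 1
 note P = this
 show ?case
 proof (rule pullbackI)
  fix a b assume "arr a" "arr b" "dom a = dom b" "cod a = dom g" "cod b = dom f" "g \<cdot> a = f \<cdot> b"
  thus "\<exists>h. arr h \<and> dom h = dom b \<and> cod h = dom q \<and> q \<cdot> h = a \<and> p \<cdot> h = b"
   using P(10)[of b a] P(6) by metis
 qed (use P(1-9) P(11) in \<open>simp_all\<close>)
qed

lemma pullback_paste: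
 assumes "is_pullback f g p q" "is_pullback q h p' q'"
 shows "is_pullback f (g \<cdot> h) (p \<cdot> p') q'"
 using assms(1)
proof (rule pullbackE, goal_cases)
 case 1
 note P = this
 from assms(2) show ?case
 proof (rule pullbackE, goal_cases)
  case 1
  note Q = this
  show ?case
  proof (rule pullbackI)
   have "f \<cdot> (p \<cdot> p') = g \<cdot> (q \<cdot> p')" using P(1-9) Q(1-9) by (simp add: reassoc[OF P(9)])
   also have "... = (g \<cdot> h) \<cdot> q'" using P(1-9) Q(1-9) by simp
   finally show "f \<cdot> (p \<cdot> p') = (g \<cdot> h) \<cdot> q'" .
  next
   fix a b assume ab: "arr a" "arr b" "dom a = dom b" "cod a = dom f"
    "cod b = dom (g \<cdot> h)" "f \<cdot> a = (g \<cdot> h) \<cdot> b"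
   hence "f \<cdot> a = g \<cdot> (h \<cdot> b)" using P(1-9) Q(1-9) by simp
   then obtain k where k: "arr k" "dom k = dom b" "cod k = dom p" "p \<cdot> k = a" "q \<cdot> k = h \<cdot> b"
    using P(10)[of a "h \<cdot> b"] P(1-9) Q(1-9) ab by auto
   then obtain l where l: "arr l" "dom l = dom b" "cod l = dom p'" "p' \<cdot> l = k" "q' \<cdot> l = b"
    using Q(10)[of k b] P(1-9) Q(1-9) ab by auto
   show "\<exists>h. arr h \<and> dom h = dom b \<and> cod h = dom (p \<cdot> p') \<and> (p \<cdot> p') \<cdot> h = a \<and> q' \<cdot> h = b"
    using k l P(1-9) Q(1-9) ab by (intro exI[of _ l]) auto
  next
   fix a b assume ab: "arr a" "arr b" "dom a = dom b" "cod a = dom (p \<cdot> p')"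
    "cod b = dom (p \<cdot> p')" "(p \<cdot> p') \<cdot> a = (p \<cdot> p') \<cdot> b" "q' \<cdot> a = q' \<cdot> b"
   have "q \<cdot> (p' \<cdot> a) = q \<cdot> (p' \<cdot> b)" using P(1-9) Q(1-9) ab by (simp add: reassoc[OF Q(9)])
   hence "p' \<cdot> a = p' \<cdot> b" using ab P(1-9) Q(1-9) P(11)[of "p' \<cdot> a" "p' \<cdot> b"] by simp
   thus "a = b" using ab P(1-9) Q(1-9) Q(11)[of a b] by simp
  qed (use P(1-9) Q(1-9) in auto)
 qed
qed

lemma pullback_mono:
 assumes "is_pullback f g p q" "mono f"
 shows "mono q"
 using assms(1)
proof (rule pullbackE, goal_cases)
 case 1
 note P = this
 show ?case
 proof (rule monoI)
  fix a b assume ab: "arr a" "arr b" "dom a = dom b" "cod a = dom q"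
   "cod b = dom q" "q \<cdot> a = q \<cdot> b"
  have "f \<cdot> (p \<cdot> a) = f \<cdot> (p \<cdot> b)" using P(1-9) ab by (simp add: reassoc[OF P(9)])
  hence "p \<cdot> a = p \<cdot> b" using monoD[OF assms(2)] P(1-9) ab by simp
  thus "a = b" using P(11)[of a b] P(1-9) ab by simp
 qed (use P(1-9) in simp)
qed

lemma pullback_id:
 assumes "arr f"
 shows "is_pullback f (ide (cod f)) (ide (dom f)) f"
 by (rule pullbackI) (use assms in auto)

text \<open>The source both of degree one for isomorphisms and of composition with graphs of
  isomorphisms: each reads an isomorphism as one side of a cartesian square.\<close>

lemma pullback_iso:
 assumes "iso f" "f \<cdot> p = g \<cdot> q" "arr p" "iso q" "arr g" "cod p = dom f"
  "cod q = dom g" "dom q = dom p" "cod g = cod f"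
 shows "is_pullback f g p q"
proof -
 obtain q' where q': "arr q" "arr q'" "dom q' = cod q" "cod q' = dom q"
  "q' \<cdot> q = ide (dom q)" "q \<cdot> q' = ide (cod q)"
  using isoE[OF assms(4)] by metis
 show ?thesis
 proof (rule pullbackI)
  fix a b assume ab: "arr a" "arr b" "dom a = dom b" "cod a = dom f"
   "cod b = dom g" "f \<cdot> a = g \<cdot> b"
  have "f \<cdot> (p \<cdot> (q' \<cdot> b)) = f \<cdot> a"
   using ab q' assms by (simp add: reassoc[OF assms(2)] reassoc[OF q'(6)])
  hence "p \<cdot> (q' \<cdot> b) = a" using monoD[OF iso_mono[OF assms(1)]] ab q' assms by simp
  thus "\<exists>h. arr h \<and> dom h = dom b \<and> cod h = dom p \<and> p \<cdot> h = a \<and> q \<cdot> h = b"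
   using ab q' assms by (intro exI[of _ "q' \<cdot> b"]) (simp add: reassoc[OF q'(6)])
 next
  fix h k assume "arr h" "arr k" "dom h = dom k" "cod h = dom p" "cod k = dom p"
    "q \<cdot> h = q \<cdot> k"
  thus "h = k" using monoD[OF iso_mono[OF assms(4)]] assms by simp
 qed (use assms q' in simp_all)
qed

lemma pullback_unique:
 assumes "is_pullback f g p q" "is_pullback f g p' q'"
 obtains h where "iso h" "dom h = dom p'" "cod h = dom p" "p \<cdot> h = p'" "q \<cdot> h = q'"
 using assms(1)
proof (rule pullbackE, goal_cases)
 case 1
 note P = this(2-)
 note that = 1(1)
 from assms(2) show ?case
 proof (rule pullbackE, goal_cases)
  case 1
  note Q = this
  obtain h where h: "arr h" "dom h = dom p'" "cod h = dom p" "p \<cdot> h = p'" "q \<cdot> h = q'"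
   using P(10)[of p' q'] P(1-9) Q(1-9) by auto
  obtain k where k: "arr k" "dom k = dom p" "cod k = dom p'" "p' \<cdot> k = p" "q' \<cdot> k = q"
   using Q(10)[of p q] P(1-9) Q(1-9) by auto
  have 1: "h \<cdot> k = ide (dom p)"
   by (rule P(11)) (use P(1-9) Q(1-9) h k in \<open>auto simp: reassoc[OF h(4)] reassoc[OF h(5)]\<close>)
  have 2: "k \<cdot> h = ide (dom p')"
   by (rule Q(11)) (use P(1-9) Q(1-9) h k in \<open>auto simp: reassoc[OF k(4)] reassoc[OF k(5)]\<close>)
  have "iso h"
   by (rule isoI[of _ k]) (use h k 1 2 in simp_all)
  with h show ?case using that by blast
 qed
qed

end

section \<open>Terminal object, pullbacks and products from finite limits\<close>

locale finlim_category = category C for C :: "('o, 'm, 'e) cat_scheme" (structure) +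
 assumes fin_complete: "finitely_complete C"
begin

abbreviation cmp (infixl "o" 75) where "g o f \<equiv> Comp C g f"

lemma limit_exists:
 fixes J :: "(nat, nat) cat"
 assumes "category J" "finite (Obj J)" "finite (Arr J)" "is_diagram J C Fo Fa"
 obtains l c where "is_limit J C Fo Fa l c"
 using fin_complete assms unfolding finitely_complete_def by blast

lemma terminal_exists: "\<exists>t. is_terminal C t"
proof -
 \<comment> \<open>The empty shape; its structure maps are arbitrary.\<close>
 define J :: "(nat, nat) cat" where
  "J = \<lparr>Obj = {}, Arr = {}, Dom = id, Cod = id, Ident = id, Comp = (\<lambda>_ _. 0)\<rparr>"
 have "category J" by unfold_locales (auto simp: J_def Hom_def)
 moreover have "is_diagram J C Fo Fa" for Fo Fa by (simp add: is_diagram_def J_def)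
 ultimately obtain l c where l: "is_limit J C (\<lambda>_. undefined) (\<lambda>_. undefined) l c"
  using limit_exists[of J "\<lambda>_. undefined" "\<lambda>_. undefined"] by (fastforce simp: J_def)
 have "is_terminal C l"
  unfolding is_terminal_def
 proof (intro conjI ballI)
  show "ob l" using l unfolding is_limit_def is_cone_def by blast
  fix x assume "ob x"
  hence "is_cone J C (\<lambda>_. undefined) (\<lambda>_. undefined) x (\<lambda>_. undefined)"
   by (simp add: is_cone_def J_def)
  thus "\<exists>!f. f \<in> Hom C x l" using l unfolding is_limit_def by (auto simp: J_def)
 qed
 thus ?thesis ..
qed

lemma terminal: "is_terminal C (term_obj)"
 unfolding term_obj_def by (rule someI_ex) (rule terminal_exists)

lemma term_obj_Obj [simp]: "ob (term_obj)"
 using terminal by (simp add: is_terminal_def)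

lemma to_term_arr [simp]:
 assumes "ob x"
 shows "arr (to_term x)" "dom (to_term x) = x" "cod (to_term x) = term_obj"
proof -
 have "\<exists>!f. f \<in> Hom C x (term_obj)" using terminal assms by (simp add: is_terminal_def)
 from theI'[OF this]
 show "arr (to_term x)" "dom (to_term x) = x" "cod (to_term x) = term_obj"
  by (auto simp: to_term_def)
qed

lemma to_term_unique:
 assumes "arr f" "cod f = term_obj" "arr g" "cod g = term_obj" "dom f = dom g"
 shows "f = g"
proof -
 have "\<exists>!h. h \<in> Hom C (dom f) (term_obj)"
  using terminal assms(1) dom_obj[OF assms(1)] unfolding is_terminal_def by blast
 moreover have "f \<in> Hom C (dom f) (term_obj)" "g \<in> Hom C (dom f) (term_obj)"
  using assms by auto
 ultimately show ?thesis by blast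
qed

lemma to_term_eq: "arr f ==> cod f = term_obj ==> f = to_term (dom f)"
 by (rule to_term_unique) simp_all

lemma to_term_comp [simp]:
 "arr f ==> cod f = x ==> to_term x o f = to_term (dom f)"
 by (rule to_term_unique) auto

lemma to_term_term_obj [simp]: "to_term (term_obj) = ide (term_obj)"
 by (rule to_term_unique) auto

lemma pullback_exists:
 assumes "arr f" "arr g" "cod f = cod g"
 shows "\<exists>p q. is_pullback f g p q"
proof -
 \<comment> \<open>The cospan 0 -> 2 <- 1: the arrows 0, 1, 2 are the identities, 3 and 4 the two
   arrows into 2, and \<open>Comp\<close> returns the factor that is not an identity, if there is
   one.\<close>
 define J :: "(nat, nat) cat" where
  "J = \<lparr>Obj = {0, 1, 2}, Arr = {0, 1, 2, 3, 4}, Dom = (\<lambda>u. if u = 3 then 0 else if u = 4 then 1 else u),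
   Cod = (\<lambda>u. if u = 3 \<or> u = 4 then 2 else u), Ident = id, Comp = (\<lambda>v u. if v = 3 \<or> v = 4 then v else u)\<rparr>"
 have "category J"
 proof
  fix f g :: nat and x y z
  assume "f \<in> Hom J x y" "g \<in> Hom J y z"
  hence "f \<in> {0,1,2,3,4}" "g \<in> {0,1,2,3,4}" "Dom J f = x" "Dom J g = y" "Cod J f = y" "Cod J g = z"
   by (simp_all add: Hom_def J_def)
  thus "Comp J g f \<in> Hom J x z"
   by (elim insertE emptyE) (simp_all add: Hom_def J_def split: if_splits)
 next
  fix f :: nat assume "f \<in> Arr J"
  thus "Dom J f \<in> Obj J" "Cod J f \<in> Obj J" by (auto simp: J_def)
 next
  fix f :: nat and x y assume "f \<in> Hom J x y"
  hence "f \<in> {0,1,2,3,4}" "Dom J f = x" "Cod J f = y"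
   by (simp_all add: Hom_def J_def)
  thus "Comp J f (Ident J x) = f" "Comp J (Ident J y) f = f"
   by (elim insertE emptyE; simp add: J_def; fail)+
 qed (auto simp: Hom_def J_def)
 define Fo where "Fo = (\<lambda>j::nat. if j = 0 then dom f else if j = 1 then dom g else cod f)"
 define Fa where "Fa = (\<lambda>u::nat. if u = 3 then f else if u = 4 then g else ide (Fo u))"
 have "is_diagram J C Fo Fa"
  using assms by (auto simp: is_diagram_def J_def Fo_def Fa_def)
 then obtain l c where "is_limit J C Fo Fa l c"
  using limit_exists[of J Fo Fa] \<open>category J\<close> by (auto simp: J_def)
 hence c: "is_cone J C Fo Fa l c"
  and u: "\<And>l' c'. is_cone J C Fo Fa l' c' ==> \<exists>!h. h \<in> Hom C l' l \<and> (\<forall>j\<in>Obj J. c j o h = c' j)"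
  unfolding is_limit_def by auto
 have c0: "arr (c 0)" "dom (c 0) = l" "cod (c 0) = dom f"
  and c1: "arr (c 1)" "dom (c 1) = l" "cod (c 1) = dom g"
  and c2: "arr (c 2)" "dom (c 2) = l" "f o c 0 = c 2" "g o c 1 = c 2"
  using c by (auto simp: is_cone_def J_def Fo_def Fa_def)
 have "is_pullback f g (c 0) (c 1)"
  unfolding is_pullback_def
 proof (intro conjI allI ballI impI)
  fix t a b assume ab: "a \<in> Hom C t (dom f)" "b \<in> Hom C t (dom g)" "f o a = g o b"
  define c' where "c' = (\<lambda>j::nat. if j = 0 then a else if j = 1 then b else f o a)"
  have "is_cone J C Fo Fa t c'"
   using ab assms by (auto simp: is_cone_def J_def Fo_def Fa_def c'_def)
  from u[OF this] obtain h where h: "h \<in> Hom C t l" "\<forall>j\<in>Obj J. c j o h = c' j"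
   and un: "\<And>k. k \<in> Hom C t l ==> (\<forall>j\<in>Obj J. c j o k = c' j) ==> k = h"
   by (elim ex1E) blast
  show "\<exists>!h. h \<in> Hom C t (dom (c 0)) \<and> c 0 o h = a \<and> c 1 o h = b"
  proof (rule ex1I[of _ h])
   show "h \<in> Hom C t (dom (c 0)) \<and> c 0 o h = a \<and> c 1 o h = b"
    using h c0 by (auto simp: J_def c'_def)
   fix k assume k: "k \<in> Hom C t (dom (c 0)) \<and> c 0 o k = a \<and> c 1 o k = b"
   hence "c 2 o k = f o a" using c0 c2(3)[symmetric] assms by simp
   with k c0 show "k = h" by (intro un) (auto simp: J_def c'_def)
  qed
 qed (use assms c0 c1 c2 in auto)
 thus ?thesis by blast
qed

lemma pb:
 assumes "arr f" "arr g" "cod f = cod g"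
 shows "is_pullback f g (fst (pb f g)) (snd (pb f g))"
proof -
 have "\<exists>w. (case w of (p, q) \<Rightarrow> is_pullback f g p q)"
  using pullback_exists[OF assms] by auto
 from someI_ex[OF this] show ?thesis unfolding pb_def by (auto split: prod.splits)
qed

lemma product_exists:
 assumes "ob x" "ob y"
 shows "\<exists>p a b. is_product C x y p a b"
proof -
 obtain a b where ab: "is_pullback (to_term x) (to_term y) a b"
  using pullback_exists[of "to_term x" "to_term y"] assms by auto
 have "is_product C x y (dom a) a b"
  unfolding is_product_def
 proof (intro conjI allI ballI)
  show "a \<in> Hom C (dom a) x" "b \<in> Hom C (dom a) y"
   using ab assms unfolding is_pullback_def by auto
  fix t f g assume "f \<in> Hom C t x" "g \<in> Hom C t y"
  thus "\<exists>!h. h \<in> Hom C t (dom a) \<and> a o h = f \<and> b o h = g"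
   using ab assms unfolding is_pullback_def by auto
 qed
 thus ?thesis by blast
qed

lemma product:
 assumes "ob x" "ob y"
 shows "is_product C x y (prd x y) (pr1 x y) (pr2 x y)"
proof -
 have "\<exists>w. (case w of (p, a, b) \<Rightarrow> is_product C x y p a b)"
  using product_exists[OF assms] by auto
 from someI_ex[OF this] show ?thesis
  unfolding prd_def pr1_def pr2_def prd_cone_def by (auto split: prod.splits)
qed

lemma pr_arr [simp]:
 assumes "ob x" "ob y"
 shows "arr (pr1 x y)" "dom (pr1 x y) = prd x y" "cod (pr1 x y) = x"
  "arr (pr2 x y)" "dom (pr2 x y) = prd x y" "cod (pr2 x y) = y"
 using product[OF assms] by (auto simp: is_product_def)

lemma prd_Obj [simp]: "ob x ==> ob y ==> ob (prd x y)"
 by (metis pr_arr(1,2) dom_obj)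

lemma pairing_facts:
 assumes "arr f" "arr g" "dom f = dom g"
 shows "pairing f g \<in> Hom C (dom f) (prd (cod f) (cod g)) \<and>
   pr1 (cod f) (cod g) o pairing f g = f \<and> pr2 (cod f) (cod g) o pairing f g = g"
 unfolding pairing_def
 by (rule theI') (use product[of "cod f" "cod g"] assms in \<open>auto simp: is_product_def\<close>)

lemma pairing_arr [simp]:
 assumes "arr f" "arr g" "dom f = dom g"
 shows "arr (pairing f g)" "dom (pairing f g) = dom g" "cod (pairing f g) = prd (cod f) (cod g)"
 using pairing_facts[OF assms] assms by auto

lemma pr_pairing [simp]:
 assumes "arr f" "arr g" "dom f = dom g" "cod f = x" "cod g = y"
 shows "pr1 x y o pairing f g = f" "pr2 x y o pairing f g = g"
 using pairing_facts[OF assms(1-3)] assms by auto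

lemma prd_ext:
 assumes "arr h" "arr k" "dom h = dom k" "cod h = prd x y" "cod k = prd x y"
  "ob x" "ob y" "pr1 x y o h = pr1 x y o k" "pr2 x y o h = pr2 x y o k"
 shows "h = k"
proof -
 have "\<exists>!l. l \<in> Hom C (dom k) (prd x y) \<and> pr1 x y o l = pr1 x y o k \<and> pr2 x y o l = pr2 x y o k"
  using product[OF assms(6,7)] assms unfolding is_product_def by auto
 thus ?thesis using assms by auto
qed

lemma pairing_comp [simp]:
 assumes "arr f" "arr g" "dom f = dom g" "arr h" "cod h = dom g"
 shows "pairing f g o h = pairing (f o h) (g o h)"
proof (rule prd_ext[of _ _ "cod f" "cod g"])
 have "pr1 (cod f) (cod g) o (pairing f g o h) = f o h"
  using assms by (subst reassoc[where k=f]) auto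
 thus "pr1 (cod f) (cod g) o (pairing f g o h) = pr1 (cod f) (cod g) o pairing (f o h) (g o h)"
  using assms by simp
 have "pr2 (cod f) (cod g) o (pairing f g o h) = g o h"
  using assms by (subst reassoc[where k=g]) auto
 thus "pr2 (cod f) (cod g) o (pairing f g o h) = pr2 (cod f) (cod g) o pairing (f o h) (g o h)"
  using assms by simp
qed (use assms in simp_all)

lemma pairing_eq_iff:
 assumes "arr f" "arr g" "dom f = dom g" "arr f'" "arr g'" "dom f' = dom g'"
  "cod f = cod f'" "cod g = cod g'"
 shows "pairing f g = pairing f' g' \<longleftrightarrow> f = f' \<and> g = g'"
 using pr_pairing[of f g "cod f" "cod g"] pr_pairing[of f' g' "cod f" "cod g"] assms by metis

lemma pairing_pr:
 assumes "ob x" "ob y" "arr h" "cod h = prd x y"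
 shows "pairing (pr1 x y o h) (pr2 x y o h) = h"
 by (rule prd_ext[of _ _ x y]) (use assms in simp_all)

lemma pairing_pr_id [simp]:
 assumes "ob x" "ob y"
 shows "pairing (pr1 x y) (pr2 x y) = ide (prd x y)"
 by (rule prd_ext[of _ _ x y]) (use assms in simp_all)

end

section \<open>Subobjects, images and surjective morphisms\<close>

context category
begin

lemma pullback_facts:
 assumes "is_pullback f g p q"
 shows "arr f" "arr g" "cod f = cod g" "arr p" "arr q" "dom q = dom p"
  "cod p = dom f" "cod q = dom g" "f \<cdot> p = g \<cdot> q"
 using assms unfolding is_pullback_def by auto

section \<open>Subobjects as classes of monomorphisms\<close>

lemma factors_through_iff:
 "factors_through f m \<longleftrightarrow> (\<exists>h. arr h \<and> dom h = dom f \<and> cod h = dom m \<and> f = m \<cdot> h)"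
 unfolding factors_through_def by auto

lemma factors_throughI:
 "arr h ==> dom h = dom f ==> cod h = dom m ==> m \<cdot> h = f ==> factors_through f m"
 unfolding factors_through_iff by auto

lemma factors_throughE:
 assumes "factors_through f m"
 obtains h where "arr h" "dom h = dom f" "cod h = dom m" "m \<cdot> h = f"
 using assms unfolding factors_through_iff by auto

lemma factors_through_refl [simp]: "arr m ==> factors_through m m"
 by (rule factors_throughI[of "ide (dom m)"]) simp_all

lemma factors_through_trans:
 assumes "factors_through f g" "factors_through g h" "arr h"
 shows "factors_through f h"
proof -
 obtain a b where "arr a" "dom a = dom f" "cod a = dom g" "g \<cdot> a = f"
  "arr b" "dom b = dom g" "cod b = dom h" "h \<cdot> b = g"
  using factors_throughE[OF assms(1)] factors_throughE[OF assms(2)] by metis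
 thus ?thesis using assms(3) by (intro factors_throughI[of "b \<cdot> a"]) (auto simp: reassoc)
qed

lemma factors_through_comp:
 assumes "factors_through f g" "arr f" "arr g" "arr a" "cod a = dom f"
 shows "factors_through (f \<cdot> a) g"
proof -
 obtain h where "arr h" "dom h = dom f" "cod h = dom g" "g \<cdot> h = f"
  using factors_throughE[OF assms(1)] .
 thus ?thesis using assms by (intro factors_throughI[of "h \<cdot> a"]) (auto simp: reassoc)
qed

lemma sub_class_self: "mono m ==> m \<in> sub_class m"
 by (simp add: sub_class_def)

lemma sub_class_eq_iff:
 assumes "mono m" "mono n"
 shows "sub_class m = sub_class n \<longleftrightarrow>
  cod m = cod n \<and> factors_through m n \<and> factors_through n m"
proof
 assume "sub_class m = sub_class n"
 hence "m \<in> sub_class n" using sub_class_self[OF assms(1)] by simp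
 thus "cod m = cod n \<and> factors_through m n \<and> factors_through n m"
  by (simp add: sub_class_def)
next
 assume a: "cod m = cod n \<and> factors_through m n \<and> factors_through n m"
 have "k \<in> sub_class m \<longleftrightarrow> k \<in> sub_class n" for k
  using a assms unfolding sub_class_def by (auto intro: factors_through_trans mono_arr)
 thus "sub_class m = sub_class n" by blast
qed

lemma mono_factor_iso:
 assumes "mono m" "mono n" "factors_through m n" "factors_through n m"
 obtains h where "iso h" "dom h = dom m" "cod h = dom n" "n \<cdot> h = m"
proof -
 obtain a where a: "arr a" "dom a = dom m" "cod a = dom n" "n \<cdot> a = m"
  using factors_throughE[OF assms(3)] .
 obtain b where b: "arr b" "dom b = dom n" "cod b = dom m" "m \<cdot> b = n"
  using factors_throughE[OF assms(4)] .
 have mn: "arr m" "arr n" using assms by auto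
 have "b \<cdot> a = ide (dom m)"
  by (rule monoD[OF assms(1)]) (use a b mn in \<open>auto simp: reassoc[OF b(4)]\<close>)
 moreover have "a \<cdot> b = ide (dom n)"
  by (rule monoD[OF assms(2)]) (use a b mn in \<open>auto simp: reassoc[OF a(4)]\<close>)
 ultimately have "iso a" using a b by (intro isoI[of a b]) auto
 with a show ?thesis using that by blast
qed

lemma sub_class_iso:
 assumes "mono m" "iso h" "cod h = dom m"
 shows "sub_class (m \<cdot> h) = sub_class m"
proof -
 obtain g where g: "arr h" "arr g" "dom g = cod h" "cod g = dom h" "h \<cdot> g = ide (cod h)"
  using isoE[OF assms(2)] by metis
 have m: "mono (m \<cdot> h)" using mono_comp[of h m] assms by simp
 show ?thesis
  unfolding sub_class_eq_iff[OF m assms(1)]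
  using g assms factors_throughI[of h "m \<cdot> h" m] factors_throughI[of g m "m \<cdot> h"] by simp
qed

lemma sub_class_in [simp]: "mono m ==> cod m = x ==> sub_class m \<in> Sub x"
 by (auto simp: Sub_def)

lemma incl_mem:
 assumes "r \<in> Sub x"
 shows "incl r \<in> r"
proof -
 obtain m where "mono m" "r = sub_class m" using assms by (auto simp: Sub_def)
 thus ?thesis unfolding incl_def using sub_class_self someI[of "\<lambda>k. k \<in> r" m] by auto
qed

lemma incl_facts [simp]:
 assumes "r \<in> Sub x"
 shows "mono (incl r)" "cod (incl r) = x" "sub_class (incl r) = r" "arr (incl r)"
proof -
 obtain m where m: "mono m" "cod m = x" "r = sub_class m" using assms by (auto simp: Sub_def)
 have 1: "incl r \<in> sub_class m" using incl_mem[OF assms] m by simp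
 thus "mono (incl r)" "cod (incl r) = x" using m by (auto simp: sub_class_def)
 with 1 m show "sub_class (incl r) = r" using sub_class_eq_iff[of "incl r" m] by (auto simp: sub_class_def)
 show "arr (incl r)" using \<open>mono (incl r)\<close> by simp
qed

text \<open>\<open>incl\<close> picks an arbitrary representative of the class, so every computation
  with a concrete monomorphism needs this comparison isomorphism.\<close>

lemma incl_sub_class:
 assumes "mono m"
 obtains h where "iso h" "dom h = dom m" "cod h = dom (incl (sub_class m))"
  "incl (sub_class m) \<cdot> h = m"
proof -
 have r: "sub_class m \<in> Sub (cod m)" using assms by simp
 have "factors_through m (incl (sub_class m)) \<and> factors_through (incl (sub_class m)) m"
  using sub_class_eq_iff[OF assms incl_facts(1)[OF r]] incl_facts(3)[OF r] by simp
 thus ?thesis using mono_factor_iso[OF assms incl_facts(1)[OF r]] that by metis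
qed

lemma factors_sub_iff:
 assumes "r \<in> Sub x"
 shows "factors_sub f r \<longleftrightarrow> factors_through f (incl r)"
proof
 assume "factors_sub f r"
 then obtain m where m: "m \<in> r" "factors_through f m" by (auto simp: factors_sub_def)
 hence "m \<in> sub_class (incl r)" using assms by simp
 thus "factors_through f (incl r)" using m assms factors_through_trans[OF m(2)]
  by (auto simp: sub_class_def)
next
 assume "factors_through f (incl r)"
 thus "factors_sub f r" using incl_mem[OF assms] unfolding factors_sub_def by blast
qed

lemma factors_sub_class:
 assumes "mono m"
 shows "factors_sub f (sub_class m) \<longleftrightarrow> factors_through f m"
proof -
 have r: "sub_class m \<in> Sub (cod m)" using assms by simp
 have "factors_through m (incl (sub_class m))" "factors_through (incl (sub_class m)) m"
  using sub_class_eq_iff[OF assms incl_facts(1)[OF r]] incl_facts(3)[OF r] by simp_all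
 thus ?thesis unfolding factors_sub_iff[OF r] using assms r
  by (meson factors_through_trans incl_facts(4) mono_arr)
qed

lemma sub_le_iff:
 assumes "r \<in> Sub x" "s \<in> Sub x"
 shows "sub_le r s \<longleftrightarrow> factors_through (incl r) (incl s)"
proof
 assume "sub_le r s"
 then obtain m where m: "m \<in> r" "factors_sub m s" by (auto simp: sub_le_def)
 hence "m \<in> sub_class (incl r)" using assms by simp
 hence "factors_through (incl r) m" "factors_through m (incl s)"
  using m assms by (auto simp: sub_class_def factors_sub_iff[OF assms(2)])
 thus "factors_through (incl r) (incl s)" using factors_through_trans assms by simp
next
 assume "factors_through (incl r) (incl s)"
 thus "sub_le r s" using incl_mem[OF assms(1)] factors_sub_iff[OF assms(2)]
  unfolding sub_le_def by blast
qed

lemma sub_le_class: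
 assumes "mono m" "mono n" "cod m = cod n"
 shows "sub_le (sub_class m) (sub_class n) \<longleftrightarrow> factors_through m n"
proof -
 let ?r = "sub_class m" and ?s = "sub_class n"
 have r: "?r \<in> Sub (cod n)" "?s \<in> Sub (cod n)" using assms by simp_all
 have "factors_through m (incl ?r)" "factors_through (incl ?r) m"
  using sub_class_eq_iff[OF assms(1) incl_facts(1)[OF r(1)]] incl_facts(3)[OF r(1)] by simp_all
 moreover have "factors_through n (incl ?s)" "factors_through (incl ?s) n"
  using sub_class_eq_iff[OF assms(2) incl_facts(1)[OF r(2)]] incl_facts(3)[OF r(2)] by simp_all
 ultimately show ?thesis unfolding sub_le_iff[OF r] using assms(1,2) r
  by (meson factors_through_trans incl_facts(4) mono_arr)
qed

lemma sub_le_refl: "r \<in> Sub x ==> sub_le r r"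
 by (simp add: sub_le_iff)

lemma sub_le_trans:
 "[|r \<in> Sub x; s \<in> Sub x; t \<in> Sub x; sub_le r s; sub_le s t|] ==> sub_le r t"
 using factors_through_trans by (simp add: sub_le_iff)

lemma sub_le_antisym:
 "[|r \<in> Sub x; s \<in> Sub x; sub_le r s; sub_le s r|] ==> r = s"
 using sub_class_eq_iff[of "incl r" "incl s"] by (simp add: sub_le_iff)

lemma sub_top_in [simp]: "ob x ==> sub_top x \<in> Sub x"
 by (simp add: sub_top_def)

lemma factors_sub_top: "arr f ==> cod f = x ==> factors_sub f (sub_top x)"
 unfolding sub_top_def
 by (subst factors_sub_class) (auto intro!: iso_mono factors_throughI[of f])

lemma sub_le_top: "r \<in> Sub x ==> ob x ==> sub_le r (sub_top x)"
 using factors_sub_top[of "incl r" x] incl_mem[of r x] unfolding sub_le_def by auto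

lemma sub_class_top_iff:
 assumes "mono m" "cod m = x"
 shows "sub_class m = sub_top x \<longleftrightarrow> iso m"
proof
 have x: "ob x" using assms by auto
 assume "sub_class m = sub_top x"
 hence "factors_through (ide x) m"
  unfolding sub_top_def using assms x sub_class_eq_iff[OF assms(1), of "ide x"] by simp
 then obtain h where "arr h" "dom h = x" "cod h = dom m" "m \<cdot> h = ide x"
  using x by (auto elim: factors_throughE)
 thus "iso m" using split_mono_iso[OF assms(1), of h] assms by auto
next
 assume "iso m"
 thus "sub_class m = sub_top x"
  using sub_class_iso[of "ide x" m] assms unfolding sub_top_def by auto
qed

section \<open>Surjective morphisms\<close>

lemma is_image_unique:
 assumes "is_image C f S" "is_image C f T"
 shows "S = T"
 using assms unfolding is_image_def by (meson sub_le_antisym)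

lemma surj_arr [simp]: "surj f ==> arr f"
 by (simp add: is_surj_def)

text \<open>Together with \<open>surjI\<close> this describes surjections as extremal epimorphisms,
  so that surjectivity is handled by factoring through monomorphisms instead of by image
  classes.\<close>

lemma surjD:
 assumes "surj f" "mono m" "cod m = cod f" "factors_through f m"
 shows "iso m"
proof -
 have f: "arr f" using assms by simp
 have "factors_sub f (sub_class m)" using factors_sub_class assms by simp
 hence "sub_le (sub_top (cod f)) (sub_class m)"
  using assms unfolding is_surj_def is_image_def by simp
 hence "sub_class m = sub_top (cod f)"
  using sub_le_top[of "sub_class m" "cod f"] assms f
  by (intro sub_le_antisym[of _ "cod f"]) auto
 thus ?thesis using sub_class_top_iff assms by simp
qed

lemma surjI:
 assumes "arr f" "\<And>m. mono m ==> cod m = cod f ==> factors_through f m ==> iso m"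
 shows "surj f"
 unfolding is_surj_def is_image_def
proof (intro conjI ballI impI)
 fix T assume T: "T \<in> Sub (cod f)" "factors_sub f T"
 hence "iso (incl T)" using assms(2)[of "incl T"] factors_sub_iff[OF T(1)] by simp
 hence "sub_class (incl T) = sub_top (cod f)" using sub_class_top_iff[of "incl T"] incl_facts[OF T(1)] by simp
 hence "T = sub_top (cod f)" using incl_facts[OF T(1)] by simp
 thus "sub_le (sub_top (cod f)) T" using T sub_le_refl[of T "cod f"] by simp
qed (use assms(1) factors_sub_top in auto)

lemma iso_surj [simp]:
 assumes "iso f"
 shows "surj f"
proof (rule surjI)
 fix m assume m: "mono m" "cod m = cod f" "factors_through f m"
 obtain g where g: "arr f" "arr g" "dom g = cod f" "cod g = dom f" "f \<cdot> g = ide (cod f)"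
  using isoE[OF assms] by metis
 obtain h where h: "arr h" "dom h = dom f" "cod h = dom m" "m \<cdot> h = f"
  using factors_throughE[OF m(3)] .
 show "iso m"
  by (rule split_mono_iso[OF m(1), of "h \<cdot> g"]) (use m g h in \<open>simp_all add: reassoc[OF h(4)]\<close>)
qed (use assms in simp)

lemma mono_surj_iso: "mono f ==> surj f ==> iso f"
 by (rule surjD[of f]) auto

lemma surj_cancel:
 assumes "surj (g \<cdot> f)" "arr f" "arr g" "dom g = cod f"
 shows "surj g"
proof (rule surjI)
 fix m assume m: "mono m" "cod m = cod g" "factors_through g m"
 hence "factors_through (g \<cdot> f) m" using assms factors_through_comp[of g m f] by simp
 thus "iso m" using surjD[OF assms(1) m(1)] m assms by simp
qed (use assms in simp)

end

section \<open>Image factorization and fill-ins in a regular category\<close>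

locale regular_category = finlim_category C for C :: "('o, 'm, 'e) cat_scheme" (structure) +
 assumes regular: "regular_cat C"
begin

lemma surj_pullback: "surj f ==> is_pullback f g p q ==> surj q"
 using regular unfolding regular_cat_def by blast

lemma image_sub_image:
 assumes "arr f"
 shows "is_image C f (image_sub f)"
proof -
 obtain S where "is_image C f S" using regular assms unfolding regular_cat_def by blast
 thus ?thesis unfolding image_sub_def
  using theI[of "is_image C f" S] is_image_unique[of f _ S] by blast
qed

lemma image_sub_in: "arr f ==> cod f = x ==> image_sub f \<in> Sub x"
 using image_sub_image[of f] unfolding is_image_def by blast

text \<open>The factor is surjective by minimality of the image: a monomorphism \<open>m\<close>
  into the image through which the factor passes, composed with the inclusion, is a subobject
  through which \<open>f\<close> passes, so it contains the image.\<close>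

lemma image_surj_facts:
 assumes "arr f"
 shows "arr (image_surj f)" "dom (image_surj f) = dom f"
  "cod (image_surj f) = dom (incl (image_sub f))"
  "incl (image_sub f) o image_surj f = f" "surj (image_surj f)"
proof -
 let ?S = "image_sub f"
 have S: "?S \<in> Sub (cod f)" "factors_sub f ?S"
  and min: "\<And>T. T \<in> Sub (cod f) ==> factors_sub f T ==> sub_le ?S T"
  using image_sub_image[OF assms] unfolding is_image_def by auto
 obtain h where h: "arr h" "dom h = dom f" "cod h = dom (incl ?S)" "incl ?S o h = f"
  using S(2) factors_throughE unfolding factors_sub_iff[OF S(1)] by blast
 have "\<exists>!e. e \<in> Hom C (dom f) (dom (incl ?S)) \<and> f = incl ?S o e"
  by (rule ex1I[of _ h]) (use h S monoD[OF incl_facts(1)[OF S(1)]] in auto)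
 from theI'[OF this] have e: "arr (image_surj f)" "dom (image_surj f) = dom f"
  "cod (image_surj f) = dom (incl ?S)" "incl ?S o image_surj f = f"
  unfolding image_surj_def by auto
 thus "arr (image_surj f)" "dom (image_surj f) = dom f"
  "cod (image_surj f) = dom (incl ?S)" "incl ?S o image_surj f = f" by auto
 show "surj (image_surj f)"
 proof (rule surjI)
  fix m assume m: "mono m" "cod m = cod (image_surj f)" "factors_through (image_surj f) m"
  obtain k where k: "arr k" "dom k = dom f" "cod k = dom m" "m o k = image_surj f"
   using factors_throughE[OF m(3)] e by metis
  have mm: "arr m" using m by simp
  have mc: "mono (incl ?S o m)" using mono_comp[of m "incl ?S"] m S e by simp
  have "factors_through f (incl ?S o m)"
   by (rule factors_throughI[of k]) (use k e m mm S(1) in auto)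
  hence "factors_sub f (sub_class (incl ?S o m))" by (simp add: factors_sub_class[OF mc])
  moreover have "sub_class (incl ?S o m) \<in> Sub (cod f)"
   using mc m mm e S(1) by (intro sub_class_in) auto
  ultimately have "sub_le ?S (sub_class (incl ?S o m))" using min by blast
  hence "factors_through (incl ?S) (incl ?S o m)"
   using sub_le_class[of "incl ?S" "incl ?S o m"] mc m mm e S(1) by simp
  then obtain l where l: "arr l" "dom l = dom (incl ?S)" "cod l = dom m" "(incl ?S o m) o l = incl ?S"
   using m mm e S(1) by (auto elim!: factors_throughE)
  have iS: "arr (incl ?S)" using incl_facts(4)[OF S(1)] .
  have "m o l = ide (cod m)"
   by (rule monoD[OF incl_facts(1)[OF S(1)]]) (use l m mm e iS in \<open>simp_all\<close>)
  thus "iso m" using split_mono_iso[OF m(1), of l] l m e by simp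
 qed (use e in simp)
qed

lemma image_factorization:
 assumes "arr f"
 obtains m e where "mono m" "surj e" "dom m = cod e" "m o e = f"
  "dom e = dom f" "cod m = cod f"
proof (rule that[of "incl (image_sub f)" "image_surj f"])
 show "mono (incl (image_sub f))" "cod (incl (image_sub f)) = cod f"
  using assms by (auto intro: incl_facts image_sub_in)
qed (use image_surj_facts[OF assms] in auto)

text \<open>Orthogonality of surjections and monomorphisms. The pullback of \<open>m\<close> along
  \<open>v\<close> is a monomorphism through which \<open>e\<close> factors, hence an isomorphism,
  and its inverse gives the diagonal.\<close>

lemma surj_mono_fill:
 assumes "surj e" "mono m" "arr u" "arr v" "m o u = v o e" "dom u = dom e"
  "cod u = dom m" "dom v = cod e" "cod v = cod m"
 obtains d where "arr d" "dom d = cod e" "cod d = dom m" "m o d = v" "d o e = u"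
proof -
 have e: "arr e" and mm: "arr m" using assms by auto
 obtain p q where pq: "is_pullback m v p q" using pullback_exists[of m v] assms mm by auto
 thus ?thesis
 proof (rule pullbackE, goal_cases)
  case 1
  note P = this
  have q: "mono q" by (rule pullback_mono[OF pq assms(2)])
  obtain h where h: "arr h" "dom h = dom e" "cod h = dom p" "p o h = u" "q o h = e"
   using P(10)[of u e] assms e by auto
  have "iso q"
   by (rule surjD[OF assms(1) q]) (use h P(1-9) assms in \<open>auto intro: factors_throughI[of h]\<close>)
  then obtain k where k: "arr k" "dom k = cod q" "cod k = dom q" "k o q = ide (dom q)"
    "q o k = ide (cod q)"
   using isoE by metis
  have "m o (p o k) = v" using P(1-9) k assms by (simp add: reassoc[OF P(9)])
  moreover have "k o e = h"
   using reassoc[OF k(4), of h] P(1-9) k h by simp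
  hence "(p o k) o e = u" using P(1-9) k h assms e by simp
  ultimately show ?case
   by (intro that[of "p o k"]) (use P(1-9) k h assms e in auto)
 qed
qed

lemma surj_comp:
 assumes "surj f" "surj g" "dom g = cod f"
 shows "surj (g o f)"
proof (rule surjI)
 fix m assume m: "mono m" "cod m = cod (g o f)" "factors_through (g o f) m"
 have fg: "arr f" "arr g" "arr m" using assms m by auto
 then obtain h where h: "arr h" "dom h = dom f" "cod h = dom m" "m o h = g o f"
  using m assms by (auto elim!: factors_throughE)
 obtain d where "arr d" "dom d = cod f" "cod d = dom m" "m o d = g" "d o f = h"
  by (rule surj_mono_fill[of f m h g]) (use assms m h fg in auto)
 thus "iso m"
  by (intro surjD[OF assms(2) m(1)]) (use assms m fg in \<open>auto intro: factors_throughI[of d]\<close>)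
qed (use assms in simp)

text \<open>The diagonal of the target is a monomorphism; a fill-in of \<open>e\<close> against it
  makes the pair \<open>f\<close>, \<open>g\<close> factor through the diagonal.\<close>

lemma surj_epi:
 assumes "surj e" "f o e = g o e" "arr f" "arr g" "dom f = cod e" "dom g = cod e"
  "cod f = cod g"
 shows "f = g"
proof -
 let ?y = "cod g"
 have e: "arr e" and y: "ob ?y" using assms by auto
 let ?D = "pairing (ide ?y) (ide ?y)"
 have D: "mono ?D"
  by (rule mono_cancel[of "pr1 ?y ?y"], rule iso_mono) (use y in simp_all)
 have "?D o (f o e) = pairing f g o e" using assms e y by simp
 then obtain d where d: "arr d" "dom d = cod e" "cod d = ?y" "?D o d = pairing f g"
  by (rule surj_mono_fill[OF assms(1) D, rotated 2]) (use assms e y in auto)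
 hence "pairing d d = pairing f g" using y by simp
 thus "f = g" using d assms by (subst (asm) pairing_eq_iff) auto
qed

text \<open>A surjection is the quotient by its kernel pair. The image of the pair \<open>e\<close>,
  \<open>f\<close> in the product is the graph of the morphism sought: its projection to
  \<open>cod e\<close> is surjective because \<open>e\<close> is, and monic by \<open>ker\<close>,
  hence invertible.\<close>

lemma surj_factor:
 assumes "surj e" "arr f" "dom f = dom e"
  and ker: "\<And>a b. [|arr a; arr b; dom a = dom b; cod a = dom e; cod b = dom e;
   e o a = e o b|] ==> f o a = f o b"
 obtains h where "arr h" "dom h = cod e" "cod h = cod f" "h o e = f"
proof -
 have e: "arr e" using assms by simp
 obtain m w where m: "mono m" "surj w" "dom m = cod w" "m o w = pairing e f"
  "dom w = dom e" "cod m = prd (cod e) (cod f)"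
  using image_factorization[of "pairing e f"] assms e by auto
 have mw: "arr m" "arr w" using m by auto
 let ?p = "pr1 (cod e) (cod f) o m" and ?q = "pr2 (cod e) (cod f) o m"
 have pw: "?p o w = e" "?q o w = f" using m mw assms(1-3) e by simp_all
 have "surj ?p"
  by (rule surj_cancel[of ?p w]) (use pw m mw assms(1-3) e in simp_all)
 moreover have "mono ?p"
 proof (rule monoI)
  fix a b assume ab: "arr a" "arr b" "dom a = dom b" "cod a = dom ?p" "cod b = dom ?p"
   "?p o a = ?p o b"
  \<comment> \<open>Both elements of the image are lifted along \<open>w\<close>, one after the
    other; on the common cover \<open>a2 o b2\<close> the hypothesis \<open>ker\<close> applies to
    the lifts.\<close>
  obtain a1 a2 where a1: "is_pullback w a a1 a2" using pullback_exists[of w a] ab m mw e assms(1-3) by auto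
  have a2: "surj a2" by (rule surj_pullback[OF m(2) a1])
  obtain b1 b2 where b1: "is_pullback w (b o a2) b1 b2"
   using pullback_facts[OF a1] pullback_exists[of w "b o a2"] ab m mw e assms(1-3) by auto
  have b2: "surj b2" by (rule surj_pullback[OF m(2) b1])
  have A: "arr a1" "arr a2" "dom a2 = dom a1" "cod a1 = dom w" "cod a2 = dom a" "w o a1 = a o a2"
   using pullback_facts[OF a1] by auto
  have B: "arr b1" "arr b2" "dom b2 = dom b1" "cod b1 = dom w" "cod b2 = dom a1" "w o b1 = b o (a2 o b2)"
   using pullback_facts[OF b1] ab A mw m by auto
  have "e o (a1 o b2) = ?p o (w o (a1 o b2))"
   using pw(1) A B mw m e assms(1-3) by (simp add: reassoc[OF m(4)])
  also have "... = ?p o (a o (a2 o b2))" using A B ab mw m e by (simp add: reassoc[OF A(6)])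
  also have "... = ?p o (b o (a2 o b2))"
   using reassoc[OF ab(6), of "a2 o b2"] A B ab mw m e assms(1-3) by simp
  also have "... = ?p o (w o b1)" using B by simp
  also have "... = e o b1"
   using pw(1) A B(1-5) mw m e assms(1-3) by (simp add: reassoc[OF m(4)])
  finally have ee: "e o (a1 o b2) = e o b1" .
  have ff: "f o (a1 o b2) = f o b1" by (rule ker[OF _ _ _ _ _ ee]) (use A B m in simp_all)
  have "m o (w o (a1 o b2)) = m o (w o b1)"
   using ee ff A(1-5) B(1-5) m mw e assms(1-3) by (simp add: reassoc[OF m(4)])
  moreover have "w o (a1 o b2) = a o (a2 o b2)"
   using reassoc[OF A(6), of b2] A(1-5) B(1-5) ab(1-5) mw by simp
  ultimately have "m o (a o (a2 o b2)) = m o (b o (a2 o b2))"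
   using B(6) by simp
  hence "a o (a2 o b2) = b o (a2 o b2)"
   by (rule monoD[OF m(1)]) (use A(1-5) B(1-5) m mw ab(1-5) e assms(1-3) in simp_all)
  thus "a = b"
   by (rule surj_epi[OF surj_comp[OF b2 a2], rotated]) (use A(1-5) B(1-5) m mw ab(1-5) e assms(1-3) in simp_all)
 qed (use mw m assms(1-3) e in simp)
 ultimately have "iso ?p" by (rule mono_surj_iso[rotated])
 then obtain k where k: "arr k" "dom k = cod ?p" "cod k = dom ?p" "k o ?p = ide (dom ?p)"
  using isoE by metis
 have "?q o (k o e) = f"
 proof -
  have "k o e = k o (?p o w)" by (simp only: pw(1))
  also have "... = (k o ?p) o w"
   by (rule comp_assoc'[symmetric]) (use k(1-3) mw m(1-3,5-) assms(1-3) e in simp_all)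
  also have "... = w" unfolding k(4) using mw m assms(1-3) e by simp
  finally show ?thesis using pw(2) by simp
 qed
 thus ?thesis
  by (intro that[of "?q o k"]) (use k mw m assms(1-3) e in simp_all)
qed

end

section \<open>The calculus of spans\<close>

context regular_category
begin

text \<open>Lets any factorization into a surjection and a monomorphism compute image and degree;
  the difference to the chosen one is an isomorphism, which the degree does not see.\<close>

lemma image_sub_unique:
 assumes "mono m" "surj e" "dom m = cod e" "m o e = f"
 shows "image_sub f = sub_class m"
  and "\<exists>i. iso i \<and> dom i = cod e \<and> cod i = dom (incl (image_sub f)) \<and>
   image_surj f = i o e"
proof -
 have me: "arr m" "arr e" using assms by auto
 have f: "arr f" "dom f = dom e" "cod f = cod m" using me assms by auto
 let ?S = "image_sub f" and ?w = "image_surj f"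
 have S: "?S \<in> Sub (cod m)" using f by (simp add: image_sub_in)
 note iS = incl_facts[OF S]
 note w = image_surj_facts[OF f(1)]
 have sq: "m o e = incl ?S o ?w" using assms w by simp
 obtain d where d: "arr d" "dom d = cod e" "cod d = dom (incl ?S)" "incl ?S o d = m" "d o e = ?w"
  by (rule surj_mono_fill[OF assms(2) iS(1) w(1) me(1) sq[symmetric]]) (use w(1-3,5) f S iS assms(1-3) me in simp_all)
 obtain d' where d': "arr d'" "dom d' = cod ?w" "cod d' = dom m" "m o d' = incl ?S"
  by (rule surj_mono_fill[OF w(5) assms(1) me(2) iS(4) sq]) (use w(1-3,5) f S iS assms(1-3) me in simp_all)
 have "factors_through m (incl ?S)" "factors_through (incl ?S) m"
  using factors_throughI[of d m "incl ?S"] factors_throughI[of d' "incl ?S" m] d d' w assms by auto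
 hence "sub_class m = sub_class (incl ?S)"
  using sub_class_eq_iff[OF assms(1) iS(1)] iS by simp
 thus "?S = sub_class m" using iS by simp
 have "mono d" by (rule mono_cancel[of "incl ?S"]) (use d iS assms in auto)
 moreover have "surj d" by (rule surj_cancel[of d e]) (use d w me in auto)
 ultimately have "iso d" by (rule mono_surj_iso)
 with d show "\<exists>i. iso i \<and> dom i = cod e \<and> cod i = dom (incl ?S) \<and> ?w = i o e"
  by auto
qed

end

section \<open>Degrees and the class of a span\<close>

locale tensor_setting = regular_category C for C :: "('o, 'm, 'e) cat_scheme" (structure) +
 fixes \<delta> :: "'m \<Rightarrow> 'k :: field"
 assumes sub_finite: "subobject_finite C"
  and term_simple: "no_proper_subobject C (term_obj)"
  and degree: "degree_function C \<delta>"
begin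

lemma finite_Sub [simp]: "ob x ==> finite (Sub x)"
 using sub_finite by (simp add: subobject_finite_def)

lemma deg_ident [simp]: "ob x ==> \<delta> (ide x) = 1"
 using degree by (simp add: degree_function_def)

lemma deg_pullback: "surj e ==> is_pullback e g p e' ==> \<delta> e' = \<delta> e"
 using degree unfolding degree_function_def by blast

lemma deg_comp: "surj e ==> surj f ==> dom e = cod f ==> \<delta> (e o f) = \<delta> e * \<delta> f"
 using degree unfolding degree_function_def by blast

text \<open>An isomorphism is a pullback of an identity.\<close>

lemma deg_iso: "iso i ==> \<delta> i = 1"
 using deg_pullback[of "ide (cod i)" "ide (cod i)" i i]
  pullback_iso[of "ide (cod i)" i "ide (cod i)" i] by simp

text \<open>Here the simplicity of the terminal object enters; it gives every object a degree
  \<open>\<delta> (to_term x)\<close>.\<close>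

lemma surj_to_term [simp]:
 assumes "ob x"
 shows "surj (to_term x)"
proof (rule surjI)
 fix m assume m: "mono m" "cod m = cod (to_term x)"
 hence "sub_class m \<in> Sub (term_obj)" using assms by simp
 hence "sub_class m = sub_top (term_obj)"
  using term_simple by (simp add: no_proper_subobject_def)
 thus "iso m" using sub_class_top_iff[OF m(1)] m assms by simp
qed (use assms in simp)

text \<open>The morphism of an arbitrary span, jointly monic or not: the basis relation of its
  image, weighted by the degree of the surjection onto the image. Graphs, braiding, cups and caps
  are all of this form, and \<open>sp_comp\<close> makes their composition a matter of
  pullbacks.\<close>

definition sp :: "'m \<Rightarrow> 'm \<Rightarrow> ('o, 'm, 'k) rel_arr" where
 "sp f g = (cod f, (\<lambda>t. if t = image_sub (pairing f g) then \<delta> (image_surj (pairing f g)) else 0), cod g)"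

lemma sp_factor:
 assumes "mono m" "surj e" "dom m = cod e" "m o e = pairing f g"
 shows "sp f g = (cod f, (\<lambda>t. if t = sub_class m then \<delta> e else 0), cod g)"
proof -
 obtain i where i: "iso i" "dom i = cod e" "image_surj (pairing f g) = i o e"
  using image_sub_unique(2)[OF assms] by auto
 hence "\<delta> (image_surj (pairing f g)) = \<delta> e"
  using deg_comp[of i e] deg_iso[OF i(1)] assms by simp
 thus ?thesis unfolding sp_def image_sub_unique(1)[OF assms] by (simp cong: if_cong)
qed

lemma sp_mono:
 assumes "mono (pairing f g)"
 shows "sp f g = basis (cod f) (cod g) (sub_class (pairing f g))"
proof -
 have "arr (pairing f g)" using assms by simp
 thus ?thesis
  using sp_factor[of "pairing f g" "ide (dom (pairing f g))" f g] assms
  unfolding basis_def by (simp cong: if_cong)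
qed

lemma basis_sp:
 assumes "r \<in> Sub (prd x y)" "ob x" "ob y"
 shows "basis x y r = sp (pr1 x y o incl r) (pr2 x y o incl r)"
 using sp_mono[of "pr1 x y o incl r" "pr2 x y o incl r"] pairing_pr[of x y "incl r"] assms by simp

lemma pairing_mono_left:
 assumes "mono f" "arr g" "dom f = dom g"
 shows "mono (pairing f g)"
 by (rule mono_cancel[of "pr1 (cod f) (cod g)"]) (use assms mono_arr[OF assms(1)] in simp_all)

lemma pairing_mono_right:
 assumes "mono g" "arr f" "dom f = dom g"
 shows "mono (pairing f g)"
 by (rule mono_cancel[of "pr2 (cod f) (cod g)"]) (use assms mono_arr[OF assms(1)] in simp_all)

lemma br_sp: "arr f ==> br f = sp (ide (dom f)) f"
 unfolding br_def graph_def
 by (subst sp_mono) (auto intro: pairing_mono_left)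

end

section \<open>The linear structure of \<open>T0\<close> and the composition of spans\<close>

context tensor_setting
begin

abbreviation L where "L \<equiv> T0 C \<delta>"
abbreviation hom where "hom \<equiv> Hom L"
abbreviation omg where "omg \<equiv> omega_obj C \<delta>"
abbreviation ten where "ten \<equiv> TenA L"
abbreviation idt where "idt \<equiv> Ident L"
abbreviation pls where "pls \<equiv> Plus L"
abbreviation scl where "scl \<equiv> Scale L"
abbreviation dual where "dual \<equiv> DualA L"
abbreviation coev where "coev \<equiv> Coev L"
abbreviation brd where "brd \<equiv> Braid L"
abbreviation ev where "ev \<equiv> Ev L"
abbreviation zr where "zr \<equiv> Zero L"

abbreviation T0_comp (infixl "oo" 75) where "T0_comp \<equiv> Comp L"

definition cf :: "('o, 'm, 'k) rel_arr \<Rightarrow> 'm set \<Rightarrow> 'k" where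
 "cf a = fst (snd a)"

lemma T0_simps [simp]:
 "Obj L = Obj C" "Dom L a = fst a" "Cod L a = snd (snd a)" "idt x = br (ide x)"
 "zr x y = (x, (\<lambda>t. 0), y)"
 "pls a b = (fst a, (\<lambda>t. cf a t + cf b t), snd (snd a))"
 "scl k a = (fst a, (\<lambda>t. k * cf a t), snd (snd a))"
 "UnitO L = term_obj" "TenO L = prd" "DualO L = (\<lambda>x. x)"
 by (auto simp: T0_def cf_def split: prod.splits)

lemma cf_simps [simp]:
 "cf (x, c, y) = c" "cf (basis x y r) = (\<lambda>t. if t = r then 1 else 0)"
 "fst (basis x y r) = x" "snd (snd (basis x y r)) = y"
 "fst (sp f g) = cod f" "snd (snd (sp f g)) = cod g"
 by (simp_all add: cf_def basis_def sp_def)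

lemma T0_Hom:
 "hom x y = {a. fst a = x \<and> snd (snd a) = y \<and> ob x \<and> ob y \<and>
   (\<forall>r. r \<notin> Sub (prd x y) \<longrightarrow> cf a r = 0)}"
 by (auto simp: Hom_def T0_def cf_def)

lemma T0_eqI: "fst a = fst b ==> snd (snd a) = snd (snd b) ==> (\<And>t. cf a t = cf b t) ==> a = b"
 by (metis cf_def prod.expand ext)

lemma sp_Hom [simp]:
 "arr f ==> arr g ==> dom f = dom g ==> x = cod f ==> y = cod g ==> sp f g \<in> hom x y"
 by (auto simp: T0_Hom sp_def cf_def image_sub_in)

lemma basis_Hom [simp]:
 "ob x ==> ob y ==> r \<in> Sub (prd x y) ==> basis x y r \<in> hom x y"
 by (auto simp: T0_Hom)

text \<open>Every basis relation is the span of its two legs, so spans generate; the induction runs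
  over the set of relations whose coefficients have already been restored.\<close>

lemma T0_span_induct [consumes 1, case_names Zero Span Plus Scale]:
 assumes a: "a \<in> hom x y"
  and zero: "P (zr x y)"
  and span: "\<And>f g. arr f ==> arr g ==> dom f = dom g ==> cod f = x ==> cod g = y ==> P (sp f g)"
  and plus: "\<And>a b. a \<in> hom x y ==> b \<in> hom x y ==> P a ==> P b ==> P (pls a b)"
  and scale: "\<And>k a. a \<in> hom x y ==> P a ==> P (scl k a)"
 shows "P a"
proof -
 have xy: "ob x" "ob y" using a by (auto simp: T0_Hom)
 have "P (x, (\<lambda>t. if t \<in> R then cf a t else 0), y)" if "finite R" "R \<subseteq> Sub (prd x y)" for R
  using that
 proof (induction R rule: finite_induct)
  case empty
  thus ?case using zero by simp
 next
  case (insert r R)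
  let ?A = "(x, (\<lambda>t. if t \<in> R then cf a t else 0), y)" and ?B = "scl (cf a r) (basis x y r)"
  have r: "r \<in> Sub (prd x y)" using insert by simp
  have "P (basis x y r)" unfolding basis_sp[OF r xy] using r xy by (intro span) auto
  hence B: "P ?B" using scale basis_Hom[OF xy r] by blast
  have "P (pls ?A ?B)"
   by (rule plus) (use insert B xy r in \<open>auto simp: T0_Hom\<close>)
  moreover have "pls ?A ?B = (x, (\<lambda>t. if t \<in> insert r R then cf a t else 0), y)"
   using insert by auto
  ultimately show ?case by simp
 qed
 from this[of "Sub (prd x y)"] have "P (x, (\<lambda>t. if t \<in> Sub (prd x y) then cf a t else 0), y)"
  using xy by simp
 moreover have "(x, (\<lambda>t. if t \<in> Sub (prd x y) then cf a t else 0), y) = a"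
  using a by (intro T0_eqI) (auto simp: T0_Hom)
 ultimately show ?thesis by simp
qed

definition comp_coeff :: "'o \<Rightarrow> 'o \<Rightarrow> 'o \<Rightarrow> 'm set \<Rightarrow> 'm set \<Rightarrow> 'm set \<Rightarrow> 'k" where
 "comp_coeff x y z r s t = (if rel_comp x y z r s = t then rel_deg C \<delta> x y z r s else 0)"

lemma T0_Comp:
 assumes "a \<in> hom x y" "b \<in> hom y z"
 shows "b oo a = (x, (\<lambda>t. \<Sum>r\<in>Sub (prd x y). \<Sum>s\<in>Sub (prd y z).
   cf a r * cf b s * comp_coeff x y z r s t), z)"
proof -
 obtain c d where "a = (x, c, y)" "b = (y, d, z)"
  using assms unfolding T0_Hom by (cases a, cases b) auto
 thus ?thesis by (auto simp: T0_def comp_coeff_def intro!: ext sum.cong)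
qed

lemma rel_span_facts:
 assumes "r \<in> Sub (prd x y)" "s \<in> Sub (prd y z)" "ob x" "ob y" "ob z"
 shows "arr (rel_span C x y z r s)" "cod (rel_span C x y z r s) = prd x z"
  "rel_comp x y z r s \<in> Sub (prd x z)"
proof -
 obtain p q where pq: "pb (pr2 x y o incl r) (pr1 y z o incl s) = (p, q)" by fastforce
 have "is_pullback (pr2 x y o incl r) (pr1 y z o incl s) p q"
  using pb[of "pr2 x y o incl r" "pr1 y z o incl s"] pq assms by simp
 note P = pullback_facts[OF this]
 show "arr (rel_span C x y z r s)" "cod (rel_span C x y z r s) = prd x z"
  unfolding rel_span_def pq using P(4-8) assms by simp_all
 thus "rel_comp x y z r s \<in> Sub (prd x z)" unfolding rel_comp_def by (simp add: image_sub_in)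
qed

lemma T0_comp_Hom:
 assumes "a \<in> hom x y" "b \<in> hom y z"
 shows "b oo a \<in> hom x z"
proof -
 have xyz: "ob x" "ob y" "ob z" using assms by (auto simp: T0_Hom)
 have "comp_coeff x y z r s t = 0"
  if "t \<notin> Sub (prd x z)" "r \<in> Sub (prd x y)" "s \<in> Sub (prd y z)" for r s t
  using rel_span_facts(3)[OF that(2,3) xyz] that(1) by (auto simp: comp_coeff_def)
 thus ?thesis unfolding T0_Comp[OF assms] using xyz by (auto simp: T0_Hom)
qed

lemma T0_zero_Hom [simp]: "ob x ==> ob y ==> (x, (\<lambda>t. 0), y) \<in> hom x y"
 by (simp add: T0_Hom)

lemma T0_plus_Hom:
 "a \<in> hom x y ==> b \<in> hom x y ==> pls a b \<in> hom x y"
 by (simp add: T0_Hom)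

lemma T0_scale_Hom:
 "a \<in> hom x y ==> scl k a \<in> hom x y"
 by (simp add: T0_Hom)

lemma T0_comp_plus_right:
 assumes "a \<in> hom x y" "a' \<in> hom x y" "b \<in> hom y z"
 shows "b oo pls a a' = pls (b oo a) (b oo a')"
 using T0_Comp[OF T0_plus_Hom[OF assms(1,2)] assms(3)] T0_Comp[OF assms(1,3)] T0_Comp[OF assms(2,3)]
 by (simp add: distrib_right sum.distrib)

lemma T0_comp_plus_left:
 assumes "a \<in> hom x y" "b \<in> hom y z" "b' \<in> hom y z"
 shows "pls b b' oo a = pls (b oo a) (b' oo a)"
 using T0_Comp[OF assms(1) T0_plus_Hom[OF assms(2,3)]] T0_Comp[OF assms(1,2)] T0_Comp[OF assms(1,3)]
 by (simp add: distrib_right distrib_left sum.distrib)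

lemma T0_comp_scale_right:
 assumes "a \<in> hom x y" "b \<in> hom y z"
 shows "b oo scl k a = scl k (b oo a)"
 using T0_Comp[OF T0_scale_Hom[OF assms(1)] assms(2)] T0_Comp[OF assms]
 by (simp add: mult.assoc sum_distrib_left)

lemma T0_comp_scale_left:
 assumes "a \<in> hom x y" "b \<in> hom y z"
 shows "scl k b oo a = scl k (b oo a)"
 using T0_Comp[OF assms(1) T0_scale_Hom[OF assms(2)]] T0_Comp[OF assms]
 by (simp add: mult.assoc mult.left_commute[of _ k] sum_distrib_left)

lemma T0_comp_zero:
 assumes "a \<in> hom x y" "ob w"
 shows "a oo (w, (\<lambda>t. 0), x) = (w, (\<lambda>t. 0), y)" "(y, (\<lambda>t. 0), w) oo a = (x, (\<lambda>t. 0), w)"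
proof -
 have "ob x" "ob y" using assms by (auto simp: T0_Hom)
 thus "a oo (w, (\<lambda>t. 0), x) = (w, (\<lambda>t. 0), y)" "(y, (\<lambda>t. 0), w) oo a = (x, (\<lambda>t. 0), w)"
  using T0_Comp[OF T0_zero_Hom[OF assms(2)] assms(1)] T0_Comp[OF assms(1) T0_zero_Hom[OF _ assms(2)]]
  by simp_all
qed

text \<open>The image does not change, and the surjection onto it gains the factor \<open>e\<close>,
  whose degree splits off by multiplicativity.\<close>

lemma sp_surj:
 assumes "surj e" "arr f" "arr g" "dom f = cod e" "dom g = cod e"
 shows "sp (f o e) (g o e) = scl (\<delta> e) (sp f g)"
proof -
 have e: "arr e" using assms by simp
 obtain m w where mw: "mono m" "surj w" "dom m = cod w" "m o w = pairing f g"
  "dom w = cod e" "cod m = prd (cod f) (cod g)"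
  using image_factorization[of "pairing f g"] assms by auto
 have "arr m" "arr w" using mw by auto
 hence "m o (w o e) = pairing (f o e) (g o e)"
  using mw e assms by (simp add: reassoc[OF mw(4)])
 moreover have "surj (w o e)" using surj_comp[OF assms(1) mw(2)] mw by simp
 ultimately have "sp (f o e) (g o e) = (cod (f o e), (\<lambda>t. if t = sub_class m then \<delta> (w o e) else 0), cod (g o e))"
  using sp_factor[of m "w o e" "f o e" "g o e"] mw e \<open>arr w\<close> by simp
 thus ?thesis
  using sp_factor[OF mw(1-4)] deg_comp[OF mw(2) assms(1)] mw assms e by (auto simp: mult.commute)
qed

lemma sp_iso:
 assumes "iso e" "arr f" "arr g" "dom f = cod e" "dom g = cod e"
 shows "sp (f o e) (g o e) = sp f g"
 using sp_surj[of e f g] assms deg_iso[of e] by (auto intro: T0_eqI)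

lemma comp_basis:
 assumes "r \<in> Sub (prd x y)" "s \<in> Sub (prd y z)" "ob x" "ob y" "ob z"
 shows "basis y z s oo basis x y r = scl (rel_deg C \<delta> x y z r s) (basis x z (rel_comp x y z r s))"
proof (rule T0_eqI)
 fix t
 have "(if a = r then 1 else 0) * (if b = s then 1 else 0) * comp_coeff x y z a b t =
  (if a = r then if b = s then comp_coeff x y z r s t else 0 else 0)" for a b
  by auto
 moreover have "(\<Sum>b\<in>Sub (prd y z). if a = r then if b = s then comp_coeff x y z r s t else 0 else 0) =
  (if a = r then comp_coeff x y z r s t else 0)" for a
  using assms by (cases "a = r") simp_all
 ultimately show "cf (basis y z s oo basis x y r) t =
   cf (scl (rel_deg C \<delta> x y z r s) (basis x z (rel_comp x y z r s))) t"
  using T0_Comp[of "basis x y r" x y "basis y z s" z] assms by (simp add: comp_coeff_def)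
qed (use T0_Comp[of "basis x y r" x y "basis y z s" z] assms in simp_all)

text \<open>The degree in the composition of relations exists to make this true: pulling back the
  surjections onto the two images gives surjections of the same degrees, and these combine with
  \<open>rel_deg\<close> to the degree of the composite span onto its image.\<close>

lemma sp_comp:
 assumes fg: "arr f" "arr g" "dom f = dom g"
  and fg': "arr f'" "arr g'" "dom f' = dom g'"
  and pq: "is_pullback g f' p q"
 shows "sp f' g' oo sp f g = sp (f o p) (g' o q)"
proof -
 define x y z where "x = cod f" and "y = cod g" and "z = cod g'"
 have y': "cod f' = y" using pullback_facts[OF pq] by (simp add: y_def)
 have xyz: "ob x" "ob y" "ob z" using fg fg' by (auto simp: x_def y_def z_def)
 define r u where "r = image_sub (pairing f g)" and "u = image_surj (pairing f g)"
 define s v where "s = image_sub (pairing f' g')" and "v = image_surj (pairing f' g')"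
 have r: "r \<in> Sub (prd x y)" and s: "s \<in> Sub (prd y z)"
  using fg fg' y' by (simp_all add: r_def s_def x_def y_def z_def image_sub_in)
 have u: "arr u" "dom u = dom g" "cod u = dom (incl r)" "incl r o u = pairing f g" "surj u"
  using image_surj_facts[of "pairing f g"] fg by (simp_all add: r_def u_def)
 have v: "arr v" "dom v = dom g'" "cod v = dom (incl s)" "incl s o v = pairing f' g'" "surj v"
  using image_surj_facts[of "pairing f' g'"] fg' by (simp_all add: s_def v_def)
 define r1 r2 where "r1 = pr1 x y o incl r" and "r2 = pr2 x y o incl r"
 define s1 s2 where "s1 = pr1 y z o incl s" and "s2 = pr2 y z o incl s"
 have r12: "arr r1" "arr r2" "dom r1 = dom (incl r)" "dom r2 = dom (incl r)" "cod r1 = x" "cod r2 = y"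
  using incl_facts[OF r] xyz by (simp_all add: r1_def r2_def)
 have s12: "arr s1" "arr s2" "dom s1 = dom (incl s)" "dom s2 = dom (incl s)" "cod s1 = y" "cod s2 = z"
  using incl_facts[OF s] xyz by (simp_all add: s1_def s2_def)
 have ru: "r1 o u = f" "r2 o u = g" and sv: "s1 o v = f'" "s2 o v = g'"
  using incl_facts[OF r] incl_facts[OF s] xyz u v fg fg' y'
  by (simp_all add: r1_def r2_def s1_def s2_def x_def y_def z_def)
 obtain p0 q0 where pq0: "pb r2 s1 = (p0, q0)" by fastforce
 have P0: "is_pullback r2 s1 p0 q0" using pb[of r2 s1] pq0 r12 s12 by simp
 \<comment> \<open>The passage to images is undone one leg at a time: pulling back \<open>u\<close>,
   then \<open>v\<close>, exhibits the pullback of \<open>g\<close> and \<open>f'\<close> as a cover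
   \<open>a2 o b1\<close> of the pullback of the relation legs.\<close>
 obtain a1 a2 where a: "is_pullback u p0 a1 a2"
  using pullback_exists[of u p0] u r12 pullback_facts[OF P0] by auto
 have 1: "is_pullback g s1 a1 (q0 o a2)"
  using pullback_sym[OF pullback_paste[OF pullback_sym[OF P0] pullback_sym[OF a]]] ru by simp
 obtain b1 b2 where b: "is_pullback (q0 o a2) v b1 b2"
  using pullback_exists[of "q0 o a2" v] v s12 pullback_facts[OF 1] by auto
 have 2: "is_pullback g f' (a1 o b1) b2"
  using pullback_paste[OF 1 b] sv by simp
 \<comment> \<open>The given \<open>p\<close>, \<open>q\<close> are an arbitrary pullback and agree
   with the constructed one only up to \<open>h\<close>.\<close>
 obtain h where h: "iso h" "dom h = dom p" "cod h = dom (a1 o b1)" "(a1 o b1) o h = p" "b2 o h = q"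
  using pullback_unique[OF 2 pq] by metis
 note A = pullback_facts[OF a] and B = pullback_facts[OF b] and P = pullback_facts[OF P0]
 have w: "surj (a2 o b1)" "\<delta> (a2 o b1) = \<delta> u * \<delta> v"
 proof -
  have a2: "surj a2" "\<delta> a2 = \<delta> u" using surj_pullback[OF u(5) a] deg_pullback[OF u(5) a] by auto
  have b1: "surj b1" "\<delta> b1 = \<delta> v"
   using surj_pullback[OF v(5) pullback_sym[OF b]] deg_pullback[OF v(5) pullback_sym[OF b]] by auto
  have "cod b1 = dom a2" using A B P u v r12 s12 by simp
  thus "surj (a2 o b1)" "\<delta> (a2 o b1) = \<delta> u * \<delta> v"
   using surj_comp[OF b1(1) a2(1)] deg_comp[OF a2(1) b1(1)] a2 b1 by simp_all
 qed
 have sp_fg: "sp f g = scl (\<delta> u) (basis x y r)" "sp f' g' = scl (\<delta> v) (basis y z s)"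
  by (auto simp: sp_def x_def y_def z_def y' r_def u_def s_def v_def intro: T0_eqI)
 have "sp f' g' oo sp f g = scl (\<delta> u * \<delta> v) (basis y z s oo basis x y r)"
  unfolding sp_fg T0_comp_scale_right[OF basis_Hom[OF xyz(1,2) r] T0_scale_Hom[OF basis_Hom[OF xyz(2,3) s]]]
   T0_comp_scale_left[OF basis_Hom[OF xyz(1,2) r] basis_Hom[OF xyz(2,3) s]]
  by (simp add: mult.assoc)
 also have "basis y z s oo basis x y r = sp (r1 o p0) (s2 o q0)"
  unfolding comp_basis[OF r s xyz] rel_comp_def rel_deg_def rel_span_def r1_def[symmetric] r2_def[symmetric]
   s1_def[symmetric] s2_def[symmetric] pq0
  using P r12 s12 by (auto simp: sp_def intro: T0_eqI)
 also have "scl (\<delta> u * \<delta> v) (sp (r1 o p0) (s2 o q0)) = sp ((r1 o p0) o (a2 o b1)) ((s2 o q0) o (a2 o b1))"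
  using sp_surj[OF w(1), of "r1 o p0" "s2 o q0"] w(2) A(1-8) B(1-8) P(1-8) r12 s12 u(1-3) v(1-3) by simp
 also have "(r1 o p0) o (a2 o b1) = f o (a1 o b1)"
  using A(1-8) B(1-8) P(1-8) r12 s12 u(1-3) v(1-3)
  by (simp add: ru(1)[symmetric] reassoc[OF A(9)])
 also have "(s2 o q0) o (a2 o b1) = s2 o ((q0 o a2) o b1)"
  using A(1-8) B(1-8) P(1-8) r12 s12 u(1-3) v(1-3) by simp
 also have "... = g' o b2"
  unfolding B(9) using A(1-8) B(1-8) P(1-8) r12 s12 u(1-3) v(1-3) reassoc[OF sv(2), of b2] by simp
 also have "sp (f o (a1 o b1)) (g' o b2) = sp ((f o (a1 o b1)) o h) ((g' o b2) o h)"
  by (rule sp_iso[symmetric]) (use h(1-3) A(1-8) B(1-8) P(1-8) r12 s12 u(1-3) v(1-3) fg fg' in simp_all)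
 also have "... = sp (f o p) (g' o q)"
  using h A(1-8) B(1-8) P(1-8) r12 s12 u(1-3) v(1-3) fg fg' by simp
 finally show ?thesis .
qed

lemma sp_comp_graph:
 assumes "arr f" "arr g" "dom f = dom g" "arr h" "dom h = cod g"
 shows "br h oo sp f g = sp f (h o g)"
 unfolding br_sp[OF assms(4)]
 using sp_comp[OF assms(1-3) _ assms(4), of "ide (dom h)" "ide (dom g)" g]
  pullback_id[of g] assms by simp

text \<open>Restricted to isomorphisms because then the pullback of the left leg along
  \<open>h\<close> is the left leg itself, corrected by the inverse \<open>k\<close>.\<close>

lemma sp_precomp_graph:
 assumes "arr f" "arr g" "dom f = dom g" "iso h" "cod h = cod f"
  and that: "arr k" "dom k = cod h" "cod k = dom h" "h o k = ide (cod h)"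
 shows "sp f g oo br h = sp (k o f) g"
proof -
 have "is_pullback h f (k o f) (ide (dom f))"
  by (rule pullback_iso) (use assms that in \<open>simp_all add: reassoc[OF that(4)]\<close>)
 thus ?thesis
  unfolding br_sp[OF iso_arr[OF assms(4)]]
  using sp_comp[of "ide (dom h)" h f g "k o f" "ide (dom f)"] assms that by simp
qed

lemma T0_ident:
 assumes "a \<in> hom x y"
 shows "a oo br (ide x) = a" "br (ide y) oo a = a"
proof -
 have xy: "ob x" "ob y" using assms by (auto simp: T0_Hom)
 have H: "br (ide x) \<in> hom x x" "br (ide y) \<in> hom y y"
  using xy by (simp_all add: br_sp del: T0_Hom)
 show "a oo br (ide x) = a"
  using assms
 proof (induction rule: T0_span_induct)
  case Zero
  thus ?case using T0_comp_zero(2)[OF H(1) xy(2)] by simp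
 next
  case (Span f g)
  have "sp f g oo br (ide x) = sp (ide x o f) g"
   by (rule sp_precomp_graph) (use Span xy in simp_all)
  thus ?case using Span by (simp only: ident_comp')
 next
  case (Plus a b)
  thus ?case using T0_comp_plus_left[OF H(1)] by metis
 next
  case (Scale k a)
  thus ?case using T0_comp_scale_left[OF H(1)] by metis
 qed
 show "br (ide y) oo a = a"
  using assms
 proof (induction rule: T0_span_induct)
  case Zero
  thus ?case using T0_comp_zero(1)[OF H(2) xy(1)] by simp
 next
  case (Span f g)
  have "br (ide y) oo sp f g = sp f (ide y o g)"
   by (rule sp_comp_graph) (use Span xy in simp_all)
  thus ?case using Span by (simp only: ident_comp')
 next
  case (Plus a b)
  thus ?case using T0_comp_plus_right[OF _ _ H(2)] by metis
 next
  case (Scale k a)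
  thus ?case using T0_comp_scale_right[OF _ H(2)] by metis
 qed
qed

end

section \<open>The tensor category of relations\<close>

context category
begin

lemma pullback_lift:
 assumes "is_pullback f g p q" "arr a" "arr b" "dom a = dom b" "cod a = dom f"
  "cod b = dom g" "f \<cdot> a = g \<cdot> b"
 obtains h where "arr h" "dom h = dom b" "cod h = dom p" "p \<cdot> h = a" "q \<cdot> h = b"
 using assms(1) by (rule pullbackE) (use assms(2-7) that in blast)

lemma pullback_cancel:
 assumes "is_pullback f g p q" "arr h" "arr k" "dom h = dom k" "cod h = dom p"
  "cod k = dom p" "p \<cdot> h = p \<cdot> k" "q \<cdot> h = q \<cdot> k"
 shows "h = k"
 using assms(1) by (rule pullbackE) (use assms(2-8) in blast)

end

section \<open>Products of morphisms, the swap and equalizers\<close>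

context finlim_category
begin

definition crs :: "'m \<Rightarrow> 'm \<Rightarrow> 'm" where
 "crs f g = pairing (f o pr1 (dom f) (dom g)) (g o pr2 (dom f) (dom g))"

lemma crs_arr [simp]:
 assumes "arr f" "arr g"
 shows "arr (crs f g)" "dom (crs f g) = prd (dom f) (dom g)"
  "cod (crs f g) = prd (cod f) (cod g)"
 using assms by (simp_all add: crs_def)

lemma crs_pairing [simp]:
 assumes "arr f" "arr g" "arr a" "arr b" "dom a = dom b" "cod a = dom f" "cod b = dom g"
 shows "crs f g o pairing a b = pairing (f o a) (g o b)"
 using assms by (simp add: crs_def)

lemma crs_comp [simp]:
 assumes "arr f" "arr g" "arr f'" "arr g'" "dom f = cod f'" "dom g = cod g'"
 shows "crs f g o crs f' g' = crs (f o f') (g o g')"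
 unfolding crs_def[of f' g'] crs_def[of "f o f'"] using assms by simp

lemma crs_ident [simp]:
 "ob x ==> ob y ==> crs (ide x) (ide y) = ide (prd x y)"
 by (simp add: crs_def)

lemma crs_app:
 assumes "arr f" "arr g" "arr h" "cod h = prd (dom f) (dom g)"
 shows "crs f g o h = pairing (f o (pr1 (dom f) (dom g) o h)) (g o (pr2 (dom f) (dom g) o h))"
 using assms by (simp add: crs_def)

lemma crs_app_eq_iff:
 assumes "arr f" "arr g" "arr h" "cod h = prd (dom f) (dom g)"
  "arr f'" "arr g'" "arr k" "cod k = prd (dom f') (dom g')"
  "dom h = dom k" "cod f = cod f'" "cod g = cod g'"
 shows "crs f g o h = crs f' g' o k \<longleftrightarrow>
  f o (pr1 (dom f) (dom g) o h) = f' o (pr1 (dom f') (dom g') o k) \<and>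
  g o (pr2 (dom f) (dom g) o h) = g' o (pr2 (dom f') (dom g') o k)"
 unfolding crs_app[OF assms(1-4)] crs_app[OF assms(5-8)]
 by (rule pairing_eq_iff) (use assms in simp_all)

lemma crs_mono:
 assumes "mono f" "mono g"
 shows "mono (crs f g)"
proof (rule monoI)
 have fg: "arr f" "arr g" using assms by auto
 thus "arr (crs f g)" by simp
 fix a b assume ab: "arr a" "arr b" "dom a = dom b" "cod a = dom (crs f g)"
  "cod b = dom (crs f g)" "crs f g o a = crs f g o b"
 let ?p = "pr1 (dom f) (dom g)" and ?q = "pr2 (dom f) (dom g)"
 have "f o (?p o a) = f o (?p o b)" "g o (?q o a) = g o (?q o b)"
  using crs_app_eq_iff[of f g a f g b] ab fg by simp_all
 hence "?p o a = ?p o b" "?q o a = ?q o b"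
  using monoD[OF assms(1), of "?p o a" "?p o b"] monoD[OF assms(2), of "?q o a" "?q o b"] ab(1-5) fg by simp_all
 thus "a = b" by (intro prd_ext[of a b "dom f" "dom g"]) (use ab(1-5) fg in simp_all)
qed

lemma pullback_crs:
 assumes P: "is_pullback f g p q" and P': "is_pullback f' g' p' q'"
 shows "is_pullback (crs f f') (crs g g') (crs p p') (crs q q')"
proof -
 note F = pullback_facts[OF P] and F' = pullback_facts[OF P']
 have O: "ob (dom f)" "ob (dom f')" "ob (dom g)" "ob (dom g')" "ob (dom p)" "ob (dom p')"
  using dom_obj[OF F(1)] dom_obj[OF F(2)] dom_obj[OF F(4)] dom_obj[OF F'(1)] dom_obj[OF F'(2)] dom_obj[OF F'(4)] by auto
 show ?thesis
 proof (rule pullbackI)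
  fix a b assume ab: "arr a" "arr b" "dom a = dom b" "cod a = dom (crs f f')"
   "cod b = dom (crs g g')" "crs f f' o a = crs g g' o b"
  let ?a1 = "pr1 (dom f) (dom f') o a" and ?a2 = "pr2 (dom f) (dom f') o a"
  let ?b1 = "pr1 (dom g) (dom g') o b" and ?b2 = "pr2 (dom g) (dom g') o b"
  have C: "cod a = prd (dom f) (dom f')" "cod b = prd (dom g) (dom g')"
   using ab(4,5) F(1-3) F'(1-3) by simp_all
  have e: "f o ?a1 = g o ?b1" "f' o ?a2 = g' o ?b2"
   using crs_app_eq_iff[of f f' a g g' b] ab(1-3,6) C F(1-3) F'(1-3) by simp_all
  obtain h where h: "arr h" "dom h = dom ?b1" "cod h = dom p" "p o h = ?a1" "q o h = ?b1"
   by (rule pullback_lift[OF P, of ?a1 ?b1]) (use e ab(1-3) C O in simp_all)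
  obtain h' where h': "arr h'" "dom h' = dom ?b2" "cod h' = dom p'" "p' o h' = ?a2" "q' o h' = ?b2"
   by (rule pullback_lift[OF P', of ?a2 ?b2]) (use e ab(1-3) C O in simp_all)
  have d: "dom h = dom b" "dom h' = dom b" using h(2) h'(2) ab(2) C O by simp_all
  have "crs p p' o pairing h h' = a"
   using h(1,3) h'(1,3) d F(4-8) F'(4-8) ab(1) C O by (simp add: h(4) h'(4) pairing_pr)
  moreover have "crs q q' o pairing h h' = b"
   using h(1,3) h'(1,3) d F(4-8) F'(4-8) ab(2) C O by (simp add: h(5) h'(5) pairing_pr)
  ultimately show "\<exists>h. arr h \<and> dom h = dom b \<and> cod h = dom (crs p p') \<and> crs p p' o h = a \<and> crs q q' o h = b"
   using h(1,3) h'(1,3) d F(4-8) F'(4-8) by (intro exI[of _ "pairing h h'"]) simp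
 next
  fix a b assume ab: "arr a" "arr b" "dom a = dom b" "cod a = dom (crs p p')"
   "cod b = dom (crs p p')" "crs p p' o a = crs p p' o b" "crs q q' o a = crs q q' o b"
  let ?p = "pr1 (dom p) (dom p')" and ?q = "pr2 (dom p) (dom p')"
  have C: "cod a = prd (dom p) (dom p')" "cod b = prd (dom p) (dom p')"
   using ab(4,5) F(4-8) F'(4-8) by simp_all
  have "p o (?p o a) = p o (?p o b) \<and> p' o (?q o a) = p' o (?q o b)"
   using crs_app_eq_iff[of p p' a p p' b] ab(1-3,6) C F(4-8) F'(4-8) by simp
  moreover have "q o (?p o a) = q o (?p o b) \<and> q' o (?q o a) = q' o (?q o b)"
   using crs_app_eq_iff[of q q' a q q' b] ab(1-3,7) C F(4-8) F'(4-8) by simp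
  ultimately have "?p o a = ?p o b" "?q o a = ?q o b"
   using pullback_cancel[OF P, of "?p o a" "?p o b"] pullback_cancel[OF P', of "?q o a" "?q o b"] ab(1-3) C O by simp_all
  thus "a = b" by (intro prd_ext[of a b "dom p" "dom p'"]) (use ab(1-3) C O in simp_all)
 qed (use F F' in simp_all)
qed

text \<open>Exhibits the product of \<open>u\<close> with an identity as a pullback of
  \<open>u\<close>, so that surjectivity and degree pass to products of surjections.\<close>

lemma pullback_pr1:
 assumes "arr u" "ob y"
 shows "is_pullback u (pr1 (cod u) y) (pr1 (dom u) y) (crs u (ide y))"
proof (rule pullbackI)
 show "u o pr1 (dom u) y = pr1 (cod u) y o crs u (ide y)"
  using assms by (simp add: crs_def)
next
 fix a b assume ab: "arr a" "arr b" "dom a = dom b" "cod a = dom u"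
  "cod b = dom (pr1 (cod u) y)" "u o a = pr1 (cod u) y o b"
 have "crs u (ide y) o pairing a (pr2 (cod u) y o b) = b"
  using ab(1-5) assms by (simp add: ab(6) pairing_pr)
 thus "\<exists>h. arr h \<and> dom h = dom b \<and> cod h = dom (pr1 (dom u) y) \<and>
   pr1 (dom u) y o h = a \<and> crs u (ide y) o h = b"
  using ab(1-5) assms by (intro exI[of _ "pairing a (pr2 (cod u) y o b)"]) simp
next
 fix h k assume hk: "arr h" "arr k" "dom h = dom k" "cod h = dom (pr1 (dom u) y)"
  "cod k = dom (pr1 (dom u) y)" "pr1 (dom u) y o h = pr1 (dom u) y o k"
  "crs u (ide y) o h = crs u (ide y) o k"
 have "pr2 (dom u) y o h = pr2 (dom u) y o k"
  using crs_app_eq_iff[of u "ide y" h u "ide y" k] hk(1-5,7) assms by simp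
 thus "h = k" using hk(1-6) assms by (intro prd_ext[of h k "dom u" y]) simp_all
qed (use assms in simp_all)

definition sw :: "'o \<Rightarrow> 'o \<Rightarrow> 'm" where
 "sw x y = pairing (pr2 x y) (pr1 x y)"

lemma sw_arr [simp]:
 assumes "ob x" "ob y"
 shows "arr (sw x y)" "dom (sw x y) = prd x y" "cod (sw x y) = prd y x"
 using assms by (simp_all add: sw_def)

lemma sw_pairing [simp]:
 assumes "arr a" "arr b" "dom a = dom b" "cod a = x" "cod b = y"
 shows "sw x y o pairing a b = pairing b a"
 using assms by (auto simp: sw_def)

lemma sw_sw [simp]:
 assumes "ob x" "ob y"
 shows "sw y x o sw x y = ide (prd x y)"
 unfolding sw_def[of x y] using assms by simp

lemma sw_iso: "ob x ==> ob y ==> iso (sw x y)"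
 by (rule isoI[of _ "sw y x"]) simp_all

lemma sw_crs:
 assumes "arr f" "arr g" "cod f = x" "cod g = y"
 shows "sw x y o crs f g = crs g f o sw (dom f) (dom g)"
 unfolding sw_def[of "dom f"] using assms by (auto simp: crs_def[of f g])

lemma pullback_pr2:
 assumes "arr v" "ob x"
 shows "is_pullback v (pr2 x (cod v)) (pr2 x (dom v)) (crs (ide x) v)"
proof (rule pullbackI)
 show "v o pr2 x (dom v) = pr2 x (cod v) o crs (ide x) v"
  using assms by (simp add: crs_def)
next
 fix a b assume ab: "arr a" "arr b" "dom a = dom b" "cod a = dom v"
  "cod b = dom (pr2 x (cod v))" "v o a = pr2 x (cod v) o b"
 have "crs (ide x) v o pairing (pr1 x (cod v) o b) a = b"
  using ab(1-5) assms by (simp add: ab(6) pairing_pr)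
 thus "\<exists>h. arr h \<and> dom h = dom b \<and> cod h = dom (pr2 x (dom v)) \<and>
   pr2 x (dom v) o h = a \<and> crs (ide x) v o h = b"
  using ab(1-5) assms by (intro exI[of _ "pairing (pr1 x (cod v) o b) a"]) simp
next
 fix h k assume hk: "arr h" "arr k" "dom h = dom k" "cod h = dom (pr2 x (dom v))"
  "cod k = dom (pr2 x (dom v))" "pr2 x (dom v) o h = pr2 x (dom v) o k"
  "crs (ide x) v o h = crs (ide x) v o k"
 have "pr1 x (dom v) o h = pr1 x (dom v) o k"
  using crs_app_eq_iff[of "ide x" v h "ide x" v k] hk(1-5,7) assms by simp
 thus "h = k" using hk(1-6) assms by (intro prd_ext[of h k x "dom v"]) simp_all
qed (use assms in simp_all)

definition is_equalizer :: "'m \<Rightarrow> 'm \<Rightarrow> 'm \<Rightarrow> bool" where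
 "is_equalizer f g m \<longleftrightarrow> mono m \<and> cod m = dom f \<and> f o m = g o m \<and>
  (\<forall>h. arr h \<and> cod h = dom f \<and> f o h = g o h \<longrightarrow> factors_through h m)"

text \<open>The equalizer as a pullback along the diagonal is the form in which it arises when a
  span is composed with \<open>Ev\<close>.\<close>

lemma equalizer_pullback:
 assumes "arr f" "arr g" "dom f = dom g" "cod f = x" "cod g = x"
 shows "is_equalizer f g m \<longleftrightarrow>
  is_pullback (pairing f g) (pairing (ide x) (ide x)) m (f o m) \<and> arr m \<and> cod m = dom f"
  (is "_ \<longleftrightarrow> ?P \<and> _")
proof -
 have x: "ob x" using assms by auto
 show ?thesis
 proof
  assume e: "is_equalizer f g m"
  hence m: "mono m" "cod m = dom f" "f o m = g o m" "arr m" by (auto simp: is_equalizer_def)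
  have "?P"
  proof (rule pullbackI)
   fix a b assume ab: "arr a" "arr b" "dom a = dom b" "cod a = dom (pairing f g)"
    "cod b = dom (pairing (ide x) (ide x))" "pairing f g o a = pairing (ide x) (ide x) o b"
   hence "pairing (f o a) (g o a) = pairing b b" using assms x by simp
   hence "f o a = b" "g o a = b" using ab(1-5) assms x by (simp_all add: pairing_eq_iff)
   hence "factors_through a m" using e ab(1-4) assms unfolding is_equalizer_def by simp
   then obtain h where h: "arr h" "dom h = dom a" "cod h = dom m" "m o h = a" by (rule factors_throughE)
   have "(f o m) o h = f o (m o h)" by (rule comp_assoc') (use h(1-3) m(2,4) assms in simp_all)
   hence "(f o m) o h = b" using h(4) \<open>f o a = b\<close> by simp
   thus "\<exists>h. arr h \<and> dom h = dom b \<and> cod h = dom m \<and> m o h = a \<and> (f o m) o h = b"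
    using h ab(3) by (intro exI[of _ h]) (simp del: comp_assoc')
  next
   fix h k assume "arr h" "arr k" "dom h = dom k" "cod h = dom m" "cod k = dom m"
    "m o h = m o k"
   thus "h = k" using monoD[OF m(1)] by simp
  qed (use m(2,4) assms x in \<open>simp_all add: m(3)\<close>)
  with m show "?P \<and> arr m \<and> cod m = dom f" by simp
 next
  assume P: "?P \<and> arr m \<and> cod m = dom f"
  have D: "mono (pairing (ide x) (ide x))"
   by (rule mono_cancel[of "pr1 x x"]) (use x in simp_all)
  have m: "mono m" using pullback_mono[OF pullback_sym[OF conjunct1[OF P]] D] .
  have "pairing (f o m) (g o m) = pairing (f o m) (f o m)"
   using pullback_facts(9)[of "pairing f g" "pairing (ide x) (ide x)" m "f o m"] P assms x by simp
  hence fg: "f o m = g o m" using P assms by (simp add: pairing_eq_iff)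
  moreover have "factors_through h m" if h: "arr h" "cod h = dom f" "f o h = g o h" for h
  proof -
   obtain k where "arr k" "dom k = dom (f o h)" "cod k = dom m" "m o k = h"
    by (rule pullback_lift[OF conjunct1[OF P], of h "f o h"]) (use h assms x in simp_all)
   thus ?thesis using h assms by (auto intro: factors_throughI)
  qed
  ultimately show "is_equalizer f g m" using m P unfolding is_equalizer_def by blast
 qed
qed

lemma equalizer_exists:
 assumes "arr f" "arr g" "dom f = dom g" "cod f = cod g"
 obtains m where "is_equalizer f g m"
proof -
 let ?x = "cod g"
 obtain p q where P: "is_pullback (pairing f g) (pairing (ide ?x) (ide ?x)) p q"
  using pullback_exists[of "pairing f g" "pairing (ide ?x) (ide ?x)"] assms by auto
 note F = pullback_facts[OF P]
 have "pairing (f o p) (g o p) = pairing q q" using F assms by simp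
 hence "f o p = q" using F(4-8) assms by (simp add: pairing_eq_iff)
 hence "is_equalizer f g p" using equalizer_pullback[of f g ?x p] P F(4-8) assms by simp
 thus ?thesis by (rule that)
qed

end

section \<open>Linear extension from spans, associativity and the tensor product\<close>

context tensor_setting
begin

declare T0_simps(5-7) [simp del]

definition lin :: "'o \<Rightarrow> 'o \<Rightarrow> 'o \<Rightarrow> 'o \<Rightarrow> (('o, 'm, 'k) rel_arr \<Rightarrow> ('o, 'm, 'k) rel_arr) \<Rightarrow> bool" where
 "lin x y u v F \<longleftrightarrow> (\<forall>a\<in>hom x y. F a \<in> hom u v) \<and>
   (\<forall>a\<in>hom x y. \<forall>b\<in>hom x y. F (pls a b) = pls (F a) (F b)) \<and>
   (\<forall>k. \<forall>a\<in>hom x y. F (scl k a) = scl k (F a))"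

lemma linI:
 assumes "\<And>a. a \<in> hom x y ==> F a \<in> hom u v"
  "\<And>a b. a \<in> hom x y ==> b \<in> hom x y ==> F (pls a b) = pls (F a) (F b)"
  "\<And>k a. a \<in> hom x y ==> F (scl k a) = scl k (F a)"
 shows "lin x y u v F"
 using assms unfolding lin_def by blast

lemma linD:
 assumes "lin x y u v F" "a \<in> hom x y"
 shows "F a \<in> hom u v" "b \<in> hom x y ==> F (pls a b) = pls (F a) (F b)" "F (scl k a) = scl k (F a)"
 using assms unfolding lin_def by blast+

lemma lin_compose:
 assumes "lin x y u v F" "lin u v p q G"
 shows "lin x y p q (\<lambda>a. G (F a))"
proof (rule linI)
 fix a assume a: "a \<in> hom x y"
 note Fa = linD(1)[OF assms(1) a]
 show "G (F a) \<in> hom p q" by (rule linD(1)[OF assms(2) Fa])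
 show "G (F (scl k a)) = scl k (G (F a))" for k
  unfolding linD(3)[OF assms(1) a] linD(3)[OF assms(2) Fa] ..
 fix b assume b: "b \<in> hom x y"
 show "G (F (pls a b)) = pls (G (F a)) (G (F b))"
  unfolding linD(2)[OF assms(1) a b] linD(2)[OF assms(2) Fa linD(1)[OF assms(1) b]] ..
qed

lemma zero_scale: "a \<in> hom x y ==> scl 0 a = zr x y"
 by (auto simp: T0_Hom T0_simps)

lemma lin_zero:
 assumes "lin x y u v F" "ob x" "ob y"
 shows "F (zr x y) = zr u v"
proof -
 have z: "zr x y \<in> hom x y" using assms by (simp add: T0_simps)
 show ?thesis
  using linD(3)[OF assms(1) z, of 0] zero_scale[OF z] zero_scale[OF linD(1)[OF assms(1) z]] by simp
qed

text \<open>Applied once per argument, this reduces a multilinear identity in \<open>T0\<close> to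
  an identity of spans, that is, to a statement about pullbacks.\<close>

lemma lin_ext:
 assumes "lin x y u v F" "lin x y u v G"
  and "\<And>f g. [|arr f; arr g; dom f = dom g; cod f = x; cod g = y|] ==> F (sp f g) = G (sp f g)"
  and a: "a \<in> hom x y"
 shows "F a = G a"
 using a
proof (induction rule: T0_span_induct)
 case Zero
 have "ob x" "ob y" using a by (auto simp: T0_Hom)
 thus ?case using lin_zero[OF assms(1)] lin_zero[OF assms(2)] by metis
next
 case (Plus a b)
 thus ?case using linD(2)[OF assms(1)] linD(2)[OF assms(2)] by metis
next
 case (Scale k a)
 thus ?case using linD(3)[OF assms(1)] linD(3)[OF assms(2)] by metis
qed (rule assms(3))

lemma lin_comp_left: "c \<in> hom y z ==> lin x y x z (\<lambda>a. c oo a)"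
 by (rule linI) (blast intro: T0_comp_Hom T0_comp_plus_right T0_comp_scale_right)+

lemma lin_comp_right: "c \<in> hom w x ==> lin x y w y (\<lambda>a. a oo c)"
 by (rule linI) (blast intro: T0_comp_Hom T0_comp_plus_left T0_comp_scale_left)+

lemma lin_id: "lin x y x y (\<lambda>a. a)"
 by (rule linI) auto

lemma sp_HomI: "[|arr f; arr g; dom f = dom g; cod f = x; cod g = y|] ==> sp f g \<in> hom x y"
 by (rule sp_Hom) auto

lemma br_Hom: "arr f ==> dom f = x ==> cod f = y ==> br f \<in> hom x y"
 unfolding br_sp by (rule sp_HomI) auto

lemma T0_assoc:
 assumes "a \<in> hom w x" "b \<in> hom x y" "c \<in> hom y z"
 shows "c oo (b oo a) = (c oo b) oo a"
 using _ _ _ assms(1)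
proof (rule lin_ext[where F = "\<lambda>a. c oo (b oo a)"])
 show "lin w x w z (\<lambda>a. c oo (b oo a))"
  using lin_compose[OF lin_comp_left[OF assms(2)] lin_comp_left[OF assms(3)]] .
 show "lin w x w z ((oo) (c oo b))"
  using lin_comp_left[OF T0_comp_Hom[OF assms(2,3)]] .
 fix f g assume fg: "arr f" "arr g" "dom f = dom g" "cod f = w" "cod g = x"
 have sfg: "sp f g \<in> hom w x" by (rule sp_HomI[OF fg])
 show "c oo (b oo sp f g) = (c oo b) oo sp f g"
  using _ _ _ assms(2)
 proof (rule lin_ext[where F = "\<lambda>b. c oo (b oo sp f g)"])
  show "lin x y w z (\<lambda>b. c oo (b oo sp f g))"
   using lin_compose[OF lin_comp_right[OF sfg] lin_comp_left[OF assms(3)]] .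
  show "lin x y w z (\<lambda>b. (c oo b) oo sp f g)"
   using lin_compose[OF lin_comp_left[OF assms(3)] lin_comp_right[OF sfg]] .
  fix f' g' assume fg': "arr f'" "arr g'" "dom f' = dom g'" "cod f' = x" "cod g' = y"
  have sfg': "sp f' g' \<in> hom x y" by (rule sp_HomI[OF fg'])
  show "c oo (sp f' g' oo sp f g) = (c oo sp f' g') oo sp f g"
   using _ _ _ assms(3)
  proof (rule lin_ext[where F = "\<lambda>c. c oo (sp f' g' oo sp f g)"])
   show "lin y z w z (\<lambda>c. c oo (sp f' g' oo sp f g))"
    by (rule lin_comp_right[OF T0_comp_Hom[OF sfg sfg']])
   show "lin y z w z (\<lambda>c. (c oo sp f' g') oo sp f g)"
    using lin_compose[OF lin_comp_right[OF sfg'] lin_comp_right[OF sfg]] .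
   fix h k assume hk: "arr h" "arr k" "dom h = dom k" "cod h = y" "cod k = z"
   obtain p q where P: "is_pullback g f' p q" using pullback_exists[of g f'] fg fg' by auto
   note FP = pullback_facts[OF P]
   obtain p' q' where P': "is_pullback g' h p' q'" using pullback_exists[of g' h] fg' hk by auto
   note FP' = pullback_facts[OF P']
   \<comment> \<open>The pullback of the two pullbacks is the limit of the whole zigzag; pasting it
     on either side computes the two bracketings.\<close>
   obtain r s where R: "is_pullback q p' r s" using pullback_exists[of q p'] FP(4-8) FP'(4-8) fg' by auto
   note FR = pullback_facts[OF R]
   have 1: "is_pullback g (f' o p') (p o r) s" by (rule pullback_paste[OF P R])
   have 2: "is_pullback (g' o q) h r (q' o s)"
    using pullback_sym[OF pullback_paste[OF pullback_sym[OF P'] pullback_sym[OF R]]] .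
   have "sp h k oo (sp f' g' oo sp f g) = sp h k oo sp (f o p) (g' o q)"
    using sp_comp[OF fg(1-3) fg'(1-3) P] by simp
   also have "... = sp ((f o p) o r) (k o (q' o s))"
    by (rule sp_comp[OF _ _ _ hk(1-3) 2]) (use fg fg' FP(4-8) in simp_all)
   also have "... = sp (f o (p o r)) ((k o q') o s)"
    using fg fg' hk FP(4-8) FP'(4-8) FR(4-8) by simp
   also have "... = sp (f' o p') (k o q') oo sp f g"
    by (rule sp_comp[OF fg(1-3) _ _ _ 1, symmetric]) (use fg' hk FP'(4-8) in simp_all)
   also have "... = (sp h k oo sp f' g') oo sp f g"
    using sp_comp[OF fg'(1-3) hk(1-3) P'] by simp
   finally show "sp h k oo (sp f' g' oo sp f g) = (sp h k oo sp f' g') oo sp f g" .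
  qed
 qed
qed

lemma sp_image:
 assumes "arr f" "arr g" "dom f = dom g" "cod f = x" "cod g = y"
 obtains r u where "r \<in> Sub (prd x y)" "surj u" "dom u = dom g" "cod u = dom (incl r)"
  "pr1 x y o incl r o u = f" "pr2 x y o incl r o u = g" "sp f g = scl (\<delta> u) (basis x y r)"
proof -
 let ?r = "image_sub (pairing f g)" and ?u = "image_surj (pairing f g)"
 have r: "?r \<in> Sub (prd x y)" using assms by (auto simp: image_sub_in)
 note u = image_surj_facts[of "pairing f g"]
 show ?thesis
  by (rule that[of ?r ?u])
   (use r u assms incl_facts[OF r] in \<open>auto simp: sp_def T0_simps intro!: T0_eqI\<close>)
qed

text \<open>The two factors of u x v = (u x id)(id x v) are pullbacks of u and v along
  projections.\<close>

lemma deg_crs: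
 assumes "surj u" "surj v"
 shows "surj (crs u v)" "\<delta> (crs u v) = \<delta> u * \<delta> v"
proof -
 let ?a = "crs u (ide (cod v))" and ?b = "crs (ide (dom u)) v"
 have uv: "arr u" "arr v" using assms by auto
 have e: "crs u v = ?a o ?b" using uv by simp
 have a: "surj ?a" "\<delta> ?a = \<delta> u"
  using surj_pullback[OF assms(1) pullback_pr1] deg_pullback[OF assms(1) pullback_pr1] uv by simp_all
 have b: "surj ?b" "\<delta> ?b = \<delta> v"
  using surj_pullback[OF assms(2) pullback_pr2] deg_pullback[OF assms(2) pullback_pr2] uv by simp_all
 show "surj (crs u v)" "\<delta> (crs u v) = \<delta> u * \<delta> v"
  unfolding e using surj_comp[OF b(1) a(1)] deg_comp[OF a(1) b(1)] a b uv by simp_all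
qed

lemma T0_Ten:
 assumes "a \<in> hom x y" "b \<in> hom x' y'"
 shows "ten a b = (prd x x', (\<lambda>t. \<Sum>r\<in>Sub (prd x y). \<Sum>s\<in>Sub (prd x' y').
   cf a r * cf b s * (if rel_ten x y x' y' r s = t then 1 else 0)), prd y y')"
proof -
 obtain c d where "a = (x, c, y)" "b = (x', d, y')"
  using assms unfolding T0_Hom by (cases a, cases b) auto
 thus ?thesis by (auto simp: T0_def intro!: ext sum.cong)
qed

lemma rel_ten_sp:
 assumes "r \<in> Sub (prd x y)" "s \<in> Sub (prd x' y')" "ob x" "ob y" "ob x'" "ob y'"
 shows "rel_ten x y x' y' r s \<in> Sub (prd (prd x x') (prd y y'))"
  "basis (prd x x') (prd y y') (rel_ten x y x' y' r s) =
   sp (crs (pr1 x y o incl r) (pr1 x' y' o incl s)) (crs (pr2 x y o incl r) (pr2 x' y' o incl s))"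
proof -
 note r = incl_facts[OF assms(1)] and s = incl_facts[OF assms(2)]
 define r1 r2 s1 s2 where "r1 = pr1 x y o incl r" and "r2 = pr2 x y o incl r"
  and "s1 = pr1 x' y' o incl s" and "s2 = pr2 x' y' o incl s"
 have t: "arr r1" "arr r2" "dom r1 = dom (incl r)" "dom r2 = dom (incl r)" "cod r1 = x" "cod r2 = y"
  "arr s1" "arr s2" "dom s1 = dom (incl s)" "dom s2 = dom (incl s)" "cod s1 = x'" "cod s2 = y'"
  using r s assms by (simp_all add: r1_def r2_def s1_def s2_def)
 have e: "rel_ten x y x' y' r s = sub_class (pairing (crs r1 s1) (crs r2 s2))"
  unfolding rel_ten_def Let_def r1_def[symmetric] r2_def[symmetric] s1_def[symmetric] s2_def[symmetric]
  by (simp add: crs_def t)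
 have "mono (pairing (crs r1 s1) (crs r2 s2))"
 proof (rule monoI)
  fix a b assume ab: "arr a" "arr b" "dom a = dom b" "cod a = dom (pairing (crs r1 s1) (crs r2 s2))"
   "cod b = dom (pairing (crs r1 s1) (crs r2 s2))"
   "pairing (crs r1 s1) (crs r2 s2) o a = pairing (crs r1 s1) (crs r2 s2) o b"
  let ?R = "dom (incl r)" and ?S = "dom (incl s)"
  have C: "cod a = prd ?R ?S" "cod b = prd ?R ?S" using ab(4,5) t by simp_all
  have "pairing (crs r1 s1 o a) (crs r2 s2 o a) = pairing (crs r1 s1 o b) (crs r2 s2 o b)"
   using ab(6) ab(1-3) C t by simp
  hence c: "crs r1 s1 o a = crs r1 s1 o b" "crs r2 s2 o a = crs r2 s2 o b"
   using ab(1-3) C t by (simp_all add: pairing_eq_iff)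
  have O: "ob ?R" "ob ?S" using r(4) s(4) by auto
  have "r1 o (pr1 ?R ?S o a) = r1 o (pr1 ?R ?S o b)" "s1 o (pr2 ?R ?S o a) = s1 o (pr2 ?R ?S o b)"
   "r2 o (pr1 ?R ?S o a) = r2 o (pr1 ?R ?S o b)" "s2 o (pr2 ?R ?S o a) = s2 o (pr2 ?R ?S o b)"
   using crs_app_eq_iff[of r1 s1 a r1 s1 b] crs_app_eq_iff[of r2 s2 a r2 s2 b] c ab(1-3) C t by simp_all
  hence "pairing r1 r2 o (pr1 ?R ?S o a) = pairing r1 r2 o (pr1 ?R ?S o b)"
   "pairing s1 s2 o (pr2 ?R ?S o a) = pairing s1 s2 o (pr2 ?R ?S o b)"
   using t ab(1-3) C O by simp_all
  moreover have "pairing r1 r2 = incl r" "pairing s1 s2 = incl s"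
   using r s assms by (simp_all add: r1_def r2_def s1_def s2_def pairing_pr)
  ultimately have "pr1 ?R ?S o a = pr1 ?R ?S o b" "pr2 ?R ?S o a = pr2 ?R ?S o b"
   using monoD[OF r(1), of "pr1 ?R ?S o a" "pr1 ?R ?S o b"] monoD[OF s(1), of "pr2 ?R ?S o a" "pr2 ?R ?S o b"]
    ab(1-3) C O by simp_all
  thus "a = b" by (intro prd_ext[of a b ?R ?S]) (use ab(1-3) C O in simp_all)
 qed (use t in simp)
 thus "rel_ten x y x' y' r s \<in> Sub (prd (prd x x') (prd y y'))"
  "basis (prd x x') (prd y y') (rel_ten x y x' y' r s) = sp (crs r1 s1) (crs r2 s2)"
  unfolding e using t sp_mono[of "crs r1 s1" "crs r2 s2"] by simp_all
qed

lemma T0_Ten_Hom: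
 assumes "a \<in> hom x y" "b \<in> hom x' y'"
 shows "ten a b \<in> hom (prd x x') (prd y y')"
proof -
 have O: "ob x" "ob y" "ob x'" "ob y'" using assms by (auto simp: T0_Hom)
 have "(\<Sum>r\<in>Sub (prd x y). \<Sum>s\<in>Sub (prd x' y').
   cf a r * cf b s * (if rel_ten x y x' y' r s = t then 1 else 0)) = 0"
  if "t \<notin> Sub (prd (prd x x') (prd y y'))" for t
  using rel_ten_sp(1)[OF _ _ O] that by (intro sum.neutral ballI) auto
 thus ?thesis unfolding T0_Ten[OF assms] using O by (simp add: T0_Hom)
qed

lemma lin_Ten_left:
 assumes b: "b \<in> hom x' y'"
 shows "lin x y (prd x x') (prd y y') (\<lambda>a. ten a b)"
proof (rule linI)
 fix a assume a: "a \<in> hom x y"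
 show "ten a b \<in> hom (prd x x') (prd y y')" by (rule T0_Ten_Hom[OF a b])
 show "ten (scl k a) b = scl k (ten a b)" for k
  unfolding T0_Ten[OF T0_scale_Hom[OF a] b] T0_Ten[OF a b]
  by (simp add: T0_simps mult.assoc sum_distrib_left)
 fix a' assume a': "a' \<in> hom x y"
 show "ten (pls a a') b = pls (ten a b) (ten a' b)"
  unfolding T0_Ten[OF T0_plus_Hom[OF a a'] b] T0_Ten[OF a b] T0_Ten[OF a' b]
  by (simp add: T0_simps distrib_right sum.distrib)
qed

lemma lin_Ten_right:
 assumes a: "a \<in> hom x y"
 shows "lin x' y' (prd x x') (prd y y') (\<lambda>b. ten a b)"
proof (rule linI)
 fix b assume b: "b \<in> hom x' y'"
 show "ten a b \<in> hom (prd x x') (prd y y')" by (rule T0_Ten_Hom[OF a b])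
 show "ten a (scl k b) = scl k (ten a b)" for k
  unfolding T0_Ten[OF a T0_scale_Hom[OF b]] T0_Ten[OF a b]
  by (simp add: T0_simps mult.assoc mult.left_commute[of _ k] sum_distrib_left)
 fix b' assume b': "b' \<in> hom x' y'"
 show "ten a (pls b b') = pls (ten a b) (ten a b')"
  unfolding T0_Ten[OF a T0_plus_Hom[OF b b']] T0_Ten[OF a b] T0_Ten[OF a b']
  by (simp add: T0_simps distrib_right distrib_left sum.distrib)
qed

lemma Ten_basis:
 assumes "r \<in> Sub (prd x y)" "s \<in> Sub (prd x' y')" "ob x" "ob y" "ob x'" "ob y'"
 shows "ten (basis x y r) (basis x' y' s) = basis (prd x x') (prd y y') (rel_ten x y x' y' r s)"
proof -
 have "(if a = r then 1 else 0) * (if b = s then 1 else 0) * (if rel_ten x y x' y' a b = t then 1 else (0::'k)) =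
  (if a = r then if b = s then if rel_ten x y x' y' r s = t then 1 else 0 else 0 else 0)" for a b t
  by auto
 moreover have "(\<Sum>b\<in>Sub (prd x' y'). if a = r then if b = s then c else 0 else (0::'k)) =
  (if a = r then c else 0)" for a c
  using assms by (cases "a = r") simp_all
 ultimately show ?thesis
  using T0_Ten[of "basis x y r" x y "basis x' y' s" x' y'] assms by (auto intro!: T0_eqI)
qed

lemma sp_Ten:
 assumes fg: "arr f" "arr g" "dom f = dom g" and fg': "arr f'" "arr g'" "dom f' = dom g'"
 shows "ten (sp f g) (sp f' g') = sp (crs f f') (crs g g')"
proof -
 define x y x' y' where "x = cod f" and "y = cod g" and "x' = cod f'" and "y' = cod g'"
 have O: "ob x" "ob y" "ob x'" "ob y'" using fg fg' by (auto simp: x_def y_def x'_def y'_def)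
 obtain r u where ru: "r \<in> Sub (prd x y)" "surj u" "dom u = dom g" "cod u = dom (incl r)"
  "pr1 x y o incl r o u = f" "pr2 x y o incl r o u = g" "sp f g = scl (\<delta> u) (basis x y r)"
  using sp_image[of f g x y] fg by (auto simp: x_def y_def)
 obtain s v where sv: "s \<in> Sub (prd x' y')" "surj v" "dom v = dom g'" "cod v = dom (incl s)"
  "pr1 x' y' o incl s o v = f'" "pr2 x' y' o incl s o v = g'" "sp f' g' = scl (\<delta> v) (basis x' y' s)"
  using sp_image[of f' g' x' y'] fg' by (auto simp: x'_def y'_def)
 have br: "basis x y r \<in> hom x y" "basis x' y' s \<in> hom x' y'" using O ru sv by simp_all
 let ?R = "sp (crs (pr1 x y o incl r) (pr1 x' y' o incl s)) (crs (pr2 x y o incl r) (pr2 x' y' o incl s))"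
 have "ten (sp f g) (sp f' g') = scl (\<delta> u) (scl (\<delta> v) (ten (basis x y r) (basis x' y' s)))"
  unfolding ru(7) sv(7)
  using linD(3)[OF lin_Ten_left[OF T0_scale_Hom[OF br(2)]] br(1)] linD(3)[OF lin_Ten_right[OF br(1)] br(2)]
  by metis
 also have "... = scl (\<delta> (crs u v)) ?R"
  unfolding Ten_basis[OF ru(1) sv(1) O] rel_ten_sp(2)[OF ru(1) sv(1) O] deg_crs[OF ru(2) sv(2)]
  by (simp add: T0_simps mult.assoc)
 also have "... = sp (crs (pr1 x y o incl r) (pr1 x' y' o incl s) o crs u v) (crs (pr2 x y o incl r) (pr2 x' y' o incl s) o crs u v)"
  by (rule sp_surj[OF deg_crs(1)[OF ru(2) sv(2)], symmetric])
   (use O incl_facts[OF ru(1)] incl_facts[OF sv(1)] ru(4) sv(4) surj_arr[OF ru(2)] surj_arr[OF sv(2)] in simp_all)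
 also have "... = sp (crs f f') (crs g g')"
  unfolding ru(5,6)[symmetric] sv(5,6)[symmetric]
  using O incl_facts[OF ru(1)] incl_facts[OF sv(1)] ru(4) sv(4) surj_arr[OF ru(2)] surj_arr[OF sv(2)]
  by (simp del: comp_assoc')
 finally show ?thesis .
qed

end

section \<open>Functoriality of the tensor product, braiding, duals, cups and caps\<close>

context tensor_setting
begin

text \<open>Linearity in each of the four arguments leaves spans, for which the claim is that
  products preserve pullbacks.\<close>

lemma T0_Ten_comp:
 assumes "a \<in> hom x y" "b \<in> hom y z" "a' \<in> hom x' y'" "b' \<in> hom y' z'"
 shows "ten (b oo a) (b' oo a') = ten b b' oo ten a a'"
 using _ _ _ assms(1)
proof (rule lin_ext[where F = "\<lambda>a. ten (b oo a) (b' oo a')"])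
 show "lin x y (prd x x') (prd z z') (\<lambda>a. ten (b oo a) (b' oo a'))"
  using lin_compose[OF lin_comp_left[OF assms(2)] lin_Ten_left[OF T0_comp_Hom[OF assms(3,4)]]] .
 show "lin x y (prd x x') (prd z z') (\<lambda>a. ten b b' oo ten a a')"
  using lin_compose[OF lin_Ten_left[OF assms(3)] lin_comp_left[OF T0_Ten_Hom[OF assms(2,4)]]] .
 fix f g assume fg: "arr f" "arr g" "dom f = dom g" "cod f = x" "cod g = y"
 note A = sp_HomI[OF fg]
 show "ten (b oo sp f g) (b' oo a') = ten b b' oo ten (sp f g) a'"
  using _ _ _ assms(2)
 proof (rule lin_ext[where F = "\<lambda>b. ten (b oo sp f g) (b' oo a')"])
  show "lin y z (prd x x') (prd z z') (\<lambda>b. ten (b oo sp f g) (b' oo a'))"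
   using lin_compose[OF lin_comp_right[OF A] lin_Ten_left[OF T0_comp_Hom[OF assms(3,4)]]] .
  show "lin y z (prd x x') (prd z z') (\<lambda>b. ten b b' oo ten (sp f g) a')"
   using lin_compose[OF lin_Ten_left[OF assms(4)] lin_comp_right[OF T0_Ten_Hom[OF A assms(3)]]] .
  fix h k assume hk: "arr h" "arr k" "dom h = dom k" "cod h = y" "cod k = z"
  note B = sp_HomI[OF hk]
  show "ten (sp h k oo sp f g) (b' oo a') = ten (sp h k) b' oo ten (sp f g) a'"
   using _ _ _ assms(3)
  proof (rule lin_ext[where F = "\<lambda>a'. ten (sp h k oo sp f g) (b' oo a')"])
   show "lin x' y' (prd x x') (prd z z') (\<lambda>a'. ten (sp h k oo sp f g) (b' oo a'))"
    using lin_compose[OF lin_comp_left[OF assms(4)] lin_Ten_right[OF T0_comp_Hom[OF A B]]] .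
   show "lin x' y' (prd x x') (prd z z') (\<lambda>a'. ten (sp h k) b' oo ten (sp f g) a')"
    using lin_compose[OF lin_Ten_right[OF A] lin_comp_left[OF T0_Ten_Hom[OF B assms(4)]]] .
   fix f' g' assume fg': "arr f'" "arr g'" "dom f' = dom g'" "cod f' = x'" "cod g' = y'"
   note A' = sp_HomI[OF fg']
   show "ten (sp h k oo sp f g) (b' oo sp f' g') = ten (sp h k) b' oo ten (sp f g) (sp f' g')"
    using _ _ _ assms(4)
   proof (rule lin_ext[where F = "\<lambda>b'. ten (sp h k oo sp f g) (b' oo sp f' g')"])
    show "lin y' z' (prd x x') (prd z z') (\<lambda>b'. ten (sp h k oo sp f g) (b' oo sp f' g'))"
     using lin_compose[OF lin_comp_right[OF A'] lin_Ten_right[OF T0_comp_Hom[OF A B]]] .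
    show "lin y' z' (prd x x') (prd z z') (\<lambda>b'. ten (sp h k) b' oo ten (sp f g) (sp f' g'))"
     using lin_compose[OF lin_Ten_right[OF B] lin_comp_right[OF T0_Ten_Hom[OF A A']]] .
    fix h' k' assume hk': "arr h'" "arr k'" "dom h' = dom k'" "cod h' = y'" "cod k' = z'"
    obtain p q where P: "is_pullback g h p q" using pullback_exists[of g h] fg hk by auto
    obtain p' q' where P': "is_pullback g' h' p' q'" using pullback_exists[of g' h'] fg' hk' by auto
    note F = pullback_facts[OF P] and F' = pullback_facts[OF P']
    have "ten (sp h k oo sp f g) (sp h' k' oo sp f' g') = ten (sp (f o p) (k o q)) (sp (f' o p') (k' o q'))"
     using sp_comp[OF fg(1-3) hk(1-3) P] sp_comp[OF fg'(1-3) hk'(1-3) P'] by simp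
    also have "... = sp (crs (f o p) (f' o p')) (crs (k o q) (k' o q'))"
     by (rule sp_Ten) (use fg fg' hk hk' F(4-8) F'(4-8) in simp_all)
    also have "... = sp (crs f f' o crs p p') (crs k k' o crs q q')"
     using fg fg' hk hk' F(4-8) F'(4-8) by simp
    also have "... = sp (crs h h') (crs k k') oo sp (crs f f') (crs g g')"
     by (rule sp_comp[OF _ _ _ _ _ _ pullback_crs[OF P P'], symmetric]) (use fg fg' hk hk' in simp_all)
    also have "... = ten (sp h k) (sp h' k') oo ten (sp f g) (sp f' g')"
     using sp_Ten[OF fg(1-3) fg'(1-3)] sp_Ten[OF hk(1-3) hk'(1-3)] by simp
    finally show "ten (sp h k oo sp f g) (sp h' k' oo sp f' g') =
     ten (sp h k) (sp h' k') oo ten (sp f g) (sp f' g')" .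
   qed
  qed
 qed
qed

lemma T0_Braid: "brd x y = br (sw x y)"
 by (simp add: T0_def sw_def)

lemma T0_Braid_Hom:
 "ob x ==> ob y ==> brd x y \<in> hom (prd x y) (prd y x)"
 unfolding T0_Braid by (rule br_Hom) simp_all

lemma T0_Braid_nat:
 assumes "a \<in> hom x y" "b \<in> hom x' y'"
 shows "brd y y' oo ten a b = ten b a oo brd x x'"
 using _ _ _ assms(1)
proof (rule lin_ext[where F = "\<lambda>a. brd y y' oo ten a b"])
 have O: "ob x" "ob y" "ob x'" "ob y'" using assms by (auto simp: T0_Hom)
 note Bx = T0_Braid_Hom[OF O(1,3)] and By = T0_Braid_Hom[OF O(2,4)]
 show "lin x y (prd x x') (prd y' y) (\<lambda>a. brd y y' oo ten a b)"
  using lin_compose[OF lin_Ten_left[OF assms(2)] lin_comp_left[OF By]] .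
 show "lin x y (prd x x') (prd y' y) (\<lambda>a. ten b a oo brd x x')"
  using lin_compose[OF lin_Ten_right[OF assms(2)] lin_comp_right[OF Bx]] .
 fix f g assume fg: "arr f" "arr g" "dom f = dom g" "cod f = x" "cod g = y"
 note A = sp_HomI[OF fg]
 show "brd y y' oo ten (sp f g) b = ten b (sp f g) oo brd x x'"
  using _ _ _ assms(2)
 proof (rule lin_ext[where F = "\<lambda>b. brd y y' oo ten (sp f g) b"])
  show "lin x' y' (prd x x') (prd y' y) (\<lambda>b. brd y y' oo ten (sp f g) b)"
   using lin_compose[OF lin_Ten_right[OF A] lin_comp_left[OF By]] .
  show "lin x' y' (prd x x') (prd y' y) (\<lambda>b. ten b (sp f g) oo brd x x')"
   using lin_compose[OF lin_Ten_left[OF A] lin_comp_right[OF Bx]] .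
  fix f' g' assume fg': "arr f'" "arr g'" "dom f' = dom g'" "cod f' = x'" "cod g' = y'"
  \<comment> \<open>The apexes of the two sides are the two products of \<open>dom g\<close> and
    \<open>dom g'\<close>; \<open>?i\<close> identifies them.\<close>
  let ?i = "sw (dom g) (dom g')"
  have D: "ob (dom g)" "ob (dom g')" using fg fg' by auto
  have "brd y y' oo ten (sp f g) (sp f' g') = sp (crs f f') (sw y y' o crs g g')"
   unfolding sp_Ten[OF fg(1-3) fg'(1-3)] T0_Braid
   by (rule sp_comp_graph) (use fg fg' O in simp_all)
  also have "sw y y' o crs g g' = crs g' g o ?i" using sw_crs fg fg' by simp
  also have "crs f f' = (sw x' x o crs f' f) o ?i"
  proof -
   have "(sw x' x o crs f' f) o ?i = sw x' x o (sw x x' o crs f f')"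
    using sw_crs[of f f' x x'] fg fg' O D by simp
   also have "... = crs f f'" using fg fg' O by (simp add: reassoc[OF sw_sw])
   finally show ?thesis by simp
  qed
  also have "sp ((sw x' x o crs f' f) o ?i) (crs g' g o ?i) = sp (sw x' x o crs f' f) (crs g' g)"
   by (rule sp_iso[OF sw_iso[OF D]]) (use fg fg' O D in simp_all)
  also have "... = sp (crs f' f) (crs g' g) oo br (sw x x')"
   by (rule sp_precomp_graph[OF _ _ _ sw_iso[OF O(1,3)], symmetric]) (use fg fg' O in simp_all)
  also have "... = ten (sp f' g') (sp f g) oo brd x x'"
   unfolding sp_Ten[OF fg'(1-3) fg(1-3)] T0_Braid ..
  finally show "brd y y' oo ten (sp f g) (sp f' g') = ten (sp f' g') (sp f g) oo brd x x'" .
 qed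
qed

lemma T0_Dual:
 assumes "a \<in> hom x y"
 shows "dual a = (y, (\<lambda>t. \<Sum>r\<in>Sub (prd x y). cf a r * (if rel_op x y r = t then 1 else 0)), x)"
proof -
 obtain c where "a = (x, c, y)" using assms unfolding T0_Hom by (cases a) auto
 thus ?thesis by (auto simp: T0_def intro!: ext sum.cong)
qed

lemma rel_op_sp:
 assumes "r \<in> Sub (prd x y)" "ob x" "ob y"
 shows "rel_op x y r \<in> Sub (prd y x)"
  "basis y x (rel_op x y r) = sp (pr2 x y o incl r) (pr1 x y o incl r)"
proof -
 note r = incl_facts[OF assms(1)]
 let ?m = "pairing (pr2 x y o incl r) (pr1 x y o incl r)"
 have "?m = sw x y o incl r" using r assms by (simp add: sw_def)
 moreover have "mono (sw x y o incl r)"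
  by (rule mono_comp[OF r(1)]) (use sw_iso[OF assms(2,3)] r assms in simp_all)
 ultimately have m: "mono ?m" by simp
 thus "rel_op x y r \<in> Sub (prd y x)"
  unfolding rel_op_def using r assms by (intro sub_class_in) simp_all
 show "basis y x (rel_op x y r) = sp (pr2 x y o incl r) (pr1 x y o incl r)"
  using sp_mono[OF m] r assms by (simp add: rel_op_def)
qed

lemma T0_Dual_Hom:
 assumes "a \<in> hom x y"
 shows "dual a \<in> hom y x"
proof -
 have O: "ob x" "ob y" using assms by (auto simp: T0_Hom)
 have "(\<Sum>r\<in>Sub (prd x y). cf a r * (if rel_op x y r = t then 1 else 0)) = 0"
  if "t \<notin> Sub (prd y x)" for t
  using rel_op_sp(1)[OF _ O] that by (intro sum.neutral ballI) auto
 thus ?thesis unfolding T0_Dual[OF assms] using O by (simp add: T0_Hom)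
qed

lemma lin_Dual: "lin x y y x (dual)"
proof (rule linI)
 fix a assume a: "a \<in> hom x y"
 show "dual a \<in> hom y x" by (rule T0_Dual_Hom[OF a])
 show "dual (scl k a) = scl k (dual a)" for k
  unfolding T0_Dual[OF T0_scale_Hom[OF a]] T0_Dual[OF a]
  by (simp add: T0_simps mult.assoc sum_distrib_left)
 fix b assume b: "b \<in> hom x y"
 show "dual (pls a b) = pls (dual a) (dual b)"
  unfolding T0_Dual[OF T0_plus_Hom[OF a b]] T0_Dual[OF a] T0_Dual[OF b]
  by (simp add: T0_simps distrib_right sum.distrib)
qed

lemma sp_Dual:
 assumes "arr f" "arr g" "dom f = dom g"
 shows "dual (sp f g) = sp g f"
proof -
 define x y where "x = cod f" and "y = cod g"
 have O: "ob x" "ob y" using assms by (auto simp: x_def y_def)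
 obtain r u where ru: "r \<in> Sub (prd x y)" "surj u" "dom u = dom g" "cod u = dom (incl r)"
  "pr1 x y o incl r o u = f" "pr2 x y o incl r o u = g" "sp f g = scl (\<delta> u) (basis x y r)"
  using sp_image[of f g x y] assms by (auto simp: x_def y_def)
 have b: "basis x y r \<in> hom x y" using O ru by simp
 have "(if a = r then 1 else 0) * (if rel_op x y a = t then 1 else (0::'k)) =
  (if a = r then if rel_op x y r = t then 1 else 0 else 0)" for a t
  by auto
 hence "dual (basis x y r) = basis y x (rel_op x y r)"
  using T0_Dual[OF b] ru(1) O by (auto intro!: T0_eqI)
 hence "dual (sp f g) = scl (\<delta> u) (sp (pr2 x y o incl r) (pr1 x y o incl r))"
  unfolding ru(7) linD(3)[OF lin_Dual b] rel_op_sp(2)[OF ru(1) O, symmetric] by simp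
 also have "... = sp g f"
  using sp_surj[OF ru(2), of "pr2 x y o incl r" "pr1 x y o incl r"] ru(4-6) O incl_facts[OF ru(1)]
  by (simp del: comp_assoc')
 finally show ?thesis .
qed

lemma T0_Dual_comp:
 assumes "a \<in> hom x y" "b \<in> hom y z"
 shows "dual (b oo a) = dual a oo dual b"
 using _ _ _ assms(1)
proof (rule lin_ext[where F = "\<lambda>a. dual (b oo a)"])
 show "lin x y z x (\<lambda>a. dual (b oo a))"
  using lin_compose[OF lin_comp_left[OF assms(2)] lin_Dual] .
 show "lin x y z x (\<lambda>a. dual a oo dual b)"
  using lin_compose[OF lin_Dual lin_comp_right[OF T0_Dual_Hom[OF assms(2)]]] .
 fix f g assume fg: "arr f" "arr g" "dom f = dom g" "cod f = x" "cod g = y"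
 note A = sp_HomI[OF fg]
 show "dual (b oo sp f g) = dual (sp f g) oo dual b"
  using _ _ _ assms(2)
 proof (rule lin_ext[where F = "\<lambda>b. dual (b oo sp f g)"])
  show "lin y z z x (\<lambda>b. dual (b oo sp f g))"
   using lin_compose[OF lin_comp_right[OF A] lin_Dual] .
  show "lin y z z x (\<lambda>b. dual (sp f g) oo dual b)"
   using lin_compose[OF lin_Dual lin_comp_left[OF T0_Dual_Hom[OF A]]] .
  fix h k assume hk: "arr h" "arr k" "dom h = dom k" "cod h = y" "cod k = z"
  obtain p q where P: "is_pullback g h p q" using pullback_exists[of g h] fg hk by auto
  note F = pullback_facts[OF P]
  have "dual (sp h k oo sp f g) = sp (k o q) (f o p)"
   unfolding sp_comp[OF fg(1-3) hk(1-3) P] using sp_Dual fg hk F(4-8) by simp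
  also have "... = sp g f oo sp k h"
   by (rule sp_comp[OF _ _ _ _ _ _ pullback_sym[OF P], symmetric]) (use fg hk in simp_all)
  finally show "dual (sp h k oo sp f g) = dual (sp f g) oo dual (sp h k)"
   using sp_Dual fg hk by simp
 qed
qed

lemma diag_mono: "ob x ==> mono (pairing (ide x) (ide x))"
 by (rule pairing_mono_left) simp_all

lemma T0_Coev:
 assumes "ob x"
 shows "coev x = sp (to_term x) (pairing (ide x) (ide x))"
 using sp_mono[OF pairing_mono_right[OF diag_mono[OF assms], of "to_term x"]] assms
 by (simp add: T0_def)

lemma T0_Ev:
 assumes "ob x"
 shows "ev x = sp (pairing (ide x) (ide x)) (to_term x)"
 using sp_mono[OF pairing_mono_left[OF diag_mono[OF assms], of "to_term x"]] assms
 by (simp add: T0_def)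

lemma T0_Coev_Hom: "ob x ==> coev x \<in> hom (term_obj) (prd x x)"
 unfolding T0_Coev by (rule sp_HomI) simp_all

lemma T0_Ev_Hom: "ob x ==> ev x \<in> hom (prd x x) (term_obj)"
 unfolding T0_Ev by (rule sp_HomI) simp_all

lemma T0_ident_Hom: "ob x ==> idt x \<in> hom x x"
 by (auto intro: br_Hom)

text \<open>Bending the input leg to the output side: the pullback of the diagonal along f x id is
  the graph of \<open>f\<close>, so the two legs are merely paired.\<close>

lemma Ten_Coev_left:
 assumes "arr f" "arr g" "dom f = dom g" "cod f = x"
 shows "ten (sp f g) (idt x) oo coev x = sp (to_term (dom g)) (pairing g f)"
proof -
 have x: "ob x" using assms by auto
 let ?D = "pairing (ide x) (ide x)"
 have "is_pullback ?D (crs f (ide x)) f (pairing (ide (dom g)) f)"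
 proof (rule pullbackI)
  fix a b assume ab: "arr a" "arr b" "dom a = dom b" "cod a = dom ?D"
   "cod b = dom (crs f (ide x))" "?D o a = crs f (ide x) o b"
  let ?b1 = "pr1 (dom g) x o b" and ?b2 = "pr2 (dom g) x o b"
  have "pairing a a = pairing (f o ?b1) ?b2"
   using ab assms x by (simp add: crs_app)
  hence e: "a = f o ?b1" "a = ?b2" using ab(1-5) assms x by (subst (asm) pairing_eq_iff; simp)+
  have "pairing ?b1 (f o ?b1) = b"
   unfolding e(1)[symmetric] e(2) using ab(1-5) assms x by (simp add: pairing_pr)
  thus "\<exists>h. arr h \<and> dom h = dom b \<and> cod h = dom f \<and> f o h = a \<and> pairing (ide (dom g)) f o h = b"
   using ab(1-5) assms x e(1) by (intro exI[of _ ?b1]) simp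
 next
  fix h k assume hk: "arr h" "arr k" "dom h = dom k" "cod h = dom f" "cod k = dom f"
   "pairing (ide (dom g)) f o h = pairing (ide (dom g)) f o k"
  hence "pairing h (f o h) = pairing k (f o k)" using assms by simp
  thus "h = k" using hk(1-5) assms by (simp add: pairing_eq_iff)
 qed (use assms x in simp_all)
 hence "sp (crs f (ide x)) (crs g (ide x)) oo sp (to_term x) ?D =
  sp (to_term x o f) (crs g (ide x) o pairing (ide (dom g)) f)"
  by (intro sp_comp) (use assms x in simp_all)
 thus ?thesis using assms x by (simp add: T0_Coev br_sp sp_Ten)
qed

lemma Ten_Coev_right:
 assumes "arr f" "arr g" "dom f = dom g" "cod g = y"
 shows "ten (idt y) (sp g f) oo coev y = sp (to_term (dom g)) (pairing g f)"
proof -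
 have y: "ob y" using assms by auto
 let ?D = "pairing (ide y) (ide y)"
 have "is_pullback ?D (crs (ide y) g) g (pairing g (ide (dom g)))"
 proof (rule pullbackI)
  fix a b assume ab: "arr a" "arr b" "dom a = dom b" "cod a = dom ?D"
   "cod b = dom (crs (ide y) g)" "?D o a = crs (ide y) g o b"
  let ?b1 = "pr1 y (dom g) o b" and ?b2 = "pr2 y (dom g) o b"
  have "pairing a a = pairing ?b1 (g o ?b2)"
   using ab assms y by (simp add: crs_app)
  hence e: "a = ?b1" "a = g o ?b2" using ab(1-5) assms y by (subst (asm) pairing_eq_iff; simp)+
  have "pairing (g o ?b2) ?b2 = b"
   unfolding e(2)[symmetric] e(1) using ab(1-5) assms y by (simp add: pairing_pr)
  thus "\<exists>h. arr h \<and> dom h = dom b \<and> cod h = dom g \<and> g o h = a \<and> pairing g (ide (dom g)) o h = b"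
   using ab(1-5) assms y e(2) by (intro exI[of _ ?b2]) simp
 next
  fix h k assume hk: "arr h" "arr k" "dom h = dom k" "cod h = dom g" "cod k = dom g"
   "pairing g (ide (dom g)) o h = pairing g (ide (dom g)) o k"
  hence "pairing (g o h) h = pairing (g o k) k" using assms by simp
  thus "h = k" using hk(1-5) assms by (simp add: pairing_eq_iff)
 qed (use assms y in simp_all)
 hence "sp (crs (ide y) g) (crs (ide y) f) oo sp (to_term y) ?D =
  sp (to_term y o g) (crs (ide y) f o pairing g (ide (dom g)))"
  by (intro sp_comp) (use assms y in simp_all)
 thus ?thesis using assms y by (simp add: T0_Coev br_sp sp_Ten)
qed

text \<open>A morphism slides around the cup as its dual: for a span both sides pair the same two
  legs over the same apex.\<close>

lemma T0_Coev_dual: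
 assumes "a \<in> hom x y"
 shows "ten a (idt x) oo coev x = ten (idt y) (dual a) oo coev y"
 using _ _ _ assms
proof (rule lin_ext[where F = "\<lambda>a. ten a (idt x) oo coev x"])
 have O: "ob x" "ob y" using assms by (auto simp: T0_Hom)
 show "lin x y (term_obj) (prd y x) (\<lambda>a. ten a (idt x) oo coev x)"
  using lin_compose[OF lin_Ten_left[OF T0_ident_Hom[OF O(1)]] lin_comp_right[OF T0_Coev_Hom[OF O(1)]]] .
 show "lin x y (term_obj) (prd y x) (\<lambda>a. ten (idt y) (dual a) oo coev y)"
  using lin_compose[OF lin_Dual lin_compose[OF lin_Ten_right[OF T0_ident_Hom[OF O(2)]] lin_comp_right[OF T0_Coev_Hom[OF O(2)]]]] .
 fix f g assume fg: "arr f" "arr g" "dom f = dom g" "cod f = x" "cod g = y"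
 show "ten (sp f g) (idt x) oo coev x = ten (idt y) (dual (sp f g)) oo coev y"
  using Ten_Coev_left[OF fg(1-4)] Ten_Coev_right[OF fg(1-3,5)] sp_Dual[OF fg(1-3)] by simp
qed

end

section \<open>Linear categories with a trace\<close>

locale tcat_category = category L for L :: "('o, 'm, 'k :: field, 'e) tcat_scheme" (structure)
begin

abbreviation ten where "ten \<equiv> TenA L"
abbreviation teno where "teno \<equiv> TenO L"
abbreviation du where "du \<equiv> DualO L"
abbreviation dual where "dual \<equiv> DualA L"
abbreviation U where "U \<equiv> UnitO L"
abbreviation addt where "addt \<equiv> add_ten L"
abbreviation pls where "pls \<equiv> Plus L"
abbreviation zr where "zr \<equiv> Zero L"
abbreviation scl where "scl \<equiv> Scale L"
abbreviation brd where "brd \<equiv> Braid L"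
abbreviation coev where "coev \<equiv> Coev L"
abbreviation ev where "ev \<equiv> Ev L"
abbreviation hom where "hom \<equiv> Hom L"

end

locale lin_category = tcat_category L for L :: "('o, 'm, 'k :: field, 'e) tcat_scheme" (structure) +
 assumes zero_hom: "ob x ==> ob y ==> zr x y \<in> hom x y"
  and plus_hom: "f \<in> hom x y ==> g \<in> hom x y ==> pls f g \<in> hom x y"
  and scale_hom: "f \<in> hom x y ==> scl k f \<in> hom x y"
  and plus_assoc: "[|f \<in> hom x y; g \<in> hom x y; h \<in> hom x y|] ==>
   pls (pls f g) h = pls f (pls g h)"
  and plus_comm: "f \<in> hom x y ==> g \<in> hom x y ==> pls f g = pls g f"
  and plus_zero: "f \<in> hom x y ==> pls f (zr x y) = f"
  and scale_plus: "f \<in> hom x y ==> g \<in> hom x y ==> scl k (pls f g) = pls (scl k f) (scl k g)"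
  and plus_scale: "f \<in> hom x y ==> scl (k + l) f = pls (scl k f) (scl l f)"
  and scale_scale: "f \<in> hom x y ==> scl k (scl l f) = scl (k * l) f"
  and scale_one: "f \<in> hom x y ==> scl 1 f = f"
  and scale_zero: "f \<in> hom x y ==> scl 0 f = zr x y"
  and comp_plus_left: "[|f \<in> hom x y; g \<in> hom y z; h \<in> hom y z|] ==> pls g h \<cdot> f = pls (g \<cdot> f) (h \<cdot> f)"
  and comp_plus_right: "[|f \<in> hom x y; h \<in> hom x y; g \<in> hom y z|] ==> g \<cdot> pls f h = pls (g \<cdot> f) (g \<cdot> h)"
  and comp_scale_left: "[|f \<in> hom x y; g \<in> hom y z|] ==> scl k g \<cdot> f = scl k (g \<cdot> f)"
  and comp_scale_right: "[|f \<in> hom x y; g \<in> hom y z|] ==> g \<cdot> scl k f = scl k (g \<cdot> f)"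

text \<open>The axioms are those that traces need and that pass to the additive completion. Rigidity
  appears as the sliding rule \<open>coev_dual\<close>, and cyclicity of the trace as an axiom that
  is inherited from matrix entries.\<close>

locale tensor_category = lin_category L for L :: "('o, 'm, 'k :: field, 'e) tcat_scheme" (structure) +
 assumes unit_obj: "ob U"
  and scalars: "a \<in> hom U U ==> \<exists>k. a = scl k (ide U)"
  and scale_unit_inj: "scl k (ide U) = scl l (ide U) ==> k = l"
  and ten_obj: "ob x ==> ob y ==> ob (teno x y)"
  and ten_hom: "f \<in> hom x y ==> g \<in> hom x' y' ==> ten f g \<in> hom (teno x x') (teno y y')"
  and ten_comp: "[|a \<in> hom x y; b \<in> hom y z; a' \<in> hom x' y'; b' \<in> hom y' z'|] ==>
   ten (b \<cdot> a) (b' \<cdot> a') = ten b b' \<cdot> ten a a'"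
  and ten_plus_left: "[|a \<in> hom x y; b \<in> hom x y; c \<in> hom x' y'|] ==>
   ten (pls a b) c = pls (ten a c) (ten b c)"
  and ten_plus_right: "[|c \<in> hom x y; a \<in> hom x' y'; b \<in> hom x' y'|] ==>
   ten c (pls a b) = pls (ten c a) (ten c b)"
  and ten_scale_left: "[|a \<in> hom x y; c \<in> hom x' y'|] ==> ten (scl k a) c = scl k (ten a c)"
  and ten_scale_right: "[|c \<in> hom x y; a \<in> hom x' y'|] ==> ten c (scl k a) = scl k (ten c a)"
  and braid_hom: "ob x ==> ob y ==> brd x y \<in> hom (teno x y) (teno y x)"
  and braid_nat: "[|a \<in> hom x y; b \<in> hom x' y'|] ==> brd y y' \<cdot> ten a b = ten b a \<cdot> brd x x'"
  and dual_obj: "ob x ==> ob (du x)"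
  and dual_hom: "a \<in> hom x y ==> dual a \<in> hom (du y) (du x)"
  and dual_comp: "[|a \<in> hom x y; b \<in> hom y z|] ==> dual (b \<cdot> a) = dual a \<cdot> dual b"
  and dual_plus: "[|a \<in> hom x y; b \<in> hom x y|] ==> dual (pls a b) = pls (dual a) (dual b)"
  and dual_scale: "a \<in> hom x y ==> dual (scl k a) = scl k (dual a)"
  and coev_hom: "ob x ==> coev x \<in> hom U (teno x (du x))"
  and ev_hom: "ob x ==> ev x \<in> hom (teno (du x) x) U"
  and coev_dual: "a \<in> hom x y ==>
   ten a (ide (du x)) \<cdot> coev x = ten (ide y) (dual a) \<cdot> coev y"
  and trace_cyclic: "[|a \<in> hom x y; b \<in> hom y x|] ==> cat_trace L (b \<cdot> a) = cat_trace L (a \<cdot> b)"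
begin

text \<open>The endomorphism of the unit whose scalar \<open>cat_trace\<close> extracts by
  description; \<open>scalars\<close> and \<open>scale_unit_inj\<close> give existence and
  uniqueness of that scalar.\<close>

definition trace_arr :: "'m \<Rightarrow> 'm" where
 "trace_arr f = ev (dom f) \<cdot> (brd (dom f) (du (dom f)) \<cdot>
   (ten f (ide (du (dom f))) \<cdot> coev (dom f)))"

lemma trace_arr_hom:
 assumes "f \<in> hom x x"
 shows "trace_arr f \<in> hom U U"
proof -
 have x: "ob x" "dom f = x" using assms by auto
 thus ?thesis
  unfolding trace_arr_def x(2)
  using ten_hom[OF assms ident_hom[OF dual_obj[OF x(1)]]] braid_hom[OF x(1) dual_obj[OF x(1)]]
   coev_hom[OF x(1)] ev_hom[OF x(1)] comp_hom
  by blast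
qed

lemma trace_unique: "scl k (ide U) = trace_arr f ==> cat_trace L f = k"
 unfolding cat_trace_def Let_def trace_arr_def[symmetric]
 by (rule the_equality) (metis scale_unit_inj)+

lemma trace_arr_eq:
 assumes "f \<in> hom x x"
 shows "trace_arr f = scl (cat_trace L f) (ide U)"
 using scalars[OF trace_arr_hom[OF assms]] trace_unique by metis

lemma trace_plus:
 assumes f: "f \<in> hom x x" and g: "g \<in> hom x x"
 shows "cat_trace L (pls f g) = cat_trace L f + cat_trace L g"
proof (rule trace_unique)
 have x: "ob x" "dom f = x" "dom g = x" "dom (pls f g) = x" using f g plus_hom[OF f g] by auto
 note i = ident_hom[OF dual_obj[OF x(1)]] and br = braid_hom[OF x(1) dual_obj[OF x(1)]]
  and co = coev_hom[OF x(1)] and ev = ev_hom[OF x(1)]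
 note tf = ten_hom[OF f i] and tg = ten_hom[OF g i]
 have "trace_arr (pls f g) = pls (trace_arr f) (trace_arr g)"
  unfolding trace_arr_def x(2-4) ten_plus_left[OF f g i] comp_plus_left[OF co tf tg]
   comp_plus_right[OF comp_hom[OF co tf] comp_hom[OF co tg] br]
   comp_plus_right[OF comp_hom[OF comp_hom[OF co tf] br] comp_hom[OF comp_hom[OF co tg] br] ev] ..
 thus "scl (cat_trace L f + cat_trace L g) (ide U) = trace_arr (pls f g)"
  unfolding trace_arr_eq[OF f] trace_arr_eq[OF g] plus_scale[OF ident_hom[OF unit_obj]] by simp
qed

lemma trace_scale:
 assumes f: "f \<in> hom x x"
 shows "cat_trace L (scl k f) = k * cat_trace L f"
proof (rule trace_unique)
 have x: "ob x" "dom f = x" "dom (scl k f) = x" using f scale_hom[OF f] by auto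
 note i = ident_hom[OF dual_obj[OF x(1)]] and br = braid_hom[OF x(1) dual_obj[OF x(1)]]
  and co = coev_hom[OF x(1)] and ev = ev_hom[OF x(1)]
 note tf = ten_hom[OF f i]
 have "trace_arr (scl k f) = scl k (trace_arr f)"
  unfolding trace_arr_def x(2-3) ten_scale_left[OF f i] comp_scale_left[OF co tf]
   comp_scale_right[OF comp_hom[OF co tf] br]
   comp_scale_right[OF comp_hom[OF comp_hom[OF co tf] br] ev] ..
 thus "scl (k * cat_trace L f) (ide U) = trace_arr (scl k f)"
  unfolding trace_arr_eq[OF f] scale_scale[OF ident_hom[OF unit_obj]] by simp
qed

lemma trace_zero: "ob x ==> cat_trace L (zr x x) = 0"
 using trace_scale[of "zr x x" x 0] zero_hom[of x x] scale_zero[of "zr x x" x x] by simp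

end

section \<open>The trace of a span\<close>

context tensor_setting
begin

lemma T0_Dual_Dual:
 assumes "a \<in> hom x y"
 shows "dual (dual a) = a"
 by (rule lin_ext[where F = "\<lambda>a. dual (dual a)", OF lin_compose[OF lin_Dual lin_Dual] lin_id _ assms])
  (simp add: sp_Dual)

lemma T0_Dual_Ten:
 assumes "a \<in> hom x y" "b \<in> hom x' y'"
 shows "dual (ten a b) = ten (dual a) (dual b)"
 using _ _ _ assms(1)
proof (rule lin_ext[where F = "\<lambda>a. dual (ten a b)"])
 show "lin x y (prd y y') (prd x x') (\<lambda>a. dual (ten a b))"
  using lin_compose[OF lin_Ten_left[OF assms(2)] lin_Dual] .
 show "lin x y (prd y y') (prd x x') (\<lambda>a. ten (dual a) (dual b))"
  using lin_compose[OF lin_Dual lin_Ten_left[OF T0_Dual_Hom[OF assms(2)]]] .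
 fix f g assume fg: "arr f" "arr g" "dom f = dom g" "cod f = x" "cod g = y"
 note A = sp_HomI[OF fg]
 show "dual (ten (sp f g) b) = ten (dual (sp f g)) (dual b)"
  using _ _ _ assms(2)
 proof (rule lin_ext[where F = "\<lambda>b. dual (ten (sp f g) b)"])
  show "lin x' y' (prd y y') (prd x x') (\<lambda>b. dual (ten (sp f g) b))"
   using lin_compose[OF lin_Ten_right[OF A] lin_Dual] .
  show "lin x' y' (prd y y') (prd x x') (\<lambda>b. ten (dual (sp f g)) (dual b))"
   using lin_compose[OF lin_Dual lin_Ten_right[OF T0_Dual_Hom[OF A]]] .
 qed (use fg in \<open>simp add: sp_Dual sp_Ten\<close>)
qed

text \<open>Obtained from the cup by the contravariant \<open>dual\<close>, which turns cups into
  caps and respects tensor products.\<close>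

lemma T0_Ev_dual:
 assumes "a \<in> hom x y"
 shows "ev x oo ten (dual a) (idt x) = ev y oo ten (idt y) a"
proof -
 have O: "ob x" "ob y" using assms by (auto simp: T0_Hom)
 have D: "dual (coev z) = ev z" "dual (idt z) = idt z" if "ob z" for z
  using that by (simp_all add: T0_Coev T0_Ev sp_Dual br_sp)
 note i = T0_ident_Hom[OF O(1)] T0_ident_Hom[OF O(2)]
 note da = T0_Dual_Hom[OF assms]
 have "dual (ten a (idt x) oo coev x) = dual (ten (idt y) (dual a) oo coev y)"
  using T0_Coev_dual[OF assms] by simp
 thus ?thesis
  unfolding T0_Dual_comp[OF T0_Coev_Hom[OF O(1)] T0_Ten_Hom[OF assms i(1)]]
   T0_Dual_comp[OF T0_Coev_Hom[OF O(2)] T0_Ten_Hom[OF i(2) da]]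
   T0_Dual_Ten[OF assms i(1)] T0_Dual_Ten[OF i(2) da] D[OF O(1)] D[OF O(2)] T0_Dual_Dual[OF assms] .
qed

lemma T0_category: "category L"
proof
 show "f \<in> Arr L ==> Dom L f \<in> Obj L" "f \<in> Arr L ==> Cod L f \<in> Obj L" for f
  by (auto simp: T0_def)
 show "x \<in> Obj L ==> idt x \<in> hom x x" for x
  by (rule T0_ident_Hom) simp
 show "f \<in> hom x y ==> g \<in> hom y z ==> g oo f \<in> hom x z" for f g x y z
  by (rule T0_comp_Hom)
 show "f \<in> hom x y ==> f oo idt x = f" "f \<in> hom x y ==> idt y oo f = f" for f x y
  by (simp_all add: T0_ident)
 show "f \<in> hom w x ==> g \<in> hom x y ==> h \<in> hom y z ==> h oo (g oo f) = h oo g oo f" for f g h w x y z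
  by (rule T0_assoc)
qed

lemma T0_lin_category: "lin_category L"
proof (intro lin_category.intro tcat_category.intro T0_category lin_category_axioms.intro)
 show "x \<in> Obj L ==> y \<in> Obj L ==> zr x y \<in> hom x y" for x y
  by (simp add: T0_simps)
 show "f \<in> hom x y ==> pls f (zr x y) = f" for f x y
  by (auto simp: T0_simps T0_Hom intro: T0_eqI)
 show "f \<in> hom x y ==> scl 0 f = zr x y" for f x y
  by (rule zero_scale)
 show "f \<in> hom x y ==> g \<in> hom x y ==> pls f g \<in> hom x y"
  "f \<in> hom x y ==> scl k f \<in> hom x y" for f g x y k
  by (rule T0_plus_Hom T0_scale_Hom; assumption)+
 show "f \<in> hom x y ==> g \<in> hom y z ==> h \<in> hom y z ==> pls g h oo f = pls (g oo f) (h oo f)"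
  "f \<in> hom x y ==> g \<in> hom y z ==> scl k g oo f = scl k (g oo f)"
  "f \<in> hom x y ==> g \<in> hom y z ==> g oo scl k f = scl k (g oo f)" for f g h x y z k
  by (rule T0_comp_plus_left T0_comp_scale_left T0_comp_scale_right; assumption)+
 show "f \<in> hom x y ==> h \<in> hom x y ==> g \<in> hom y z ==> g oo pls f h = pls (g oo f) (g oo h)" for f g h x y z
  by (rule T0_comp_plus_right)
qed (auto simp: T0_simps T0_Hom algebra_simps intro: T0_eqI)

text \<open>\<open>a\<close> slides around the cup as its dual, past the braiding to the other
  factor, and back around the cap as \<open>a\<close> on the other side of \<open>b\<close>.\<close>

lemma T0_trace_arr_cyclic:
 assumes a: "a \<in> hom x y" and b: "b \<in> hom y x"
 shows "ev x oo (brd x x oo (ten (b oo a) (idt x) oo coev x)) =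
  ev y oo (brd y y oo (ten (a oo b) (idt y) oo coev y))"
proof -
 have x: "ob x" and y: "ob y" using a by (auto simp: T0_Hom)
 note ix = T0_ident_Hom[OF x] and iy = T0_ident_Hom[OF y]
 note da = T0_Dual_Hom[OF a] and bx = T0_Braid_Hom[OF x x] and by' = T0_Braid_Hom[OF y y]
 note cx = T0_Coev_Hom[OF x] and cy = T0_Coev_Hom[OF y] and ex = T0_Ev_Hom[OF x] and ey = T0_Ev_Hom[OF y]
 have id: "c oo idt u = c" "idt v oo c = c" if "c \<in> hom u v" for c u v
  using T0_ident[OF that] by simp_all
 note B = T0_Ten_Hom[OF b da] and BB = T0_Ten_Hom[OF da b]
 have "ten (b oo a) (idt x) oo coev x = ten b (idt x) oo (ten a (idt x) oo coev x)"
  using T0_Ten_comp[OF a b ix ix] id[OF ix] T0_assoc[OF cx T0_Ten_Hom[OF a ix] T0_Ten_Hom[OF b ix]] by simp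
 also have "... = ten b (idt x) oo (ten (idt y) (dual a) oo coev y)"
  unfolding T0_Coev_dual[OF a] ..
 also have "... = ten b (dual a) oo coev y"
  using T0_Ten_comp[OF iy b da ix] id[OF b] id[OF da] T0_assoc[OF cy T0_Ten_Hom[OF iy da] T0_Ten_Hom[OF b ix]] by simp
 finally have "brd x x oo (ten (b oo a) (idt x) oo coev x) = ten (dual a) b oo (brd y y oo coev y)"
  using T0_Braid_nat[OF b da] T0_assoc[OF cy B bx] T0_assoc[OF cy by' BB] by simp
 hence "ev x oo (brd x x oo (ten (b oo a) (idt x) oo coev x)) =
  (ev x oo ten (dual a) b) oo (brd y y oo coev y)"
  using T0_assoc[OF T0_comp_Hom[OF cy by'] BB ex] by simp
 also have "ev x oo ten (dual a) b = (ev x oo ten (dual a) (idt x)) oo ten (idt y) b"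
  using T0_Ten_comp[OF iy da b ix] id[OF b] id[OF da] T0_assoc[OF T0_Ten_Hom[OF iy b] T0_Ten_Hom[OF da ix] ex] by simp
 also have "... = ev y oo ten (idt y) (a oo b)"
  unfolding T0_Ev_dual[OF a]
  using T0_Ten_comp[OF iy iy b a] id[OF iy] T0_assoc[OF T0_Ten_Hom[OF iy b] T0_Ten_Hom[OF iy a] ey] by simp
 also have "... oo (brd y y oo coev y) = ev y oo (brd y y oo (ten (a oo b) (idt y) oo coev y))"
  using T0_assoc[OF T0_comp_Hom[OF cy by'] T0_Ten_Hom[OF iy T0_comp_Hom[OF b a]] ey]
   T0_Braid_nat[OF T0_comp_Hom[OF b a] iy] T0_assoc[OF cy by' T0_Ten_Hom[OF iy T0_comp_Hom[OF b a]]]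
   T0_assoc[OF cy T0_Ten_Hom[OF T0_comp_Hom[OF b a] iy] by'] by simp
 finally show ?thesis .
qed

lemma sp_to_term:
 assumes "ob t"
 shows "sp (to_term t) (to_term t) = scl (\<delta> (to_term t)) (idt (term_obj))"
 using sp_surj[of "to_term t" "ide (term_obj)" "ide (term_obj)"] assms by (simp add: br_sp)

text \<open>Both legs of a span into the terminal object are the unique morphism, which is
  surjective, so the span is its degree times the identity.\<close>

lemma T0_scalars:
 assumes "a \<in> hom (term_obj) (term_obj)"
 shows "\<exists>k. a = scl k (idt (term_obj))"
 using assms
proof (induction rule: T0_span_induct)
 interpret T: lin_category L by (rule T0_lin_category)
 note i = T0_ident_Hom[OF term_obj_Obj]
 {
  case Zero
  show ?case using T.scale_zero[OF i] by metis
 next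
  case (Span f g)
  hence "f = to_term (dom g)" "g = to_term (dom g)"
   using to_term_eq[of f] to_term_eq[of g] by simp_all
  thus ?case using sp_to_term[of "dom g"] dom_obj[OF Span(2)] by metis
 next
  case (Plus a b)
  thus ?case using T.plus_scale[OF i] by metis
 next
  case (Scale k a)
  thus ?case using T.scale_scale[OF i] by metis
 }
qed

lemma T0_tensor_category: "tensor_category L"
proof (intro tensor_category.intro T0_lin_category tensor_category_axioms.intro)
 show "k = l" if "scl k (idt (UnitO L)) = scl l (idt (UnitO L))" for k l
 proof -
  have "cf (scl k (idt (UnitO L))) (graph (ide (term_obj))) =
   cf (scl l (idt (UnitO L))) (graph (ide (term_obj)))"
   using that by simp
  thus ?thesis by (simp add: T0_simps br_def)
 qed
 show "cat_trace L (b oo a) = cat_trace L (a oo b)" if "a \<in> hom x y" "b \<in> hom y x" for a b x y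
 proof -
  have "Dom L (b oo a) = x" "Dom L (a oo b) = y"
   using T0_comp_Hom[OF that] T0_comp_Hom[OF that(2,1)] by (auto simp: Hom_def)
  thus ?thesis
   using T0_trace_arr_cyclic[OF that] unfolding cat_trace_def Let_def by simp
 qed
 note lt = linD(2,3)[OF lin_Ten_left] linD(2,3)[OF lin_Ten_right] linD(2,3)[OF lin_Dual]
 show "a \<in> hom x y ==> b \<in> hom x y ==> c \<in> hom x' y' ==> ten (pls a b) c = pls (ten a c) (ten b c)"
  "a \<in> hom x y ==> c \<in> hom x' y' ==> ten (scl k a) c = scl k (ten a c)"
  "c \<in> hom x y ==> a \<in> hom x' y' ==> b' \<in> hom x' y' ==> ten c (pls a b') = pls (ten c a) (ten c b')"
  "c \<in> hom x y ==> a \<in> hom x' y' ==> ten c (scl k a) = scl k (ten c a)"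
  "a \<in> hom x y ==> b \<in> hom x y ==> dual (pls a b) = pls (dual a) (dual b)"
  "a \<in> hom x y ==> dual (scl k a) = scl k (dual a)"
  for a b b' c x y x' y' k
  by (rule lt; assumption)+
 show "a \<in> hom x y ==> ten a (idt (DualO L x)) oo coev x = ten (idt y) (dual a) oo coev y" for a x y
  using T0_Coev_dual by simp
 show "a \<in> hom x y ==> dual a \<in> hom (DualO L y) (DualO L x)" for a x y
  using T0_Dual_Hom by simp
 show "\<exists>k. a = scl k (idt (UnitO L))" if "a \<in> hom (UnitO L) (UnitO L)" for a
  using T0_scalars that by simp
 show "a \<in> hom x y ==> b \<in> hom x' y' ==> ten a b \<in> hom (TenO L x x') (TenO L y y')" for a b x y x' y'
  using T0_Ten_Hom by simp
qed (simp_all add: T0_Ten_comp T0_Braid_Hom T0_Braid_nat T0_Dual_comp T0_Coev_Hom T0_Ev_Hom)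

text \<open>Closing the span up pairs its legs and composes with the cap, that is, pulls the pair
  back along the diagonal; the apex becomes the equalizer and only its degree over the terminal
  object is left.\<close>

lemma trace_sp:
 assumes fg: "arr f" "arr g" "dom f = dom g" "cod f = x" "cod g = x"
  and m: "is_equalizer f g m"
 shows "cat_trace L (sp f g) = \<delta> (to_term (dom m))"
proof -
 interpret T: tensor_category L by (rule T0_tensor_category)
 have x: "ob x" using fg by auto
 have P: "is_pullback (pairing f g) (pairing (ide x) (ide x)) m (f o m)" "arr m" "cod m = dom f"
  using equalizer_pullback[OF fg] m by simp_all
 show ?thesis
 proof (rule T.trace_unique)
  have "T.trace_arr (sp f g) = ev x oo (brd x x oo sp (to_term (dom g)) (pairing g f))"
   unfolding T.trace_arr_def using Ten_Coev_left[OF fg(1-4)] fg by simp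
  also have "brd x x oo sp (to_term (dom g)) (pairing g f) = sp (to_term (dom g)) (sw x x o pairing g f)"
   unfolding T0_Braid by (rule sp_comp_graph) (use fg x in simp_all)
  also have "sw x x o pairing g f = pairing f g" using fg by simp
  also have "ev x oo sp (to_term (dom g)) (pairing f g) = sp (to_term (dom g) o m) (to_term x o (f o m))"
   unfolding T0_Ev[OF x] by (rule sp_comp[OF _ _ _ _ _ _ P(1)]) (use fg x in simp_all)
  also have "... = scl (\<delta> (to_term (dom m))) (idt (term_obj))"
   using fg P(2,3) sp_to_term[of "dom m"] by simp
  finally show "scl (\<delta> (to_term (dom m))) (idt (UnitO L)) = T.trace_arr (sp f g)" by simp
 qed
qed

end

section \<open>Finite sums of morphisms\<close>

context lin_category
begin

lemma comp_zero:
 assumes "f \<in> hom x y" "ob w"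
 shows "f \<cdot> zr w x = zr w y" "zr y w \<cdot> f = zr x w"
proof -
 have o: "ob x" "ob y" using assms by auto
 note z = zero_hom[OF assms(2) o(1)] zero_hom[OF o(2) assms(2)]
 show "f \<cdot> zr w x = zr w y"
  using comp_scale_right[OF z(1) assms(1), of 0] scale_zero[OF z(1)] scale_zero[OF comp_hom[OF z(1) assms(1)]] by simp
 show "zr y w \<cdot> f = zr x w"
  using comp_scale_left[OF assms(1) z(2), of 0] scale_zero[OF z(2)] scale_zero[OF comp_hom[OF assms(1) z(2)]] by simp
qed

lemma zero_plus: "f \<in> hom x y ==> pls (zr x y) f = f"
 using plus_comm[OF zero_hom, of x y f] plus_zero[of f x y] by auto

text \<open>Indexed by numbers rather than by a list of summands, to match the row and column
  indices of matrices.\<close>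

definition fsum :: "'o \<Rightarrow> 'o \<Rightarrow> nat \<Rightarrow> (nat \<Rightarrow> 'm) \<Rightarrow> 'm" where
 "fsum x y n F = lsum L x y (map F [0..<n])"

lemma lsum_hom: "ob x ==> ob y ==> set fs \<subseteq> hom x y ==> lsum L x y fs \<in> hom x y"
proof (induction fs)
 case Nil
 thus ?case using zero_hom unfolding lsum_def by simp
next
 case (Cons f fs)
 thus ?case using plus_hom[of f x y "lsum L x y fs"] unfolding lsum_def by simp
qed

lemma lsum_append:
 "ob x ==> ob y ==> set fs \<subseteq> hom x y ==> set gs \<subseteq> hom x y ==>
  lsum L x y (fs @ gs) = pls (lsum L x y fs) (lsum L x y gs)"
proof (induction fs)
 case Nil
 thus ?case using zero_plus[OF lsum_hom] by (simp add: lsum_def del: hom_iff)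
next
 case (Cons f fs)
 hence "lsum L x y ((f # fs) @ gs) = pls f (pls (lsum L x y fs) (lsum L x y gs))"
  by (simp add: lsum_def)
 thus ?case
  using Cons plus_assoc[of f x y "lsum L x y fs" "lsum L x y gs"] lsum_hom[of x y fs] lsum_hom[of x y gs]
  by (simp add: lsum_def del: hom_iff)
qed

lemma fsum_0: "fsum x y 0 F = zr x y"
 by (simp add: fsum_def lsum_def)

lemma fsum_hom:
 assumes "ob x" "ob y" "\<And>j. j < n ==> F j \<in> hom x y"
 shows "fsum x y n F \<in> hom x y"
 unfolding fsum_def by (rule lsum_hom) (use assms in \<open>auto simp del: hom_iff\<close>)

lemma fsum_Suc:
 assumes "ob x" "ob y" "\<And>j. j < Suc n ==> F j \<in> hom x y"
 shows "fsum x y (Suc n) F = pls (fsum x y n F) (F n)"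
proof -
 have "fsum x y (Suc n) F = pls (fsum x y n F) (lsum L x y [F n])"
 proof -
  have "set (map F [0..<n]) \<subseteq> hom x y" "set [F n] \<subseteq> hom x y"
   using assms(3) by (auto simp del: hom_iff)
  from lsum_append[OF assms(1,2) this] show ?thesis by (simp add: fsum_def)
 qed
 also have "lsum L x y [F n] = F n" using plus_zero assms(3) by (simp add: lsum_def del: hom_iff)
 finally show ?thesis .
qed

lemma fsum_cong: "(\<And>j. j < n ==> F j = G j) ==> fsum x y n F = fsum x y n G"
 unfolding fsum_def by (rule arg_cong[where f = "lsum L x y"]) auto

lemma fsum_map:
 assumes o: "ob x" "ob y" "u \<in> Obj L'" "v \<in> Obj L'" and lc: "lin_category L'"
  and T: "\<And>f. f \<in> hom x y ==> T f \<in> Hom L' u v"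
   "\<And>f g. f \<in> hom x y ==> g \<in> hom x y ==> T (pls f g) = Plus L' (T f) (T g)"
   "T (zr x y) = Zero L' u v"
  and F: "\<And>j. j < n ==> F j \<in> hom x y"
 shows "T (fsum x y n F) = lin_category.fsum L' u v n (\<lambda>j. T (F j))"
 using F
proof (induction n)
 case 0
 thus ?case using T(3) lin_category.fsum_0[OF lc] by (simp add: fsum_0)
next
 case (Suc n)
 have "T (fsum x y (Suc n) F) = T (pls (fsum x y n F) (F n))"
  using fsum_Suc[OF o(1,2)] Suc.prems by simp
 also have "... = Plus L' (T (fsum x y n F)) (T (F n))"
  using T(2) fsum_hom[OF o(1,2)] Suc.prems by (metis less_Suc_eq)
 also have "... = lin_category.fsum L' u v (Suc n) (\<lambda>j. T (F j))"
  using lin_category.fsum_Suc[OF lc o(3,4), of n "\<lambda>j. T (F j)"] T(1) Suc by simp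
 finally show ?case .
qed

lemma self_lin: "lin_category L" ..

lemma fsum_map_endo:
 assumes "ob x" "ob y" "ob u" "ob v"
  "\<And>f. f \<in> hom x y ==> T f \<in> hom u v"
  "\<And>f g. f \<in> hom x y ==> g \<in> hom x y ==> T (pls f g) = pls (T f) (T g)"
  "\<And>k f. f \<in> hom x y ==> T (scl k f) = scl k (T f)"
  "\<And>j. j < n ==> F j \<in> hom x y"
 shows "T (fsum x y n F) = fsum u v n (\<lambda>j. T (F j))"
proof (rule fsum_map[OF assms(1-4) self_lin assms(5,6) _ assms(8)])
 show "T (zr x y) = zr u v"
  using assms(7)[OF zero_hom[OF assms(1,2)], of 0] scale_zero[OF zero_hom[OF assms(1,2)]]
   scale_zero[OF assms(5)[OF zero_hom[OF assms(1,2)]]] by simp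
qed

lemma comp_fsum:
 assumes "g \<in> hom y z" "ob x" "\<And>j. j < n ==> F j \<in> hom x y"
 shows "g \<cdot> fsum x y n F = fsum x z n (\<lambda>j. g \<cdot> F j)"
 by (rule fsum_map_endo) (use assms comp_plus_right[OF _ _ assms(1)] comp_scale_right[OF _ assms(1)] in auto)

lemma fsum_comp:
 assumes "g \<in> hom w x" "ob y" "\<And>j. j < n ==> F j \<in> hom x y"
 shows "fsum x y n F \<cdot> g = fsum w y n (\<lambda>j. F j \<cdot> g)"
 by (rule fsum_map_endo) (use assms comp_plus_left[OF assms(1)] comp_scale_left[OF assms(1)] in auto)

lemma fsum_scale:
 assumes "ob x" "ob y" "\<And>j. j < n ==> F j \<in> hom x y"
 shows "scl k (fsum x y n F) = fsum x y n (\<lambda>j. scl k (F j))"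
 by (rule fsum_map_endo)
  (use assms scale_hom scale_plus scale_scale in \<open>auto simp: mult.commute simp del: hom_iff\<close>)

lemma fsum_zero:
 assumes "ob x" "ob y" "\<And>j. j < n ==> F j = zr x y"
 shows "fsum x y n F = zr x y"
 using assms(3)
proof (induction n)
 case (Suc n)
 hence "fsum x y (Suc n) F = pls (fsum x y n F) (F n)"
  by (intro fsum_Suc[OF assms(1,2)]) (use zero_hom[OF assms(1,2)] in simp)
 thus ?case using Suc plus_zero[OF zero_hom[OF assms(1,2)]] by simp
qed (simp add: fsum_0)

lemma plus_swap:
 assumes "a \<in> hom x y" "b \<in> hom x y" "c \<in> hom x y" "d \<in> hom x y"
 shows "pls (pls a b) (pls c d) = pls (pls a c) (pls b d)"
proof -
 have "pls (pls a b) (pls c d) = pls a (pls b (pls c d))"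
  by (rule plus_assoc[OF assms(1,2) plus_hom[OF assms(3,4)]])
 also have "pls b (pls c d) = pls (pls b c) d" by (rule plus_assoc[OF assms(2-4), symmetric])
 also have "pls b c = pls c b" by (rule plus_comm[OF assms(2,3)])
 also have "pls (pls c b) d = pls c (pls b d)" by (rule plus_assoc[OF assms(3,2,4)])
 also have "pls a (pls c (pls b d)) = pls (pls a c) (pls b d)"
  by (rule plus_assoc[OF assms(1,3) plus_hom[OF assms(2,4)], symmetric])
 finally show ?thesis .
qed

lemma fsum_plus:
 assumes o: "ob x" "ob y" and F: "\<And>j. j < n ==> F j \<in> hom x y" and G: "\<And>j. j < n ==> G j \<in> hom x y"
 shows "fsum x y n (\<lambda>j. pls (F j) (G j)) = pls (fsum x y n F) (fsum x y n G)"
 using F G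
proof (induction n)
 case 0
 thus ?case using plus_zero[OF zero_hom[OF o]] by (simp add: fsum_0)
next
 case (Suc n)
 have "fsum x y (Suc n) (\<lambda>j. pls (F j) (G j)) = pls (fsum x y n (\<lambda>j. pls (F j) (G j))) (pls (F n) (G n))"
  by (rule fsum_Suc[OF o plus_hom]) (rule Suc.prems, assumption)+
 also have "... = pls (pls (fsum x y n F) (fsum x y n G)) (pls (F n) (G n))"
  using Suc by simp
 also have "... = pls (pls (fsum x y n F) (F n)) (pls (fsum x y n G) (G n))"
  by (rule plus_swap[where x = x and y = y]) (rule fsum_hom[OF o] | rule Suc.prems | simp del: hom_iff)+
 also have "... = pls (fsum x y (Suc n) F) (fsum x y (Suc n) G)"
  using fsum_Suc[OF o, of n F] fsum_Suc[OF o, of n G] Suc.prems by metis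
 finally show ?case .
qed

lemma fsum_swap:
 assumes o: "ob x" "ob y" and F: "\<And>i j. i < m ==> j < n ==> F i j \<in> hom x y"
 shows "fsum x y m (\<lambda>i. fsum x y n (\<lambda>j. F i j)) = fsum x y n (\<lambda>j. fsum x y m (\<lambda>i. F i j))"
 using F
proof (induction n)
 case 0
 thus ?case using fsum_zero[OF o] by (simp add: fsum_0)
next
 case (Suc n)
 have "fsum x y m (\<lambda>i. fsum x y (Suc n) (\<lambda>j. F i j)) = fsum x y m (\<lambda>i. pls (fsum x y n (\<lambda>j. F i j)) (F i n))"
  by (rule fsum_cong, rule fsum_Suc[OF o]) (rule Suc.prems; assumption)
 also have "... = pls (fsum x y m (\<lambda>i. fsum x y n (\<lambda>j. F i j))) (fsum x y m (\<lambda>i. F i n))"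
  by (rule fsum_plus[OF o fsum_hom[OF o]]) (rule Suc.prems; simp)+
 also have "... = pls (fsum x y n (\<lambda>j. fsum x y m (\<lambda>i. F i j))) (fsum x y m (\<lambda>i. F i n))"
  using Suc by simp
 also have "... = fsum x y (Suc n) (\<lambda>j. fsum x y m (\<lambda>i. F i j))"
  by (rule fsum_Suc[OF o fsum_hom[OF o], symmetric]) (rule Suc.prems; simp)
 finally show ?case .
qed

lemma fsum_single:
 assumes o: "ob x" "ob y" and k: "k < n" "F k \<in> hom x y"
  and z: "\<And>j. j < n ==> j \<noteq> k ==> F j = zr x y"
 shows "fsum x y n F = F k"
 using k(1) z
proof (induction n)
 case (Suc n)
 note zo = zero_hom[OF o]
 have F: "F j \<in> hom x y" if "j < Suc n" for j using Suc.prems that k(2) zo by metis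
 have S: "fsum x y (Suc n) F = pls (fsum x y n F) (F n)" by (rule fsum_Suc[OF o F])
 show ?case
 proof (cases "k = n")
  case True
  hence "fsum x y n F = zr x y" using fsum_zero[OF o] Suc.prems by simp
  thus ?thesis using S True zero_plus[OF k(2)] by simp
 next
  case False
  thus ?thesis using S Suc plus_zero[OF k(2)] by simp
 qed
qed simp

lemma fsum_add:
 assumes o: "ob x" "ob y" and F: "\<And>j. j < m + n ==> F j \<in> hom x y"
 shows "fsum x y (m + n) F = pls (fsum x y m F) (fsum x y n (\<lambda>j. F (m + j)))"
 using F
proof (induction n)
 case 0
 thus ?case using plus_zero[OF fsum_hom[OF o]] by (simp add: fsum_0 del: hom_iff)
next
 case (Suc n)
 have "fsum x y (m + Suc n) F = pls (fsum x y (m + n) F) (F (m + n))"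
  using fsum_Suc[OF o, of "m + n" F] Suc.prems by simp
 also have "... = pls (pls (fsum x y m F) (fsum x y n (\<lambda>j. F (m + j)))) (F (m + n))"
  using Suc by simp
 also have "... = pls (fsum x y m F) (pls (fsum x y n (\<lambda>j. F (m + j))) (F (m + n)))"
  by (rule plus_assoc[where x = x and y = y]) (rule fsum_hom[OF o] | rule Suc.prems | simp del: hom_iff)+
 also have "pls (fsum x y n (\<lambda>j. F (m + j))) (F (m + n)) = fsum x y (Suc n) (\<lambda>j. F (m + j))"
  by (rule fsum_Suc[OF o, symmetric]) (rule Suc.prems, simp)
 finally show ?case .
qed

text \<open>The flattening \<open>a * n + b\<close> of a pair of indices is the one used by
  \<open>add_ten\<close>.\<close>

lemma fsum_prod:
 assumes o: "ob x" "ob y" and F: "\<And>j. j < m * n ==> F j \<in> hom x y"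
 shows "fsum x y (m * n) F = fsum x y m (\<lambda>a. fsum x y n (\<lambda>b. F (a * n + b)))"
 using F
proof (induction m)
 case (Suc m)
 have lt: "a * n + b < Suc m * n" if "a < Suc m" "b < n" for a b
 proof -
  have "a * n + b < Suc a * n" using that by simp
  also have "... \<le> Suc m * n" using that by (intro mult_le_mono1) simp
  finally show ?thesis .
 qed
 have "fsum x y (Suc m * n) F = fsum x y (m * n + n) F" by (simp add: add.commute)
 also have "... = pls (fsum x y (m * n) F) (fsum x y n (\<lambda>b. F (m * n + b)))"
  by (rule fsum_add[OF o]) (rule Suc.prems, simp)
 also have "fsum x y (m * n) F = fsum x y m (\<lambda>a. fsum x y n (\<lambda>b. F (a * n + b)))"
  by (rule Suc.IH) (rule Suc.prems, simp)
 also have "pls ... (fsum x y n (\<lambda>b. F (m * n + b))) = fsum x y (Suc m) (\<lambda>a. fsum x y n (\<lambda>b. F (a * n + b)))"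
  by (rule fsum_Suc[OF o fsum_hom[OF o], symmetric]) (rule Suc.prems, rule lt)
 finally show ?case .
qed (simp add: fsum_0)

end

context tensor_category
begin

lemma ten_fsum_left:
 assumes "g \<in> hom x' y'" "ob x" "ob y" "\<And>j. j < n ==> F j \<in> hom x y"
 shows "ten (fsum x y n F) g = fsum (teno x x') (teno y y') n (\<lambda>j. ten (F j) g)"
proof -
 have o: "ob x'" "ob y'" using assms by auto
 show ?thesis
  by (rule fsum_map_endo[OF assms(2,3) ten_obj[OF assms(2) o(1)] ten_obj[OF assms(3) o(2)] ten_hom[OF _ assms(1)]
    ten_plus_left[OF _ _ assms(1)] ten_scale_left[OF _ assms(1)] assms(4)])
qed

lemma ten_fsum_right:
 assumes "g \<in> hom x' y'" "ob x" "ob y" "\<And>j. j < n ==> F j \<in> hom x y"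
 shows "ten g (fsum x y n F) = fsum (teno x' x) (teno y' y) n (\<lambda>j. ten g (F j))"
proof -
 have o: "ob x'" "ob y'" using assms by auto
 show ?thesis
  by (rule fsum_map_endo[OF assms(2,3) ten_obj[OF o(1) assms(2)] ten_obj[OF o(2) assms(3)] ten_hom[OF assms(1)]
    ten_plus_right[OF assms(1)] ten_scale_right[OF assms(1)] assms(4)])
qed

lemma ten_zero:
 assumes "g \<in> hom x' y'" "ob x" "ob y"
 shows "ten (zr x y) g = zr (teno x x') (teno y y')"
  "ten g (zr x y) = zr (teno x' x) (teno y' y)"
 using ten_fsum_left[OF assms, of 0] ten_fsum_right[OF assms, of 0] by (simp_all add: fsum_0)

lemma dual_fsum:
 assumes "ob x" "ob y" "\<And>j. j < n ==> F j \<in> hom x y"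
 shows "dual (fsum x y n F) = fsum (du y) (du x) n (\<lambda>j. dual (F j))"
 by (rule fsum_map_endo[OF assms(1,2) dual_obj[OF assms(2)] dual_obj[OF assms(1)] dual_hom dual_plus dual_scale assms(3)])

lemma trace_fsum:
 assumes "ob x" "\<And>j. j < n ==> F j \<in> hom x x"
 shows "cat_trace L (fsum x x n F) = (\<Sum>j<n. cat_trace L (F j))"
 using assms(2)
proof (induction n)
 case 0
 thus ?case using trace_zero assms by (simp add: fsum_0)
next
 case (Suc n)
 have "cat_trace L (fsum x x (Suc n) F) = cat_trace L (fsum x x n F) + cat_trace L (F n)"
  using fsum_Suc[OF assms(1,1), of n F] trace_plus[OF fsum_hom[OF assms(1,1)], of n F "F n"] Suc.prems
  by (metis less_Suc_eq)
 thus ?case using Suc by simp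
qed

end

section \<open>The additive completion\<close>

text \<open>Arrows of the additive completion through their entry function, row first:
  \<open>E j i\<close> goes from \<open>xs ! i\<close> to \<open>ys ! j\<close>. Equality then
  becomes equality of entries within bounds.\<close>

definition mk :: "'o list \<Rightarrow> 'o list \<Rightarrow> (nat \<Rightarrow> nat \<Rightarrow> 'm) \<Rightarrow> ('o, 'm) add_arr" where
 "mk xs ys E = (xs, mat (length ys) (length xs) (\<lambda>(j, i). E j i), ys)"

lemma mk_cong: "(\<And>i j. i < length xs ==> j < length ys ==> E j i = E' j i) ==> mk xs ys E = mk xs ys E'"
 unfolding mk_def by (auto intro!: cong_mat)

lemma div_mod_less:
 assumes "k < m * (n::nat)"
 shows "k div n < m" "k mod n < n"
 using assms by (auto simp: less_mult_imp_div_less) (metis mod_less_divisor mult_0_right neq0_conv not_less0)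

lemma pair_less:
 assumes "a < m" "b < (n::nat)"
 shows "a * n + b < m * n"
proof -
 have "a * n + b < Suc a * n" using assms by simp
 also have "... \<le> m * n" using assms by (intro mult_le_mono1) simp
 finally show ?thesis .
qed

lemma length_add_ten [simp]: "length (add_ten L xs ys) = length xs * length ys"
 by (induction xs) (simp_all add: add_ten_def)

lemma add_ten_nth:
 "k < length xs * length ys ==> add_ten L xs ys ! k = TenO L (xs ! (k div length ys)) (ys ! (k mod length ys))"
proof (induction xs arbitrary: k)
 case (Cons x xs)
 have e: "add_ten L (x # xs) ys = map (TenO L x) ys @ add_ten L xs ys" by (simp add: add_ten_def)
 show ?case
 proof (cases "k < length ys")
  case True
  thus ?thesis by (simp add: e nth_append)
 next
  case False
  hence n: "length ys > 0" using Cons.prems by (cases ys) auto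
  have "k - length ys < length xs * length ys" using Cons.prems False by simp
  hence "add_ten L xs ys ! (k - length ys) = TenO L (xs ! ((k - length ys) div length ys)) (ys ! ((k - length ys) mod length ys))"
   by (rule Cons.IH)
  moreover have "k div length ys = Suc ((k - length ys) div length ys)" using False n by (simp add: le_div_geq)
  moreover have "(k - length ys) mod length ys = k mod length ys" using False by (simp add: le_mod_geq)
  ultimately show ?thesis using False by (simp add: e nth_append)
 qed
qed simp

context lin_category
begin

declare hom_iff [simp del]

abbreviation AL where "AL \<equiv> add_compl L"

definition ents :: "'o list \<Rightarrow> 'o list \<Rightarrow> (nat \<Rightarrow> nat \<Rightarrow> 'm) \<Rightarrow> bool" where
 "ents xs ys E \<longleftrightarrow> set xs \<subseteq> Obj L \<and> set ys \<subseteq> Obj L \<and>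
   (\<forall>i<length xs. \<forall>j<length ys. E j i \<in> hom (xs ! i) (ys ! j))"

lemma entsD:
 assumes "ents xs ys E"
 shows "i < length xs ==> j < length ys ==> E j i \<in> hom (xs ! i) (ys ! j)"
  "i < length xs ==> ob (xs ! i)" "j < length ys ==> ob (ys ! j)"
 using assms nth_mem by (auto simp: ents_def)

lemma entsI:
 "set xs \<subseteq> Obj L ==> set ys \<subseteq> Obj L ==> (\<And>i j. i < length xs ==> j < length ys ==> E j i \<in> hom (xs ! i) (ys ! j)) ==> ents xs ys E"
 by (simp add: ents_def)

lemma add_Hom: "Hom AL xs ys = {mk xs ys E | E. ents xs ys E}"
proof (intro equalityI subsetI)
 fix F assume "F \<in> Hom AL xs ys"
 then obtain M where M: "F = (xs, M, ys)" "set xs \<subseteq> Obj L" "set ys \<subseteq> Obj L" "M \<in> carrier_mat (length ys) (length xs)"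
  "\<forall>i<length xs. \<forall>j<length ys. M $$ (j, i) \<in> hom (xs ! i) (ys ! j)"
  by (cases F) (auto simp: Hom_def add_compl_def)
 hence "F = mk xs ys (\<lambda>j i. M $$ (j, i))" by (auto simp: mk_def)
 moreover have "ents xs ys (\<lambda>j i. M $$ (j, i))" using M by (simp add: ents_def)
 ultimately show "F \<in> {mk xs ys E | E. ents xs ys E}" by blast
next
 fix F assume "F \<in> {mk xs ys E | E. ents xs ys E}"
 thus "F \<in> Hom AL xs ys" by (auto simp: Hom_def add_compl_def mk_def ents_def)
qed

lemma add_cases:
 assumes "F \<in> Hom AL xs ys"
 obtains E where "F = mk xs ys E" "ents xs ys E"
 using assms unfolding add_Hom by blast

lemma mk_Hom: "ents xs ys E ==> mk xs ys E \<in> Hom AL xs ys"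
 unfolding add_Hom by blast

lemma mk_eq_iff:
 "mk xs ys E = mk xs ys E' \<longleftrightarrow> (\<forall>i<length xs. \<forall>j<length ys. E j i = E' j i)"
proof
 assume "mk xs ys E = mk xs ys E'"
 hence "mat (length ys) (length xs) (\<lambda>(j, i). E j i) = mat (length ys) (length xs) (\<lambda>(j, i). E' j i)"
  by (simp add: mk_def)
 hence m: "mat (length ys) (length xs) (\<lambda>(j, i). E j i) $$ (j, i) = mat (length ys) (length xs) (\<lambda>(j, i). E' j i) $$ (j, i)" for i j
  by simp
 show "\<forall>i<length xs. \<forall>j<length ys. E j i = E' j i"
 proof (intro allI impI)
  fix i j assume "i < length xs" "j < length ys"
  thus "E j i = E' j i" using m[of j i] by simp
 qed
qed (auto intro: mk_cong)

lemma Obj_AL: "xs \<in> Obj AL \<longleftrightarrow> set xs \<subseteq> Obj L"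
 by (simp add: add_compl_def)

lemma add_Comp:
 "Comp AL (mk ys zs G) (mk xs ys F) = mk xs zs (\<lambda>k i. fsum (xs ! i) (zs ! k) (length ys) (\<lambda>j. G k j \<cdot> F j i))"
 by (auto simp: add_compl_def mk_def fsum_def intro!: cong_mat arg_cong[where f = "lsum L _ _"])

lemma add_Ident: "Ident AL xs = mk xs xs (\<lambda>j i. if i = j then ide (xs ! i) else zr (xs ! i) (xs ! j))"
 by (simp add: add_compl_def mk_def)

lemma add_Zero: "Zero AL xs ys = mk xs ys (\<lambda>j i. zr (xs ! i) (ys ! j))"
 by (simp add: add_compl_def mk_def)

lemma add_Plus: "Plus AL (mk xs ys F) (mk xs ys G) = mk xs ys (\<lambda>j i. pls (F j i) (G j i))"
 by (auto simp: add_compl_def mk_def intro!: cong_mat)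

lemma add_Scale: "Scale AL k (mk xs ys F) = mk xs ys (\<lambda>j i. scl k (F j i))"
 by (auto simp: add_compl_def mk_def intro!: cong_mat)

lemma ents_ident: "set xs \<subseteq> Obj L ==> ents xs xs (\<lambda>j i. if i = j then ide (xs ! i) else zr (xs ! i) (xs ! j))"
 by (rule entsI) (auto intro!: ident_hom zero_hom nth_mem simp: subset_iff)

lemma ents_comp:
 assumes "ents xs ys F" "ents ys zs G"
 shows "ents xs zs (\<lambda>k i. fsum (xs ! i) (zs ! k) (length ys) (\<lambda>j. G k j \<cdot> F j i))"
proof (rule entsI)
 show "fsum (xs ! i) (zs ! k) (length ys) (\<lambda>j. G k j \<cdot> F j i) \<in> hom (xs ! i) (zs ! k)"
  if "i < length xs" "k < length zs" for i k
  by (rule fsum_hom[OF entsD(2)[OF assms(1) that(1)] entsD(3)[OF assms(2) that(2)]])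
   (rule comp_hom[OF entsD(1)[OF assms(1) that(1)] entsD(1)[OF assms(2) _ that(2)]])
qed (use assms in \<open>auto simp: ents_def\<close>)

lemma add_category: "category AL"
proof
 show "f \<in> Arr AL ==> Dom AL f \<in> Obj AL" "f \<in> Arr AL ==> Cod AL f \<in> Obj AL" for f
  by (auto simp: add_compl_def)
 show "xs \<in> Obj AL ==> Ident AL xs \<in> Hom AL xs xs" for xs
  unfolding add_Ident Obj_AL by (intro mk_Hom ents_ident)
 show "Comp AL g f \<in> Hom AL x z" if "f \<in> Hom AL x y" "g \<in> Hom AL y z" for f g x y z
  using that by (elim add_cases) (simp add: add_Comp mk_Hom ents_comp)
 show "Comp AL f (Ident AL x) = f" if "f \<in> Hom AL x y" for f x y
  using that
 proof (rule add_cases)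
  fix E assume f: "f = mk x y E" and E: "ents x y E"
  have "fsum (x ! i) (y ! k) (length x) (\<lambda>j. E k j \<cdot> (if i = j then ide (x ! i) else zr (x ! i) (x ! j))) = E k i"
   if "i < length x" "k < length y" for i k
  proof -
   note e = entsD(1)[OF E that] and o = entsD(2)[OF E] entsD(3)[OF E]
   have "fsum (x ! i) (y ! k) (length x) (\<lambda>j. E k j \<cdot> (if i = j then ide (x ! i) else zr (x ! i) (x ! j))) =
    E k i \<cdot> (if i = i then ide (x ! i) else zr (x ! i) (x ! i))"
    by (rule fsum_single[OF o(1)[OF that(1)] o(2)[OF that(2)] that(1)])
     (use comp_ident[OF e] e comp_zero(1)[OF entsD(1)[OF E _ that(2)] o(1)[OF that(1)]] in auto)
   thus ?thesis using comp_ident[OF e] by simp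
  qed
  thus ?thesis unfolding f add_Ident add_Comp by (intro mk_cong)
 qed
 show "Comp AL (Ident AL y) f = f" if "f \<in> Hom AL x y" for f x y
  using that
 proof (rule add_cases)
  fix E assume f: "f = mk x y E" and E: "ents x y E"
  have "fsum (x ! i) (y ! k) (length y) (\<lambda>j. (if j = k then ide (y ! j) else zr (y ! j) (y ! k)) \<cdot> E j i) = E k i"
   if "i < length x" "k < length y" for i k
  proof -
   note e = entsD(1)[OF E that] and o = entsD(2)[OF E] entsD(3)[OF E]
   have "fsum (x ! i) (y ! k) (length y) (\<lambda>j. (if j = k then ide (y ! j) else zr (y ! j) (y ! k)) \<cdot> E j i) =
    (if k = k then ide (y ! k) else zr (y ! k) (y ! k)) \<cdot> E k i"
    by (rule fsum_single[OF o(1)[OF that(1)] o(2)[OF that(2)] that(2)])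
     (use ident_comp[OF e] e comp_zero(2)[OF entsD(1)[OF E that(1)] o(2)[OF that(2)]] in auto)
   thus ?thesis using ident_comp[OF e] by simp
  qed
  thus ?thesis unfolding f add_Ident add_Comp by (intro mk_cong)
 qed
 show "Comp AL h (Comp AL g f) = Comp AL (Comp AL h g) f"
  if "f \<in> Hom AL w x" "g \<in> Hom AL x y" "h \<in> Hom AL y z" for f g h w x y z
 proof -
  obtain F where f: "f = mk w x F" and F: "ents w x F" using \<open>f \<in> _\<close> by (rule add_cases)
  obtain G where g: "g = mk x y G" and G: "ents x y G" using \<open>g \<in> _\<close> by (rule add_cases)
  obtain H where h: "h = mk y z H" and H: "ents y z H" using \<open>h \<in> _\<close> by (rule add_cases)
  have "fsum (w ! i) (z ! l) (length y) (\<lambda>k. H l k \<cdot> fsum (w ! i) (y ! k) (length x) (\<lambda>j. G k j \<cdot> F j i)) =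
   fsum (w ! i) (z ! l) (length x) (\<lambda>j. fsum (x ! j) (z ! l) (length y) (\<lambda>k. H l k \<cdot> G k j) \<cdot> F j i)"
   (is "?A = ?B") if i: "i < length w" and l: "l < length z" for i l
  proof -
   have o: "ob (w ! i)" "ob (z ! l)" using entsD(2)[OF F i] entsD(3)[OF H l] .
   note hF = entsD(1)[OF F i] and hG = entsD(1)[OF G] and hH = entsD(1)[OF H _ l]
   have "?A = fsum (w ! i) (z ! l) (length y) (\<lambda>k. fsum (w ! i) (z ! l) (length x) (\<lambda>j. H l k \<cdot> (G k j \<cdot> F j i)))"
    by (rule fsum_cong, rule comp_fsum[OF hH o(1) comp_hom[OF hF hG]])
   also have "... = fsum (w ! i) (z ! l) (length x) (\<lambda>j. fsum (w ! i) (z ! l) (length y) (\<lambda>k. H l k \<cdot> (G k j \<cdot> F j i)))"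
    by (rule fsum_swap[OF o comp_hom[OF comp_hom[OF hF hG] hH]])
   also have "... = fsum (w ! i) (z ! l) (length x) (\<lambda>j. fsum (w ! i) (z ! l) (length y) (\<lambda>k. (H l k \<cdot> G k j) \<cdot> F j i))"
    by (rule fsum_cong, rule fsum_cong, rule comp_assoc[OF hF hG hH])
   also have "... = ?B"
    by (rule fsum_cong, rule fsum_comp[OF hF o(2) comp_hom[OF hG hH], symmetric])
   finally show ?thesis .
  qed
  thus ?thesis unfolding f g h add_Comp by (intro mk_cong)
 qed
qed

lemma add_lin_category: "lin_category AL"
proof (intro lin_category.intro tcat_category.intro add_category lin_category_axioms.intro)
 show "Zero AL x y \<in> Hom AL x y" if "x \<in> Obj AL" "y \<in> Obj AL" for x y
  unfolding add_Zero using that by (intro mk_Hom entsI zero_hom) (auto simp: Obj_AL)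
 fix x y f assume "f \<in> Hom AL x y"
 then obtain F where f: "f = mk x y F" and F: "ents x y F" by (rule add_cases)
 note hF = entsD(1)[OF F]
 show "Scale AL k f \<in> Hom AL x y" for k
  unfolding f add_Scale using F by (intro mk_Hom entsI scale_hom hF) (auto simp: ents_def)
 show "Plus AL f (Zero AL x y) = f"
  unfolding f add_Zero add_Plus by (rule mk_cong) (rule plus_zero[OF hF])
 show "Scale AL (k + l) f = Plus AL (Scale AL k f) (Scale AL l f)" for k l
  unfolding f add_Scale add_Plus by (rule mk_cong) (rule plus_scale[OF hF])
 show "Scale AL k (Scale AL l f) = Scale AL (k * l) f" for k l
  unfolding f add_Scale by (rule mk_cong) (rule scale_scale[OF hF])
 show "Scale AL 1 f = f" unfolding f add_Scale by (rule mk_cong) (rule scale_one[OF hF])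
 show "Scale AL 0 f = Zero AL x y" unfolding f add_Scale add_Zero by (rule mk_cong) (rule scale_zero[OF hF])
 {
  fix g assume "g \<in> Hom AL x y"
  then obtain G where g: "g = mk x y G" and G: "ents x y G" by (rule add_cases)
  note hG = entsD(1)[OF G]
  show "Plus AL f g \<in> Hom AL x y"
   unfolding f g add_Plus using F by (intro mk_Hom entsI plus_hom hF hG) (auto simp: ents_def)
  show "Plus AL f g = Plus AL g f" unfolding f g add_Plus by (rule mk_cong) (rule plus_comm[OF hF hG])
  show "Scale AL k (Plus AL f g) = Plus AL (Scale AL k f) (Scale AL k g)" for k
   unfolding f g add_Plus add_Scale by (rule mk_cong) (rule scale_plus[OF hF hG])
  show "Plus AL (Plus AL f g) h = Plus AL f (Plus AL g h)" if "h \<in> Hom AL x y" for h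
   using that
  proof (rule add_cases)
   fix H assume h: "h = mk x y H" and H: "ents x y H"
   show ?thesis unfolding f g h add_Plus by (rule mk_cong) (rule plus_assoc[OF hF hG entsD(1)[OF H]])
  qed
  show "Comp AL h (Plus AL f g) = Plus AL (Comp AL h f) (Comp AL h g)" if "h \<in> Hom AL y z" for h z
   using that
  proof (rule add_cases)
   fix H assume h: "h = mk y z H" and H: "ents y z H"
   have "fsum (x ! i) (z ! k) (length y) (\<lambda>j. H k j \<cdot> pls (F j i) (G j i)) =
    pls (fsum (x ! i) (z ! k) (length y) (\<lambda>j. H k j \<cdot> F j i)) (fsum (x ! i) (z ! k) (length y) (\<lambda>j. H k j \<cdot> G j i))"
    if "i < length x" "k < length z" for i k
   proof -
    note hH = entsD(1)[OF H _ that(2)]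
    have "fsum (x ! i) (z ! k) (length y) (\<lambda>j. H k j \<cdot> pls (F j i) (G j i)) =
     fsum (x ! i) (z ! k) (length y) (\<lambda>j. pls (H k j \<cdot> F j i) (H k j \<cdot> G j i))"
     by (rule fsum_cong, rule comp_plus_right[OF hF hG hH]) (use that in auto)
    also have "... = pls (fsum (x ! i) (z ! k) (length y) (\<lambda>j. H k j \<cdot> F j i)) (fsum (x ! i) (z ! k) (length y) (\<lambda>j. H k j \<cdot> G j i))"
     by (rule fsum_plus[OF entsD(2)[OF F that(1)] entsD(3)[OF H that(2)]])
      (rule comp_hom[OF hF[OF that(1)] hH] comp_hom[OF hG[OF that(1)] hH]; assumption)+
    finally show ?thesis .
   qed
   thus ?thesis unfolding f g h add_Plus add_Comp by (intro mk_cong)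
  qed
 }
 fix z g assume "g \<in> Hom AL y z"
 then obtain G where g: "g = mk y z G" and G: "ents y z G" by (rule add_cases)
 note hG = entsD(1)[OF G]
 have o: "i < length x ==> ob (x ! i)" "k < length z ==> ob (z ! k)" for i k
  using entsD(2)[OF F] entsD(3)[OF G] by auto
 show "Comp AL (Scale AL k g) f = Scale AL k (Comp AL g f)" for k
 proof -
  have "fsum (x ! i) (z ! l) (length y) (\<lambda>j. scl k (G l j) \<cdot> F j i) =
   scl k (fsum (x ! i) (z ! l) (length y) (\<lambda>j. G l j \<cdot> F j i))" if "i < length x" "l < length z" for i l
   by (subst fsum_scale[OF o(1)[OF that(1)] o(2)[OF that(2)] comp_hom[OF hF[OF that(1)] hG[OF _ that(2)]]])
    (auto intro!: fsum_cong comp_scale_left[OF hF hG] that)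
  thus ?thesis unfolding f g add_Scale add_Comp by (intro mk_cong)
 qed
 show "Comp AL g (Scale AL k f) = Scale AL k (Comp AL g f)" for k
 proof -
  have "fsum (x ! i) (z ! l) (length y) (\<lambda>j. G l j \<cdot> scl k (F j i)) =
   scl k (fsum (x ! i) (z ! l) (length y) (\<lambda>j. G l j \<cdot> F j i))" if "i < length x" "l < length z" for i l
   by (subst fsum_scale[OF o(1)[OF that(1)] o(2)[OF that(2)] comp_hom[OF hF[OF that(1)] hG[OF _ that(2)]]])
    (auto intro!: fsum_cong comp_scale_right[OF hF hG] that)
  thus ?thesis unfolding f g add_Scale add_Comp by (intro mk_cong)
 qed
 show "Comp AL (Plus AL g h) f = Plus AL (Comp AL g f) (Comp AL h f)" if "h \<in> Hom AL y z" for h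
  using that
 proof (rule add_cases)
  fix H assume h: "h = mk y z H" and H: "ents y z H"
  have "fsum (x ! i) (z ! k) (length y) (\<lambda>j. pls (G k j) (H k j) \<cdot> F j i) =
   pls (fsum (x ! i) (z ! k) (length y) (\<lambda>j. G k j \<cdot> F j i)) (fsum (x ! i) (z ! k) (length y) (\<lambda>j. H k j \<cdot> F j i))"
   if "i < length x" "k < length z" for i k
  proof -
   note hH = entsD(1)[OF H _ that(2)]
   have "fsum (x ! i) (z ! k) (length y) (\<lambda>j. pls (G k j) (H k j) \<cdot> F j i) =
    fsum (x ! i) (z ! k) (length y) (\<lambda>j. pls (G k j \<cdot> F j i) (H k j \<cdot> F j i))"
    by (rule fsum_cong, rule comp_plus_left[OF hF hG hH]) (use that in auto)
   also have "... = pls (fsum (x ! i) (z ! k) (length y) (\<lambda>j. G k j \<cdot> F j i)) (fsum (x ! i) (z ! k) (length y) (\<lambda>j. H k j \<cdot> F j i))"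
    by (rule fsum_plus[OF o(1)[OF that(1)] o(2)[OF that(2)]])
     (rule comp_hom[OF hF[OF that(1)] hH] comp_hom[OF hF[OF that(1)] hG[OF _ that(2)]]; assumption)+
   finally show ?thesis .
  qed
  thus ?thesis unfolding f g h add_Plus add_Comp by (intro mk_cong)
 qed
qed

end

lemma pair_div_mod: "b < (n::nat) ==> (a * n + b) div n = a" "b < n ==> (a * n + b) mod n = b"
 by simp_all

section \<open>Tensor product, duals and trace of matrices\<close>

context tensor_category
begin

abbreviation dul where "dul \<equiv> map (du)"

abbreviation tenE where
 "tenE xs ys F G j i \<equiv> ten (F (j div length ys) (i div length xs)) (G (j mod length ys) (i mod length xs))"

abbreviation brE where
 "brE xs ys j i \<equiv> if i div length ys = j mod length xs \<and> i mod length ys = j div length xs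
   then brd (xs ! (i div length ys)) (ys ! (i mod length ys)) else zr (addt xs ys ! i) (addt ys xs ! j)"

abbreviation coE where
 "coE xs j \<equiv> if j div length xs = j mod length xs then coev (xs ! (j mod length xs)) else zr U (addt xs (dul xs) ! j)"

abbreviation evE where
 "evE xs i \<equiv> if i div length xs = i mod length xs then ev (xs ! (i mod length xs)) else zr (addt (dul xs) xs ! i) U"

lemma add_Ten:
 "TenA AL (mk xs ys F) (mk xs' ys' G) = mk (addt xs xs') (addt ys ys')
   (tenE xs' ys' F G)"
 unfolding mk_def add_compl_def by (auto intro!: cong_mat simp: div_mod_less)

lemma add_Braid:
 "Braid AL xs ys = mk (addt xs ys) (addt ys xs)
   (brE xs ys)"
 unfolding mk_def add_compl_def by (auto intro!: cong_mat)

lemma add_Dual: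
 "DualA AL (mk xs ys F) = mk (dul ys) (dul xs) (\<lambda>i j. dual (F j i))"
 unfolding mk_def add_compl_def by (auto intro!: cong_mat)

lemma add_Ev:
 "Ev AL xs = mk (addt (dul xs) xs) [U]
   (\<lambda>_ i. evE xs i)"
 unfolding mk_def add_compl_def by (auto intro!: cong_mat simp: Let_def)

lemma add_Coev:
 "Coev AL xs = mk [U] (addt xs (dul xs))
   (\<lambda>j _. coE xs j)"
 unfolding mk_def add_compl_def by (auto intro!: cong_mat simp: Let_def)

lemma AL_simps: "UnitO AL = [U]" "TenO AL = addt" "DualO AL = dul"
 by (simp_all add: add_compl_def)

lemma set_add_ten: "set xs \<subseteq> Obj L ==> set ys \<subseteq> Obj L ==> set (addt xs ys) \<subseteq> Obj L"
 by (auto simp: add_ten_def intro!: ten_obj)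

lemma set_dual: "set xs \<subseteq> Obj L ==> set (dul xs) \<subseteq> Obj L"
 by (auto intro!: dual_obj)

lemma nth_Obj: "set xs \<subseteq> Obj L ==> i < length xs ==> ob (xs ! i)"
 using nth_mem by blast

lemma ents_Ten:
 assumes "ents xs ys F" "ents xs' ys' G"
 shows "ents (addt xs xs') (addt ys ys')
  (tenE xs' ys' F G)"
proof (rule entsI)
 show "set (addt xs xs') \<subseteq> Obj L" "set (addt ys ys') \<subseteq> Obj L"
  using set_add_ten assms by (simp_all add: ents_def)
 fix i j assume "i < length (addt xs xs')" "j < length (addt ys ys')"
 hence ij: "i < length xs * length xs'" "j < length ys * length ys'" by auto
 show "tenE xs' ys' F G j i
  \<in> hom (addt xs xs' ! i) (addt ys ys' ! j)"
  unfolding add_ten_nth[OF ij(1)] add_ten_nth[OF ij(2)]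
  using ij by (intro ten_hom entsD(1)[OF assms(1)] entsD(1)[OF assms(2)] div_mod_less)
qed

lemma ents_Braid:
 assumes xs: "set xs \<subseteq> Obj L" and ys: "set ys \<subseteq> Obj L"
 shows "ents (addt xs ys) (addt ys xs)
   (brE xs ys)"
proof (rule entsI)
 show s: "set (addt xs ys) \<subseteq> Obj L" "set (addt ys xs) \<subseteq> Obj L"
  using set_add_ten assms by simp_all
 fix i j assume ij: "i < length (addt xs ys)" "j < length (addt ys xs)"
 hence ij': "i < length xs * length ys" "j < length ys * length xs" by auto
 have "brd (xs ! (i div length ys)) (ys ! (i mod length ys)) \<in> hom (teno (xs ! (i div length ys)) (ys ! (i mod length ys)))
   (teno (ys ! (i mod length ys)) (xs ! (i div length ys)))"
  by (rule braid_hom) (use nth_Obj[OF xs] nth_Obj[OF ys] div_mod_less[OF ij'(1)] in auto)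
 moreover have "zr (addt xs ys ! i) (addt ys xs ! j) \<in> hom (addt xs ys ! i) (addt ys xs ! j)"
  by (rule zero_hom) (use nth_Obj[OF s(1) ij(1)] nth_Obj[OF s(2) ij(2)] in auto)
 ultimately show "brE xs ys j i \<in> hom (addt xs ys ! i) (addt ys xs ! j)"
  using add_ten_nth[OF ij'(1), of L] add_ten_nth[OF ij'(2), of L] by auto
qed

lemma ents_Dual:
 assumes "ents xs ys F"
 shows "ents (dul ys) (dul xs) (\<lambda>i j. dual (F j i))"
proof (rule entsI)
 show "set (dul ys) \<subseteq> Obj L" "set (dul xs) \<subseteq> Obj L"
  using assms set_dual by (auto simp: ents_def)
qed (use entsD(1)[OF assms] dual_hom in auto)

lemma ents_Coev:
 assumes xs: "set xs \<subseteq> Obj L"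
 shows "ents [U] (addt xs (dul xs))
   (\<lambda>j _. coE xs j)"
proof (rule entsI)
 show s: "set [U] \<subseteq> Obj L" "set (addt xs (dul xs)) \<subseteq> Obj L"
  using xs set_dual set_add_ten unit_obj by auto
 fix i j assume i: "i < length [U]" and j: "j < length (addt xs (dul xs))"
 hence j': "j < length xs * length (dul xs)" "j < length xs * length xs" by auto
 note d = div_mod_less[OF j'(2)]
 have "coev (xs ! (j mod length xs)) \<in> hom U (teno (xs ! (j mod length xs)) (du (xs ! (j mod length xs))))"
  using coev_hom nth_Obj[OF xs d(2)] .
 moreover have "zr U (addt xs (dul xs) ! j) \<in> hom U (addt xs (dul xs) ! j)"
  using zero_hom unit_obj nth_Obj[OF s(2) j] by blast
 ultimately show "coE xs j \<in> hom ([U] ! i) (addt xs (dul xs) ! j)"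
  using add_ten_nth[OF j'(1), of L] i d by simp
qed

lemma ents_Ev:
 assumes xs: "set xs \<subseteq> Obj L"
 shows "ents (addt (dul xs) xs) [U]
   (\<lambda>_ i. evE xs i)"
proof (rule entsI)
 show s: "set (addt (dul xs) xs) \<subseteq> Obj L" "set [U] \<subseteq> Obj L"
  using xs set_dual set_add_ten unit_obj by auto
 fix j i assume i: "i < length [U]" and j: "j < length (addt (dul xs) xs)"
 hence j': "j < length (dul xs) * length xs" "j < length xs * length xs" by auto
 note d = div_mod_less[OF j'(2)]
 have "ev (xs ! (j mod length xs)) \<in> hom (teno (du (xs ! (j mod length xs))) (xs ! (j mod length xs))) U"
  using ev_hom nth_Obj[OF xs d(2)] .
 moreover have "zr (addt (dul xs) xs ! j) U \<in> hom (addt (dul xs) xs ! j) U"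
  using zero_hom unit_obj nth_Obj[OF s(1) j] by blast
 ultimately show "evE xs j \<in> hom (addt (dul xs) xs ! j) ([U] ! i)"
  using add_ten_nth[OF j'(1), of L] i d by simp
qed

lemma fsum_pair:
 assumes "ob x" "ob y" "\<And>a b. a < m ==> b < n ==> F a b \<in> hom x y"
 shows "fsum x y (m * n) (\<lambda>j. F (j div n) (j mod n)) = fsum x y m (\<lambda>a. fsum x y n (\<lambda>b. F a b))"
proof -
 have "fsum x y (m * n) (\<lambda>j. F (j div n) (j mod n)) = fsum x y m (\<lambda>a. fsum x y n (\<lambda>b. F ((a * n + b) div n) ((a * n + b) mod n)))"
  by (rule fsum_prod[OF assms(1,2)]) (rule assms(3)[OF div_mod_less])
 also have "... = fsum x y m (\<lambda>a. fsum x y n (\<lambda>b. F a b))"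
  by (intro fsum_cong) simp
 finally show ?thesis .
qed

text \<open>The mixed product rule for Kronecker products; the flattened inner index runs over the
  pairs of the two inner indices.\<close>

lemma add_Ten_comp:
 assumes "a \<in> Hom AL x y" "b \<in> Hom AL y z" "a' \<in> Hom AL x' y'" "b' \<in> Hom AL y' z'"
 shows "TenA AL (Comp AL b a) (Comp AL b' a') = Comp AL (TenA AL b b') (TenA AL a a')"
proof -
 obtain A where a: "a = mk x y A" and A: "ents x y A" using assms(1) by (rule add_cases)
 obtain B where b: "b = mk y z B" and B: "ents y z B" using assms(2) by (rule add_cases)
 obtain A' where a': "a' = mk x' y' A'" and A': "ents x' y' A'" using assms(3) by (rule add_cases)
 obtain B' where b': "b' = mk y' z' B'" and B': "ents y' z' B'" using assms(4) by (rule add_cases)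
 show ?thesis
  unfolding a b a' b' add_Comp add_Ten
 proof (rule mk_cong)
  fix i k assume "i < length (addt x x')" "k < length (addt z z')"
  hence i: "i < length x * length x'" and k: "k < length z * length z'" by auto
  define i1 i2 k1 k2 where "i1 = i div length x'" and "i2 = i mod length x'" and "k1 = k div length z'" and "k2 = k mod length z'"
  have l: "i1 < length x" "i2 < length x'" "k1 < length z" "k2 < length z'"
   using div_mod_less[OF i] div_mod_less[OF k] by (simp_all add: i1_def i2_def k1_def k2_def)
  note hA = entsD(1)[OF A l(1)] and hB = entsD(1)[OF B _ l(3)] and hA' = entsD(1)[OF A' l(2)] and hB' = entsD(1)[OF B' _ l(4)]
  have o: "ob (x ! i1)" "ob (z ! k1)" "ob (x' ! i2)" "ob (z' ! k2)"
   using entsD(2)[OF A l(1)] entsD(3)[OF B l(3)] entsD(2)[OF A' l(2)] entsD(3)[OF B' l(4)] .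
  have n: "addt x x' ! i = teno (x ! i1) (x' ! i2)" "addt z z' ! k = teno (z ! k1) (z' ! k2)"
   using add_ten_nth[OF i] add_ten_nth[OF k] by (simp_all add: i1_def i2_def k1_def k2_def)
  let ?x = "teno (x ! i1) (x' ! i2)" and ?z = "teno (z ! k1) (z' ! k2)"
  have O: "ob ?x" "ob ?z" using o ten_obj by auto
  have "ten (fsum (x ! i1) (z ! k1) (length y) (\<lambda>j. B k1 j \<cdot> A j i1)) (fsum (x' ! i2) (z' ! k2) (length y') (\<lambda>j. B' k2 j \<cdot> A' j i2)) =
   fsum ?x ?z (length y) (\<lambda>j. ten (B k1 j \<cdot> A j i1) (fsum (x' ! i2) (z' ! k2) (length y') (\<lambda>j. B' k2 j \<cdot> A' j i2)))"
   by (rule ten_fsum_left[OF fsum_hom[OF o(3,4) comp_hom[OF hA' hB']] o(1,2) comp_hom[OF hA hB]])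
  also have "... = fsum ?x ?z (length y) (\<lambda>j. fsum ?x ?z (length y') (\<lambda>j'. ten (B k1 j \<cdot> A j i1) (B' k2 j' \<cdot> A' j' i2)))"
   by (rule fsum_cong, rule ten_fsum_right[OF comp_hom[OF hA hB] o(3,4) comp_hom[OF hA' hB']])
  also have "... = fsum ?x ?z (length y) (\<lambda>j. fsum ?x ?z (length y') (\<lambda>j'. ten (B k1 j) (B' k2 j') \<cdot> ten (A j i1) (A' j' i2)))"
   by (rule fsum_cong, rule fsum_cong, rule ten_comp[OF hA hB hA' hB'])
  also have "... = fsum ?x ?z (length y * length y') (\<lambda>j. ten (B k1 (j div length y')) (B' k2 (j mod length y')) \<cdot>
    ten (A (j div length y') i1) (A' (j mod length y') i2))"
   by (rule fsum_pair[OF O comp_hom[OF ten_hom[OF hA hA'] ten_hom[OF hB hB']], symmetric])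
  finally show "ten (fsum (x ! (i div length x')) (z ! (k div length z')) (length y) (\<lambda>j. B (k div length z') j \<cdot> A j (i div length x')))
    (fsum (x' ! (i mod length x')) (z' ! (k mod length z')) (length y') (\<lambda>j. B' (k mod length z') j \<cdot> A' j (i mod length x'))) =
   fsum (addt x x' ! i) (addt z z' ! k) (length (addt y y'))
    (\<lambda>j. tenE y' z' B B' k j \<cdot>
      tenE x' y' A A' j i)"
   unfolding n by (simp add: i1_def i2_def k1_def k2_def)
 qed
qed

lemma fsum_pair_single:
 assumes o: "ob x" "ob y" and ab: "a < m" "b < n" and h: "F (a * n + b) \<in> hom x y"
  and z: "\<And>j. j < m * n ==> \<not> (j div n = a \<and> j mod n = b) ==> F j = zr x y"
 shows "fsum x y (m * n) F = F (a * n + b)"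
proof (rule fsum_single[where F = F, OF o pair_less[OF ab] h])
 fix j assume j: "j < m * n" "j \<noteq> a * n + b"
 hence "\<not> (j div n = a \<and> j mod n = b)" using div_mult_mod_eq[of j n] by auto
 thus "F j = zr x y" using z[OF j(1)] by simp
qed

lemma add_Braid_nat:
 assumes "a \<in> Hom AL x y" "b \<in> Hom AL x' y'"
 shows "Comp AL (Braid AL y y') (TenA AL a b) = Comp AL (TenA AL b a) (Braid AL x x')"
proof -
 obtain A where a: "a = mk x y A" and A: "ents x y A" using assms(1) by (rule add_cases)
 obtain B where b: "b = mk x' y' B" and B: "ents x' y' B" using assms(2) by (rule add_cases)
 have s: "set x \<subseteq> Obj L" "set y \<subseteq> Obj L" "set x' \<subseteq> Obj L" "set y' \<subseteq> Obj L" using A B by (auto simp: ents_def)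
 note T = ents_Ten[OF A B] and T' = ents_Ten[OF B A]
 show ?thesis
  unfolding a b add_Ten add_Braid add_Comp
 proof (rule mk_cong)
  fix i k assume ik: "i < length (addt x x')" "k < length (addt y' y)"
  hence i: "i < length x * length x'" and k: "k < length y' * length y" by auto
  note li = div_mod_less[OF i] and lk = div_mod_less[OF k]
  \<comment> \<open>The braiding exchanges the two digits of a flattened index, so each of the two
    sums has at most one nonzero term, at \<open>?j\<close> and at \<open>?l\<close>.\<close>
  let ?j = "(k mod length y) * length y' + k div length y"
  let ?l = "(i mod length x') * length x + i div length x'"
  have O: "ob (addt x x' ! i)" "ob (addt y' y ! k)"
   using entsD(2)[OF T ik(1)] entsD(3)[OF T' ik(2)] .
  have dj: "?j div length y' = k mod length y" "?j mod length y' = k div length y" using pair_div_mod[OF lk(1)] by auto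
  have dl: "?l div length x = i mod length x'" "?l mod length x = i div length x'" using pair_div_mod[OF li(1)] by auto
  have jl: "?j < length (addt y y')" "?l < length (addt x' x)"
   using pair_less[OF lk(2) lk(1)] pair_less[OF li(2) li(1)] by simp_all
  note Br = entsD(1)[OF ents_Braid[OF s(2,4)] _ ik(2)] and Br' = entsD(1)[OF ents_Braid[OF s(1,3)] ik(1)]
  have L: "fsum (addt x x' ! i) (addt y' y ! k) (length y * length y')
   (\<lambda>j. brE y y' k j \<cdot>
     tenE x' y' A B j i) =
   brd (y ! (k mod length y)) (y' ! (k div length y)) \<cdot> ten (A (k mod length y) (i div length x')) (B (k div length y) (i mod length x'))"
   (is "fsum _ _ _ ?F = _")
  proof -
   have "fsum (addt x x' ! i) (addt y' y ! k) (length y * length y') ?F = ?F ?j"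
   proof (rule fsum_pair_single[where F = ?F, OF O lk(2,1)])
    show "?F ?j \<in> hom (addt x x' ! i) (addt y' y ! k)"
     by (rule comp_hom[OF entsD(1)[OF T ik(1) jl(1)] Br[OF jl(1)]])
    fix j assume j: "j < length y * length y'" "\<not> (j div length y' = k mod length y \<and> j mod length y' = k div length y)"
    show "?F j = zr (addt x x' ! i) (addt y' y ! k)"
     using comp_zero(2)[OF entsD(1)[OF T ik(1), of j] O(2)] j by auto
   qed
   thus ?thesis by (simp only: dj simp_thms if_True)
  qed
  have R: "fsum (addt x x' ! i) (addt y' y ! k) (length x' * length x)
   (\<lambda>j. tenE x y B A k j \<cdot>
    brE x x' j i) =
   ten (B (k div length y) (i mod length x')) (A (k mod length y) (i div length x')) \<cdot> brd (x ! (i div length x')) (x' ! (i mod length x'))"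
   (is "fsum _ _ _ ?G = _")
  proof -
   have "fsum (addt x x' ! i) (addt y' y ! k) (length x' * length x) ?G = ?G ?l"
   proof (rule fsum_pair_single[where F = ?G, OF O li(2,1)])
    show "?G ?l \<in> hom (addt x x' ! i) (addt y' y ! k)"
     by (rule comp_hom[OF Br'[OF jl(2)] entsD(1)[OF T' jl(2) ik(2)]])
    fix j assume j: "j < length x' * length x" "\<not> (j div length x = i mod length x' \<and> j mod length x = i div length x')"
    show "?G j = zr (addt x x' ! i) (addt y' y ! k)"
     using comp_zero(1)[OF entsD(1)[OF T' _ ik(2), of j] O(1)] j by auto
   qed
   thus ?thesis by (simp only: dl simp_thms if_True)
  qed
  have N: "brd (y ! (k mod length y)) (y' ! (k div length y)) \<cdot> ten (A (k mod length y) (i div length x')) (B (k div length y) (i mod length x')) =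
   ten (B (k div length y) (i mod length x')) (A (k mod length y) (i div length x')) \<cdot> brd (x ! (i div length x')) (x' ! (i mod length x'))"
   by (rule braid_nat[OF entsD(1)[OF A li(1) lk(2)] entsD(1)[OF B li(2) lk(1)]])
  show "fsum (addt x x' ! i) (addt y' y ! k) (length (addt y y'))
   (\<lambda>j. brE y y' k j \<cdot>
     tenE x' y' A B j i) =
   fsum (addt x x' ! i) (addt y' y ! k) (length (addt x' x))
   (\<lambda>j. tenE x y B A k j \<cdot>
    brE x x' j i)"
   unfolding length_add_ten L R by (rule N)
 qed
qed

lemma add_Dual_comp:
 assumes "a \<in> Hom AL x y" "b \<in> Hom AL y z"
 shows "DualA AL (Comp AL b a) = Comp AL (DualA AL a) (DualA AL b)"
proof -
 obtain A where a: "a = mk x y A" and A: "ents x y A" using assms(1) by (rule add_cases)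
 obtain B where b: "b = mk y z B" and B: "ents y z B" using assms(2) by (rule add_cases)
 show ?thesis
  unfolding a b add_Comp add_Dual
 proof (rule mk_cong)
  fix k i assume "k < length (dul z)" "i < length (dul x)"
  hence ik: "i < length x" "k < length z" by auto
  note hA = entsD(1)[OF A ik(1)] and hB = entsD(1)[OF B _ ik(2)]
  have "dual (fsum (x ! i) (z ! k) (length y) (\<lambda>j. B k j \<cdot> A j i)) =
   fsum (du (z ! k)) (du (x ! i)) (length y) (\<lambda>j. dual (B k j \<cdot> A j i))"
   by (rule dual_fsum[OF entsD(2)[OF A ik(1)] entsD(3)[OF B ik(2)] comp_hom[OF hA hB]])
  also have "... = fsum (du (z ! k)) (du (x ! i)) (length y) (\<lambda>j. dual (A j i) \<cdot> dual (B k j))"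
   by (rule fsum_cong, rule dual_comp[OF hA hB])
  finally show "dual (fsum (x ! i) (z ! k) (length y) (\<lambda>j. B k j \<cdot> A j i)) =
   fsum (dul z ! k) (dul x ! i) (length (dul y)) (\<lambda>j. dual (A j i) \<cdot> dual (B k j))"
   using ik by simp
 qed
qed

text \<open>\<open>Coev\<close> lives on the diagonal indices \<open>a * length x + a\<close>, and
  row \<open>k\<close> of \<open>T\<close> meets only one of them, the one given by
  \<open>c k\<close>; no sum survives. It serves both sides of the sliding rule.\<close>

lemma add_comp_Coev:
 assumes T: "ents (addt x (dul x)) z T" and x: "set x \<subseteq> Obj L"
  and c: "\<And>k. k < length z ==> c k < length x"
  and T0: "\<And>a k. [|a < length x; k < length z; a \<noteq> c k|]
   ==> T k (a * length x + a) = zr (addt x (dul x) ! (a * length x + a)) (z ! k)"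
 shows "Comp AL (mk (addt x (dul x)) z T) (Coev AL x) = mk [U] z (\<lambda>k _. T k (c k * length x + c k) \<cdot> coev (x ! c k))"
 unfolding add_Coev add_Comp
proof (rule mk_cong)
 fix i k assume i: "i < length [U]" and k: "k < length z"
 note K = ents_Coev[OF x]
 have iU: "[U] ! i = U" using i by simp
 have O: "ob U" "ob (z ! k)" using unit_obj entsD(3)[OF T k] .
 let ?F = "\<lambda>j. T k j \<cdot> coE x j" and ?j = "c k * length x + c k"
 have l: "length (addt x (dul x)) = length x * length x" by simp
 note jl = pair_less[OF c[OF k] c[OF k], folded l]
 have "fsum U (z ! k) (length x * length x) ?F = ?F ?j"
 proof (rule fsum_pair_single[where F = ?F, OF O c[OF k] c[OF k]
    comp_hom[OF entsD(1)[OF K i jl, unfolded iU] entsD(1)[OF T jl k]]])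
  fix j assume j: "j < length x * length x" "\<not> (j div length x = c k \<and> j mod length x = c k)"
  note j' = j(1)[folded l] and ld = div_mod_less[OF j(1)]
  show "?F j = zr U (z ! k)"
  proof (cases "j div length x = j mod length x")
   case True
   hence "j = j mod length x * length x + j mod length x" using div_mult_mod_eq[of j "length x"] by simp
   hence "T k j = zr (addt x (dul x) ! j) (z ! k)" using T0[OF ld(2) k] j(2) True by metis
   thus ?thesis using comp_zero(2)[OF entsD(1)[OF K i j', unfolded iU] O(2)] by simp
  next
   case False
   thus ?thesis using comp_zero(1)[OF entsD(1)[OF T j' k] O(1)] by simp
  qed
 qed
 also have "... = T k ?j \<cdot> coev (x ! c k)" using pair_div_mod[OF c[OF k]] by simp
 finally show "fsum ([U] ! i) (z ! k) (length (addt x (dul x))) ?F = T k ?j \<cdot> coev (x ! c k)" using i by simp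
qed

lemma add_Ten_Coev_left:
 assumes A: "ents x y A"
 shows "Comp AL (TenA AL (mk x y A) (Ident AL (dul x))) (Coev AL x) =
  mk [U] (addt y (dul x)) (\<lambda>k _. ten (A (k div length x) (k mod length x)) (ide (du (x ! (k mod length x)))) \<cdot>
   coev (x ! (k mod length x)))"
proof -
 have s: "set x \<subseteq> Obj L" using A by (auto simp: ents_def)
 note T = ents_Ten[OF A ents_ident[OF set_dual[OF s]]]
 show ?thesis
  unfolding add_Ident add_Ten
 proof (rule trans[OF add_comp_Coev[OF T s, where c = "\<lambda>k. k mod length x"]], goal_cases)
  case (2 a k)
  hence k: "k < length y * length x" by simp
  note lk = div_mod_less[OF k]
  show ?case
   using 2 pair_less[of a _ a "length x"] lk add_ten_nth[of k y "dul x" L] add_ten_nth[of "a * length x + a" x "dul x" L] k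
    ten_zero(2)[OF entsD(1)[OF A 2(1) lk(1)] dual_obj[OF nth_Obj[OF s 2(1)]] dual_obj[OF nth_Obj[OF s lk(2)]]]
   by (simp add: pair_div_mod[OF 2(1)])
 qed (auto intro!: mk_cong simp: div_mod_less pair_div_mod)
qed

lemma add_Ten_Coev_right:
 assumes A: "ents x y A"
 shows "Comp AL (TenA AL (Ident AL y) (DualA AL (mk x y A))) (Coev AL y) =
  mk [U] (addt y (dul x)) (\<lambda>k _. ten (ide (y ! (k div length x))) (dual (A (k div length x) (k mod length x))) \<cdot>
   coev (y ! (k div length x)))"
proof -
 have s: "set y \<subseteq> Obj L" using A by (auto simp: ents_def)
 note T = ents_Ten[OF ents_ident[OF s] ents_Dual[OF A]]
 show ?thesis
  unfolding add_Ident add_Dual add_Ten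
 proof (rule trans[OF add_comp_Coev[OF T s, where c = "\<lambda>k. k div length x"]], goal_cases)
  case (2 a k)
  hence k: "k < length y * length x" by simp
  note lk = div_mod_less[OF k]
  show ?case
   using 2 pair_less[of a _ a "length y"] lk add_ten_nth[of k y "dul x" L] add_ten_nth[of "a * length y + a" y "dul y" L] k
    ten_zero(1)[OF dual_hom[OF entsD(1)[OF A lk(2) 2(1)]] nth_Obj[OF s 2(1)] nth_Obj[OF s lk(1)]]
   by (simp add: pair_div_mod[OF 2(1)])
 qed (auto intro!: mk_cong simp: div_mod_less pair_div_mod)
qed

text \<open>The cup produces all matrix entries, the braiding exchanges their two indices, and the
  cap keeps the diagonal; what remains are the traces of the diagonal entries.\<close>

lemma add_trace_arr:
 assumes A: "ents x x A"
 shows "Comp AL (Ev AL x) (Comp AL (Braid AL x (dul x))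
   (Comp AL (TenA AL (mk x x A) (Ident AL (dul x))) (Coev AL x))) =
  Scale AL (\<Sum>i<length x. cat_trace L (A i i)) (Ident AL [U])"
proof -
 have s: "set x \<subseteq> Obj L" using A by (auto simp: ents_def)
 note sd = set_dual[OF s]
 define n where "n = length x"
 let ?dx = "dul x"
 have ln: "length x = n" "length ?dx = n" by (simp_all add: n_def)
 let ?U = "U"
 \<comment> \<open>\<open>R\<close> is the column after coevaluation, by flattened index;
   \<open>S a b\<close> is the entry at position \<open>a * n + b\<close> after the braiding, to
   which \<open>A b a\<close> has moved.\<close>
 define R where "R = (\<lambda>k. ten (A (k div n) (k mod n)) (ide (du (x ! (k mod n)))) \<cdot> coev (x ! (k mod n)))"
 define S where "S = (\<lambda>a b. brd (x ! b) (du (x ! a)) \<cdot> (ten (A b a) (ide (du (x ! a))) \<cdot> coev (x ! a)))"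
 have ox: "ob (x ! a)" "ob (du (x ! a))" if "a < n" for a
  using nth_Obj[OF s, of a] dual_obj that ln by auto
 have hS: "S a b \<in> hom ?U (teno (du (x ! a)) (x ! b))" if "a < n" "b < n" for a b
  unfolding S_def
  by (rule comp_hom[OF comp_hom[OF coev_hom[OF ox(1)[OF that(1)]] ten_hom[OF entsD(1)[OF A] ident_hom[OF ox(2)[OF that(1)]]]]
    braid_hom[OF ox(1)[OF that(2)] ox(2)[OF that(1)]]])
   (use that ln in auto)
 have 1: "Comp AL (TenA AL (mk x x A) (Ident AL ?dx)) (Coev AL x) = mk [?U] (addt x ?dx) (\<lambda>k _. R k)"
  unfolding add_Ten_Coev_left[OF A] R_def ln ..
 have hR: "R k \<in> hom ?U (addt x ?dx ! k)" if "k < length (addt x ?dx)" for k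
 proof -
  have k: "k < n * n" using that ln by simp
  note lk = div_mod_less[OF k]
  have "R k \<in> hom ?U (teno (x ! (k div n)) (du (x ! (k mod n))))"
   unfolding R_def
   by (rule comp_hom[OF coev_hom[OF ox(1)[OF lk(2)]] ten_hom[OF entsD(1)[OF A] ident_hom[OF ox(2)[OF lk(2)]]]])
    (use lk ln in auto)
  thus ?thesis using add_ten_nth[of k x ?dx L] k ln lk by simp
 qed
 have 2: "Comp AL (Braid AL x ?dx) (mk [?U] (addt x ?dx) (\<lambda>k _. R k)) =
  mk [?U] (addt ?dx x) (\<lambda>l _. S (l div n) (l mod n))"
  unfolding add_Braid add_Comp
 proof (rule mk_cong)
  fix i l assume i: "i < length [?U]" and l': "l < length (addt ?dx x)"
  hence l: "l < n * n" using ln by simp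
  note ll = div_mod_less[OF l]
  have iU: "[?U] ! i = ?U" using i by simp
  let ?z = "addt ?dx x ! l"
  note Br = entsD(1)[OF ents_Braid[OF s sd] _ l', unfolded ln]
  have O: "ob ?U" "ob ?z" using unit_obj nth_Obj[OF set_add_ten[OF sd s] l'] .
  let ?F = "\<lambda>j. (if j div n = l mod n \<and> j mod n = l div n then brd (x ! (j div n)) (?dx ! (j mod n))
     else zr (addt x ?dx ! j) ?z) \<cdot> R j"
  let ?j = "(l mod n) * n + l div n"
  have dj: "?j div n = l mod n" "?j mod n = l div n" using pair_div_mod[OF ll(1)] by auto
  have jl: "?j < length (addt x ?dx)" using pair_less[OF ll(2) ll(1)] ln by simp
  have "fsum ?U ?z (n * n) ?F = ?F ?j"
  proof (rule fsum_pair_single[where F = ?F, OF O ll(2) ll(1) comp_hom[OF hR[OF jl] Br[OF jl]]])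
   fix j assume j: "j < n * n" "\<not> (j div n = l mod n \<and> j mod n = l div n)"
   hence "?F j = zr (addt x ?dx ! j) ?z \<cdot> R j" by auto
   also have "... = zr ?U ?z" by (rule comp_zero(2)[OF hR O(2)]) (use j ln in simp)
   finally show "?F j = zr ?U ?z" .
  qed
  also have "?F ?j = S (l div n) (l mod n)"
   unfolding S_def R_def dj using ll ln by simp
  finally show "fsum ([?U] ! i) ?z (length (addt x ?dx))
   (\<lambda>j. brE x ?dx l j \<cdot> R j) =
   S (l div n) (l mod n)"
   unfolding iU length_add_ten ln .
 qed
 have 3: "Comp AL (Ev AL x) (mk [?U] (addt ?dx x) (\<lambda>l _. S (l div n) (l mod n))) =
  mk [?U] [?U] (\<lambda>_ _. fsum ?U ?U n (\<lambda>a. trace_arr (A a a)))"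
  unfolding add_Ev add_Comp
 proof (rule mk_cong)
  fix i k assume i: "i < length [?U]" and k: "k < length [?U]"
  have iU: "[?U] ! i = ?U" "[?U] ! k = ?U" using i k by simp_all
  let ?G = "\<lambda>a b. if a = b then trace_arr (A b b) else zr ?U ?U"
  have tA: "trace_arr (A a a) \<in> hom ?U ?U" if "a < n" for a
   by (rule trace_arr_hom[OF entsD(1)[OF A]]) (use that ln in auto)
  have hG: "?G a b \<in> hom ?U ?U" if "a < n" "b < n" for a b
   using tA that zero_hom[OF unit_obj unit_obj] by simp
  have dA: "dom (A a a) = x ! a" if "a < n" for a
   using entsD(1)[OF A, of a a] that ln by (simp add: Hom_def)
  have "fsum ?U ?U (n * n) (\<lambda>l. (if l div n = l mod n then ev (x ! (l mod n)) else zr (addt ?dx x ! l) ?U) \<cdot> S (l div n) (l mod n)) =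
   fsum ?U ?U (n * n) (\<lambda>l. ?G (l div n) (l mod n))"
  proof (rule fsum_cong)
   fix l assume l: "l < n * n"
   note ll = div_mod_less[OF l]
   show "(if l div n = l mod n then ev (x ! (l mod n)) else zr (addt ?dx x ! l) ?U) \<cdot> S (l div n) (l mod n) = ?G (l div n) (l mod n)"
   proof (cases "l div n = l mod n")
    case True
    thus ?thesis unfolding S_def trace_arr_def using dA[OF ll(2)] by simp
   next
    case False
    have "addt ?dx x ! l = teno (du (x ! (l div n))) (x ! (l mod n))"
     using add_ten_nth[of l ?dx x L] l ll ln by simp
    thus ?thesis using False comp_zero(2)[OF hS[OF ll] unit_obj] by simp
   qed
  qed
  also have "... = fsum ?U ?U n (\<lambda>a. fsum ?U ?U n (\<lambda>b. ?G a b))"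
   by (rule fsum_pair[OF unit_obj unit_obj hG])
  also have "... = fsum ?U ?U n (\<lambda>a. trace_arr (A a a))"
  proof (rule fsum_cong)
   fix a assume a: "a < n"
   have "fsum ?U ?U n (\<lambda>b. ?G a b) = ?G a a"
    by (rule fsum_single[where F = "\<lambda>b. ?G a b", OF unit_obj unit_obj a hG[OF a a]]) simp
   thus "fsum ?U ?U n (\<lambda>b. ?G a b) = trace_arr (A a a)" by simp
  qed
  finally show "fsum ([?U] ! i) ([?U] ! k) (length (addt ?dx x))
   (\<lambda>l. evE x l \<cdot> S (l div n) (l mod n)) =
   fsum ?U ?U n (\<lambda>a. trace_arr (A a a))"
   unfolding iU length_add_ten ln .
 qed
 have 4: "fsum ?U ?U n (\<lambda>a. trace_arr (A a a)) = scl (\<Sum>i<n. cat_trace L (A i i)) (ide ?U)"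
 proof -
  note iU = ident_hom[OF unit_obj]
  have "fsum ?U ?U m (\<lambda>a. trace_arr (A a a)) = scl (\<Sum>i<m. cat_trace L (A i i)) (ide ?U)" if "m \<le> n" for m
   using that
  proof (induction m)
   case 0
   thus ?case using scale_zero[OF iU] by (simp add: fsum_0)
  next
   case (Suc m)
   have h: "A a a \<in> hom (x ! a) (x ! a)" if "a < Suc m" for a
    using entsD(1)[OF A, of a a] that Suc.prems ln by auto
   have "fsum ?U ?U (Suc m) (\<lambda>a. trace_arr (A a a)) = pls (fsum ?U ?U m (\<lambda>a. trace_arr (A a a))) (trace_arr (A m m))"
    by (rule fsum_Suc[OF unit_obj unit_obj trace_arr_hom[OF h]])
   also have "trace_arr (A m m) = scl (cat_trace L (A m m)) (ide ?U)" by (rule trace_arr_eq[OF h]) simp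
   finally show ?case using Suc plus_scale[OF iU] by simp
  qed
  thus ?thesis by simp
 qed
 show ?thesis
  unfolding 1 2 3 4 ln
  unfolding add_Ident add_Scale
  by (rule mk_cong) simp
qed

lemma add_scale_unit_inj:
 assumes "Scale AL k (Ident AL [U]) = Scale AL l (Ident AL [U])"
 shows "k = l"
 using assms scale_unit_inj unfolding add_Ident add_Scale mk_eq_iff by auto

lemma add_trace:
 assumes A: "ents x x A"
 shows "cat_trace AL (mk x x A) = (\<Sum>i<length x. cat_trace L (A i i))"
proof -
 have "Dom AL (mk x x A) = x" using mk_Hom[OF A] by (auto simp: Hom_def)
 thus ?thesis
  unfolding cat_trace_def[of AL] Let_def AL_simps
  using add_trace_arr[OF A] add_scale_unit_inj by (intro the_equality) auto
qed

lemma add_tensor_category: "tensor_category AL"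
proof (intro tensor_category.intro add_lin_category tensor_category_axioms.intro)
 show "UnitO AL \<in> Obj AL" using unit_obj by (simp add: AL_simps Obj_AL)
 show "\<exists>k. a = Scale AL k (Ident AL (UnitO AL))" if a: "a \<in> Hom AL (UnitO AL) (UnitO AL)" for a
 proof -
  obtain A where A: "a = mk [U] [U] A" "ents [U] [U] A"
   using a unfolding AL_simps by (rule add_cases)
  then obtain k where "A 0 0 = scl k (ide U)" using entsD(1)[OF A(2), of 0 0] scalars by auto
  thus ?thesis
   unfolding A AL_simps add_Ident add_Scale by (intro exI[of _ k] mk_cong) auto
 qed
 show "k = l" if "Scale AL k (Ident AL (UnitO AL)) = Scale AL l (Ident AL (UnitO AL))" for k l
  using that add_scale_unit_inj by (simp add: AL_simps)
 show "x \<in> Obj AL ==> y \<in> Obj AL ==> TenO AL x y \<in> Obj AL" for x y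
  using set_add_ten by (simp add: AL_simps Obj_AL)
 show "x \<in> Obj AL ==> DualO AL x \<in> Obj AL" for x
  using set_dual by (simp add: AL_simps Obj_AL)
 show "x \<in> Obj AL ==> y \<in> Obj AL ==> Braid AL x y \<in> Hom AL (TenO AL x y) (TenO AL y x)" for x y
  unfolding add_Braid AL_simps Obj_AL by (intro mk_Hom ents_Braid)
 show "x \<in> Obj AL ==> Coev AL x \<in> Hom AL (UnitO AL) (TenO AL x (DualO AL x))" for x
  unfolding add_Coev AL_simps Obj_AL by (intro mk_Hom ents_Coev)
 show "x \<in> Obj AL ==> Ev AL x \<in> Hom AL (TenO AL (DualO AL x) x) (UnitO AL)" for x
  unfolding add_Ev AL_simps Obj_AL by (intro mk_Hom ents_Ev)
 show "a \<in> Hom AL x y ==> b \<in> Hom AL y z ==> a' \<in> Hom AL x' y' ==> b' \<in> Hom AL y' z' ==>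
  TenA AL (Comp AL b a) (Comp AL b' a') = Comp AL (TenA AL b b') (TenA AL a a')" for a b a' b' x y z x' y' z'
  by (rule add_Ten_comp)
 show "a \<in> Hom AL x y ==> b \<in> Hom AL x' y' ==>
  Comp AL (Braid AL y y') (TenA AL a b) = Comp AL (TenA AL b a) (Braid AL x x')" for a b x y x' y'
  by (rule add_Braid_nat)
 show "a \<in> Hom AL x y ==> b \<in> Hom AL y z ==> DualA AL (Comp AL b a) = Comp AL (DualA AL a) (DualA AL b)" for a b x y z
  by (rule add_Dual_comp)
 fix x y a assume "a \<in> Hom AL x y"
 then obtain A where a: "a = mk x y A" and A: "ents x y A" by (rule add_cases)
 show "DualA AL a \<in> Hom AL (DualO AL y) (DualO AL x)"
  unfolding a add_Dual AL_simps by (intro mk_Hom ents_Dual A)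
 show "DualA AL (Scale AL k a) = Scale AL k (DualA AL a)" for k
  unfolding a add_Dual add_Scale using dual_scale[OF entsD(1)[OF A]] by (intro mk_cong) simp
 show "Comp AL (TenA AL a (Ident AL (DualO AL x))) (Coev AL x) = Comp AL (TenA AL (Ident AL y) (DualA AL a)) (Coev AL y)"
  unfolding a AL_simps add_Ten_Coev_left[OF A] add_Ten_Coev_right[OF A]
 proof (rule mk_cong)
  fix i k assume "k < length (addt y (dul x))"
  hence k: "k < length y * length x" by simp
  show "ten (A (k div length x) (k mod length x)) (ide (du (x ! (k mod length x)))) \<cdot> coev (x ! (k mod length x)) =
   ten (ide (y ! (k div length x))) (dual (A (k div length x) (k mod length x))) \<cdot> coev (y ! (k div length x))"
   using coev_dual[OF entsD(1)[OF A div_mod_less(2)[OF k] div_mod_less(1)[OF k]]] .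
 qed
 show "cat_trace AL (Comp AL b a) = cat_trace AL (Comp AL a b)" if "b \<in> Hom AL y x" for b
  using that
 proof (rule add_cases)
  fix B assume b: "b = mk y x B" and B: "ents y x B"
  have "cat_trace AL (Comp AL b a) = (\<Sum>i<length x. cat_trace L (fsum (x ! i) (x ! i) (length y) (\<lambda>j. B i j \<cdot> A j i)))"
   unfolding a b add_Comp by (rule add_trace[OF ents_comp[OF A B]])
  also have "... = (\<Sum>i<length x. \<Sum>j<length y. cat_trace L (B i j \<cdot> A j i))"
   using entsD(2)[OF A] comp_hom[OF entsD(1)[OF A] entsD(1)[OF B]] by (intro sum.cong refl trace_fsum) auto
  also have "... = (\<Sum>i<length x. \<Sum>j<length y. cat_trace L (A j i \<cdot> B i j))"
   using trace_cyclic[OF entsD(1)[OF A] entsD(1)[OF B]] by (intro sum.cong refl) auto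
  also have "... = (\<Sum>j<length y. \<Sum>i<length x. cat_trace L (A j i \<cdot> B i j))" by (rule sum.swap)
  also have "... = (\<Sum>j<length y. cat_trace L (fsum (y ! j) (y ! j) (length x) (\<lambda>i. A j i \<cdot> B i j)))"
   using entsD(2)[OF B] comp_hom[OF entsD(1)[OF B] entsD(1)[OF A]] by (intro sum.cong refl trace_fsum[symmetric]) auto
  also have "... = cat_trace AL (Comp AL a b)"
   unfolding a b add_Comp by (rule add_trace[OF ents_comp[OF B A], symmetric])
  finally show ?thesis .
 qed
 {
  fix b assume "b \<in> Hom AL x y"
  then obtain B where b: "b = mk x y B" and B: "ents x y B" by (rule add_cases)
  show "DualA AL (Plus AL a b) = Plus AL (DualA AL a) (DualA AL b)"
   unfolding a b add_Dual add_Plus using dual_plus[OF entsD(1)[OF A] entsD(1)[OF B]] by (intro mk_cong) simp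
  fix c x' y' assume "c \<in> Hom AL x' y'"
  then obtain C where c: "c = mk x' y' C" and C: "ents x' y' C" by (rule add_cases)
  show "TenA AL (Plus AL a b) c = Plus AL (TenA AL a c) (TenA AL b c)"
   unfolding a b c add_Ten add_Plus
   using ten_plus_left[OF entsD(1)[OF A] entsD(1)[OF B] entsD(1)[OF C]] div_mod_less by (intro mk_cong) auto
 }
 fix x' y' c assume "c \<in> Hom AL x' y'"
 then obtain C where c: "c = mk x' y' C" and C: "ents x' y' C" by (rule add_cases)
 show "TenA AL a c \<in> Hom AL (TenO AL x x') (TenO AL y y')"
  unfolding a c add_Ten AL_simps by (intro mk_Hom ents_Ten A C)
 show "TenA AL (Scale AL k a) c = Scale AL k (TenA AL a c)" for k
  unfolding a c add_Ten add_Scale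
  using ten_scale_left[OF entsD(1)[OF A] entsD(1)[OF C]] div_mod_less by (intro mk_cong) auto
 show "TenA AL a (Scale AL k c) = Scale AL k (TenA AL a c)" for k
  unfolding a c add_Ten add_Scale
  using ten_scale_right[OF entsD(1)[OF A] entsD(1)[OF C]] div_mod_less by (intro mk_cong) auto
 show "TenA AL a (Plus AL c d) = Plus AL (TenA AL a c) (TenA AL a d)" if "d \<in> Hom AL x' y'" for d
  using that
 proof (rule add_cases)
  fix D assume d: "d = mk x' y' D" and D: "ents x' y' D"
  show ?thesis
   unfolding a c d add_Ten add_Plus
   using ten_plus_right[OF entsD(1)[OF A] entsD(1)[OF C] entsD(1)[OF D]] div_mod_less by (intro mk_cong) auto
 qed
qed

section \<open>The idempotent completion\<close>

abbreviation KL where "KL \<equiv> kar_compl L"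

lemma kar_objs_iff: "X \<in> kar_objs L \<longleftrightarrow> ob (fst X) \<and> snd X \<in> hom (fst X) (fst X) \<and> snd X \<cdot> snd X = snd X"
 by (auto simp: kar_objs_def)

text \<open>The condition e' f e = f is split into two one-sided absorptions, which is what
  composition and units use.\<close>

lemma kar_Hom:
 "Hom KL X Y = {(X, f, Y) | f. X \<in> kar_objs L \<and> Y \<in> kar_objs L \<and> f \<in> hom (fst X) (fst Y) \<and>
   snd Y \<cdot> f = f \<and> f \<cdot> snd X = f}"
proof -
 have "snd Y \<cdot> (f \<cdot> snd X) = f \<longleftrightarrow> snd Y \<cdot> f = f \<and> f \<cdot> snd X = f"
  if "X \<in> kar_objs L" "Y \<in> kar_objs L" "f \<in> hom (fst X) (fst Y)" for f
 proof -
  have e: "snd X \<in> hom (fst X) (fst X)" "snd X \<cdot> snd X = snd X" "snd Y \<in> hom (fst Y) (fst Y)" "snd Y \<cdot> snd Y = snd Y"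
   using that by (auto simp: kar_objs_iff)
  show ?thesis
  proof
   assume a: "snd Y \<cdot> (f \<cdot> snd X) = f"
   have "snd Y \<cdot> f = snd Y \<cdot> (snd Y \<cdot> (f \<cdot> snd X))" using a by simp
   also have "... = f" using comp_assoc[OF comp_hom[OF e(1) that(3)] e(3) e(3)] e(4) a by simp
   moreover have "f \<cdot> snd X = (snd Y \<cdot> (f \<cdot> snd X)) \<cdot> snd X" using a by simp
   moreover have "... = f"
    using comp_assoc[OF e(1) comp_hom[OF e(1) that(3)] e(3)] comp_assoc[OF e(1) e(1) that(3)] e(2) a by simp
   ultimately show "snd Y \<cdot> f = f \<and> f \<cdot> snd X = f" by simp
  qed simp
 qed
 moreover have "Hom KL X Y = {(X, f, Y) | f. X \<in> kar_objs L \<and> Y \<in> kar_objs L \<and> f \<in> hom (fst X) (fst Y) \<and>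
   snd Y \<cdot> (f \<cdot> snd X) = f}"
  unfolding Hom_def[of KL] by (auto simp: kar_compl_def)
 ultimately show ?thesis by auto
qed

lemma kar_simps:
 "Comp KL (Y', g, Z) (X, f, Y) = (X, g \<cdot> f, Z)" "Ident KL X = (X, snd X, X)" "Obj KL = kar_objs L"
 "Zero KL X Y = (X, zr (fst X) (fst Y), Y)" "Plus KL (X, f, Y) (X', f', Y') = (X, pls f f', Y)"
 "Scale KL k (X, f, Y) = (X, scl k f, Y)"
 by (simp_all add: kar_compl_def)

lemma kar_lin_category: "lin_category KL"
proof (intro lin_category.intro tcat_category.intro lin_category_axioms.intro)
 show "category KL"
 proof
  show "f \<in> Arr KL ==> Dom KL f \<in> Obj KL" "f \<in> Arr KL ==> Cod KL f \<in> Obj KL" for f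
   by (auto simp: kar_compl_def)
  show "X \<in> Obj KL ==> Ident KL X \<in> Hom KL X X" for X
   by (auto simp: kar_Hom kar_simps kar_objs_iff)
  show "Comp KL g f \<in> Hom KL X Z" if "f \<in> Hom KL X Y" "g \<in> Hom KL Y Z" for f g X Y Z
  proof -
   obtain f' g' where f: "f = (X, f', Y)" "X \<in> kar_objs L" "f' \<in> hom (fst X) (fst Y)" "f' \<cdot> snd X = f'"
    and g: "g = (Y, g', Z)" "Z \<in> kar_objs L" "g' \<in> hom (fst Y) (fst Z)" "snd Z \<cdot> g' = g'"
    using \<open>f \<in> Hom KL X Y\<close> \<open>g \<in> Hom KL Y Z\<close> unfolding kar_Hom by auto
   have e: "snd X \<in> hom (fst X) (fst X)" "snd Z \<in> hom (fst Z) (fst Z)" using f g by (auto simp: kar_objs_iff)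
   show ?thesis
    using comp_hom[OF f(3) g(3)] comp_assoc[OF f(3) g(3) e(2)] comp_assoc[OF e(1) f(3) g(3)] f g
    by (simp add: kar_Hom kar_simps)
  qed
  show "f \<in> Hom KL X Y ==> Comp KL f (Ident KL X) = f" "f \<in> Hom KL X Y ==> Comp KL (Ident KL Y) f = f" for f X Y
   by (auto simp: kar_Hom kar_simps)
  show "f \<in> Hom KL W X ==> g \<in> Hom KL X Y ==> h \<in> Hom KL Y Z ==> Comp KL h (Comp KL g f) = Comp KL (Comp KL h g) f" for f g h W X Y Z
   by (auto simp: kar_Hom kar_simps comp_assoc)
 qed
 show "X \<in> Obj KL ==> Y \<in> Obj KL ==> Zero KL X Y \<in> Hom KL X Y" for X Y
  by (auto simp: kar_Hom kar_simps kar_objs_iff zero_hom comp_zero)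
 show "f \<in> Hom KL X Y ==> g \<in> Hom KL X Y ==> Plus KL f g \<in> Hom KL X Y" for f g X Y
  by (auto simp: kar_Hom kar_simps kar_objs_iff plus_hom comp_plus_left comp_plus_right)
 show "f \<in> Hom KL X Y ==> Scale KL k f \<in> Hom KL X Y" for f X Y k
  by (auto simp: kar_Hom kar_simps kar_objs_iff scale_hom comp_scale_left comp_scale_right)
 show "f \<in> Hom KL X Y ==> g \<in> Hom KL X Y ==> h \<in> Hom KL X Y ==>
   Plus KL (Plus KL f g) h = Plus KL f (Plus KL g h)" for f g h X Y
  by (auto simp: kar_Hom kar_simps plus_assoc)
 show "f \<in> Hom KL X Y ==> g \<in> Hom KL X Y ==> Plus KL f g = Plus KL g f" for f g X Y
  by (auto simp: kar_Hom kar_simps plus_comm)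
 show "f \<in> Hom KL X Y ==> Plus KL f (Zero KL X Y) = f" for f X Y
  by (auto simp: kar_Hom kar_simps plus_zero)
 show "f \<in> Hom KL X Y ==> g \<in> Hom KL X Y ==> Scale KL k (Plus KL f g) = Plus KL (Scale KL k f) (Scale KL k g)" for f g X Y k
  by (auto simp: kar_Hom kar_simps scale_plus)
 show "f \<in> Hom KL X Y ==> Scale KL (k + l) f = Plus KL (Scale KL k f) (Scale KL l f)" for f X Y k l
  by (auto simp: kar_Hom kar_simps plus_scale)
 show "f \<in> Hom KL X Y ==> Scale KL k (Scale KL l f) = Scale KL (k * l) f" for f X Y k l
  by (auto simp: kar_Hom kar_simps scale_scale)
 show "f \<in> Hom KL X Y ==> Scale KL 1 f = f" for f X Y
  by (auto simp: kar_Hom kar_simps scale_one)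
 show "f \<in> Hom KL X Y ==> Scale KL 0 f = Zero KL X Y" for f X Y
  by (auto simp: kar_Hom kar_simps scale_zero)
 show "f \<in> Hom KL X Y ==> g \<in> Hom KL Y Z ==> h \<in> Hom KL Y Z ==>
   Comp KL (Plus KL g h) f = Plus KL (Comp KL g f) (Comp KL h f)" for f g h X Y Z
  by (auto simp: kar_Hom kar_simps comp_plus_left)
 show "f \<in> Hom KL X Y ==> h \<in> Hom KL X Y ==> g \<in> Hom KL Y Z ==>
   Comp KL g (Plus KL f h) = Plus KL (Comp KL g f) (Comp KL g h)" for f g h X Y Z
  by (auto simp: kar_Hom kar_simps comp_plus_right)
 show "f \<in> Hom KL X Y ==> g \<in> Hom KL Y Z ==> Comp KL (Scale KL k g) f = Scale KL k (Comp KL g f)" for f g X Y Z k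
  by (auto simp: kar_Hom kar_simps comp_scale_left)
 show "f \<in> Hom KL X Y ==> g \<in> Hom KL Y Z ==> Comp KL g (Scale KL k f) = Scale KL k (Comp KL g f)" for f g X Y Z k
  by (auto simp: kar_Hom kar_simps comp_scale_right)
qed

end

section \<open>The trace in the idempotent completion\<close>

context category
begin

text \<open>\<open>kar_compl\<close> inserts idempotents into evaluation, braiding and coevaluation.
  They move past the braiding \<open>B\<close>, where \<open>Q\<close> turns into \<open>P\<close>,
  and are absorbed by \<open>T\<close>.\<close>

lemma sandwich_collapse:
 assumes "coev \<in> Hom C u x" "P \<in> Hom C x x" "T \<in> Hom C x x" "B \<in> Hom C x y" "Q \<in> Hom C y y" "ev \<in> Hom C y v"
  and PT: "P \<cdot> T = T" and TP: "T \<cdot> P = T" and QB: "Q \<cdot> B = B \<cdot> P" and PP: "P \<cdot> P = P"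
 shows "(ev \<cdot> Q) \<cdot> ((Q \<cdot> (B \<cdot> P)) \<cdot> (T \<cdot> (P \<cdot> coev))) = ev \<cdot> (B \<cdot> (T \<cdot> coev))"
proof -
 note h = assms(1-6)[unfolded hom_iff]
 have r: "P \<cdot> (T \<cdot> k) = T \<cdot> k" "T \<cdot> (P \<cdot> k) = T \<cdot> k" "Q \<cdot> (B \<cdot> k) = B \<cdot> (P \<cdot> k)"
  if "arr k" "cod k = x" for k
  using reassoc[OF PT, of k] reassoc[OF TP, of k] reassoc[OF QB, of k] h that by simp_all
 show ?thesis using h by (simp add: r)
qed

end

context tensor_category
begin

lemma kar_trace:
 assumes X: "X \<in> kar_objs L" and F: "(X, f, X) \<in> Hom KL X X"
 shows "cat_trace KL (X, f, X) = cat_trace L f"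
proof -
 obtain x e where Xe: "X = (x, e)" by (cases X)
 have x: "ob x" and e: "e \<in> hom x x" "e \<cdot> e = e" using X unfolding Xe kar_objs_iff by auto
 have f: "f \<in> hom x x" "e \<cdot> f = f" "f \<cdot> e = f" using F unfolding kar_Hom Xe by auto
 let ?x' = "du x" and ?e' = "dual e" and ?U = "U"
 have x': "ob ?x'" by (rule dual_obj[OF x])
 have e': "?e' \<in> hom ?x' ?x'" "?e' \<cdot> ?e' = ?e'"
  using dual_hom[OF e(1)] dual_comp[OF e(1) e(1)] e(2) by auto
 let ?P = "ten e ?e'" and ?Q = "ten ?e' e" and ?T = "ten f ?e'" and ?B = "brd x ?x'"
 note hP = ten_hom[OF e(1) e'(1)] and hQ = ten_hom[OF e'(1) e(1)] and hT = ten_hom[OF f(1) e'(1)] and hB = braid_hom[OF x x']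
 have "(ev x \<cdot> ?Q) \<cdot> ((?Q \<cdot> (?B \<cdot> ?P)) \<cdot> (?T \<cdot> (?P \<cdot> coev x))) = ev x \<cdot> (?B \<cdot> (?T \<cdot> coev x))"
 proof (rule sandwich_collapse[OF coev_hom[OF x] hP hT hB hQ ev_hom[OF x]])
  show "?P \<cdot> ?T = ?T" using ten_comp[OF f(1) e(1) e'(1) e'(1)] e'(2) f(2) by simp
  show "?T \<cdot> ?P = ?T" using ten_comp[OF e(1) f(1) e'(1) e'(1)] e'(2) f(3) by simp
  show "?Q \<cdot> ?B = ?B \<cdot> ?P" by (rule braid_nat[OF e(1) e'(1), symmetric])
  show "?P \<cdot> ?P = ?P" using ten_comp[OF e(1) e(1) e'(1) e'(1)] e'(2) e(2) by simp
 qed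
 \<comment> \<open>The idempotent left on the dual factor slides around the cup and is absorbed by
   \<open>f\<close> as \<open>e\<close>.\<close>
 also have "?T \<cdot> coev x = ten f (ide ?x') \<cdot> coev x"
 proof -
  note i = ident_hom[OF x] and i' = ident_hom[OF x']
  have "?T = ten f (ide ?x') \<cdot> ten (ide x) ?e'"
   using ten_comp[OF i f(1) e'(1) i'] comp_ident[OF f(1)] ident_comp[OF e'(1)] by simp
  hence "?T \<cdot> coev x = ten f (ide ?x') \<cdot> (ten (ide x) ?e' \<cdot> coev x)"
   using comp_assoc[OF coev_hom[OF x] ten_hom[OF i e'(1)] ten_hom[OF f(1) i']] by simp
  also have "... = ten f (ide ?x') \<cdot> (ten e (ide ?x') \<cdot> coev x)"
   unfolding coev_dual[OF e(1)] ..
  also have "... = ten f (ide ?x') \<cdot> coev x"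
   using comp_assoc[OF coev_hom[OF x] ten_hom[OF e(1) i'] ten_hom[OF f(1) i']] ten_comp[OF e(1) f(1) i' i']
    ident_comp[OF i'] f(3) by simp
  finally show ?thesis .
 qed
 also have "ev x \<cdot> (?B \<cdot> (ten f (ide ?x') \<cdot> coev x)) = trace_arr f"
  using f(1) by (simp add: trace_arr_def Hom_def)
 also have "... = scl (cat_trace L f) (ide ?U)" by (rule trace_arr_eq[OF f(1)])
 finally have big: "(ev x \<cdot> ?Q) \<cdot> ((?Q \<cdot> (?B \<cdot> ?P)) \<cdot> (?T \<cdot> (?P \<cdot> coev x))) = scl (cat_trace L f) (ide ?U)" .
 show ?thesis
  unfolding cat_trace_def[of KL] Let_def
  by (rule the_equality)
   (auto simp: kar_compl_def kar_dual_def kar_ten_def kar_unit_def Xe big dest: scale_unit_inj)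
qed

lemma kar_trace_cyclic:
 assumes "a \<in> Hom KL X Y" "b \<in> Hom KL Y X"
 shows "cat_trace KL (Comp KL b a) = cat_trace KL (Comp KL a b)"
proof -
 interpret K: lin_category KL by (rule kar_lin_category)
 obtain a' b' where a: "a = (X, a', Y)" "a' \<in> hom (fst X) (fst Y)" "X \<in> kar_objs L" "Y \<in> kar_objs L"
  and b: "b = (Y, b', X)" "b' \<in> hom (fst Y) (fst X)"
  using assms unfolding kar_Hom by auto
 have "Comp KL b a \<in> Hom KL X X" "Comp KL a b \<in> Hom KL Y Y"
  using K.comp_hom[OF assms] K.comp_hom[OF assms(2,1)] .
 thus ?thesis
  unfolding a(1) b(1) kar_simps using kar_trace a(3,4) trace_cyclic[OF a(2) b(2)] by simp
qed

lemma kar_trace_lin: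
 assumes "a \<in> Hom KL X X"
 shows "b \<in> Hom KL X X ==> cat_trace KL (Plus KL a b) = cat_trace KL a + cat_trace KL b"
  "cat_trace KL (Scale KL k a) = k * cat_trace KL a"
  "cat_trace KL (Zero KL X X) = 0"
proof -
 interpret K: lin_category KL by (rule kar_lin_category)
 obtain a' where a: "a = (X, a', X)" "a' \<in> hom (fst X) (fst X)" "X \<in> kar_objs L"
  using assms unfolding kar_Hom by auto
 show "cat_trace KL (Plus KL a b) = cat_trace KL a + cat_trace KL b" if bb: "b \<in> Hom KL X X"
 proof -
  obtain b' where b: "b = (X, b', X)" "b' \<in> hom (fst X) (fst X)" using bb unfolding kar_Hom by auto
  show ?thesis using K.plus_hom[OF assms bb] assms bb a b kar_trace[OF a(3)] trace_plus[OF a(2) b(2)] by (simp add: kar_simps)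
 qed
 show "cat_trace KL (Scale KL k a) = k * cat_trace KL a"
  using K.scale_hom[OF assms] assms a kar_trace[OF a(3)] trace_scale[OF a(2)] by (simp add: kar_simps)
 have "X \<in> Obj KL" "ob (fst X)" using a by (auto simp: kar_simps kar_objs_iff)
 thus "cat_trace KL (Zero KL X X) = 0"
  using K.zero_hom[of X X] kar_trace[OF a(3)] trace_zero[of "fst X"] by (simp add: kar_simps)
qed

end

section \<open>Relations in exact Mal'cev categories\<close>

context regular_category
begin

definition pre_sub :: "'m \<Rightarrow> 'm set \<Rightarrow> 'm set" where
 "pre_sub e T = sub_class (snd (pb (incl T) e))"

lemma pre_sub_pb:
 assumes "arr e" "T \<in> Sub (cod e)"
 obtains p q where "is_pullback (incl T) e p q" "mono q" "pre_sub e T = sub_class q" "pre_sub e T \<in> Sub (dom e)"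
proof -
 note T = incl_facts[OF assms(2)]
 have P: "is_pullback (incl T) e (fst (pb (incl T) e)) (snd (pb (incl T) e))"
  by (rule pb) (use T assms in simp_all)
 have m: "mono (snd (pb (incl T) e))" by (rule pullback_mono[OF P T(1)])
 show ?thesis
  using that[OF P m] m pullback_facts(8)[OF P] unfolding pre_sub_def by simp
qed

text \<open>The image of the inverse image returns \<open>T\<close>, because the pullback of
  \<open>e\<close> is again surjective.\<close>

lemma pre_sub_inj:
 assumes "surj e"
 shows "inj_on (pre_sub e) (Sub (cod e))"
proof -
 have "image_sub (e o incl (pre_sub e T)) = T" if T: "T \<in> Sub (cod e)" for T
 proof -
  note iT = incl_facts[OF T]
  obtain p q where P: "is_pullback (incl T) e p q" and q: "mono q" "pre_sub e T = sub_class q"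
   using pre_sub_pb[OF surj_arr[OF assms] T] by blast
  note F = pullback_facts[OF P]
  obtain h where h: "iso h" "dom h = dom q" "cod h = dom (incl (pre_sub e T))" "incl (pre_sub e T) o h = q"
   using incl_sub_class[OF q(1)] q(2) by metis
  obtain k where k: "arr k" "dom k = cod h" "cod k = dom h" "h o k = ide (cod h)" "iso k"
   using isoE[OF h(1)] by metis
  have i: "arr (incl (pre_sub e T))" "cod (incl (pre_sub e T)) = dom e"
   using incl_facts[OF sub_class_in[OF q(1) refl]] F(8) q(2) by simp_all
  have "(incl (pre_sub e T) o h) o k = incl (pre_sub e T)"
   using k h(1-3) i by simp
  hence "q o k = incl (pre_sub e T)" unfolding h(4) .
  hence "incl T o (p o k) = e o incl (pre_sub e T)"
   using F k h(2,3) by (simp add: reassoc[OF F(9)])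
  moreover have "surj (p o k)"
   using surj_comp[OF iso_surj[OF k(5)] surj_pullback[OF assms pullback_sym[OF P]]] F(6) k(3) h(2) by simp
  ultimately have "image_sub (e o incl (pre_sub e T)) = sub_class (incl T)"
   using image_sub_unique(1)[OF iT(1), of "p o k"] F(4,6,7) k(1-3) h(2,3) by simp
  thus ?thesis using iT by simp
 qed
 thus ?thesis by (rule inj_on_inverseI)
qed

definition push_sub :: "'m \<Rightarrow> 'm set \<Rightarrow> 'm set" where
 "push_sub m T = sub_class (m o incl T)"

lemma push_sub_mono:
 assumes "mono m" "T \<in> Sub (dom m)"
 shows "mono (m o incl T)" "push_sub m T \<in> Sub (cod m)"
proof -
 note T = incl_facts[OF assms(2)]
 show m: "mono (m o incl T)" by (rule mono_comp[OF T(1) assms(1)]) (use T in simp)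
 show "push_sub m T \<in> Sub (cod m)" unfolding push_sub_def by (rule sub_class_in[OF m]) (use T mono_arr[OF assms(1)] in simp)
qed

lemma factors_mono_cancel:
 assumes "mono m" "arr a" "arr b" "cod a = dom m" "cod b = dom m"
 shows "factors_through (m o a) (m o b) \<longleftrightarrow> factors_through a b"
proof
 assume "factors_through (m o a) (m o b)"
 then obtain h where h: "arr h" "dom h = dom a" "cod h = dom b" "(m o b) o h = m o a"
  using assms mono_arr[OF assms(1)] by (auto elim!: factors_throughE)
 have "b o h = a" by (rule monoD[OF assms(1)]) (use h assms mono_arr[OF assms(1)] in simp_all)
 thus "factors_through a b" using h by (intro factors_throughI[of h])
next
 assume "factors_through a b"
 then obtain h where h: "arr h" "dom h = dom a" "cod h = dom b" "b o h = a"
  by (rule factors_throughE)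
 thus "factors_through (m o a) (m o b)"
  using assms mono_arr[OF assms(1)] by (intro factors_throughI[of h]) simp_all
qed

lemma push_sub_le:
 assumes "mono m" "T \<in> Sub (dom m)" "T' \<in> Sub (dom m)"
 shows "sub_le (push_sub m T) (push_sub m T') \<longleftrightarrow> sub_le T T'"
 unfolding push_sub_def
 using sub_le_class[OF push_sub_mono(1)[OF assms(1,2)] push_sub_mono(1)[OF assms(1,3)]]
  factors_mono_cancel[OF assms(1), of "incl T" "incl T'"] sub_le_iff[OF assms(2,3)]
  incl_facts[OF assms(2)] incl_facts[OF assms(3)] mono_arr[OF assms(1)] by simp

lemma push_sub_inj:
 assumes "mono m"
 shows "inj_on (push_sub m) (Sub (dom m))"
proof (rule inj_onI)
 fix T T' assume T: "T \<in> Sub (dom m)" "T' \<in> Sub (dom m)" "push_sub m T = push_sub m T'"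
 have "sub_le (push_sub m T) (push_sub m T')" "sub_le (push_sub m T') (push_sub m T)"
  using T(3) sub_le_refl[OF push_sub_mono(2)[OF assms T(1)]] by simp_all
 thus "T = T'" using push_sub_le[OF assms T(1,2)] push_sub_le[OF assms T(2,1)] sub_le_antisym[OF T(1,2)] by simp
qed

lemma related_iff:
 assumes "r \<in> Sub (prd x y)"
 shows "related r f g \<longleftrightarrow> factors_through (pairing f g) (incl r)"
 unfolding related_def using factors_sub_iff[OF assms] .

end

section \<open>Counting subobjects and the quotient of a relation\<close>

locale malcev_setting = tensor_setting C \<delta>
 for C :: "('o, 'm, 'e) cat_scheme" (structure) and \<delta> :: "'m \<Rightarrow> 'k :: field" +
 assumes exact: "exact_cat C" and malcev: "malcev_cat C"
begin

lemma pr1_surj: "ob x ==> surj (pr1 x x)"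
 by (rule surj_cancel[of _ "pairing (ide x) (ide x)"]) simp_all

text \<open>Subobjects of \<open>x \<times> x\<close> are counted instead of those of \<open>x\<close>: a proper quotient may have
 as many subobjects as \<open>x\<close>, but the diagonal of \<open>x \<times> x\<close> is no preimage from its square.\<close>

lemma subquotient_card:
 assumes m: "mono m" and e: "surj e" "dom e = dom m"
 shows "card (Sub (prd (cod e) (cod e))) \<le> card (Sub (prd (cod m) (cod m)))"
  "card (Sub (prd (cod m) (cod m))) \<le> card (Sub (prd (cod e) (cod e))) ==> iso m \<and> iso e"
proof -
 define x y v where "x = cod m" and "y = dom m" and "v = cod e"
 have me: "arr m" "arr e" using m e by auto
 have O: "ob x" "ob y" "ob v" using me by (auto simp: x_def y_def v_def)
 let ?M = "crs m m" and ?E = "crs e e"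
 have M: "mono ?M" "dom ?M = prd y y" "cod ?M = prd x x" using crs_mono[OF m m] me by (simp_all add: x_def y_def)
 have E: "surj ?E" "dom ?E = prd y y" "cod ?E = prd v v" using deg_crs(1)[OF e(1) e(1)] me e(2) by (simp_all add: y_def v_def)
 have "pre_sub ?E ` Sub (prd v v) \<subseteq> Sub (prd y y)"
  using pre_sub_pb[OF surj_arr[OF E(1)]] E(2,3) by (metis image_subsetI)
 moreover have pi: "inj_on (pre_sub ?E) (Sub (prd v v))" using pre_sub_inj[OF E(1)] E(3) by simp
 ultimately have 1: "card (Sub (prd v v)) \<le> card (Sub (prd y y))"
  "card (Sub (prd v v)) = card (Sub (prd y y)) ==> pre_sub ?E ` Sub (prd v v) = Sub (prd y y)"
  using card_inj_on_le[OF pi _ finite_Sub] card_image[OF pi] card_subset_eq[OF finite_Sub] O by auto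
 have "push_sub ?M ` Sub (prd y y) \<subseteq> Sub (prd x x)"
  using push_sub_mono(2)[OF M(1)] M(2,3) by auto
 moreover have qi: "inj_on (push_sub ?M) (Sub (prd y y))" using push_sub_inj[OF M(1)] M(2) by simp
 ultimately have 2: "card (Sub (prd y y)) \<le> card (Sub (prd x x))"
  "card (Sub (prd y y)) = card (Sub (prd x x)) ==> push_sub ?M ` Sub (prd y y) = Sub (prd x x)"
  using card_inj_on_le[OF qi _ finite_Sub] card_image[OF qi] card_subset_eq[OF finite_Sub] O by auto
 show "card (Sub (prd v v)) \<le> card (Sub (prd x x))" using 1(1) 2(1) by simp
 assume "card (Sub (prd x x)) \<le> card (Sub (prd v v))"
 hence S: "pre_sub ?E ` Sub (prd v v) = Sub (prd y y)" "push_sub ?M ` Sub (prd y y) = Sub (prd x x)"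
  using 1 2 by auto
 have "iso m"
 proof -
  \<comment> \<open>If every subobject of \<open>prd x x\<close> is a direct image, so is the top
    one; then \<open>?M\<close> is surjective, and a projection carries this over to
    \<open>m\<close>.\<close>
  have "sub_top (prd x x) \<in> push_sub ?M ` Sub (prd y y)" using S(2) O by simp
  then obtain T where T: "T \<in> Sub (prd y y)" "push_sub ?M T = sub_top (prd x x)" by auto
  note iT = incl_facts[OF T(1)]
  have "iso (?M o incl T)"
   using T push_sub_mono[OF M(1)] M(2,3) sub_class_top_iff[of "?M o incl T" "prd x x"] me iT
   by (simp add: push_sub_def x_def)
  hence "surj ?M" using surj_cancel[OF iso_surj] iT M me by simp
  hence "surj (pr1 x x o ?M)" by (rule surj_comp) (use pr1_surj O M in simp_all)
  moreover have "pr1 x x o ?M = m o pr1 y y" using me by (simp add: crs_def x_def y_def)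
  ultimately have "surj (m o pr1 y y)" by simp
  hence "surj m" by (rule surj_cancel) (use me O in \<open>simp_all add: y_def\<close>)
  thus ?thesis by (rule mono_surj_iso[OF m])
 qed
 moreover have "iso e"
 proof (rule mono_surj_iso[OF monoI e(1)])
  fix f g assume fg: "arr f" "arr g" "dom f = dom g" "cod f = dom e" "cod g = dom e" "e o f = e o g"
  have fy: "cod f = y" "cod g = y" using fg(4,5) e(2) by (simp_all add: y_def)
  let ?D = "pairing (ide y) (ide y)"
  have D: "mono ?D" using diag_mono O by simp
  \<comment> \<open>The diagonal is an inverse image under \<open>?E\<close>. It contains the pair
    (f, f), which has the same image under \<open>?E\<close> as (f, g); hence it contains (f,
    g).\<close>
  have "sub_class ?D \<in> pre_sub ?E ` Sub (prd v v)" using S(1) D O by simp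
  then obtain T where T: "T \<in> Sub (prd v v)" "pre_sub ?E T = sub_class ?D" by auto
  then obtain p q where P: "is_pullback (incl T) ?E p q" and q: "mono q" "pre_sub ?E T = sub_class q"
   using pre_sub_pb[of ?E T] E(3) me by (metis surj_arr E(1))
  note F = pullback_facts[OF P]
  have ft: "factors_through ?D q" "factors_through q ?D"
   using sub_class_eq_iff[OF q(1) D] T q by auto
  have dD: "dom ?D = y" "arr ?D" using O by simp_all
  obtain i where i: "arr i" "dom i = y" "cod i = dom q" "q o i = ?D"
   using factors_throughE[OF ft(1)] unfolding dD by blast
  obtain j where j: "arr j" "dom j = dom q" "cod j = y" "?D o j = q"
   using factors_throughE[OF ft(2)] unfolding dD by blast
  have "?E o pairing f g = ?E o (?D o f)"
   using fg(1-5) fy me e(2) O by (simp add: fg(6) y_def)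
  also have "... = ?E o (q o (i o f))" using reassoc[OF i(4), of f] i(1-3) fg(1) fy F(4-8) by simp
  also have "... = incl T o (p o (i o f))"
   using F i(1-3) fg(1) fy by (simp add: reassoc[OF F(9)])
  finally have "incl T o (p o (i o f)) = ?E o pairing f g" ..
  then obtain h where h: "arr h" "dom h = dom g" "cod h = dom p" "q o h = pairing f g"
   using pullback_lift[OF P, of "p o (i o f)" "pairing f g"] F(1-8) i(1-3) fg(1-5) fy me e(2) by (auto simp: y_def)
  have "pairing f g = ?D o (j o h)"
   using reassoc[OF j(4) j(1) dD(2), of h] j(1-3) h F(4-8) dD by simp
  also have "... = pairing (j o h) (j o h)" using j(1-3) h(1-3) F(6) O by simp
  finally show "f = g" using j(1-3) h(1-3) F(6) fg(1-5) fy by (simp add: pairing_eq_iff)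
 qed (use me in simp)
 ultimately show "iso m \<and> iso e" ..
qed

text \<open>On the members of \<open>r\<close> let (a, b) and (a', b') be related if (a, b') lies in
  \<open>r\<close>. This is the inverse image of \<open>r\<close> under the two legs and is
  reflexive because members lie in \<open>r\<close>; the Mal'cev property makes it an equivalence
  relation, and exactness gives its quotient \<open>e\<close>.\<close>

lemma relation_quotient:
 assumes r: "r \<in> Sub (prd x y)" and O: "ob x" "ob y"
 obtains e where "surj e" "dom e = dom (incl r)"
  "\<And>f g. [|arr f; arr g; dom f = dom g; cod f = dom (incl r); cod g = dom (incl r)|] ==>
   e o f = e o g \<longleftrightarrow> related r (pr1 x y o incl r o f) (pr2 x y o incl r o g)"
proof -
 note ir = incl_facts[OF r]
 define R where "R = dom (incl r)"
 have OR: "ob R" using ir by (auto simp: R_def)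
 define r1 r2 where "r1 = pr1 x y o incl r" and "r2 = pr2 x y o incl r"
 have r12: "arr r1" "dom r1 = R" "cod r1 = x" "arr r2" "dom r2 = R" "cod r2 = y" "pairing r1 r2 = incl r"
  using ir O by (simp_all add: r1_def r2_def R_def pairing_pr)
 let ?E = "crs r1 r2"
 have E: "arr ?E" "dom ?E = prd R R" "cod ?E = prd x y" using r12 by simp_all
 obtain p q where P: "is_pullback (incl r) ?E p q" and q: "mono q" and s: "pre_sub ?E r = sub_class q" "pre_sub ?E r \<in> Sub (prd R R)"
  using pre_sub_pb[OF E(1)] r E by metis
 note F = pullback_facts[OF P]
 let ?s = "pre_sub ?E r"
 note iS = incl_facts[OF s(2)]
 have rel: "related ?s f g \<longleftrightarrow> related r (r1 o f) (r2 o g)"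
  if fg: "arr f" "arr g" "dom f = dom g" "cod f = R" "cod g = R" for f g
 proof
  assume "related ?s f g"
  hence "factors_through (pairing f g) q" unfolding related_def s(1) using factors_sub_class[OF q] by simp
  then obtain h where h: "arr h" "dom h = dom g" "cod h = dom q" "q o h = pairing f g"
   using fg by (auto elim!: factors_throughE)
  have "pairing (r1 o f) (r2 o g) = ?E o (q o h)" unfolding h(4) using fg r12 by simp
  also have "... = incl r o (p o h)" using F h(1-3) by (simp add: reassoc[OF F(9)])
  finally show "related r (r1 o f) (r2 o g)"
   unfolding related_iff[OF r] using F(4-8) h(1-3) fg r12 ir(4) by (intro factors_throughI[of "p o h"]) simp_all
 next
  assume "related r (r1 o f) (r2 o g)"
  then obtain h where h: "arr h" "dom h = dom g" "cod h = R" "incl r o h = pairing (r1 o f) (r2 o g)"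
   unfolding related_iff[OF r] using fg r12 by (auto elim!: factors_throughE simp: R_def)
  obtain k where "arr k" "dom k = dom (pairing f g)" "cod k = dom p" "q o k = pairing f g"
   by (rule pullback_lift[OF P, of h "pairing f g"]) (use h fg r12 in \<open>simp_all add: R_def\<close>)
  hence "factors_through (pairing f g) q" using F(6) by (intro factors_throughI[of k]) simp_all
  thus "related ?s f g" unfolding related_def s(1) using factors_sub_class[OF q] by simp
 qed
 have "reflexive_rel C R ?s"
  unfolding reflexive_rel_def
 proof (intro conjI allI ballI)
  fix t f assume "f \<in> Hom C t R"
  hence f: "arr f" "cod f = R" by auto
  have "pairing r1 r2 o f = pairing (r1 o f) (r2 o f)" using f r12(1-6) by simp
  hence "incl r o f = pairing (r1 o f) (r2 o f)" unfolding r12(7) .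
  hence "factors_through (pairing (r1 o f) (r2 o f)) (incl r)"
   using f r12(1-6) by (intro factors_throughI[of f]) (simp_all add: R_def)
  thus "related ?s f f" using rel[of f f] f related_iff[OF r] by simp
 qed (rule s(2))
 hence "equivalence_rel C R ?s" using malcev OR unfolding malcev_cat_def by blast
 then obtain e where e: "surj e" "dom e = R"
  and K: "is_pullback e e (pr1 R R o incl ?s) (pr2 R R o incl ?s)"
  using exact OR unfolding exact_cat_def by blast
 note KF = pullback_facts[OF K]
 have ker: "e o f = e o g \<longleftrightarrow> related ?s f g"
  if fg: "arr f" "arr g" "dom f = dom g" "cod f = R" "cod g = R" for f g
 proof
  assume "e o f = e o g"
  then obtain h where h: "arr h" "dom h = dom g" "cod h = dom (pr1 R R o incl ?s)"
   "(pr1 R R o incl ?s) o h = f" "(pr2 R R o incl ?s) o h = g"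
   using pullback_lift[OF K, of f g] fg e(2) by metis
  have hd: "cod h = dom (incl ?s)" using h(3) iS OR by simp
  have "pairing (pr1 R R o (incl ?s o h)) (pr2 R R o (incl ?s o h)) = incl ?s o h"
   by (rule pairing_pr) (use OR iS h(1) hd in simp_all)
  hence "incl ?s o h = pairing f g" using h(1,4,5) hd iS OR by simp
  thus "related ?s f g" unfolding related_iff[OF s(2)] using h(1,2) hd fg by (intro factors_throughI[of h]) simp_all
 next
  assume "related ?s f g"
  then obtain h where h: "arr h" "dom h = dom g" "cod h = dom (incl ?s)" "incl ?s o h = pairing f g"
   unfolding related_iff[OF s(2)] using fg by (auto elim!: factors_throughE)
  have "(pr1 R R o incl ?s) o h = f" "(pr2 R R o incl ?s) o h = g"
   using h iS OR fg by simp_all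
  thus "e o f = e o g"
   using reassoc[OF KF(9), of h] h(1,3) KF(1-8) iS OR by simp
 qed
 show ?thesis
  by (rule that[of e]) (use e ker rel in \<open>simp_all add: R_def r1_def r2_def del: comp_assoc'\<close>)
qed

end

section \<open>Difunctionality and Goursat's lemma\<close>

context malcev_setting
begin

definition l1 :: "'o \<Rightarrow> 'o \<Rightarrow> 'm set \<Rightarrow> 'm" where "l1 x y r = pr1 x y o incl r"
definition l2 :: "'o \<Rightarrow> 'o \<Rightarrow> 'm set \<Rightarrow> 'm" where "l2 x y r = pr2 x y o incl r"

lemma leg_arr:
 assumes "r \<in> Sub (prd x y)" "ob x" "ob y"
 shows "arr (l1 x y r)" "dom (l1 x y r) = dom (incl r)" "cod (l1 x y r) = x"
  "arr (l2 x y r)" "dom (l2 x y r) = dom (incl r)" "cod (l2 x y r) = y"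
  "pairing (l1 x y r) (l2 x y r) = incl r" "ob (dom (incl r))"
 using incl_facts[OF assms(1)] assms by (simp_all add: l1_def l2_def pairing_pr)

lemma basis_legs:
 assumes "r \<in> Sub (prd x y)" "ob x" "ob y"
 shows "basis x y r = sp (l1 x y r) (l2 x y r)"
 using basis_sp[OF assms] by (simp add: l1_def l2_def)

lemma legs_cancel:
 assumes r: "r \<in> Sub (prd x y)" "ob x" "ob y"
  and h: "arr h" "arr k" "dom h = dom k" "cod h = dom (incl r)" "cod k = dom (incl r)"
  and e: "l1 x y r o h = l1 x y r o k" "l2 x y r o h = l2 x y r o k"
 shows "h = k"
proof -
 note l = leg_arr[OF r]
 have "pairing (l1 x y r) (l2 x y r) o h = pairing (l1 x y r) (l2 x y r) o k" using l(1-6) h e by simp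
 thus ?thesis using monoD[OF incl_facts(1)[OF r(1)], of h k] h l(7) by simp
qed

lemma related_lift:
 assumes r: "r \<in> Sub (prd x y)" "ob x" "ob y"
  and fg: "arr f" "arr g" "dom f = dom g" "cod f = x" "cod g = y"
 shows "related r f g \<longleftrightarrow>
  (\<exists>h. arr h \<and> dom h = dom g \<and> cod h = dom (incl r) \<and> l1 x y r o h = f \<and> l2 x y r o h = g)"
proof -
 note l = leg_arr[OF r]
 have e: "incl r o h = pairing f g \<longleftrightarrow> l1 x y r o h = f \<and> l2 x y r o h = g"
  if h: "arr h" "dom h = dom g" "cod h = dom (incl r)" for h
 proof -
  have "incl r o h = pairing (l1 x y r) (l2 x y r) o h" using l(7) by simp
  also have "... = pairing (l1 x y r o h) (l2 x y r o h)" using l(1-6) h by simp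
  finally have "incl r o h = pairing (l1 x y r o h) (l2 x y r o h)" .
  thus ?thesis using l(1-6) h fg by (simp add: pairing_eq_iff)
 qed
 have "dom (pairing f g) = dom g" using fg by simp
 thus ?thesis unfolding related_iff[OF r(1)] factors_through_iff using e by metis
qed

text \<open>Membership in a relation may be tested on a cover: the lift over \<open>c\<close> and
  the inclusion of \<open>r\<close> form a fill-in problem.\<close>

lemma related_descend:
 assumes r: "r \<in> Sub (prd x y)" "ob x" "ob y"
  and fg: "arr f" "arr g" "dom f = dom g" "cod f = x" "cod g = y"
  and c: "surj c" "cod c = dom g" and rel: "related r (f o c) (g o c)"
 shows "related r f g"
proof -
 have ca: "arr c" using c by simp
 obtain u where u: "arr u" "dom u = dom (pairing (f o c) (g o c))" "cod u = dom (incl r)" "incl r o u = pairing (f o c) (g o c)"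
  using rel unfolding related_iff[OF r(1)] by (rule factors_throughE)
 have "incl r o u = pairing f g o c" using u(4) fg ca c(2) by simp
 then obtain d where "arr d" "dom d = cod c" "cod d = dom (incl r)" "incl r o d = pairing f g"
  by (rule surj_mono_fill[OF c(1) incl_facts(1)[OF r(1)] u(1), rotated]) (use u(2,3) fg ca c(2) incl_facts[OF r(1)] in simp_all)
 thus ?thesis unfolding related_iff[OF r(1)] using c(2) fg by (intro factors_throughI[of d]) simp_all
qed

text \<open>This is transitivity of the relation behind \<open>relation_quotient\<close>, applied to
  the members (a, b'), (a', b') and (a', b).\<close>

lemma difunctional:
 assumes r: "r \<in> Sub (prd x y)" "ob x" "ob y"
  and a: "arr a" "arr a'" "arr b" "arr b'" "dom a = dom b" "dom a' = dom b" "dom b' = dom b"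
   "cod a = x" "cod a' = x" "cod b = y" "cod b' = y"
  and rel: "related r a b'" "related r a' b'" "related r a' b"
 shows "related r a b"
proof -
 obtain e where e: "surj e" "dom e = dom (incl r)"
  and ker: "\<And>f g. [|arr f; arr g; dom f = dom g; cod f = dom (incl r); cod g = dom (incl r)|] ==>
   e o f = e o g \<longleftrightarrow> related r (l1 x y r o f) (l2 x y r o g)"
  by (rule relation_quotient[OF r, folded l1_def l2_def]) (rule that)
 obtain h1 where h1: "arr h1" "dom h1 = dom b" "cod h1 = dom (incl r)" "l1 x y r o h1 = a" "l2 x y r o h1 = b'"
  using related_lift[OF r, of a b'] a rel(1) by auto
 obtain h2 where h2: "arr h2" "dom h2 = dom b" "cod h2 = dom (incl r)" "l1 x y r o h2 = a'" "l2 x y r o h2 = b'"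
  using related_lift[OF r, of a' b'] a rel(2) by auto
 obtain h3 where h3: "arr h3" "dom h3 = dom b" "cod h3 = dom (incl r)" "l1 x y r o h3 = a'" "l2 x y r o h3 = b"
  using related_lift[OF r, of a' b] a rel(3) by auto
 have "e o h1 = e o h2" using ker[of h1 h2] h1 h2 rel(1) by simp
 also have "... = e o h3" using ker[of h2 h3] h2 h3 rel(3) by simp
 finally show ?thesis using ker[of h1 h3] h1 h3 by simp
qed

text \<open>Replaces the choice of preimages: a generalized element lifts along a surjection once
  its domain has been covered.\<close>

lemma surj_cover:
 assumes "surj e" "arr f" "cod f = cod e"
 obtains c h where "surj c" "cod c = dom f" "arr h" "dom h = dom c" "cod h = dom e" "e o h = f o c"
proof -
 obtain p q where P: "is_pullback e f p q" using pullback_exists[of e f] assms surj_arr by fastforce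
 show ?thesis using that[of q p] surj_pullback[OF assms(1) P] pullback_facts[OF P] by simp
qed

text \<open>The quotient of \<open>relation_quotient\<close> identifies members of \<open>r\<close>
  that share a coordinate, so it factors through both images; conversely members of the same class
  may exchange coordinates, so \<open>r\<close> is the whole fibre product over that
  quotient.\<close>

lemma goursat:
 assumes r: "r \<in> Sub (prd x x')" "ob x" "ob x'"
 obtains m1 e1 m2 e2 p q where "mono m1" "cod m1 = x" "surj e1" "dom e1 = dom m1"
  "mono m2" "cod m2 = x'" "surj e2" "dom e2 = dom m2" "cod e1 = cod e2"
  "is_pullback e1 e2 p q" "surj p" "surj q" "m1 o p = l1 x x' r" "m2 o q = l2 x x' r"
proof -
 note l = leg_arr[OF r]
 obtain m1 p where m1: "mono m1" "surj p" "dom m1 = cod p" "m1 o p = l1 x x' r"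
  "dom p = dom (incl r)" "cod m1 = x"
  using image_factorization[OF l(1)] l by metis
 obtain m2 q where m2: "mono m2" "surj q" "dom m2 = cod q" "m2 o q = l2 x x' r"
  "dom q = dom (incl r)" "cod m2 = x'"
  using image_factorization[OF l(4)] l by metis
 have A: "arr m1" "arr p" "arr m2" "arr q" using m1 m2 by auto
 obtain e where e: "surj e" "dom e = dom (incl r)"
  and ker: "\<And>f g. [|arr f; arr g; dom f = dom g; cod f = dom (incl r); cod g = dom (incl r)|] ==>
   e o f = e o g \<longleftrightarrow> related r (l1 x x' r o f) (l2 x x' r o g)"
  by (rule relation_quotient[OF r, folded l1_def l2_def]) (rule that)
 have ea: "arr e" using e by simp
 have self: "related r (l1 x x' r o f) (l2 x x' r o f)" if "arr f" "cod f = dom (incl r)" for f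
  using related_lift[OF r, of "l1 x x' r o f" "l2 x x' r o f"] l(1-6) that by auto
 obtain e1 where e1: "arr e1" "dom e1 = cod p" "cod e1 = cod e" "e1 o p = e"
 proof (rule surj_factor[OF m1(2) ea])
  fix a b assume ab: "arr a" "arr b" "dom a = dom b" "cod a = dom p" "cod b = dom p" "p o a = p o b"
  have "l1 x x' r o a = l1 x x' r o b"
   using reassoc[OF m1(4), of a] reassoc[OF m1(4), of b] ab A m1(3) by simp
  thus "e o a = e o b" using ker[of a b] self[of b] ab m1(5) by simp
 qed (use e m1 in auto)
 obtain e2 where e2: "arr e2" "dom e2 = cod q" "cod e2 = cod e" "e2 o q = e"
 proof (rule surj_factor[OF m2(2) ea])
  fix a b assume ab: "arr a" "arr b" "dom a = dom b" "cod a = dom q" "cod b = dom q" "q o a = q o b"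
  have "l2 x x' r o a = l2 x x' r o b"
   using reassoc[OF m2(4), of a] reassoc[OF m2(4), of b] ab A m2(3) by simp
  thus "e o a = e o b" using ker[of a b] self[of a] ab m2(5) by simp
 qed (use e m2 in auto)
 have "surj (e1 o p)" "surj (e2 o q)" using e1(4) e2(4) e(1) by simp_all
 hence s: "surj e1" "surj e2" using surj_cancel A e1(1,2) e2(1,2) by blast+
 have "is_pullback e1 e2 p q"
 proof (rule pullbackI)
  \<comment> \<open>Elements \<open>a\<close> and \<open>b\<close> with equal class are completed,
    after covers \<open>c\<close> and \<open>d\<close>, to members \<open>f\<close> and
    \<open>g\<close> of \<open>r\<close>. These have the same class, so (a, b) lies in
    \<open>r\<close> over the cover, and by descent already before it.\<close>
  fix a b assume ab: "arr a" "arr b" "dom a = dom b" "cod a = dom e1" "cod b = dom e2" "e1 o a = e2 o b"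
  have ab': "cod a = cod p" "cod b = cod q" using ab(4,5) e1(2) e2(2) by simp_all
  obtain c f where c: "surj c" "cod c = dom b" "arr f" "dom f = dom c" "cod f = dom p" "p o f = a o c"
   using surj_cover[OF m1(2) ab(1)] ab'(1) ab(3) by metis
  have ca: "arr c" using c by simp
  obtain d g where d: "surj d" "cod d = dom c" "arr g" "dom g = dom d" "cod g = dom q" "q o g = (b o c) o d"
   using surj_cover[OF m2(2), of "b o c"] ab'(2) ab(2) c(2) ca by auto
  have da: "arr d" using d by simp
  have pf: "p o (f o d) = a o (c o d)"
   using reassoc[OF c(6), of d] A(2) c(2-5) ca da d(2) ab(1,3) by simp
  have qg: "q o g = b o (c o d)" using d(6) ab(2) c(2) ca da d(2) by simp
  have "e o (f o d) = e1 o (a o (c o d))"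
   using reassoc[OF e1(4), of "f o d"] pf e1 A c(3-5) d(2) da ea by simp
  also have "... = e2 o (b o (c o d))"
   using reassoc[OF ab(6), of "c o d"] e1 e2 ab ca da c(2) d(2) by simp
  also have "... = e o g" using reassoc[OF e2(4), of g] qg e2 A d(3,5) by simp
  finally have "related r (l1 x x' r o (f o d)) (l2 x x' r o g)"
   using ker[of "f o d" g] c(3-5) d(2-5) da m1(5) m2(5) by simp
  moreover have "l1 x x' r o (f o d) = (m1 o a) o (c o d)"
   using reassoc[OF m1(4), of "f o d"] pf A m1(3) c(2-5) d(2) ca da ab(1,3) ab' by simp
  moreover have "l2 x x' r o g = (m2 o b) o (c o d)"
   using reassoc[OF m2(4), of g] qg A m2(3) d(2-5) c(2) ca da ab(2) ab' by simp
  ultimately have "related r ((m1 o a) o (c o d)) ((m2 o b) o (c o d))" by simp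
  hence "related r (m1 o a) (m2 o b)"
   using surj_comp[OF d(1) c(1)]
   by (intro related_descend[OF r, of "m1 o a" "m2 o b" "c o d"])
    (use A m1(3,6) m2(3,6) ab(1-3) ab' c(2) d(2) ca da in \<open>simp_all del: comp_assoc'\<close>)
  then obtain h where h: "arr h" "dom h = dom b" "cod h = dom (incl r)" "l1 x x' r o h = m1 o a" "l2 x x' r o h = m2 o b"
   using related_lift[OF r, of "m1 o a" "m2 o b"] A m1(3,6) m2(3,6) ab(1-3) ab' by auto
  have "p o h = a" using monoD[OF m1(1), of "p o h" a] reassoc[OF m1(4), of h] h A m1(3,5) ab(1,3) ab' by simp
  moreover have "q o h = b" using monoD[OF m2(1), of "q o h" b] reassoc[OF m2(4), of h] h A m2(3,5) ab(2) ab' by simp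
  ultimately show "\<exists>h. arr h \<and> dom h = dom b \<and> cod h = dom p \<and> p o h = a \<and> q o h = b"
   using h(1-3) m1(5) by auto
 next
  fix h k assume hk: "arr h" "arr k" "dom h = dom k" "cod h = dom p" "cod k = dom p"
   "p o h = p o k" "q o h = q o k"
  show "h = k"
  proof (rule legs_cancel[OF r hk(1-3)])
   show "l1 x x' r o h = l1 x x' r o k" "l2 x x' r o h = l2 x x' r o k"
    using reassoc[OF m1(4), of h] reassoc[OF m1(4), of k] reassoc[OF m2(4), of h] reassoc[OF m2(4), of k]
     hk A m1(3,5) m2(3,5) by simp_all
  qed (use hk m1(5) in simp_all)
 qed (use e1 e2 A m1 m2 in simp_all)
 thus ?thesis
  using that[of m1 e1 m2 e2 p q] m1 m2 e1 e2 s by metis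
qed

text \<open>The first leg is the quotient map onto \<open>z\<close>, the second the inclusion of a
  subobject of \<open>x\<close>.\<close>

definition Q :: "'o \<Rightarrow> 'o \<Rightarrow> 'm set set" where
 "Q z x = {r \<in> Sub (prd z x). surj (l1 z x r) \<and> mono (l2 z x r)}"

lemma rel_comp_legs:
 assumes r: "r \<in> Sub (prd x y)" and s: "s \<in> Sub (prd y z)" and O: "ob x" "ob y" "ob z"
 obtains p q w where "is_pullback (l2 x y r) (l1 y z s) p q" "surj w" "dom w = dom p"
  "cod w = dom (incl (rel_comp x y z r s))"
  "l1 x z (rel_comp x y z r s) o w = l1 x y r o p" "l2 x z (rel_comp x y z r s) o w = l2 y z s o q"
proof -
 note lr = leg_arr[OF r O(1,2)] and ls = leg_arr[OF s O(2,3)]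
 note c = rel_span_facts[OF r s O]
 let ?c = "rel_comp x y z r s"
 note lc = leg_arr[OF c(3) O(1,3)]
 obtain p q where pq: "pb (l2 x y r) (l1 y z s) = (p, q)" by fastforce
 have P: "is_pullback (l2 x y r) (l1 y z s) p q"
  using pb[of "l2 x y r" "l1 y z s"] pq lr ls by simp
 note F = pullback_facts[OF P]
 have sp: "rel_span C x y z r s = pairing (l1 x y r o p) (l2 y z s o q)"
  unfolding rel_span_def l1_def[symmetric] l2_def[symmetric] pq by simp
 note w = image_surj_facts[OF c(1), folded rel_comp_def, unfolded sp]
 let ?w = "image_surj (pairing (l1 x y r o p) (l2 y z s o q))"
 have "pairing (l1 x z ?c) (l2 x z ?c) o ?w = pairing (l1 x y r o p) (l2 y z s o q)"
  using w(4) lc(7) by simp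
 hence "pairing (l1 x z ?c o ?w) (l2 x z ?c o ?w) = pairing (l1 x y r o p) (l2 y z s o q)"
  using w(1-3) lc(1-6) by simp
 hence "l1 x z ?c o ?w = l1 x y r o p \<and> l2 x z ?c o ?w = l2 y z s o q"
  by (subst (asm) pairing_eq_iff) (use w(1-3) lc(1-6) lr ls F(4-8) in simp_all)
 thus ?thesis
  by (intro that[OF P w(5)]) (use w(2,3) lr ls F(4-8) in simp_all)
qed

text \<open>Composition never leads back into \<open>Q\<close>. Let u and u' be related by
  \<open>m\<close> to the same t. Since the composite has surjective first leg, u is related by
  \<open>m\<close> to some a that \<open>b\<close> relates to some w; difunctionality relates u' to
  a as well, so both u and u' are related to w by the composite, and u = u' because its second leg
  is monic.\<close>

lemma Q_comp:
 assumes m: "m \<in> Sub (prd z x)" and b: "b \<in> Sub (prd x x')" and O: "ob z" "ob x" "ob x'"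
  and q: "rel_comp z x x' m b \<in> Q z x'"
 shows "m \<in> Q z x"
proof -
 let ?c = "rel_comp z x x' m b"
 note lm = leg_arr[OF m O(1,2)] and lb = leg_arr[OF b O(2,3)]
 note lc = leg_arr[OF rel_span_facts(3)[OF m b O] O(1,3)]
 have q': "surj (l1 z x' ?c)" "mono (l2 z x' ?c)" using q by (auto simp: Q_def)
 obtain p q w where P: "is_pullback (l2 z x m) (l1 x x' b) p q" and w: "surj w" "dom w = dom p" "cod w = dom (incl ?c)"
  "l1 z x' ?c o w = l1 z x m o p" "l2 z x' ?c o w = l2 x x' b o q"
  by (rule rel_comp_legs[OF m b O])
 note F = pullback_facts[OF P]
 have wa: "arr w" using w by simp
 have s: "surj (l1 z x m o p)" using surj_comp[OF w(1) q'(1)] w(3,4) lc by simp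
 have "surj (l1 z x m)" by (rule surj_cancel[OF s]) (use F lm in simp_all)
 moreover have "mono (l2 z x m)"
 proof (rule monoI)
  fix f g assume fg: "arr f" "arr g" "dom f = dom g" "cod f = dom (l2 z x m)" "cod g = dom (l2 z x m)"
   "l2 z x m o f = l2 z x m o g"
  have fM: "cod f = dom (incl m)" "cod g = dom (incl m)" using fg lm by simp_all
  obtain k l where k: "surj k" "cod k = dom g" and kl: "arr l" "dom l = dom k" "cod l = dom p"
   "(l1 z x m o p) o l = (l1 z x m o f) o k"
   using surj_cover[OF s, of "l1 z x m o f"] fg(1,3) fM F lm by auto
  have ka: "arr k" using k by simp
  have kl': "l1 z x m o (p o l) = l1 z x m o (f o k)" using kl k ka fg(1,3) fM F lm by simp
  let ?a = "l2 z x m o (p o l)" and ?mf = "l1 z x m o (f o k)" and ?mg = "l1 z x m o (g o k)"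
  have e2: "l2 z x m o (f o k) = l2 z x m o (g o k)"
   using reassoc[OF fg(6), of k] fg(1-5) fM k(2) ka lm by simp
  have T: "arr ?a" "arr ?mf" "arr ?mg" "arr (l2 z x m o (f o k))"
   "dom ?a = dom k" "dom ?mf = dom k" "dom ?mg = dom k" "dom (l2 z x m o (f o k)) = dom k"
   "cod ?a = x" "cod ?mf = z" "cod ?mg = z" "cod (l2 z x m o (f o k)) = x"
   using fg(1-3) fM k(2) ka kl(1-3) F(4-8) lm by simp_all
  have self: "related m (l1 z x m o h) (l2 z x m o h)" if "arr h" "cod h = dom (incl m)" for h
   using related_lift[OF m O(1,2), of "l1 z x m o h" "l2 z x m o h"] lm(1-6) that by auto
  \<comment> \<open>Difunctionality with the common partner of \<open>?mf\<close> and
    \<open>?mg\<close>.\<close>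
  have "related m ?mg ?a"
  proof (rule difunctional[OF m O(1,2) T(3,2,1,4)])
   show "related m ?mg (l2 z x m o (f o k))" unfolding e2 by (rule self) (use fg fM k ka in simp_all)
   show "related m ?mf (l2 z x m o (f o k))" by (rule self) (use fg fM k ka in simp_all)
   show "related m ?mf ?a" unfolding kl'[symmetric] by (rule self) (use kl F lm in simp_all)
  qed (use T in simp_all)
  then obtain n where n: "arr n" "dom n = dom ?a" "cod n = dom (incl m)" "l1 z x m o n = ?mg" "l2 z x m o n = ?a"
   using related_lift[OF m O(1,2) T(3,1)] T by auto
  have nq: "l2 z x m o n = l1 x x' b o (q o l)"
   using n(5) reassoc[OF F(9), of l] kl(1-3) F(1-8) by simp
  obtain i where i: "arr i" "dom i = dom (q o l)" "cod i = dom p" "p o i = n" "q o i = q o l"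
   by (rule pullback_lift[OF P n(1) _ _ _ _ nq]) (use n(2,3) T(5) kl(1-3) F(4-8) lm in simp_all)
  have il: "dom i = dom l" using i(2) kl(1-3) F(4-8) by simp
  have "l2 z x' ?c o (w o i) = l2 z x' ?c o (w o l)"
   using reassoc[OF w(5), of i] reassoc[OF w(5), of l] i(1,3,5) kl(1,3) wa w(2,3) lc lb F(4-8) by simp
  hence wi: "w o i = w o l"
   using monoD[OF q'(2), of "w o i" "w o l"] i(1,3) il kl(1-3) wa w(2,3) lc by simp
  have "?mg = l1 z x' ?c o (w o i)"
   using reassoc[OF w(4), of i] i(1,3,4) n(4) wa w(2,3) lc lm F(4-8) by simp
  also have "... = ?mf"
   unfolding wi using reassoc[OF w(4), of l] kl(1-3) kl' wa w(2,3) lc lm F(4-8) by simp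
  finally have "(l1 z x m o g) o k = (l1 z x m o f) o k" using fg(1-3) fM k(2) ka lm by simp
  hence "l1 z x m o g = l1 z x m o f"
   by (rule surj_epi[OF k(1)]) (use fg(1-3) fM k(2) lm in simp_all)
  thus "f = g" using legs_cancel[OF m O(1,2), of f g] fg fM by simp
 qed (use lm in simp)
 ultimately show ?thesis using m by (simp add: Q_def)
qed

end

section \<open>Moebius functions of finite posets\<close>

locale finite_poset =
 fixes r :: "('a \<times> 'a) set"
 assumes fin: "finite r" and po: "Partial_order r"
begin

lemma refl_left: "(a, b) \<in> r ==> (a, a) \<in> r" and refl_right: "(a, b) \<in> r ==> (b, b) \<in> r"
 using po unfolding partial_order_on_def preorder_on_def refl_on_def Field_def by blast+

lemma le_trans: "(a, b) \<in> r ==> (b, c) \<in> r ==> (a, c) \<in> r"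
 using po unfolding partial_order_on_def preorder_on_def by (blast dest: transD)

lemma le_antisym: "(a, b) \<in> r ==> (b, a) \<in> r ==> a = b"
 using po unfolding partial_order_on_def by (blast dest: antisymD)

definition seg :: "'a \<Rightarrow> 'a \<Rightarrow> 'a set" where "seg a b = {c. (a, c) \<in> r \<and> (c, b) \<in> r}"

lemma finite_below [simp]: "finite {c. (c, b) \<in> r}"
 by (rule finite_subset[OF _ finite_imageI[OF fin, of fst]]) force

lemma finite_above [simp]: "finite {c. (a, c) \<in> r}"
 by (rule finite_subset[OF _ finite_imageI[OF fin, of snd]]) force

lemma finite_seg [simp]: "finite (seg a b)"
 unfolding seg_def by (rule finite_subset[OF _ finite_below[of b]]) auto

lemma moebius_refl: "(a, a) \<in> r ==> moebius r a a = 1"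
 by (subst moebius.simps) (simp add: fin po)

lemma moebius_sum_left:
 assumes "(a, b) \<in> r"
 shows "(\<Sum>c\<in>seg a b. moebius r a c) = (if a = b then 1 else 0)"
proof (cases "a = b")
 case True
 hence "seg a b = {a}" using assms le_antisym by (auto simp: seg_def)
 thus ?thesis using True assms moebius_refl by simp
next
 case False
 have "b \<in> seg a b" using assms refl_right by (auto simp: seg_def)
 hence "(\<Sum>c\<in>seg a b. moebius r a c) = moebius r a b + (\<Sum>c\<in>seg a b - {b}. moebius r a c)"
  by (simp add: sum.remove)
 moreover have "seg a b - {b} = {c. (a, c) \<in> r \<and> (c, b) \<in> r \<and> c \<noteq> b}" by (auto simp: seg_def)
 ultimately show ?thesis using False assms by (subst (asm) (2) moebius.simps) (simp add: fin po)
qed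

lemma up_induct [case_names less]:
 assumes "\<And>a. (\<And>c. (a, c) \<in> r ==> c \<noteq> a ==> P c) ==> P a"
 shows "P a"
proof (induction "card {c. (a, c) \<in> r}" arbitrary: a rule: less_induct)
 case less
 show ?case
 proof (rule assms)
  fix c assume c: "(a, c) \<in> r" "c \<noteq> a"
  have "{d. (c, d) \<in> r} \<subset> {d. (a, d) \<in> r}"
   using c le_trans[OF c(1)] le_antisym[OF c(1)] refl_left[OF c(1)] by blast
  thus "P c" by (intro less psubset_card_mono) simp_all
 qed
qed

lemma down_induct [case_names greater]:
 assumes "\<And>b. (\<And>c. (c, b) \<in> r ==> c \<noteq> b ==> P c) ==> P b"
 shows "P b"
proof (induction "card {c. (c, b) \<in> r}" arbitrary: b rule: less_induct)
 case less
 show ?case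
 proof (rule assms)
  fix c assume c: "(c, b) \<in> r" "c \<noteq> b"
  have "{d. (d, c) \<in> r} \<subset> {d. (d, b) \<in> r}"
   using c le_trans[OF _ c(1)] le_antisym[OF c(1)] refl_right[OF c(1)] by blast
  thus "P c" by (intro less psubset_card_mono) simp_all
 qed
qed

text \<open>The defining recursion makes \<open>moebius\<close> a one-sided inverse of the zeta
  function; this is the other side, which \<open>phi_sum\<close> needs.\<close>

lemma moebius_sum_right:
 assumes "(a, b) \<in> r"
 shows "(\<Sum>c\<in>seg a b. moebius r c b) = (if a = b then 1 else 0)"
 using assms
proof (induction a rule: up_induct)
 case (less a)
 let ?D = "\<lambda>c. \<Sum>d\<in>seg c b. moebius r d b"
 have sw: "(\<Sum>c\<in>seg a b. \<Sum>d\<in>seg c b. f c d) = (\<Sum>d\<in>seg a b. \<Sum>c\<in>seg a d. f c d)" for f :: "'a \<Rightarrow> 'a \<Rightarrow> int"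
  by (subst (1 2) sum.Sigma, simp, simp, simp, simp, rule sum.reindex_bij_witness[of _ "\<lambda>(x, y). (y, x)" "\<lambda>(x, y). (y, x)"])
   (auto simp: seg_def intro: le_trans)
 \<comment> \<open>Evaluated with the sum over \<open>c\<close> inside, this is
   \<open>moebius r a b\<close>; evaluated by the induction hypothesis at all
   \<open>c \<noteq> a\<close>, it is \<open>?D a\<close> plus, for \<open>a \<noteq> b\<close>,
   that same term.\<close>
 have "(\<Sum>c\<in>seg a b. moebius r a c * ?D c) = (\<Sum>d\<in>seg a b. moebius r d b * (\<Sum>c\<in>seg a d. moebius r a c))"
  by (simp add: sum_distrib_left sw mult.commute)
 also have "... = (\<Sum>d\<in>seg a b. if a = d then moebius r d b else 0)"
  by (rule sum.cong[OF refl]) (subst moebius_sum_left, auto simp: seg_def)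
 also have "... = moebius r a b" using less.prems refl_left by (auto simp: seg_def)
 finally have 1: "(\<Sum>c\<in>seg a b. moebius r a c * ?D c) = moebius r a b" .
 have "(\<Sum>c\<in>seg a b. moebius r a c * ?D c) = ?D a + (\<Sum>c\<in>seg a b - {a}. moebius r a c * ?D c)"
  using less.prems refl_left moebius_refl by (subst sum.remove[of _ a]) (auto simp: seg_def)
 also have "(\<Sum>c\<in>seg a b - {a}. moebius r a c * ?D c) = (\<Sum>c\<in>seg a b - {a}. if c = b then moebius r a c else 0)"
  by (rule sum.cong[OF refl]) (use less.IH in \<open>auto simp: seg_def\<close>)
 also have "... = (if a = b then 0 else moebius r a b)"
  using less.prems refl_right by (auto simp: seg_def)
 finally show ?case using 1 less.prems moebius_refl by (auto split: if_splits)
qed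

text \<open>The Moebius function of a pair depends only on the interval between them, so an order
  embedding whose image is convex preserves it.\<close>

lemma moebius_transport:
 assumes "finite_poset s"
  and emb: "\<And>a b. a \<in> S ==> b \<in> S ==> (a, b) \<in> s \<longleftrightarrow> (f a, f b) \<in> r" and inj: "inj_on f S" and S: "Field s \<subseteq> S"
  and convex: "\<And>a b c. a \<in> S ==> b \<in> S ==> (f a, c) \<in> r ==> (c, f b) \<in> r ==> c \<in> f ` S"
  and ab: "a \<in> S" "b \<in> S"
 shows "moebius s a b = moebius r (f a) (f b)"
proof -
 interpret s: finite_poset s by fact
 have "b \<in> S \<longrightarrow> moebius s a b = moebius r (f a) (f b)"
 proof (induction b rule: s.down_induct)
  case (greater b)
  show ?case
  proof
   assume b: "b \<in> S"
   have e: "f a = f b \<longleftrightarrow> a = b" using inj_on_eq_iff[OF inj ab(1) b] .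
   have "{c. (f a, c) \<in> r \<and> (c, f b) \<in> r \<and> c \<noteq> f b} = f ` {c. (a, c) \<in> s \<and> (c, b) \<in> s \<and> c \<noteq> b}"
    (is "?L = f ` ?R")
   proof (intro equalityI subsetI)
    fix c assume c: "c \<in> ?L"
    then obtain d where d: "d \<in> S" "c = f d" using convex[OF ab(1) b] by blast
    thus "c \<in> f ` ?R" using c emb ab(1) b by auto
   next
    fix c assume "c \<in> f ` ?R"
    then obtain d where d: "c = f d" "(a, d) \<in> s" "(d, b) \<in> s" "d \<noteq> b" by auto
    have "d \<in> S" using d(2) S by (auto simp: Field_def)
    thus "c \<in> ?L" using d emb ab(1) b inj_on_eq_iff[OF inj _ b] by auto
   qed
   moreover have "inj_on f ?R" using S by (intro inj_on_subset[OF inj]) (auto simp: Field_def)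
   ultimately have "(\<Sum>c\<in>?L. moebius r (f a) c) = (\<Sum>c\<in>?R. moebius r (f a) (f c))"
    by (simp add: sum.reindex)
   also have "... = (\<Sum>c\<in>?R. moebius s a c)"
    using greater S by (intro sum.cong[OF refl]) (auto simp: Field_def)
   finally show "moebius s a b = moebius r (f a) (f b)"
    using fin po s.fin s.po emb[OF ab(1) b] e by (subst (1 2) moebius.simps) simp
  qed
 qed
 thus ?thesis using ab by blast
qed

end

section \<open>Vanishing of the Moebius function away from joins of atoms\<close>

locale finite_meet_poset = finite_poset +
 assumes meet: "\<And>a b. a \<in> Field r ==> b \<in> Field r ==>
  \<exists>m. (m, a) \<in> r \<and> (m, b) \<in> r \<and> (\<forall>l. (l, a) \<in> r \<and> (l, b) \<in> r \<longrightarrow> (l, m) \<in> r)"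
begin

lemma meet_set:
 assumes "finite S" "S \<noteq> {}" "S \<subseteq> Field r"
 shows "\<exists>m. (\<forall>s\<in>S. (m, s) \<in> r) \<and> (\<forall>l. (\<forall>s\<in>S. (l, s) \<in> r) \<longrightarrow> (l, m) \<in> r)"
 using assms
proof (induction S rule: finite_ne_induct)
 case (singleton x)
 thus ?case using refl_left refl_right by (intro exI[of _ x]) (auto simp: Field_def)
next
 case (insert x F)
 then obtain m where m: "\<forall>s\<in>F. (m, s) \<in> r" "\<forall>l. (\<forall>s\<in>F. (l, s) \<in> r) \<longrightarrow> (l, m) \<in> r" by auto
 hence "m \<in> Field r" using insert(2) by (auto simp: Field_def)
 then obtain n where n: "(n, x) \<in> r" "(n, m) \<in> r" "\<forall>l. (l, x) \<in> r \<and> (l, m) \<in> r \<longrightarrow> (l, n) \<in> r"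
  using meet[of x m] insert by auto
 thus ?case using m le_trans by (intro exI[of _ n]) blast
qed

text \<open>Avoids joins: \<open>w\<close> is a proper lower bound of \<open>z\<close> that already
  dominates all atoms below \<open>z\<close>. An element c < z not below \<open>w\<close> has all
  its atoms below the meet of c and \<open>w\<close>, so its value vanishes by induction; the
  elements below \<open>w\<close> contribute zero together, as \<open>w\<close> is not the bottom.
  Nothing is left for \<open>z\<close>.\<close>

lemma moebius_not_atomic:
 assumes bot: "\<And>a. a \<in> Field r ==> (b, a) \<in> r"
  and w: "(w, z) \<in> r" "w \<noteq> z"
  and atoms: "\<And>a. [|(a, z) \<in> r; a \<noteq> b; \<And>c. (c, a) \<in> r ==> c = b \<or> c = a|] ==> (a, w) \<in> r"
 shows "moebius r b z = 0"
 using w atoms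
proof (induction z arbitrary: w rule: down_induct)
 case (greater z)
 have F: "z \<in> Field r" "w \<in> Field r" using greater.prems(1) by (auto simp: Field_def)
 have bz: "(b, z) \<in> r" "(b, w) \<in> r" using bot F by auto
 have atom: "\<exists>a. (a, c) \<in> r \<and> a \<noteq> b \<and> (\<forall>d. (d, a) \<in> r \<longrightarrow> d = b \<or> d = a)" if "c \<in> Field r" "c \<noteq> b" for c
  using that
 proof (induction c rule: down_induct)
  case (greater c)
  show ?case
  proof (cases "\<forall>d. (d, c) \<in> r \<longrightarrow> d = b \<or> d = c")
   case True
   moreover have "(c, c) \<in> r" using greater.prems(1) refl_left refl_right by (auto simp: Field_def)
   ultimately show ?thesis using greater.prems(2) by blast
  next
   case False
   thus ?thesis using greater.IH le_trans by (blast intro: FieldI1)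
  qed
 qed
 have wb: "w \<noteq> b"
 proof
  assume "w = b"
  then obtain a where "(a, z) \<in> r" "a \<noteq> b" "\<And>d. (d, a) \<in> r ==> d = b \<or> d = a"
   using atom[OF F(1)] greater.prems(2) by auto
  thus False using greater.prems(3) \<open>w = b\<close> le_antisym bot by (metis FieldI1)
 qed
 \<comment> \<open>The meet of \<open>c\<close> and \<open>w\<close> plays for \<open>c\<close> the
   part that \<open>w\<close> plays for \<open>z\<close>.\<close>
 have zero: "moebius r b c = 0" if c: "(c, z) \<in> r" "c \<noteq> z" "(c, w) \<notin> r" for c
 proof -
  obtain m where m: "(m, c) \<in> r" "(m, w) \<in> r" "\<forall>l. (l, c) \<in> r \<and> (l, w) \<in> r \<longrightarrow> (l, m) \<in> r"
   using meet[of c w] c F by (auto simp: Field_def)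
  show ?thesis
  proof (rule greater.IH[OF c(1,2) m(1)])
   show "m \<noteq> c" using m(2) c(3) by auto
   fix a assume a: "(a, c) \<in> r" "a \<noteq> b" "\<And>d. (d, a) \<in> r ==> d = b \<or> d = a"
   thus "(a, m) \<in> r" using greater.prems(3)[of a] le_trans[OF a(1) c(1)] m(3) by blast
  qed
 qed
 have z: "z \<in> seg b z" using bz refl_right by (auto simp: seg_def)
 have "b \<noteq> z" using bot F greater.prems(1,2) le_antisym by blast
 hence "0 = (\<Sum>c\<in>seg b z. moebius r b c)" using moebius_sum_left[OF bz(1)] by simp
 also have "... = moebius r b z + (\<Sum>c\<in>seg b z - {z}. moebius r b c)" using z by (simp add: sum.remove)
 also have "(\<Sum>c\<in>seg b z - {z}. moebius r b c) = (\<Sum>c\<in>seg b w. moebius r b c)"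
  using zero le_trans[OF _ greater.prems(1)] greater.prems(1,2) le_antisym
  by (intro sum.mono_neutral_right) (auto simp: seg_def)
 also have "... = 0" using moebius_sum_left[OF bz(2)] wb by auto
 finally show ?case by simp
qed

end

section \<open>Automorphisms and quotients\<close>

context category
begin

lemma AutG_carrier: "g \<in> Aut x \<longleftrightarrow> iso g \<and> dom g = x \<and> cod g = x"
 by (auto simp: AutG_def)

lemma AutG_mult [simp]: "g \<otimes>\<^bsub>AutG C x\<^esub> h = g \<cdot> h" and AutG_one [simp]: "\<one>\<^bsub>AutG C x\<^esub> = ide x"
 by (simp_all add: AutG_def)

lemma AutG_group:
 assumes "ob x"
 shows "group (AutG C x)"
proof (rule groupI)
 fix g assume "g \<in> Aut x"
 hence g: "iso g" "dom g = x" "cod g = x" by (auto simp: AutG_carrier)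
 obtain k where "arr k" "dom k = cod g" "cod k = dom g" "k \<cdot> g = ide (dom g)" "iso k"
  by (rule isoE[OF g(1)])
 thus "\<exists>k\<in>Aut x. k \<otimes>\<^bsub>AutG C x\<^esub> g = \<one>\<^bsub>AutG C x\<^esub>"
  using g by (intro bexI[of _ k]) (auto simp: AutG_carrier)
qed (use assms in \<open>auto simp: AutG_carrier iso_comp\<close>)

text \<open>The object is read off as \<open>dom g\<close>, so that inverses carry no object
  parameter.\<close>

definition ivt :: "'m \<Rightarrow> 'm" where "ivt g = inv\<^bsub>AutG C (dom g)\<^esub> g"

lemma ivt:
 assumes "g \<in> Aut x"
 shows "ivt g \<in> Aut x" "g \<cdot> ivt g = ide x" "ivt g \<cdot> g = ide x" "inv\<^bsub>AutG C x\<^esub> g = ivt g"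
  "arr (ivt g)" "dom (ivt g) = x" "cod (ivt g) = x" "arr g" "dom g = x" "cod g = x" "ob x"
proof -
 have g: "iso g" "dom g = x" "cod g = x" using assms by (auto simp: AutG_carrier)
 thus x: "ob x" "arr g" "dom g = x" "cod g = x" by auto
 interpret G: group "AutG C x" by (rule AutG_group[OF x(1)])
 show "inv\<^bsub>AutG C x\<^esub> g = ivt g" using g by (simp add: ivt_def)
 thus i: "ivt g \<in> Aut x" "g \<cdot> ivt g = ide x" "ivt g \<cdot> g = ide x"
  using G.inv_closed[OF assms] G.r_inv[OF assms] G.l_inv[OF assms] by simp_all
 thus "arr (ivt g)" "dom (ivt g) = x" "cod (ivt g) = x" by (auto simp: AutG_carrier)
qed

section \<open>Quotients, their order and induced automorphisms\<close>

definition qle :: "'m \<Rightarrow> 'm \<Rightarrow> bool" where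
 "qle e e' \<longleftrightarrow> (\<exists>h\<in>Arr C. dom h = cod e \<and> cod h = cod e' \<and> h \<cdot> e = e')"

lemma qle_refl: "arr e ==> qle e e"
 unfolding qle_def by (rule bexI[of _ "ide (cod e)"]) auto

lemma qle_trans:
 assumes "qle a b" "qle b c" "arr a"
 shows "qle a c"
proof -
 obtain h k where "arr h" "dom h = cod a" "cod h = cod b" "h \<cdot> a = b"
  "arr k" "dom k = cod b" "cod k = cod c" "k \<cdot> b = c"
  using assms unfolding qle_def by blast
 thus ?thesis using assms(3) unfolding qle_def by (intro bexI[of _ "k \<cdot> h"]) auto
qed

end

context regular_category
begin

lemma qle_iso:
 assumes "surj e" "surj e'" "qle e e'" "qle e' e"
 obtains h where "iso h" "dom h = cod e" "cod h = cod e'" "h o e = e'"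
proof -
 obtain h k where h: "arr h" "dom h = cod e" "cod h = cod e'" "h o e = e'"
  and k: "arr k" "dom k = cod e'" "cod k = cod e" "k o e' = e"
  using assms(3,4) unfolding qle_def by blast
 have a: "arr e" "arr e'" using assms by auto
 have "k o h = ide (cod e)" by (rule surj_epi[OF assms(1)]) (use h k a in auto)
 moreover have "h o k = ide (cod e')" by (rule surj_epi[OF assms(2)]) (use h k a in auto)
 ultimately show ?thesis using h k by (intro that[of h] isoI[of h k]) auto
qed

lemma quo_class_eq_iff:
 assumes "surj e" "surj e'"
 shows "quo_class e = quo_class e' \<longleftrightarrow> qle e e' \<and> qle e' e"
proof -
 have mem: "f \<in> quo_class e0 \<longleftrightarrow> surj f \<and> qle e0 f \<and> qle f e0" if e0s: "surj e0" for e0 f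
 proof
  assume "f \<in> quo_class e0"
  then obtain h where f: "surj f" and h: "iso h" "dom h = cod e0" "cod h = cod f" "f = h o e0"
   unfolding quo_class_def by auto
  obtain k where k: "arr k" "dom k = cod h" "cod k = dom h" "k o h = ide (dom h)"
   by (rule isoE[OF h(1)])
  have "k o (h o e0) = e0" using reassoc[OF k(4), of e0] h(1-3) k(1-3) e0s by simp
  hence "k o f = e0" unfolding h(4) .
  thus "surj f \<and> qle e0 f \<and> qle f e0"
   using f h k(1-3) unfolding qle_def by (metis iso_arr)
 next
  assume a: "surj f \<and> qle e0 f \<and> qle f e0"
  obtain h where "iso h" "dom h = cod e0" "cod h = cod f" "h o e0 = f"
   using qle_iso[OF e0s, of f] a by blast
  thus "f \<in> quo_class e0" using a unfolding quo_class_def by (auto intro!: bexI[of _ h])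
 qed
 have a: "arr e" "arr e'" using assms by auto
 show ?thesis
 proof
  assume "quo_class e = quo_class e'"
  thus "qle e e' \<and> qle e' e" using mem[OF assms(1), of e'] mem[OF assms(2), of e'] qle_refl[OF a(2)] assms(2) by blast
 next
  assume q: "qle e e' \<and> qle e' e"
  show "quo_class e = quo_class e'"
  proof (rule Set.set_eqI)
   fix f show "f \<in> quo_class e \<longleftrightarrow> f \<in> quo_class e'"
    unfolding mem[OF assms(1)] mem[OF assms(2)] using q qle_trans a surj_arr[of f] by blast
  qed
 qed
qed

lemma quo_class_self: "surj e ==> e \<in> quo_class e"
 unfolding quo_class_def by (auto intro!: bexI[of _ "ide (cod e)"] dest!: surj_arr)

lemma quo_class_in [simp]: "surj e ==> dom e = x ==> quo_class e \<in> Quo x"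
 unfolding Quo_def by auto

lemma quo_map_facts [simp]:
 assumes "Z \<in> Quo x"
 shows "surj (quo_map Z)" "dom (quo_map Z) = x" "quo_class (quo_map Z) = Z" "cod (quo_map Z) = quo_obj Z"
  "arr (quo_map Z)"
proof -
 obtain e where e: "surj e" "dom e = x" "Z = quo_class e" using assms unfolding Quo_def by auto
 have "quo_map Z \<in> Z" unfolding quo_map_def by (rule someI[of _ e]) (use quo_class_self e in auto)
 then obtain h where h: "surj (quo_map Z)" "iso h" "dom h = cod e" "cod h = cod (quo_map Z)" "quo_map Z = h o e"
  unfolding e(3) quo_class_def by auto
 show s: "surj (quo_map Z)" "arr (quo_map Z)" using h by auto
 show "dom (quo_map Z) = x" using h e by auto
 obtain k where k: "arr k" "dom k = cod h" "cod k = dom h" "k o h = ide (dom h)" by (rule isoE[OF h(2)])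
 have "k o (h o e) = e" using reassoc[OF k(4), of e] k(1-3) h(2,3) e(1) by simp
 hence "k o quo_map Z = e" unfolding h(5) .
 hence "qle (quo_map Z) e" using k h unfolding qle_def by (intro bexI[of _ k]) simp_all
 moreover have "qle e (quo_map Z)" using h unfolding qle_def by (intro bexI[of _ h]) simp_all
 ultimately show "quo_class (quo_map Z) = Z" using e quo_class_eq_iff[OF s(1) e(1)] by simp
qed (simp add: quo_obj_def)

lemma quo_obj_Obj [simp]: "Z \<in> Quo x ==> ob (quo_obj Z)"
 using quo_map_facts cod_obj by metis

lemma quo_le_iff:
 assumes "Z \<in> Quo x" "Z' \<in> Quo x"
 shows "quo_le Z Z' \<longleftrightarrow> qle (quo_map Z) (quo_map Z')"
proof
 have mem: "surj f \<and> qle f (quo_map W) \<and> qle (quo_map W) f" if "W \<in> Quo x" "f \<in> W" for W f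
 proof -
  have f: "f \<in> quo_class (quo_map W)" using that by simp
  hence s: "surj f" unfolding quo_class_def by simp
  obtain h where h: "iso h" "dom h = cod (quo_map W)" "cod h = cod f" "f = h o quo_map W"
   using f unfolding quo_class_def by auto
  obtain k where k: "arr k" "dom k = cod h" "cod k = dom h" "k o h = ide (dom h)" by (rule isoE[OF h(1)])
  have "k o (h o quo_map W) = quo_map W" using reassoc[OF k(4), of "quo_map W"] k(1-3) h(1-3) that(1) by simp
  hence "k o f = quo_map W" unfolding h(4) .
  thus ?thesis using s k(1-3) h unfolding qle_def by (metis iso_arr)
 qed
 assume "quo_le Z Z'"
 then obtain e e' h where eh: "e \<in> Z" "e' \<in> Z'" "h \<in> Hom C (cod e) (cod e')" "e' = h o e" unfolding quo_le_def by blast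
 hence e: "e \<in> Z" "e' \<in> Z'" "qle e e'" unfolding qle_def by (auto intro!: bexI[of _ h] simp del: ident_comp')
 thus "qle (quo_map Z) (quo_map Z')" using mem[OF assms(1) e(1)] mem[OF assms(2) e(2)]
  by (meson qle_trans surj_arr quo_map_facts(5)[OF assms(1)])
next
 assume "qle (quo_map Z) (quo_map Z')"
 then obtain h where h: "h \<in> Hom C (cod (quo_map Z)) (cod (quo_map Z'))" "quo_map Z' = h o quo_map Z"
  unfolding qle_def Hom_def mem_Collect_eq by metis
 have "quo_map Z \<in> Z" "quo_map Z' \<in> Z'"
  using quo_class_self[of "quo_map Z"] quo_class_self[of "quo_map Z'"] assms by simp_all
 thus "quo_le Z Z'" unfolding quo_le_def using h by (rule_tac bexI, rule_tac bexI, rule_tac bexI)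
qed

lemma qle_quo_map:
 assumes "surj e" "Z = quo_class e"
 shows "qle (quo_map Z) e" "qle e (quo_map Z)"
 using quo_class_eq_iff[of "quo_map Z" e] quo_map_facts[of Z "dom e"] assms by auto

lemma quo_le_class:
 assumes "surj e" "surj e'" "dom e = dom e'"
 shows "quo_le (quo_class e) (quo_class e') \<longleftrightarrow> qle e e'"
proof -
 have Z: "quo_class e \<in> Quo (dom e)" "quo_class e' \<in> Quo (dom e)" using assms by simp_all
 have a: "arr e" "arr (quo_map (quo_class e))" using assms(1) quo_map_facts(5)[OF Z(1)] by simp_all
 show ?thesis
  unfolding quo_le_iff[OF Z]
  using qle_quo_map[OF assms(1) refl] qle_quo_map[OF assms(2) refl] qle_trans a by blast
qed

lemma quo_le_refl: "Z \<in> Quo x ==> quo_le Z Z"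
 by (simp add: quo_le_iff qle_refl)

lemma quo_le_trans: "[|Z \<in> Quo x; Z' \<in> Quo x; Z'' \<in> Quo x; quo_le Z Z'; quo_le Z' Z''|] ==> quo_le Z Z''"
 using qle_trans[of "quo_map Z" "quo_map Z'" "quo_map Z''"] by (simp add: quo_le_iff)

lemma quo_le_antisym: "[|Z \<in> Quo x; Z' \<in> Quo x; quo_le Z Z'; quo_le Z' Z|] ==> Z = Z'"
 using quo_class_eq_iff[of "quo_map Z" "quo_map Z'"] by (auto simp: quo_le_iff)

lemma quo_act_class:
 assumes "surj e" "dom e = x" "g \<in> Aut x"
 shows "quo_act C x g (quo_class e) = quo_class (e o ivt g)"
proof -
 note i = ivt[OF assms(3)]
 have e: "arr e" using assms by simp
 have gg: "iso g" "iso (ivt g)" using assms(3) i(1) by (auto simp: AutG_carrier)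
 show ?thesis
 proof (intro equalityI subsetI)
  fix f assume "f \<in> quo_act C x g (quo_class e)"
  then obtain h where h: "surj (h o e)" "iso h" "dom h = cod e" "cod h = cod (h o e)" "f = (h o e) o ivt g"
   unfolding quo_act_def i(4) quo_class_def by auto
  have "surj ((h o e) o ivt g)" by (rule surj_comp[OF iso_surj[OF gg(2)] h(1)]) (use h(2,3) e assms(2) i in simp)
  thus "f \<in> quo_class (e o ivt g)"
   unfolding quo_class_def h(5) using h(2,3) e assms(2) i by (auto intro!: bexI[of _ h])
 next
  fix f assume "f \<in> quo_class (e o ivt g)"
  then obtain h where h: "surj f" "iso h" "dom h = cod e" "cod h = cod f" "f = h o (e o ivt g)"
   unfolding quo_class_def using e assms(2) i by auto
  have "surj (h o e)" by (rule surj_comp[OF assms(1) iso_surj[OF h(2)] h(3)])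
  hence "h o e \<in> quo_class e" unfolding quo_class_def using h(2,3) e by (auto intro!: bexI[of _ h])
  moreover have "f = (h o e) o ivt g" using h(2,3,5) e assms(2) i by simp
  ultimately show "f \<in> quo_act C x g (quo_class e)" unfolding quo_act_def i(4) by blast
 qed
qed

text \<open>Fixedness of a quotient expressed on a representative: \<open>g\<close> descends along
  \<open>e\<close> to an automorphism.\<close>

definition stab :: "'m \<Rightarrow> 'm \<Rightarrow> bool" where
 "stab g e \<longleftrightarrow> (\<exists>h. iso h \<and> dom h = cod e \<and> cod h = cod e \<and> h o e = e o g)"

lemma quo_fix_class:
 assumes "surj e" "dom e = x" "g \<in> Aut x"
 shows "quo_class e \<in> Quo_fix x g \<longleftrightarrow> stab g e"
proof -
 note i = ivt[OF assms(3)]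
 have e: "arr e" using assms by simp
 have gg: "iso (ivt g)" using i(1) by (auto simp: AutG_carrier)
 have s: "surj (e o ivt g)" by (rule surj_comp[OF iso_surj[OF gg] assms(1)]) (use assms(2) i in simp)
 have eq: "h o (e o ivt g) = e \<longleftrightarrow> h o e = e o g" if "arr h" "dom h = cod e" for h
 proof
  assume "h o (e o ivt g) = e"
  hence "(h o (e o ivt g)) o g = e o g" by simp
  thus "h o e = e o g" using that e assms(2) i by simp
 next
  assume "h o e = e o g"
  hence "(h o e) o ivt g = (e o g) o ivt g" by simp
  thus "h o (e o ivt g) = e" using that e assms(2) i by simp
 qed
 have "quo_class e \<in> Quo_fix x g \<longleftrightarrow> quo_class (e o ivt g) = quo_class e"
  unfolding Quo_fix_def using quo_act_class[OF assms] assms by simp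
 also have "... \<longleftrightarrow> (\<exists>h. iso h \<and> dom h = cod e \<and> cod h = cod e \<and> h o (e o ivt g) = e)"
 proof
  assume "quo_class (e o ivt g) = quo_class e"
  hence "qle (e o ivt g) e" "qle e (e o ivt g)" unfolding quo_class_eq_iff[OF s assms(1)] by auto
  then obtain h where "iso h" "dom h = cod (e o ivt g)" "cod h = cod e" "h o (e o ivt g) = e"
   using qle_iso[OF s assms(1)] by blast
  thus "\<exists>h. iso h \<and> dom h = cod e \<and> cod h = cod e \<and> h o (e o ivt g) = e" using e assms(2) i by auto
 next
  assume "\<exists>h. iso h \<and> dom h = cod e \<and> cod h = cod e \<and> h o (e o ivt g) = e"
  then obtain h where h: "iso h" "dom h = cod e" "cod h = cod e" "h o (e o ivt g) = e" by blast
  obtain k where k: "arr k" "dom k = cod h" "cod k = dom h" "k o h = ide (dom h)" by (rule isoE[OF h(1)])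
  have ei: "arr (e o ivt g)" "cod (e o ivt g) = cod e" using e assms(2) i by simp_all
  have "k o (h o (e o ivt g)) = ide (dom h) o (e o ivt g)"
   by (rule reassoc[OF k(4)]) (use k(1-3) h(1-3) ei in simp_all)
  hence "k o e = e o ivt g" unfolding h(4) using ei h(2) by simp
  hence "qle e (e o ivt g)" unfolding qle_def using k(1-3) h(2,3) ei by (intro bexI[of _ k]) simp_all
  moreover have "qle (e o ivt g) e" unfolding qle_def using h ei by (intro bexI[of _ h]) simp_all
  ultimately show "quo_class (e o ivt g) = quo_class e" unfolding quo_class_eq_iff[OF s assms(1)] by simp
 qed
 finally show ?thesis unfolding stab_def using eq by auto
qed

lemma Quo_fix_Quo: "Z \<in> Quo_fix x g ==> Z \<in> Quo x"
 by (simp add: Quo_fix_def)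

lemma quo_fix_iff: "Z \<in> Quo x ==> g \<in> Aut x ==> Z \<in> Quo_fix x g \<longleftrightarrow> stab g (quo_map Z)"
 using quo_fix_class[of "quo_map Z" x g] by simp

lemma induced:
 assumes "Z \<in> Quo_fix x g" "g \<in> Aut x"
 shows "induced g Z \<in> Aut (quo_obj Z)" "induced g Z o quo_map Z = quo_map Z o g"
  "\<And>h. arr h ==> dom h = quo_obj Z ==> h o quo_map Z = quo_map Z o g ==> induced g Z = h"
proof -
 have Z: "Z \<in> Quo x" using assms Quo_fix_Quo by simp
 note q = quo_map_facts[OF Z] and i = ivt[OF assms(2)]
 obtain h where h: "iso h" "dom h = quo_obj Z" "cod h = quo_obj Z" "h o quo_map Z = quo_map Z o g"
  using assms quo_fix_iff[OF Z assms(2)] unfolding stab_def by (auto simp: q)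
 have un: "k = h" if k: "arr k" "dom k = quo_obj Z" "k o quo_map Z = quo_map Z o g" for k
 proof (rule surj_epi[OF q(1)])
  have "cod (k o quo_map Z) = cod (quo_map Z o g)" using k(3) by simp
  thus "cod k = cod h" using k(1,2) q(2,4,5) i(8-10) h(3) by simp
 qed (use k h q in simp_all)
 have ind: "induced g Z = h"
  unfolding induced_def by (rule the_equality) (use h un in auto)
 show "induced g Z \<in> Aut (quo_obj Z)" "induced g Z o quo_map Z = quo_map Z o g"
  using h unfolding ind by (auto simp: AutG_carrier)
 show "induced g Z = h'" if "arr h'" "dom h' = quo_obj Z" "h' o quo_map Z = quo_map Z o g" for h'
  using un[OF that] ind by simp
qed

lemma acts_trivially_iff:
 assumes "Z \<in> Quo_fix x g" "g \<in> Aut x"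
 shows "acts_trivially g Z \<longleftrightarrow> quo_map Z o g = quo_map Z"
proof -
 have Z: "Z \<in> Quo x" using assms Quo_fix_Quo by simp
 note q = quo_map_facts[OF Z] and n = induced[OF assms]
 show ?thesis
  unfolding acts_trivially_def using n(2) n(3)[of "ide (quo_obj Z)"] q Z by auto
qed

lemma triv_fix: "[|Z \<in> Quo x; g \<in> Aut x; quo_map Z o g = quo_map Z|] ==> Z \<in> Quo_fix x g"
 unfolding quo_fix_iff stab_def by (intro exI[of _ "ide (quo_obj Z)"]) simp

lemma qle_triv:
 assumes "qle e e'" "e o g = e" "arr e" "arr g" "cod g = dom e"
 shows "e' o g = e'"
proof -
 obtain h where h: "arr h" "dom h = cod e" "cod h = cod e'" "h o e = e'" using assms(1) unfolding qle_def by blast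
 have "(h o e) o g = h o e" using h(1-3) assms(2-5) by simp
 thus ?thesis unfolding h(4) .
qed

text \<open>With \<open>x\<close> as least element the meet is the common refinement, the image of
  \<open>x\<close> in the product of the two quotients. Being functorial, it inherits both stability
  under an automorphism and triviality of its action.\<close>

lemma quo_meet:
 assumes e: "surj e" "surj e'" "dom e = x" "dom e' = x"
 obtains w where "surj w" "dom w = x" "qle w e" "qle w e'"
  "\<And>l. surj l ==> dom l = x ==> qle l e ==> qle l e' ==> qle l w"
  "\<And>g. iso g ==> dom g = x ==> cod g = x ==> stab g e ==> stab g e' ==> stab g w"
  "\<And>g. arr g ==> dom g = x ==> cod g = x ==> e o g = e ==> e' o g = e' ==> w o g = w"
proof -
 have a: "arr e" "arr e'" using e by auto
 have O: "ob (cod e)" "ob (cod e')" using a by auto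
 have "arr (pairing e e')" using a e by simp
 then obtain m w where m: "mono m" "surj w" "dom m = cod w" "m o w = pairing e e'"
  "dom w = dom (pairing e e')" "cod m = cod (pairing e e')" by (rule image_factorization)
 have mw: "arr m" "arr w" "dom w = x" "cod m = prd (cod e) (cod e')" using m a e by simp_all
 have "(pr1 (cod e) (cod e') o m) o w = e" "(pr2 (cod e) (cod e') o m) o w = e'"
  using mw m(3,4) a e O by simp_all
 hence le: "qle w e" "qle w e'"
  unfolding qle_def using mw m(3) O
  by (auto intro: bexI[of _ "pr1 (cod e) (cod e') o m"] bexI[of _ "pr2 (cod e) (cod e') o m"])
 show ?thesis
 proof (rule that[OF m(2) mw(3) le])
  fix l assume l: "surj l" "dom l = x" "qle l e" "qle l e'"
  have la: "arr l" using l by simp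
  obtain h h' where h: "arr h" "dom h = cod l" "cod h = cod e" "h o l = e"
   and h': "arr h'" "dom h' = cod l" "cod h' = cod e'" "h' o l = e'"
   using l(3,4) unfolding qle_def by blast
  have "m o w = pairing h h' o l" using m(4) h h' la by simp
  then obtain d where "arr d" "dom d = cod l" "cod d = dom m" "d o l = w"
   by (rule surj_mono_fill[OF l(1) m(1) mw(2), rotated]) (use h h' mw m(3) l(2) in simp_all)
  thus "qle l w" unfolding qle_def using m(3) by auto
 next
  fix g assume g: "iso g" "dom g = x" "cod g = x" "stab g e" "stab g e'"
  hence ga: "arr g" by simp
  obtain h h' where h: "iso h" "dom h = cod e" "cod h = cod e" "h o e = e o g"
   and h': "iso h'" "dom h' = cod e'" "cod h' = cod e'" "h' o e' = e' o g"
   using g(4,5) unfolding stab_def by blast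
  \<comment> \<open>The product of the two induced automorphisms restricts to the image; the
    restriction is the fill-in \<open>d\<close>.\<close>
  let ?c = "crs h h'"
  have ha: "arr h" "arr h'" using h h' by auto
  have "m o (w o g) = pairing e e' o g" by (rule reassoc[OF m(4)]) (use mw m(3) ga g in simp_all)
  also have "... = ?c o pairing e e'" using a e ga g ha h h' by simp
  finally have eq: "m o (w o g) = (?c o m) o w" using m(3,4) mw ha h(2) h'(2) by simp
  obtain d where d: "arr d" "dom d = cod w" "cod d = dom m" "m o d = ?c o m" "d o w = w o g"
   by (rule surj_mono_fill[OF m(2) m(1) _ _ eq]) (use mw m(3) ga g ha h h' in simp_all)
  have "mono (?c o m)" by (rule mono_comp[OF m(1) crs_mono]) (use h h' mw ha in simp_all)
  hence dm: "mono d" by (intro mono_cancel[of m d]) (use d mw in simp_all)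
  have "surj (w o g)" by (rule surj_comp[OF iso_surj[OF g(1)] m(2)]) (use g mw in simp)
  hence "surj d" by (intro surj_cancel[of d w]) (use d mw in simp_all)
  hence "iso d" by (rule mono_surj_iso[OF dm])
  thus "stab g w" unfolding stab_def using d m(3) by auto
 next
  fix g assume g: "arr g" "dom g = x" "cod g = x" "e o g = e" "e' o g = e'"
  have "m o (w o g) = pairing e e' o g" by (rule reassoc[OF m(4)]) (use mw m(3) g in simp_all)
  also have "... = m o w" using m(4) a e g by simp
  finally show "w o g = w" by (rule monoD[OF m(1)]) (use mw m(3) g in simp_all)
 qed
qed

end

section \<open>The elements \<omega> and finiteness of the quotient lattice\<close>

context tensor_setting
begin

lemma sub_order_poset:
 assumes "ob x"
 shows "finite_poset (sub_order x)" "(y, z) \<in> sub_order x \<longleftrightarrow> y \<in> Sub x \<and> z \<in> Sub x \<and> sub_le y z"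
  "Field (sub_order x) = Sub x"
proof -
 show F: "Field (sub_order x) = Sub x"
  using sub_le_refl by (auto simp: Field_def sub_order_def)
 have "finite (sub_order x)"
  by (rule finite_subset[of _ "Sub x \<times> Sub x"]) (use assms in \<open>auto simp: sub_order_def\<close>)
 moreover have "Partial_order (sub_order x)"
  unfolding partial_order_on_def preorder_on_def F refl_on_def trans_def antisym_def
  unfolding sub_order_def using sub_le_refl sub_le_trans sub_le_antisym by blast
 ultimately show "finite_poset (sub_order x)" by unfold_locales
qed (auto simp: sub_order_def)

lemma omega_obj_eq:
 assumes "ob x"
 shows "omg x = (\<Sum>y\<in>Sub x. of_int (moebius (sub_order x) y (sub_top x)) * \<delta> (to_term (dom (incl y))))"
proof -
 have e: "to_term x o incl y = to_term (dom (incl y))" "surj (to_term (dom (incl y)))" if "y \<in> Sub x" for y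
  using incl_facts[OF that] by simp_all
 hence "{y \<in> Sub x. surj (to_term x o incl y)} = Sub x" by auto
 thus ?thesis
  unfolding omega_obj_def omega_def using assms e(1) by (auto intro: sum.cong)
qed

lemma deg_term_iso:
 assumes "iso h"
 shows "\<delta> (to_term (dom h)) = \<delta> (to_term (cod h))"
 using deg_comp[of "to_term (cod h)" h] deg_iso[OF assms] assms by simp

lemma deg_term_class:
 assumes "mono m"
 shows "\<delta> (to_term (dom (incl (sub_class m)))) = \<delta> (to_term (dom m))"
 using incl_sub_class[OF assms] deg_term_iso by metis

lemma push_sub_class:
 assumes "mono m" "mono k" "cod k = dom m"
 shows "push_sub m (sub_class k) = sub_class (m o k)"
proof -
 obtain h where h: "iso h" "dom h = dom k" "cod h = dom (incl (sub_class k))" "incl (sub_class k) o h = k"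
  by (rule incl_sub_class[OF assms(2)])
 have S: "sub_class k \<in> Sub (dom m)" using assms by simp
 note p = push_sub_mono(1)[OF assms(1) S] and i = incl_facts[OF S]
 have "sub_class ((m o incl (sub_class k)) o h) = sub_class (m o incl (sub_class k))"
  using sub_class_iso[OF p h(1)] h(3) i assms by simp
 moreover have "(m o incl (sub_class k)) o h = m o (incl (sub_class k) o h)"
  by (rule comp_assoc'[OF iso_arr[OF h(1)] i(4) mono_arr[OF assms(1)] h(3)[symmetric]]) (simp only: i(2))
 ultimately show ?thesis unfolding push_sub_def h(4) by simp
qed

text \<open>The subobjects of \<open>dom m\<close> form the interval below
  \<open>sub_class m\<close>, and the Moebius function depends only on intervals; thus the \<omega>
  of all subobjects of \<open>x\<close> are expressed in the one poset
  \<open>sub_order x\<close>.\<close>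

lemma omega_push:
 assumes m: "mono m" "cod m = x"
 shows "omg (dom m) = (\<Sum>w\<in>{w. (w, sub_class m) \<in> sub_order x}.
  of_int (moebius (sub_order x) w (sub_class m)) * \<delta> (to_term (dom (incl w))))"
proof -
 let ?y = "dom m"
 have ma: "arr m" using m by simp
 have O: "ob ?y" "ob x" using ma m(2) by auto
 interpret finite_poset "sub_order x" by (rule sub_order_poset(1)[OF O(2)])
 note so = sub_order_poset(2)[OF O(2)] and so' = sub_order_poset(2)[OF O(1)]
 have top: "push_sub m (sub_top ?y) = sub_class m"
  unfolding sub_top_def using push_sub_class[OF m(1), of "ide ?y"] ma O by simp
 have im: "c \<in> push_sub m ` Sub ?y" if c: "(c, sub_class m) \<in> sub_order x" for c
 proof -
  have cS: "c \<in> Sub x" "sub_le c (sub_class m)" using c so by auto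
  note ic = incl_facts[OF cS(1)]
  have "factors_through (incl c) m"
   using cS ic(1) m sub_le_class[of "incl c" m] ic by simp
  then obtain k where k: "arr k" "dom k = dom (incl c)" "cod k = ?y" "m o k = incl c"
   by (rule factors_throughE)
  have km: "mono k" by (rule mono_cancel[of m k]) (use k ic ma in auto)
  have "c = push_sub m (sub_class k)" using push_sub_class[OF m(1) km k(3)] k(4) ic by simp
  thus ?thesis using km k(3) by simp
 qed
 have eq: "{w. (w, sub_class m) \<in> sub_order x} = push_sub m ` Sub ?y"
 proof (intro equalityI subsetI)
  fix w assume "w \<in> push_sub m ` Sub ?y"
  then obtain T where T: "T \<in> Sub ?y" "w = push_sub m T" by auto
  have "sub_le (push_sub m T) (push_sub m (sub_top ?y))"
   using push_sub_le[OF m(1) T(1), of "sub_top ?y"] T sub_le_top O by simp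
  thus "w \<in> {w. (w, sub_class m) \<in> sub_order x}"
   unfolding top so mem_Collect_eq T(2) using push_sub_mono(2)[OF m(1) T(1)] m by simp
 qed (use im in auto)
 have mu: "moebius (sub_order ?y) T (sub_top ?y) = moebius (sub_order x) (push_sub m T) (sub_class m)"
  if T: "T \<in> Sub ?y" for T
 proof (subst top[symmetric], rule moebius_transport[OF sub_order_poset(1)[OF O(1)], where S = "Sub ?y"])
  fix a b assume "a \<in> Sub ?y" "b \<in> Sub ?y"
  thus "(a, b) \<in> sub_order ?y \<longleftrightarrow> (push_sub m a, push_sub m b) \<in> sub_order x"
   unfolding so so' using push_sub_le[OF m(1)] push_sub_mono(2)[OF m(1)] m(2) by auto
 next
  fix a b c assume b: "b \<in> Sub ?y" and "(push_sub m a, c) \<in> sub_order x" "(c, push_sub m b) \<in> sub_order x"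
  moreover have "(push_sub m b, sub_class m) \<in> sub_order x" using b eq by auto
  ultimately show "c \<in> push_sub m ` Sub ?y" using im le_trans by blast
 qed (use push_sub_inj[OF m(1)] sub_order_poset(3)[OF O(1)] T O in auto)
 have d: "\<delta> (to_term (dom (incl (push_sub m T)))) = \<delta> (to_term (dom (incl T)))" if T: "T \<in> Sub ?y" for T
  using deg_term_class[OF push_sub_mono(1)[OF m(1) T]] incl_facts[OF T] ma unfolding push_sub_def by simp
 show ?thesis
  unfolding eq sum.reindex[OF push_sub_inj[OF m(1)]] omega_obj_eq[OF O(1)] by (simp add: mu d)
qed

lemma omega_iso:
 assumes "isomorphic a b"
 shows "omg a = omg b"
proof -
 obtain h where h: "iso h" "dom h = a" "cod h = b" using assms by (auto simp: isomorphic_iff)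
 have O: "ob b" using h by auto
 have t: "sub_class h = sub_top b" using sub_class_top_iff[of h b] h by simp
 have "{w. (w, sub_top b) \<in> sub_order b} = Sub b"
  using sub_order_poset(2)[OF O] sub_le_top O by auto
 thus ?thesis using omega_push[of h b] h t omega_obj_eq[OF O] by simp
qed

text \<open>Moebius inversion of the definition of \<omega>: the degree of a subobject is the sum of
  \<omega> over everything it contains. Applied to an equalizer, it turns a trace into a sum over
  subobjects.\<close>

lemma omega_sum:
 assumes m: "mono m" "cod m = x"
 shows "(\<Sum>y\<in>{y \<in> Sub x. factors_through (incl y) m}. omg (dom (incl y))) = \<delta> (to_term (dom m))"
proof -
 have O: "ob x" using m by auto
 interpret finite_poset "sub_order x" by (rule sub_order_poset(1)[OF O])
 let ?o = "sub_order x" and ?m = "sub_class m"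
 let ?d = "\<lambda>w. \<delta> (to_term (dom (incl w)))"
 have mS: "(?m, ?m) \<in> ?o" using m sub_le_refl[OF sub_class_in[OF m]] O by (simp add: sub_order_poset(2))
 have e: "{y \<in> Sub x. factors_through (incl y) m} = {y. (y, ?m) \<in> ?o}"
 proof (intro Collect_cong)
  fix y show "(y \<in> Sub x \<and> factors_through (incl y) m) = ((y, ?m) \<in> ?o)"
   using sub_le_class[of "incl y" m] incl_facts[of y x] m unfolding sub_order_poset(2)[OF O] by auto
 qed
 have "(\<Sum>y\<in>{y. (y, ?m) \<in> ?o}. omg (dom (incl y))) =
  (\<Sum>y\<in>{y. (y, ?m) \<in> ?o}. \<Sum>w\<in>{w. (w, y) \<in> ?o}. of_int (moebius ?o w y) * ?d w)"
 proof (rule sum.cong[OF refl])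
  fix y assume "y \<in> {y. (y, ?m) \<in> ?o}"
  hence "y \<in> Sub x" using sub_order_poset(2)[OF O] by auto
  thus "omg (dom (incl y)) = (\<Sum>w\<in>{w. (w, y) \<in> ?o}. of_int (moebius ?o w y) * ?d w)"
   using omega_push[of "incl y" x] incl_facts[of y x] by simp
 qed
 also have "... = (\<Sum>w\<in>{w. (w, ?m) \<in> ?o}. \<Sum>y\<in>seg w ?m. of_int (moebius ?o w y) * ?d w)"
  by (subst (1 2) sum.Sigma, simp, simp, simp, simp, rule sum.reindex_bij_witness[of _ "\<lambda>(x, y). (y, x)" "\<lambda>(x, y). (y, x)"])
   (auto simp: seg_def intro: le_trans)
 also have "... = (\<Sum>w\<in>{w. (w, ?m) \<in> ?o}. of_int (\<Sum>y\<in>seg w ?m. moebius ?o w y) * ?d w)"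
  by (simp add: sum_distrib_right)
 also have "... = (\<Sum>w\<in>{w. (w, ?m) \<in> ?o}. if w = ?m then ?d w else 0)"
  by (rule sum.cong[OF refl]) (subst moebius_sum_left, auto)
 also have "... = ?d ?m" using mS by simp
 also have "... = \<delta> (to_term (dom m))" by (rule deg_term_class[OF m(1)])
 finally show ?thesis unfolding e .
qed

text \<open>For finiteness of the quotient lattice, kernel pairs are compared on the finitely many
  subobjects of \<open>prd x x\<close> only. A pair of generalized elements may be replaced by the
  image of its pairing, since the surjection onto the image is epi.\<close>

lemma kernel_qle:
 assumes e: "surj e" "surj e'" "dom e = x" "dom e' = x"
  and K: "\<And>r. r \<in> Sub (prd x x) ==> e o (pr1 x x o incl r) = e o (pr2 x x o incl r) ==>
   e' o (pr1 x x o incl r) = e' o (pr2 x x o incl r)"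
 shows "qle e e'"
proof -
 have a: "arr e" "arr e'" using e by auto
 have O: "ob x" using a e by auto
 obtain h where "arr h" "dom h = cod e" "cod h = cod e'" "h o e = e'"
 proof (rule surj_factor[OF e(1) a(2)])
  fix f g assume fg: "arr f" "arr g" "dom f = dom g" "cod f = dom e" "cod g = dom e" "e o f = e o g"
  let ?p = "pairing f g"
  let ?r = "image_sub ?p" and ?w = "image_surj ?p"
  have p: "arr ?p" "cod ?p = prd x x" using fg e by simp_all
  have r: "?r \<in> Sub (prd x x)" using image_sub_in[OF p] .
  note w = image_surj_facts[OF p(1)] and ir = incl_facts[OF r]
  let ?a = "pr1 x x o incl ?r" and ?b = "pr2 x x o incl ?r"
  have ab: "?a o ?w = f" "?b o ?w = g" using w(1-4) ir O fg e by simp_all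
  have "e o ?a = e o ?b"
  proof (rule surj_epi[OF w(5)])
   have "e o (?a o ?w) = e o (?b o ?w)" unfolding ab by (rule fg)
   thus "(e o ?a) o ?w = (e o ?b) o ?w" using w(1-3) ir O a e by simp
  qed (use w(1-3) ir O a e in simp_all)
  hence "(e' o ?a) o ?w = (e' o ?b) o ?w" using K[OF r] by simp
  hence "e' o (?a o ?w) = e' o (?b o ?w)" using w(1-3) ir O a e by simp
  thus "e' o f = e' o g" unfolding ab .
 qed (use e in simp)
 thus ?thesis unfolding qle_def by blast
qed

lemma finite_Quo [simp]:
 assumes "ob x"
 shows "finite (Quo x)"
proof -
 let ?K = "\<lambda>Z. {r \<in> Sub (prd x x). quo_map Z o (pr1 x x o incl r) = quo_map Z o (pr2 x x o incl r)}"
 have "inj_on ?K (Quo x)"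
 proof (rule inj_onI)
  fix Z W assume ZW: "Z \<in> Quo x" "W \<in> Quo x" "?K Z = ?K W"
  have "qle (quo_map Z) (quo_map W)" "qle (quo_map W) (quo_map Z)"
   using ZW by (auto intro!: kernel_qle[where x = x])
  thus "Z = W" using quo_class_eq_iff[of "quo_map Z" "quo_map W"] ZW by simp
 qed
 thus ?thesis by (rule inj_on_finite[of ?K _ "Pow (Sub (prd x x))"]) (use assms in auto)
qed

lemma quo_bot_facts:
 assumes "g \<in> Aut x"
 shows "quo_bot x \<in> Quo_fix x g" "\<And>Z. Z \<in> Quo x ==> quo_le (quo_bot x) Z" "iso (quo_map (quo_bot x))"
  "acts_trivially g (quo_bot x) \<longleftrightarrow> g = ide x"
proof -
 note i = ivt[OF assms]
 have s: "surj (ide x)" "dom (ide x) = x" using i by simp_all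
 have gi: "iso g" using assms by (simp add: AutG_carrier)
 show f: "quo_bot x \<in> Quo_fix x g"
  unfolding quo_bot_def quo_fix_class[OF s assms] stab_def using gi i by (auto intro!: exI[of _ g])
 have b: "quo_bot x \<in> Quo x" using Quo_fix_Quo[OF f] .
 show iso: "iso (quo_map (quo_bot x))"
  using quo_class_eq_iff[of "quo_map (quo_bot x)" "ide x"] quo_map_facts[OF b] s qle_iso[of "ide x" "quo_map (quo_bot x)"]
  unfolding quo_bot_def by (metis comp_ident' iso_arr ident_arr(3) i(11))
 show "quo_le (quo_bot x) Z" if "Z \<in> Quo x" for Z
  using quo_le_class[OF s(1), of "quo_map Z"] quo_map_facts[OF that] i
  unfolding quo_bot_def qle_def by (auto intro!: bexI[of _ "quo_map Z"])
 show "acts_trivially g (quo_bot x) \<longleftrightarrow> g = ide x"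
  unfolding acts_trivially_iff[OF f assms]
 proof
  assume "quo_map (quo_bot x) o g = quo_map (quo_bot x)"
  hence "quo_map (quo_bot x) o g = quo_map (quo_bot x) o ide x" using quo_map_facts[OF b] by simp
  thus "g = ide x"
   by (rule monoD[OF iso_mono[OF iso]]) (use quo_map_facts(2)[OF b] i(8-11) in simp_all)
 qed (use quo_map_facts[OF b] in simp)
qed

lemma quo_top_facts:
 assumes "g \<in> Aut x"
 shows "quo_class (to_term x) \<in> Quo_fix x g" "\<And>Z. Z \<in> Quo x ==> quo_le Z (quo_class (to_term x))"
  "acts_trivially g (quo_class (to_term x))"
proof -
 note i = ivt[OF assms]
 have s: "surj (to_term x)" "dom (to_term x) = x" using i by simp_all
 have Z: "quo_class (to_term x) \<in> Quo x" using s by simp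
 have tr: "quo_map (quo_class (to_term x)) o g = quo_map (quo_class (to_term x))"
  by (rule qle_triv[OF qle_quo_map(2)[OF s(1) refl]]) (use s i in simp_all)
 show f: "quo_class (to_term x) \<in> Quo_fix x g" by (rule triv_fix[OF Z assms tr])
 show "acts_trivially g (quo_class (to_term x))" unfolding acts_trivially_iff[OF f assms] by (rule tr)
 show "quo_le W (quo_class (to_term x))" if "W \<in> Quo x" for W
  using quo_le_class[of "quo_map W" "to_term x"] quo_map_facts[OF that] s that to_term_arr[OF i(11)]
  unfolding qle_def by (auto intro!: bexI[of _ "to_term (quo_obj W)"])
qed

lemma quo_poset:
 assumes g: "g \<in> Aut x"
 shows "finite_meet_poset (Quo_fix_order x g)" "Field (Quo_fix_order x g) = Quo_fix x g"
  "(Z, W) \<in> Quo_fix_order x g \<longleftrightarrow> Z \<in> Quo_fix x g \<and> W \<in> Quo_fix x g \<and> quo_le Z W"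
proof -
 let ?r = "Quo_fix_order x g"
 have O: "ob x" using ivt[OF g] by simp
 have fin: "finite (Quo_fix x g)" using finite_Quo[OF O] by (simp add: Quo_fix_def)
 have r: "(Z, W) \<in> ?r \<longleftrightarrow> Z \<in> Quo_fix x g \<and> W \<in> Quo_fix x g \<and> quo_le Z W" for Z W
  by (auto simp: Quo_fix_order_def)
 thus "(Z, W) \<in> ?r \<longleftrightarrow> Z \<in> Quo_fix x g \<and> W \<in> Quo_fix x g \<and> quo_le Z W" .
 show F: "Field ?r = Quo_fix x g"
  using quo_le_refl Quo_fix_Quo unfolding Field_def Quo_fix_order_def by blast
 have "finite ?r" by (rule finite_subset[of _ "Quo_fix x g \<times> Quo_fix x g"]) (use fin in \<open>auto simp: r\<close>)
 moreover have "Partial_order ?r"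
  unfolding partial_order_on_def preorder_on_def F refl_on_def trans_def antisym_def
  unfolding r using quo_le_refl quo_le_trans quo_le_antisym Quo_fix_Quo
  by (intro conjI; (unfold Quo_fix_order_def, blast)?) metis+
 ultimately interpret finite_poset ?r by unfold_locales
 show "finite_meet_poset ?r"
 proof
  fix a b assume ab: "a \<in> Field ?r" "b \<in> Field ?r"
  hence f: "a \<in> Quo_fix x g" "b \<in> Quo_fix x g" unfolding F by auto
  hence q: "a \<in> Quo x" "b \<in> Quo x" using Quo_fix_Quo by auto
  note qa = quo_map_facts[OF q(1)] and qb = quo_map_facts[OF q(2)]
  obtain w where w: "surj w" "dom w = x" "qle w (quo_map a)" "qle w (quo_map b)"
   "\<And>l. surj l ==> dom l = x ==> qle l (quo_map a) ==> qle l (quo_map b) ==> qle l w"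
   "\<And>g. iso g ==> dom g = x ==> cod g = x ==> stab g (quo_map a) ==> stab g (quo_map b) ==> stab g w"
   using quo_meet[OF qa(1) qb(1) qa(2) qb(2)] by metis
  have wf: "quo_class w \<in> Quo_fix x g"
   using quo_fix_class[OF w(1,2) g] w(6)[of g] g quo_fix_iff[OF _ g] f q by (auto simp: AutG_carrier)
  have "(l, quo_class w) \<in> ?r" if l: "(l, a) \<in> ?r" "(l, b) \<in> ?r" for l
  proof -
   have lq: "l \<in> Quo x" using l r Quo_fix_Quo by blast
   note ql = quo_map_facts[OF lq]
   have "qle (quo_map l) (quo_map a)" "qle (quo_map l) (quo_map b)" using l r quo_le_iff lq q by auto
   hence "quo_le l (quo_class w)"
    using w(5)[OF ql(1,2)] quo_le_class[OF ql(1) w(1)] ql w(2) by simp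
   thus ?thesis using l wf unfolding r by simp
  qed
  moreover have "(quo_class w, a) \<in> ?r" "(quo_class w, b) \<in> ?r"
   using quo_le_class[OF w(1) qa(1)] quo_le_class[OF w(1) qb(1)] w qa qb wf f unfolding r by simp_all
  ultimately show "\<exists>m. (m, a) \<in> ?r \<and> (m, b) \<in> ?r \<and> (\<forall>l. (l, a) \<in> ?r \<and> (l, b) \<in> ?r \<longrightarrow> (l, m) \<in> ?r)" by blast
 qed
qed

end

section \<open>The candidate character \<open>phi\<close>\<close>

context tensor_setting
begin

definition fixw :: "'m \<Rightarrow> 'm set \<Rightarrow> 'k" where
 "fixw g Z = (if quo_map Z o g = quo_map Z then omg (quo_obj Z) else 0)"

text \<open>Since \<open>g\<close> acts trivially on \<open>z\<close> iff \<open>x\<^sub>g \<le> z\<close>, and since \<open>\<mu>(x, z) = 0\<close> unless \<open>z\<close> is below the join of the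
 atoms, \<open>phi x g\<close> is the value of the class function of the theorem at \<open>g\<close>.\<close>

definition phi :: "'o \<Rightarrow> 'm \<Rightarrow> 'k" where
 "phi x g = (\<Sum>Z\<in>Quo_fix x g. of_int (moebius (Quo_fix_order x g) (quo_bot x) Z) * fixw g Z)"

lemma fixw_class:
 assumes "surj w" "dom w = x" "g \<in> Aut x"
 shows "fixw g (quo_class w) = (if w o g = w then omg (cod w) else 0)"
proof -
 have q: "quo_class w \<in> Quo x" using assms by simp
 note m = quo_map_facts[OF q] and l = qle_quo_map[OF assms(1) refl] and g = ivt(8-11)[OF assms(3)]
 have "quo_map (quo_class w) o g = quo_map (quo_class w) \<longleftrightarrow> w o g = w"
  using qle_triv[OF l(1), of g] qle_triv[OF l(2), of g] m(2,5) assms(1,2) g by auto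
 moreover obtain h where "iso h" "dom h = cod (quo_map (quo_class w))" "cod h = cod w"
  using qle_iso[OF m(1) assms(1) l] by blast
 hence "isomorphic (quo_obj (quo_class w)) (cod w)" using m(4) unfolding isomorphic_iff by auto
 ultimately show ?thesis using omega_iso unfolding fixw_def by simp
qed

text \<open>Composition with \<open>e\<close> identifies the \<open>h\<close>-fixed quotients of
  \<open>z\<close> with the \<open>g\<close>-fixed quotients of \<open>y\<close> above the class of
  \<open>e\<close>, as a convex part of the order. So the values of \<open>phi\<close> at all
  quotients of \<open>y\<close> are sums in one poset and can be added.\<close>

lemma phi_quo:
 assumes e: "surj e" "dom e = y" "cod e = z"
  and g: "g \<in> Aut y" and h: "h \<in> Aut z" and eq: "h o e = e o g"
 shows "phi z h = (\<Sum>W\<in>{W \<in> Quo_fix y g. quo_le (quo_class e) W}.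
  of_int (moebius (Quo_fix_order y g) (quo_class e) W) * fixw g W)"
proof -
 let ?f = "\<lambda>Z. quo_class (quo_map Z o e)"
 let ?S = "Quo_fix z h"
 have ea: "arr e" using e by simp
 note ig = ivt(8-11)[OF g] and ih = ivt(8-11)[OF h]
 interpret P: finite_meet_poset "Quo_fix_order y g" by (rule quo_poset(1)[OF g])
 have s: "surj (k o e)" "dom (k o e) = y" "arr k" "cod (k o e) = cod k" if "surj k" "dom k = z" for k
  using surj_comp[OF e(1) that(1)] that e ea by simp_all
 have fe: "f o e = f' o e \<longleftrightarrow> f = f'" if "arr f" "arr f'" "dom f = z" "dom f' = z" "cod f = cod f'" for f f'
  using surj_epi[OF e(1), of f f'] that e(3) by auto
 have sw: "(k o h) o e = (k o e) o g" if "arr k" "dom k = z" for k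
  using that ih ig e ea eq by simp
 have le: "qle (k o e) (k' o e) \<longleftrightarrow> qle k k'" if k: "surj k" "surj k'" "dom k = z" "dom k' = z" for k k'
 proof -
  have "j o (k o e) = k' o e \<longleftrightarrow> j o k = k'" if "arr j" "dom j = cod k" "cod j = cod k'" for j
   using fe[of "j o k" k'] that k s[OF k(1,3)] s[OF k(2,4)] e ea by simp
  thus ?thesis unfolding qle_def using s[OF k(1,3)] s[OF k(2,4)] by auto
 qed
 have fc: "?f (quo_class k) = quo_class (k o e)" if k: "surj k" "dom k = z" for k
 proof -
  have q: "quo_class k \<in> Quo z" using k by simp
  note m = quo_map_facts[OF q]
  show ?thesis
   unfolding quo_class_eq_iff[OF s(1)[OF m(1,2)] s(1)[OF k]] using le[OF m(1) k(1) m(2) k(2)] le[OF k(1) m(1) k(2) m(2)]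
    qle_quo_map[OF k(1) refl] by simp
 qed
 have st: "stab g (k o e) \<longleftrightarrow> stab h k" if k: "surj k" "dom k = z" for k
 proof -
  have "j o (k o e) = (k o e) o g \<longleftrightarrow> j o k = k o h" if "arr j" "dom j = cod k" "cod j = cod k" for j
   using fe[of "j o k" "k o h"] that sw[of k] s[OF k] k e ea ih by simp
  thus ?thesis unfolding stab_def using s[OF k] by auto
 qed
 have fS: "?f Z \<in> Quo_fix y g" if Z: "Z \<in> ?S" for Z
 proof -
  note m = quo_map_facts[OF Quo_fix_Quo[OF Z]]
  show ?thesis using quo_fix_class[OF s(1,2)[OF m(1,2)] g] st[OF m(1,2)] quo_fix_iff[OF Quo_fix_Quo[OF Z] h] Z by simp
 qed
 have fle: "quo_le (?f Z) (?f Z') \<longleftrightarrow> quo_le Z Z'" if Z: "Z \<in> ?S" "Z' \<in> ?S" for Z Z'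
 proof -
  note m = quo_map_facts[OF Quo_fix_Quo[OF Z(1)]] and m' = quo_map_facts[OF Quo_fix_Quo[OF Z(2)]]
  show ?thesis
   using quo_le_class[OF s(1)[OF m(1,2)] s(1)[OF m'(1,2)]] s(2)[OF m(1,2)] s(2)[OF m'(1,2)] le[OF m(1) m'(1) m(2) m'(2)]
    quo_le_iff[OF Quo_fix_Quo[OF Z(1)] Quo_fix_Quo[OF Z(2)]] by simp
 qed
 have inj: "inj_on ?f ?S"
  by (rule inj_onI, rule quo_le_antisym[of _ z]) (use fle fS Quo_fix_Quo quo_le_refl in metis)+
 have bot: "?f (quo_bot z) = quo_class e"
  unfolding quo_bot_def by (subst fc) (use ih e ea in simp_all)
 have im: "W \<in> ?f ` ?S" if W: "W \<in> Quo_fix y g" "quo_le (quo_class e) W" for W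
 proof -
  note m = quo_map_facts[OF Quo_fix_Quo[OF W(1)]]
  have "qle e (quo_map W)" using W(2) quo_le_class[OF e(1) m(1)] m e by simp
  then obtain k where k: "arr k" "dom k = z" "cod k = cod (quo_map W)" "k o e = quo_map W"
   unfolding qle_def using e by blast
  have ks: "surj k" by (rule surj_cancel[of k e]) (use k m e ea in simp_all)
  have "stab g (k o e)" using quo_fix_iff[OF Quo_fix_Quo[OF W(1)] g] W k(4) by simp
  hence "quo_class k \<in> ?S" using quo_fix_class[OF ks k(2) h] st[OF ks k(2)] by simp
  moreover have "?f (quo_class k) = W" using fc[OF ks k(2)] k(4) m by simp
  ultimately show ?thesis by (metis imageI)
 qed
 have img: "{W \<in> Quo_fix y g. quo_le (quo_class e) W} = ?f ` ?S"
 proof (intro equalityI subsetI)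
  fix W assume "W \<in> ?f ` ?S"
  then obtain Z where Z: "Z \<in> ?S" "W = ?f Z" by auto
  have "quo_le (?f (quo_bot z)) (?f Z)"
   using fle[OF quo_bot_facts(1)[OF h] Z(1)] quo_bot_facts(2)[OF h Quo_fix_Quo[OF Z(1)]] by simp
  thus "W \<in> {W \<in> Quo_fix y g. quo_le (quo_class e) W}" using Z fS unfolding bot by simp
 qed (use im in auto)
 have mu: "moebius (Quo_fix_order z h) (quo_bot z) Z = moebius (Quo_fix_order y g) (quo_class e) (?f Z)"
  if Z: "Z \<in> ?S" for Z
 proof (subst bot[symmetric], rule P.moebius_transport[where S = ?S])
  show "finite_poset (Quo_fix_order z h)" using quo_poset(1)[OF h] by (simp add: finite_meet_poset_def)
  fix a b c assume ab: "a \<in> ?S" "b \<in> ?S"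
  thus "(a, b) \<in> Quo_fix_order z h \<longleftrightarrow> (?f a, ?f b) \<in> Quo_fix_order y g"
   unfolding quo_poset(3)[OF g] quo_poset(3)[OF h] using fS fle by simp
  assume c: "(?f a, c) \<in> Quo_fix_order y g" "(c, ?f b) \<in> Quo_fix_order y g"
  have "?f a \<in> {W \<in> Quo_fix y g. quo_le (quo_class e) W}" using ab img by blast
  hence "c \<in> {W \<in> Quo_fix y g. quo_le (quo_class e) W}"
   using c quo_le_trans[of "quo_class e" y "?f a" c] e Quo_fix_Quo[of _ y g] unfolding quo_poset(3)[OF g] by simp
  thus "c \<in> ?f ` ?S" using img by blast
 qed (use inj quo_poset(2)[OF h] Z quo_bot_facts(1)[OF h] in auto)
 have F: "fixw g (?f Z) = fixw h Z" if Z: "Z \<in> ?S" for Z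
 proof -
  note m = quo_map_facts[OF Quo_fix_Quo[OF Z]]
  have "(quo_map Z o e) o g = quo_map Z o e \<longleftrightarrow> quo_map Z o h = quo_map Z"
   using fe[of "quo_map Z o h" "quo_map Z"] sw[of "quo_map Z"] m ih by simp
  thus ?thesis using fixw_class[OF s(1,2)[OF m(1,2)] g] s(4)[OF m(1,2)] m(4) unfolding fixw_def[of h] by simp
 qed
 show ?thesis unfolding img sum.reindex[OF inj] phi_def by (rule sum.cong[OF refl]) (simp add: mu F)
qed

text \<open>The system of equations that determines \<open>phi\<close>. Each value is a sum over the
  quotients above a given one, so exchanging the sums leaves, by Moebius inversion, the weight
  \<open>fixw\<close> of the bottom quotient.\<close>

lemma phi_sum:
 assumes g: "g \<in> Aut y"
 shows "(\<Sum>Z\<in>Quo_fix y g. phi (quo_obj Z) (induced g Z)) = (if g = ide y then omg y else 0)"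
proof -
 let ?r = "Quo_fix_order y g" and ?b = "quo_bot y"
 interpret P: finite_meet_poset ?r by (rule quo_poset(1)[OF g])
 note r = quo_poset(3)[OF g] and b = quo_bot_facts[OF g]
 have fin: "finite (Quo_fix y g)" using finite_Quo ivt(11)[OF g] by (simp add: Quo_fix_def)
 have "(\<Sum>Z\<in>Quo_fix y g. phi (quo_obj Z) (induced g Z)) =
  (\<Sum>Z\<in>Quo_fix y g. \<Sum>W\<in>{W \<in> Quo_fix y g. quo_le Z W}. of_int (moebius ?r Z W) * fixw g W)"
 proof (rule sum.cong[OF refl])
  fix Z assume Z: "Z \<in> Quo_fix y g"
  note m = quo_map_facts[OF Quo_fix_Quo[OF Z]]
  show "phi (quo_obj Z) (induced g Z) = (\<Sum>W\<in>{W \<in> Quo_fix y g. quo_le Z W}. of_int (moebius ?r Z W) * fixw g W)"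
   using phi_quo[OF m(1,2,4) g induced(1,2)[OF Z g]] m(3) by simp
 qed
 also have "... = (\<Sum>W\<in>Quo_fix y g. \<Sum>Z\<in>P.seg ?b W. of_int (moebius ?r Z W) * fixw g W)"
  by (subst (1 2) sum.Sigma, simp add: fin, simp add: fin, simp add: fin, simp,
    rule sum.reindex_bij_witness[of _ "\<lambda>(x, y). (y, x)" "\<lambda>(x, y). (y, x)"])
   (auto simp: P.seg_def r b(1,2) Quo_fix_Quo)
 also have "... = (\<Sum>W\<in>Quo_fix y g. of_int (\<Sum>Z\<in>P.seg ?b W. moebius ?r Z W) * fixw g W)"
  by (simp add: sum_distrib_right)
 also have "... = (\<Sum>W\<in>Quo_fix y g. if ?b = W then fixw g W else 0)"
  by (rule sum.cong[OF refl], subst P.moebius_sum_right) (auto simp: r b Quo_fix_Quo)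
 also have "... = fixw g ?b" using b(1) fin by simp
 also have "... = (if g = ide y then omg y else 0)"
  unfolding quo_bot_def using fixw_class[of "ide y" y g] ivt(8-11)[OF g] g by simp
 finally show ?thesis .
qed

text \<open>An automorphism and its inverse stabilize the same quotients and act trivially on the
  same ones. This reconciles the pairing of the theorem, which has \<chi>(g), with orthogonality,
  which has \<chi> at the inverse.\<close>

lemma phi_inv:
 assumes "g \<in> Aut x"
 shows "phi x (ivt g) = phi x g"
proof -
 note i = ivt[OF assms]
 have st: "stab (ivt g) e" if s: "stab g e" and e: "arr e" "dom e = x" and gk: "g \<in> Aut x" for e g
 proof -
  note i = ivt[OF gk]
  obtain h where h: "iso h" "dom h = cod e" "cod h = cod e" "h o e = e o g" using s unfolding stab_def by blast
  obtain k where k: "arr k" "dom k = cod e" "cod k = cod e" "k o h = ide (cod e)" "iso k"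
   using isoE[OF h(1)] h(2,3) by metis
  have "k o (h o (e o ivt g)) = e o ivt g" using reassoc[OF k(4), of "e o ivt g"] h(1-3) k(1-3) e i by simp
  moreover have "h o (e o ivt g) = e" using reassoc[OF h(4), of "ivt g"] h(1-3) e i by simp
  ultimately have "k o e = e o ivt g" by simp
  thus ?thesis unfolding stab_def using k by blast
 qed
 have ii: "ivt (ivt g) = g"
  using group.inv_inv[OF AutG_group[OF i(11)] assms] i(4) ivt(4)[OF i(1)] by simp
 have Q: "Quo_fix x (ivt g) = Quo_fix x g"
 proof (intro equalityI subsetI)
  fix Z assume Z: "Z \<in> Quo_fix x (ivt g)"
  thus "Z \<in> Quo_fix x g" using st[of "ivt g" "quo_map Z"] ii quo_fix_iff[of Z x] assms i(1) Quo_fix_Quo[OF Z] quo_map_facts[OF Quo_fix_Quo[OF Z]] by simp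
 next
  fix Z assume Z: "Z \<in> Quo_fix x g"
  thus "Z \<in> Quo_fix x (ivt g)" using st[of g "quo_map Z"] quo_fix_iff[of Z x] assms i(1) Quo_fix_Quo[OF Z] quo_map_facts[OF Quo_fix_Quo[OF Z]] by simp
 qed
 have F: "fixw (ivt g) Z = fixw g Z" if Z: "Z \<in> Quo_fix x g" for Z
 proof -
  note m = quo_map_facts[OF Quo_fix_Quo[OF Z]]
  have "(quo_map Z o g) o ivt g = quo_map Z" "(quo_map Z o ivt g) o g = quo_map Z" using m i by simp_all
  hence "quo_map Z o g = quo_map Z \<longleftrightarrow> quo_map Z o ivt g = quo_map Z" by metis
  thus ?thesis unfolding fixw_def by simp
 qed
 show ?thesis unfolding phi_def Quo_fix_order_def Q by (rule sum.cong[OF refl]) (simp add: F)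
qed

lemma phi_chi:
 assumes g: "g \<in> Aut x"
 shows "chi_x0 C \<delta> x g = phi x g"
proof -
 let ?r = "Quo_fix_order x g" and ?b = "quo_bot x" and ?T = "quo_class (to_term x)"
 interpret P: finite_meet_poset ?r by (rule quo_poset(1)[OF g])
 note r = quo_poset(3)[OF g] and F = quo_poset(2)[OF g] and b = quo_bot_facts[OF g] and t = quo_top_facts[OF g]
 have O: "ob x" using ivt[OF g] by simp
 have fin: "finite (Quo_fix x g)" using finite_Quo[OF O] by (simp add: Quo_fix_def)
 let ?A = "{Z \<in> Quo_fix x g. acts_trivially g Z}"
 \<comment> \<open>The meet of all quotients with trivial action, a nonempty set because it contains
   the terminal quotient. It will turn out to be \<open>quo_triv C x g\<close>.\<close>
 obtain m where m: "\<forall>s\<in>?A. (m, s) \<in> ?r" "\<forall>l. (\<forall>s\<in>?A. (l, s) \<in> ?r) \<longrightarrow> (l, m) \<in> ?r"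
  using P.meet_set[of ?A] fin t F by auto
 have tm: "acts_trivially g m"
 proof -
  \<comment> \<open>Triviality of the action passes to meets of two, so by induction every finite
    nonempty subfamily of \<open>?A\<close> has a lower bound within \<open>?A\<close>; for the
    whole family this is \<open>m\<close>.\<close>
  have "\<exists>m\<in>?A. \<forall>s\<in>B. (m, s) \<in> ?r" if B: "finite B" "B \<noteq> {}" "B \<subseteq> ?A" for B
   using B
  proof (induction B rule: finite_ne_induct)
   case (singleton z)
   hence "(z, z) \<in> ?r" using quo_le_refl Quo_fix_Quo[of z x g] unfolding r by blast
   thus ?case using singleton by blast
  next
   case (insert z B)
   then obtain w where w: "w \<in> ?A" "\<forall>s\<in>B. (w, s) \<in> ?r" by auto
   have z: "z \<in> ?A" using insert by auto
   have q: "w \<in> Quo x" "z \<in> Quo x" using w z Quo_fix_Quo by auto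
   note qw = quo_map_facts[OF q(1)] and qz = quo_map_facts[OF q(2)]
   have triv: "quo_map w o g = quo_map w" "quo_map z o g = quo_map z" using w z acts_trivially_iff[OF _ g] by auto
   obtain v where v: "surj v" "dom v = x" "qle v (quo_map w)" "qle v (quo_map z)" "v o g = v"
    using quo_meet[OF qw(1) qz(1) qw(2) qz(2)] triv ivt(8-10)[OF g] by metis
   have vq: "quo_class v \<in> Quo x" using v by simp
   have vt: "quo_map (quo_class v) o g = quo_map (quo_class v)"
    by (rule qle_triv[OF qle_quo_map(2)[OF v(1) refl]]) (use v ivt(8-11)[OF g] in simp_all)
   have vA: "quo_class v \<in> ?A" using triv_fix[OF vq g vt] acts_trivially_iff[OF _ g] vt by auto
   moreover have "(quo_class v, w) \<in> ?r" "(quo_class v, z) \<in> ?r"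
    using quo_le_class[OF v(1) qw(1)] quo_le_class[OF v(1) qz(1)] v qw qz w(1) z vA unfolding r by simp_all
   ultimately show ?case using w(2) P.le_trans by blast
  qed
  from this[of ?A] obtain n where n: "n \<in> ?A" "\<forall>s\<in>?A. (n, s) \<in> ?r" using fin t by auto
  hence "n = m" using m P.le_antisym by blast
  thus ?thesis using n by simp
 qed
 have mF: "m \<in> Quo_fix x g" using m(1) t r by blast
 have trv: "quo_triv C x g = m"
  unfolding quo_triv_def
 proof (rule the_equality)
  show "m \<in> Quo_fix x g \<and> acts_trivially g m \<and> (\<forall>z'\<in>Quo_fix x g. acts_trivially g z' \<longrightarrow> quo_le m z')"
   using mF tm m(1) r by blast
  fix z assume "z \<in> Quo_fix x g \<and> acts_trivially g z \<and> (\<forall>z'\<in>Quo_fix x g. acts_trivially g z' \<longrightarrow> quo_le z z')"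
  thus "z = m" using mF tm m(1) r P.le_antisym by blast
 qed
 have triv: "acts_trivially g Z \<longleftrightarrow> quo_le m Z" if Z: "Z \<in> Quo_fix x g" for Z
 proof
  assume "quo_le m Z"
  hence "qle (quo_map m) (quo_map Z)" using quo_le_iff Quo_fix_Quo[OF mF] Quo_fix_Quo[OF Z] by simp
  thus "acts_trivially g Z"
   unfolding acts_trivially_iff[OF Z g]
   by (rule qle_triv) (use acts_trivially_iff[OF mF g] tm quo_map_facts[OF Quo_fix_Quo[OF mF]] ivt(8-11)[OF g] in simp_all)
 qed (use m(1) Z r in blast)
 let ?B = "{Z \<in> Quo_fix x g. \<forall>a\<in>quo_atoms C x g. quo_le a Z}"
 have at: "a \<in> Quo_fix x g" if "a \<in> quo_atoms C x g" for a using that by (simp add: quo_atoms_def)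
 have TB: "?T \<in> ?B" using t(1,2) at Quo_fix_Quo by blast
 \<comment> \<open>Only meets have been constructed, so the join of the atoms is obtained as the
   meet of their upper bounds; the terminal quotient is one of these.\<close>
 obtain j where j: "\<forall>s\<in>?B. (j, s) \<in> ?r" "\<forall>l. (\<forall>s\<in>?B. (l, s) \<in> ?r) \<longrightarrow> (l, j) \<in> ?r"
  using P.meet_set[of ?B] fin TB F by auto
 have jF: "j \<in> Quo_fix x g" using j(1) TB r by blast
 have jB: "j \<in> ?B" using jF j(2) at r by blast
 have hat: "quo_hat C x g = j"
  unfolding quo_hat_def
 proof (rule the_equality)
  show "j \<in> Quo_fix x g \<and> (\<forall>a\<in>quo_atoms C x g. quo_le a j) \<and>
   (\<forall>z'\<in>Quo_fix x g. (\<forall>a\<in>quo_atoms C x g. quo_le a z') \<longrightarrow> quo_le j z')"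
   using jB j(1) r by blast
  fix z assume "z \<in> Quo_fix x g \<and> (\<forall>a\<in>quo_atoms C x g. quo_le a z) \<and>
   (\<forall>z'\<in>Quo_fix x g. (\<forall>a\<in>quo_atoms C x g. quo_le a z') \<longrightarrow> quo_le z z')"
  thus "z = j" using jB j(1) r P.le_antisym by blast
 qed
 \<comment> \<open>If \<open>Z\<close> is not below the join \<open>j\<close> of the atoms, then the
   meet of \<open>Z\<close> and \<open>j\<close> is a proper lower bound of \<open>Z\<close> that
   dominates all atoms below \<open>Z\<close>.\<close>
 have mu0: "moebius ?r ?b Z = 0" if Z: "Z \<in> Quo_fix x g" "\<not> quo_le Z j" for Z
 proof -
  obtain w where w: "(w, Z) \<in> ?r" "(w, j) \<in> ?r" "\<forall>l. (l, Z) \<in> ?r \<and> (l, j) \<in> ?r \<longrightarrow> (l, w) \<in> ?r"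
   using P.meet[of Z j] Z(1) jF F by blast
  show ?thesis
  proof (rule P.moebius_not_atomic[OF _ w(1)])
   show "w \<noteq> Z" using w(2) Z(2) r by blast
   show "(?b, a) \<in> ?r" if "a \<in> Field ?r" for a using that b(1,2) F Quo_fix_Quo r by blast
   fix a assume a: "(a, Z) \<in> ?r" "a \<noteq> ?b" "\<And>c. (c, a) \<in> ?r ==> c = ?b \<or> c = a"
   hence "a \<in> quo_atoms C x g" unfolding quo_atoms_def using r by blast
   thus "(a, w) \<in> ?r" using w(3) a(1) jB r by blast
  qed
 qed
 have "phi x g = (\<Sum>Z\<in>{Z \<in> Quo_fix x g. quo_le m Z \<and> quo_le Z j}. of_int (moebius ?r ?b Z) * fixw g Z)"
  unfolding phi_def
  by (rule sum.mono_neutral_right[OF fin]) (use mu0 triv acts_trivially_iff[OF _ g] in \<open>auto simp: fixw_def\<close>)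
 also have "... = chi_x0 C \<delta> x g"
  unfolding chi_x0_def trv hat by (rule sum.cong[OF refl]) (use triv acts_trivially_iff[OF _ g] in \<open>auto simp: fixw_def\<close>)
 finally show ?thesis by simp
qed

end

section \<open>A second trace on the endomorphisms of \<open>[x]\<close>\<close>

context malcev_setting
begin

text \<open>A morphism is determined by its graph, one of finitely many subobjects of the
  product.\<close>

lemma finite_Hom:
 assumes "ob x" "ob y"
 shows "finite (Hom C x y)"
proof (rule inj_on_finite)
 show "inj_on (graph) (Hom C x y)"
 proof (rule inj_onI)
  fix f g assume fg: "f \<in> Hom C x y" "g \<in> Hom C x y" "graph f = graph g"
  hence a: "arr f" "dom f = x" "cod f = y" "arr g" "dom g = x" "cod g = y" by auto
  have m: "mono (pairing (ide x) f)" "mono (pairing (ide x) g)"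
   using a assms by (auto intro!: pairing_mono_left)
  have "factors_through (pairing (ide x) f) (pairing (ide x) g)"
   using fg(3) sub_class_eq_iff[OF m] a unfolding graph_def by simp
  then obtain k where k: "arr k" "dom k = x" "cod k = x" "pairing (ide x) g o k = pairing (ide x) f"
   using a assms by (auto elim!: factors_throughE)
  hence "pairing k (g o k) = pairing (ide x) f" using a assms by simp
  hence "k = ide x" "g o k = f" using pairing_eq_iff[of k "g o k" "ide x" f] a assms k by auto
  thus "f = g" using a by simp
 qed
 show "graph ` Hom C x y \<subseteq> Sub (prd x y)"
  using assms by (auto simp: graph_def intro!: sub_class_in pairing_mono_left)
qed (use assms in simp)

lemma finite_Aut [simp]: "ob x ==> finite (Aut x)"
 by (rule finite_subset[OF _ finite_Hom[of x x]]) (auto simp: AutG_def)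

lemma cf_comp_right:
 assumes "c \<in> hom w y" "b \<in> hom y z"
 shows "cf (b oo c) t = (\<Sum>r\<in>Sub (prd w y). cf c r * cf (b oo basis w y r) t)"
proof -
 have O: "ob w" "ob y" using assms by (auto simp: T0_Hom)
 have "cf (b oo basis w y r) t = (\<Sum>s\<in>Sub (prd y z). cf b s * comp_coeff w y z r s t)" if r: "r \<in> Sub (prd w y)" for r
 proof -
  have "cf (b oo basis w y r) t = (\<Sum>r'\<in>Sub (prd w y). if r' = r then \<Sum>s\<in>Sub (prd y z). cf b s * comp_coeff w y z r s t else 0)"
   unfolding T0_Comp[OF basis_Hom[OF O r] assms(2)] cf_simps by (rule sum.cong[OF refl]) simp
  thus ?thesis using r O by simp
 qed
 thus ?thesis unfolding T0_Comp[OF assms] by (simp add: sum_distrib_left mult.assoc)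
qed

lemma cf_comp_left:
 assumes "c \<in> hom w y" "b \<in> hom y z"
 shows "cf (b oo c) t = (\<Sum>s\<in>Sub (prd y z). cf b s * cf (basis y z s oo c) t)"
proof -
 have O: "ob y" "ob z" using assms by (auto simp: T0_Hom)
 have "cf (basis y z s oo c) t = (\<Sum>r\<in>Sub (prd w y). cf c r * comp_coeff w y z r s t)" if s: "s \<in> Sub (prd y z)" for s
 proof -
  have "cf (basis y z s oo c) t = (\<Sum>r\<in>Sub (prd w y). \<Sum>s'\<in>Sub (prd y z). if s' = s then cf c r * comp_coeff w y z r s t else 0)"
   unfolding T0_Comp[OF assms(1) basis_Hom[OF O s]] cf_simps by (intro sum.cong[OF refl]) simp
  thus ?thesis using s O by simp
 qed
 thus ?thesis unfolding T0_Comp[OF assms] cf_simps by (subst sum.swap) (simp add: sum_distrib_left mult_ac)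
qed

lemma Q_Sub: "m \<in> Q z x ==> m \<in> Sub (prd z x)"
 by (simp add: Q_def)

text \<open>By \<open>Q_comp\<close>, the relations outside \<open>Q\<close> span a subspace that
  composition with \<open>b\<close> preserves: they contribute nothing to coefficients on
  \<open>Q\<close>.\<close>

lemma ent_support:
 assumes b: "b \<in> hom x x'" and r: "r \<in> Sub (prd z x)" "ob z" and t: "t \<in> Q z x'" "cf (b oo basis z x r) t \<noteq> 0"
 shows "r \<in> Q z x"
proof -
 have O: "ob x" "ob x'" using b by (auto simp: T0_Hom)
 have "cf (b oo basis z x r) t = (\<Sum>s\<in>Sub (prd x x'). cf b s * cf (basis x x' s oo basis z x r) t)"
  by (rule cf_comp_left[OF basis_Hom[OF r(2) O(1) r(1)] b])
 then obtain s where s: "s \<in> Sub (prd x x')" "cf (basis x x' s oo basis z x r) t \<noteq> 0"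
  using t(2) by (metis (no_types, lifting) mult_eq_0_iff sum.neutral)
 hence "rel_comp z x x' r s = t"
  unfolding comp_basis[OF r(1) s(1) r(2) O] by (auto simp: T0_simps split: if_splits)
 thus ?thesis using Q_comp[OF r(1) s(1) r(2) O] t(1) by simp
qed

text \<open>Hence the matrices of coefficients between \<open>Q z x\<close> and
  \<open>Q z x'\<close> multiply like the morphisms, as on a quotient representation.\<close>

lemma ent_comp:
 assumes a: "a \<in> hom x x'" and b: "b \<in> hom x' x''" and m: "m \<in> Sub (prd z x)" "ob z" and t: "t \<in> Q z x''"
 shows "cf ((b oo a) oo basis z x m) t = (\<Sum>m'\<in>Q z x'. cf (b oo basis z x' m') t * cf (a oo basis z x m) m')"
proof -
 have O: "ob x" "ob x'" using a by (auto simp: T0_Hom)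
 note mh = basis_Hom[OF m(2) O(1) m(1)]
 have "cf ((b oo a) oo basis z x m) t = cf (b oo (a oo basis z x m)) t" using T0_assoc[OF mh a b] by simp
 also have "... = (\<Sum>r\<in>Sub (prd z x'). cf (a oo basis z x m) r * cf (b oo basis z x' r) t)"
  by (rule cf_comp_right[OF T0_comp_Hom[OF mh a] b])
 also have "... = (\<Sum>m'\<in>Q z x'. cf (a oo basis z x m) m' * cf (b oo basis z x' m') t)"
  by (rule sum.mono_neutral_right) (use O m(2) ent_support[OF b _ m(2) t] Q_Sub in auto)
 finally show ?thesis by (simp add: mult.commute)
qed

section \<open>The action of automorphisms on relations and the functional
  \<open>theta\<close>\<close>

lemma legs_class:
 assumes "mono (pairing f g)" "arr f" "arr g" "dom f = dom g" "cod f = x" "cod g = y"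
 obtains i where "iso i" "dom i = dom g" "cod i = dom (incl (sub_class (pairing f g)))"
  "l1 x y (sub_class (pairing f g)) o i = f" "l2 x y (sub_class (pairing f g)) o i = g"
proof -
 let ?r = "sub_class (pairing f g)"
 have O: "ob x" "ob y" using assms by auto
 have r: "?r \<in> Sub (prd x y)" using assms by simp
 note l = leg_arr[OF r O]
 obtain i where i: "iso i" "dom i = dom (pairing f g)" "cod i = dom (incl ?r)" "incl ?r o i = pairing f g"
  by (rule incl_sub_class[OF assms(1)])
 have "pairing (l1 x y ?r) (l2 x y ?r) o i = pairing f g" using i(4) l(7) by simp
 hence "pairing (l1 x y ?r o i) (l2 x y ?r o i) = pairing f g" using i(1-3) l(1-6) by simp
 hence "l1 x y ?r o i = f \<and> l2 x y ?r o i = g"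
  by (subst (asm) pairing_eq_iff) (use i(1-3) l(1-6) assms in simp_all)
 thus ?thesis using i(1-3) assms that[of i] by simp
qed

lemma class_Q:
 assumes "surj f" "mono g" "dom f = dom g" "cod f = z" "cod g = x"
 shows "sub_class (pairing f g) \<in> Q z x" "mono (pairing f g)"
proof -
 let ?r = "sub_class (pairing f g)"
 have a: "arr f" "arr g" using assms by auto
 have O: "ob z" "ob x" using a assms by auto
 show m: "mono (pairing f g)" by (rule pairing_mono_right) (use assms a in auto)
 have r: "?r \<in> Sub (prd z x)" using m assms a by simp
 note l = leg_arr[OF r O]
 obtain i where i: "iso i" "dom i = dom g" "cod i = dom (incl ?r)" "l1 z x ?r o i = f" "l2 z x ?r o i = g"
  using legs_class[OF m a assms(3-5)] by blast
 have "surj (l1 z x ?r)" by (rule surj_cancel[of _ i]) (use i l assms in simp_all)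
 moreover obtain j where j: "arr j" "dom j = cod i" "cod j = dom i" "i o j = ide (cod i)" "iso j"
  by (rule isoE[OF i(1)])
 have "l2 z x ?r o (i o j) = g o j" by (rule reassoc[OF i(5)]) (use i(1-3) j(1-3) l in simp_all)
 hence "g o j = l2 z x ?r" unfolding j(4) using i(3) l by simp
 hence "mono (l2 z x ?r)" using mono_comp[OF iso_mono[OF j(5)] assms(2)] j i by simp
 ultimately show "?r \<in> Q z x" using r by (simp add: Q_def)
qed

text \<open>Precomposition with the graph of \<open>h\<close>; the inverse appears because this
  pulls the first leg back along \<open>h\<close>.\<close>

definition act :: "'o \<Rightarrow> 'o \<Rightarrow> 'm set \<Rightarrow> 'm \<Rightarrow> 'm set" where
 "act z x r h = sub_class (pairing (ivt h o l1 z x r) (l2 z x r))"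

lemma br_comp:
 "arr f ==> arr g ==> dom g = cod f ==> br g oo br f = br (g o f)"
 unfolding br_sp[of f] by (subst sp_comp_graph) (auto simp: br_sp)

lemma act_class:
 assumes "mono (pairing f g)" "arr f" "arr g" "dom f = dom g" "cod f = z" "cod g = x"
  and h: "h \<in> Aut z"
 shows "act z x (sub_class (pairing f g)) h = sub_class (pairing (ivt h o f) g)"
  "mono (pairing (ivt h o f) g)"
proof -
 let ?r = "sub_class (pairing f g)"
 note k = ivt[OF h]
 have O: "ob z" "ob x" using assms by auto
 have r: "?r \<in> Sub (prd z x)" using assms by simp
 note l = leg_arr[OF r O]
 have ki: "iso (ivt h)" using k(1) by (simp add: AutG_carrier)
 have mono: "mono (pairing (ivt h o a) b)" if m: "mono (pairing a b)" "arr a" "arr b" "dom a = dom b" "cod a = z" "cod b = x" for a b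
 proof -
  have "mono (crs (ivt h) (ide x) o pairing a b)"
   by (rule mono_comp[OF m(1) crs_mono]) (use ki k O m in simp_all)
  moreover have "crs (ivt h) (ide x) o pairing a b = pairing (ivt h o a) b" using m k O by simp
  ultimately show ?thesis by simp
 qed
 show M: "mono (pairing (ivt h o f) g)" by (rule mono) (use assms in simp_all)
 obtain i where i: "iso i" "dom i = dom g" "cod i = dom (incl ?r)" "l1 z x ?r o i = f" "l2 z x ?r o i = g"
  using legs_class[OF assms(1-6)] by blast
 have "mono (pairing (l1 z x ?r) (l2 z x ?r))" unfolding l(7) using incl_facts[OF r] by simp
 hence M': "mono (pairing (ivt h o l1 z x ?r) (l2 z x ?r))" by (rule mono) (use l in simp_all)
 have "pairing (ivt h o l1 z x ?r) (l2 z x ?r) o i = pairing (ivt h o f) g"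
  using i(1-3) k l by (simp add: i(4,5))
 thus "act z x ?r h = sub_class (pairing (ivt h o f) g)"
  using sub_class_iso[OF M' i(1)] i(3) k l unfolding act_def by simp
qed

lemma act_basis:
 assumes r: "r \<in> Sub (prd z x)" and O: "ob x" and h: "h \<in> Aut z"
 shows "act z x r h \<in> Sub (prd z x)" "basis z x r oo br h = basis z x (act z x r h)"
proof -
 note k = ivt[OF h] and l = leg_arr[OF r ivt(11)[OF h] O]
 have hi: "iso h" using h by (simp add: AutG_carrier)
 have m: "mono (pairing (l1 z x r) (l2 z x r))" unfolding l(7) using incl_facts[OF r] by simp
 have M: "mono (pairing (ivt h o l1 z x r) (l2 z x r))" by (rule act_class(2)[OF m _ _ _ _ _ h]) (use l in auto)
 show "act z x r h \<in> Sub (prd z x)" unfolding act_def using M l k by simp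
 have "basis z x r oo br h = sp (ivt h o l1 z x r) (l2 z x r)"
  unfolding basis_legs[OF r k(11) O] by (rule sp_precomp_graph) (use l k hi in simp_all)
 also have "... = basis z x (act z x r h)" unfolding act_def sp_mono[OF M] using l k by simp
 finally show "basis z x r oo br h = basis z x (act z x r h)" .
qed

lemma basis_inj: "basis z x r = (basis z x s :: ('o, 'm, 'k) rel_arr) ==> r = s"
proof -
 assume "basis z x r = (basis z x s :: ('o, 'm, 'k) rel_arr)"
 hence "cf (basis z x r) r = cf (basis z x s) r" by (simp only:)
 thus ?thesis by (simp split: if_splits)
qed

lemma act_inj:
 assumes O: "ob x" and h: "h \<in> Aut z"
 shows "inj_on (\<lambda>r. act z x r h) (Sub (prd z x))"
proof (rule inj_onI)
 fix r s assume rs: "r \<in> Sub (prd z x)" "s \<in> Sub (prd z x)" "act z x r h = act z x s h"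
 note k = ivt[OF h]
 have b: "br h \<in> hom z z" "br (ivt h) \<in> hom z z" using k by (auto intro: br_Hom)
 have "(basis z x t oo br h) oo br (ivt h) = basis z x t" if t: "t \<in> Sub (prd z x)" for t
  using T0_assoc[OF b(2,1) basis_Hom[OF k(11) O t]] br_comp[of "ivt h" h] k T0_ident[OF basis_Hom[OF k(11) O t]] by simp
 thus "r = s" using rs act_basis(2)[OF _ O h] basis_inj by metis
qed

text \<open>Precomposition with an automorphism permutes the basis, so coefficients move along with
  it.\<close>

lemma act_cf:
 assumes c: "c \<in> hom z x" and r: "r \<in> Sub (prd z x)" and h: "h \<in> Aut z"
 shows "cf (c oo br h) (act z x r h) = cf c r"
proof -
 note k = ivt[OF h]
 have O: "ob x" using c by (auto simp: T0_Hom)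
 have b: "br h \<in> hom z z" using k by (auto intro: br_Hom)
 have "cf (c oo br h) (act z x r h) = (\<Sum>s\<in>Sub (prd z x). cf c s * cf (basis z x s oo br h) (act z x r h))"
  by (rule cf_comp_left[OF b c])
 also have "... = (\<Sum>s\<in>Sub (prd z x). if s = r then cf c s else 0)"
  by (rule sum.cong[OF refl]) (use act_basis(2)[OF _ O h] inj_on_eq_iff[OF act_inj[OF O h] r] in auto)
 also have "... = cf c r" using r O k by simp
 finally show ?thesis .
qed

lemma act_Q:
 assumes O: "ob x" and h: "h \<in> Aut z"
 shows "bij_betw (\<lambda>m. act z x m h) (Q z x) (Q z x)"
proof -
 note k = ivt[OF h]
 have "act z x m h \<in> Q z x" if m: "m \<in> Q z x" for m
 proof -
  note l = leg_arr[OF Q_Sub[OF m] k(11) O]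
  have m': "surj (l1 z x m)" "mono (l2 z x m)" using m by (auto simp: Q_def)
  have ki: "surj (ivt h)" using k(1) by (simp add: AutG_carrier)
  show ?thesis
   unfolding act_def by (rule class_Q(1)) (use surj_comp[OF m'(1) ki] m' l k in simp_all)
 qed
 moreover have "inj_on (\<lambda>m. act z x m h) (Q z x)"
  using inj_on_subset[OF act_inj[OF O h]] Q_Sub by blast
 moreover have "finite (Q z x)"
  by (rule finite_subset[of _ "Sub (prd z x)"]) (use Q_Sub O k in auto)
 ultimately show ?thesis unfolding bij_betw_def by (metis endo_inj_surj image_subsetI)
qed

text \<open>Instead of applying the inverse of \<open>h\<close> after \<open>a\<close>, the
  coefficient is read at the \<open>h\<close>-translate of \<open>m\<close>; by
  \<open>act_cf\<close> this is the same number.\<close>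

definition theta :: "'o \<Rightarrow> ('o, 'm, 'k) rel_arr \<Rightarrow> 'm \<Rightarrow> 'k" where
 "theta z a h = (\<Sum>m\<in>Q z (fst a). cf (a oo basis z (fst a) m) (act z (fst a) m h))"

lemma theta_lin:
 assumes "a \<in> hom x x" "b \<in> hom x x" "ob z"
 shows "theta z (pls a b) h = theta z a h + theta z b h" "theta z (scl k a) h = k * theta z a h"
proof -
 have O: "ob x" "fst a = x" "fst b = x" using assms by (auto simp: T0_Hom)
 have "cf (pls a b oo basis z x m) t = cf (a oo basis z x m) t + cf (b oo basis z x m) t"
  "cf (scl k a oo basis z x m) t = k * cf (a oo basis z x m) t" if "m \<in> Q z x" for m t
  using T0_comp_plus_left[OF basis_Hom[OF assms(3) O(1) Q_Sub[OF that]] assms(1,2)]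
   T0_comp_scale_left[OF basis_Hom[OF assms(3) O(1) Q_Sub[OF that]] assms(1)] by (simp_all add: T0_simps)
 thus "theta z (pls a b) h = theta z a h + theta z b h" "theta z (scl k a) h = k * theta z a h"
  unfolding theta_def using O by (simp_all add: T0_simps(6,7) sum.distrib sum_distrib_left)
qed

text \<open>The trace of a product of matrices. The twist is harmless since the action of
  \<open>h\<close> commutes with composition on the other side and permutes
  \<open>Q\<close>.\<close>

lemma theta_cyclic:
 assumes a: "a \<in> hom x x'" and b: "b \<in> hom x' x" and h: "h \<in> Aut z"
 shows "theta z (b oo a) h = theta z (a oo b) h"
proof -
 note k = ivt[OF h]
 have O: "ob x" "ob x'" using a by (auto simp: T0_Hom)
 have f: "fst (b oo a) = x" "fst (a oo b) = x'"
  using T0_comp_Hom[OF a b] T0_comp_Hom[OF b a] by (auto simp: T0_Hom)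
 have brh: "br h \<in> hom z z" using k by (auto intro: br_Hom)
 note bij = act_Q[OF O(1) h] and bij' = act_Q[OF O(2) h]
 have eq: "cf (a oo basis z x (act z x m h)) (act z x' m' h) = cf (a oo basis z x m) m'"
  if m: "m \<in> Q z x" "m' \<in> Q z x'" for m m'
 proof -
  note mh = basis_Hom[OF k(11) O(1) Q_Sub[OF m(1)]]
  have "a oo basis z x (act z x m h) = (a oo basis z x m) oo br h"
   unfolding act_basis(2)[OF Q_Sub[OF m(1)] O(1) h, symmetric] by (rule T0_assoc[OF brh mh a])
  thus ?thesis using act_cf[OF T0_comp_Hom[OF mh a] Q_Sub[OF m(2)] h] by simp
 qed
 have "theta z (b oo a) h = (\<Sum>m\<in>Q z x. \<Sum>m'\<in>Q z x'. cf (b oo basis z x' m') (act z x m h) * cf (a oo basis z x m) m')"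
  unfolding theta_def f
  by (rule sum.cong[OF refl], rule ent_comp[OF a b Q_Sub k(11)]) (use bij in \<open>auto simp: bij_betw_def\<close>)
 also have "... = (\<Sum>m'\<in>Q z x'. \<Sum>m\<in>Q z x. cf (a oo basis z x (act z x m h)) (act z x' m' h) * cf (b oo basis z x' m') (act z x m h))"
  by (subst sum.swap) (intro sum.cong refl, simp add: eq mult.commute)
 also have "... = (\<Sum>m'\<in>Q z x'. \<Sum>m\<in>Q z x. cf (a oo basis z x m) (act z x' m' h) * cf (b oo basis z x' m') m)"
  by (rule sum.cong[OF refl], rule sum.reindex_bij_betw[OF bij])
 also have "... = theta z (a oo b) h"
  unfolding theta_def f
  by (rule sum.cong[OF refl], rule ent_comp[OF b a Q_Sub k(11), symmetric]) (use bij' in \<open>auto simp: bij_betw_def\<close>)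
 finally show ?thesis .
qed

definition Srj :: "'o \<Rightarrow> 'o \<Rightarrow> 'm set" where
 "Srj y z = {e. surj e \<and> dom e = y \<and> cod e = z}"

lemma finite_Srj [simp]: "ob y ==> ob z ==> finite (Srj y z)"
 by (rule finite_subset[OF _ finite_Hom[of y z]]) (auto simp: Srj_def)

text \<open>Reads a member of \<open>Q\<close> as a subobject with a surjection onto
  \<open>z\<close>, so that \<open>theta\<close> becomes a sum that can be ordered by
  subobjects.\<close>

lemma Q_bij:
 assumes O: "ob x" "ob z"
 shows "bij_betw (\<lambda>(y, e). sub_class (pairing e (incl y))) (SIGMA y:Sub x. Srj (dom (incl y)) z) (Q z x)"
proof (rule bij_betw_imageI)
 let ?P = "SIGMA y:Sub x. Srj (dom (incl y)) z" and ?f = "\<lambda>(y, e). sub_class (pairing e (incl y))"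
 have q: "sub_class (pairing e (incl y)) \<in> Q z x" "mono (pairing e (incl y))" if "(y, e) \<in> ?P" for y e
  using class_Q[of e "incl y" z x] that incl_facts[of y x] by (auto simp: Srj_def)
 show "inj_on ?f ?P"
 proof (rule inj_onI, clarify)
  fix y e y' e' assume p: "y \<in> Sub x" "e \<in> Srj (dom (incl y)) z" "y' \<in> Sub x" "e' \<in> Srj (dom (incl y')) z"
   "sub_class (pairing e (incl y)) = sub_class (pairing e' (incl y'))"
  note i = incl_facts[OF p(1)] and i' = incl_facts[OF p(3)]
  have e: "arr e" "dom e = dom (incl y)" "cod e = z" "arr e'" "dom e' = dom (incl y')" "cod e' = z"
   using p(2,4) by (auto simp: Srj_def)
  have m: "mono (pairing e (incl y))" "mono (pairing e' (incl y'))" using q p by auto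
  then obtain k where k: "iso k" "dom k = dom (pairing e (incl y))" "cod k = dom (pairing e' (incl y'))"
   "pairing e' (incl y') o k = pairing e (incl y)"
   using mono_factor_iso p(5) sub_class_eq_iff[OF m] by metis
  have kd: "arr k" "dom k = dom (incl y)" "cod k = dom (incl y')" using k(1-3) e i i' by simp_all
  have "pairing (e' o k) (incl y' o k) = pairing e (incl y)" using k(4) kd e i' by simp
  hence ek: "e' o k = e" "incl y' o k = incl y"
   by (subst (asm) pairing_eq_iff; use kd e i i' in simp)+
  have "sub_class (incl y' o k) = sub_class (incl y')" using sub_class_iso[OF i'(1) k(1)] kd by simp
  hence y: "y = y'" unfolding ek(2) using i i' by simp
  have "k = ide (dom (incl y))" by (rule monoD[OF i(1)]) (use ek(2) y kd i in simp_all)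
  thus "y = y' \<and> e = e'" using ek(1) y e by simp
 qed
 show "?f ` ?P = Q z x"
 proof (intro equalityI subsetI)
  fix m assume m: "m \<in> Q z x"
  hence s: "surj (l1 z x m)" "mono (l2 z x m)" by (auto simp: Q_def)
  note l = leg_arr[OF Q_Sub[OF m] O(2,1)]
  define y where "y = sub_class (l2 z x m)"
  have y: "y \<in> Sub x" using s l by (simp add: y_def)
  note i = incl_facts[OF y]
  obtain h where h: "iso h" "dom h = dom (l2 z x m)" "cod h = dom (incl y)" "incl y o h = l2 z x m"
   by (rule incl_sub_class[OF s(2), folded y_def])
  obtain k where k: "arr k" "dom k = cod h" "cod k = dom h" "h o k = ide (cod h)" "iso k" "k o h = ide (dom h)"
   using isoE[OF h(1)] by metis
  have e: "surj (l1 z x m o k)" by (rule surj_comp[OF iso_surj[OF k(5)] s(1)]) (use k h l in simp)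
  have p: "(y, l1 z x m o k) \<in> ?P" using y e k h l by (simp add: Srj_def)
  have "(l1 z x m o k) o h = l1 z x m" using k(1-3,6) h(1-3) l by simp
  hence "pairing (l1 z x m o k) (incl y) o h = incl m" using h k(1-3) l i by simp
  hence "sub_class (pairing (l1 z x m o k) (incl y)) = m"
   using sub_class_iso[OF q(2)[OF p] h(1)] h(2,3) k(1-3) l i incl_facts[OF Q_Sub[OF m]] by simp
  hence "?f (y, l1 z x m o k) = m" by simp
  thus "m \<in> ?f ` ?P" using p by (metis imageI)
 qed (use q in auto)
qed

text \<open>[g] carries the presentation (y, e) to the one with inclusion \<open>g o incl y\<close>
  and the same \<open>e\<close>. This is the \<open>h\<close>-translate of (y, e) exactly if
  \<open>g\<close> restricts to an automorphism of y that induces \<open>h\<close> on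
  \<open>z\<close>.\<close>

lemma theta_br:
 assumes g: "g \<in> Aut x" and h: "h \<in> Aut z"
 shows "theta z (br g) h = (\<Sum>y\<in>Sub x. \<Sum>e\<in>Srj (dom (incl y)) z.
  if \<exists>k\<in>Aut (dom (incl y)). incl y o k = g o incl y \<and> e o k = h o e then 1 else 0)"
proof -
 note ig = ivt[OF g] and ih = ivt[OF h]
 have O: "ob x" "ob z" using ig ih by auto
 have gi: "mono g" using g by (simp add: AutG_carrier)
 have f: "fst (br g :: ('o, 'm, 'k) rel_arr) = x" using ig by (simp add: br_sp)
 let ?c = "\<lambda>y e. \<exists>k\<in>Aut (dom (incl y)). incl y o k = g o incl y \<and> e o k = h o e"
 have *: "cf (br g oo basis z x (sub_class (pairing e (incl y)))) (act z x (sub_class (pairing e (incl y))) h) = (if ?c y e then 1 else 0)"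
  if y: "y \<in> Sub x" and e: "e \<in> Srj (dom (incl y)) z" for y e
 proof -
  note i = incl_facts[OF y]
  have es: "surj e" "arr e" "dom e = dom (incl y)" "cod e = z" using e by (auto simp: Srj_def)
  have m: "mono (pairing e (incl y))" using class_Q[of e "incl y" z x] es i by simp
  note a = act_class[OF m es(2) i(4) es(3,4) i(2) h]
  have mg: "mono (pairing e (g o incl y))"
   by (rule class_Q(2)[of _ _ z x]) (use es i ig mono_comp[OF i(1) gi] in simp_all)
  have "basis z x (sub_class (pairing e (incl y))) = sp e (incl y)" using sp_mono[OF m] es i by simp
  hence "br g oo basis z x (sub_class (pairing e (incl y))) = sp e (g o incl y)"
   using sp_comp_graph[of e "incl y" g] es i ig by simp
  also have "... = basis z x (sub_class (pairing e (g o incl y)))" using sp_mono[OF mg] es i ig by simp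
  finally have 1: "cf (br g oo basis z x (sub_class (pairing e (incl y)))) (act z x (sub_class (pairing e (incl y))) h) =
   (if sub_class (pairing (ivt h o e) (incl y)) = sub_class (pairing e (g o incl y)) then 1 else 0)"
   unfolding a(1) by simp
  have "sub_class (pairing (ivt h o e) (incl y)) = sub_class (pairing e (g o incl y)) \<longleftrightarrow> ?c y e"
  proof
   assume "sub_class (pairing (ivt h o e) (incl y)) = sub_class (pairing e (g o incl y))"
   then obtain k where k: "iso k" "dom k = dom (pairing e (g o incl y))" "cod k = dom (pairing (ivt h o e) (incl y))"
    "pairing (ivt h o e) (incl y) o k = pairing e (g o incl y)"
    using mono_factor_iso[OF mg a(2)] sub_class_eq_iff[OF a(2) mg] by metis
   have kd: "arr k" "dom k = dom (incl y)" "cod k = dom (incl y)" using k(1-3) es i ig ih by simp_all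
   have "pairing (ivt h o (e o k)) (incl y o k) = pairing e (g o incl y)" using k(4) kd es i ih by simp
   hence ek: "ivt h o (e o k) = e" "incl y o k = g o incl y"
    by (subst (asm) pairing_eq_iff; use kd es i ih ig in simp)+
   have "h o (ivt h o (e o k)) = ide z o (e o k)" by (rule reassoc[OF ih(2)]) (use ih kd es in simp_all)
   hence "e o k = h o e" unfolding ek(1) using kd es by simp
   thus "?c y e" using ek(2) k(1) kd by (auto simp: AutG_carrier)
  next
   assume "?c y e"
   then obtain k where k: "iso k" "dom k = dom (incl y)" "cod k = dom (incl y)" "incl y o k = g o incl y" "e o k = h o e"
    by (auto simp: AutG_carrier)
   have "ivt h o (h o e) = ide z o e" by (rule reassoc[OF ih(3)]) (use ih es in simp_all)
   hence "ivt h o (e o k) = e" unfolding k(5) using es by simp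
   hence "pairing (ivt h o e) (incl y) o k = pairing e (g o incl y)" using k(1-4) es i ih by simp
   thus "sub_class (pairing (ivt h o e) (incl y)) = sub_class (pairing e (g o incl y))"
    using sub_class_iso[OF a(2) k(1)] k(3) es i ih by simp
  qed
  thus ?thesis unfolding 1 by simp
 qed
 have "theta z (br g) h = (\<Sum>(y, e)\<in>(SIGMA y:Sub x. Srj (dom (incl y)) z). if ?c y e then 1 else 0)"
  unfolding theta_def f sum.reindex_bij_betw[OF Q_bij[OF O], symmetric]
  by (rule sum.cong[OF refl]) (use * in auto)
 also have "... = (\<Sum>y\<in>Sub x. \<Sum>e\<in>Srj (dom (incl y)) z. if ?c y e then 1 else 0)"
  by (rule sum.Sigma[symmetric]) (use O in auto)
 finally show ?thesis .
qed

end

section \<open>Subquotients\<close>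

context regular_category
begin

lemma subquotient_obj: "subquotient z x ==> ob z \<and> ob x"
 unfolding subquotient_def by auto

lemma subquotientI: "[|mono m; cod m = x; surj e; dom e = dom m; cod e = z|] ==> subquotient z x"
 unfolding subquotient_def by blast

lemma subquotient_refl: "ob x ==> subquotient x x"
 by (rule subquotientI[of "ide x" _ "ide x"]) simp_all

text \<open>A subobject of a quotient is pulled back along the quotient map to a subobject upstairs
  that still surjects onto it.\<close>

lemma subquotient_trans:
 assumes "subquotient z x" "subquotient x w"
 shows "subquotient z w"
proof -
 obtain m e where m: "mono m" "cod m = x" "surj e" "dom e = dom m" "cod e = z"
  using assms(1) unfolding subquotient_def by blast
 obtain n f where n: "mono n" "cod n = w" "surj f" "dom f = dom n" "cod f = x"
  using assms(2) unfolding subquotient_def by blast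
 obtain p q where P: "is_pullback f m p q" using pullback_exists[of f m] m n by auto
 note F = pullback_facts[OF P]
 have p: "mono p" by (rule pullback_mono[OF pullback_sym[OF P] m(1)])
 have q: "surj q" by (rule surj_pullback[OF n(3) P])
 show ?thesis
  by (rule subquotientI[OF mono_comp[OF p n(1)] _ surj_comp[OF q m(3)]]) (use F m n in simp_all)
qed

end

context malcev_setting
begin

text \<open>The surjections onto \<open>z\<close> with a given class form a torsor under
  \<open>Aut z\<close>, if there are any. The count cancels the averaging factor in
  \<open>Psi\<close>.\<close>

lemma isotypic_count:
 assumes Z: "Z \<in> Quo y" and z: "ob z"
 shows "card {e \<in> Srj y z. quo_class e = Z} = (if isomorphic (quo_obj Z) z then card (Aut z) else 0)"
proof -
 note m = quo_map_facts[OF Z]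
 have iso: "\<exists>i. iso i \<and> dom i = quo_obj Z \<and> cod i = z \<and> i o quo_map Z = e" if e: "e \<in> Srj y z" "quo_class e = Z" for e
 proof -
  have "surj e" "cod e = z" using e by (auto simp: Srj_def)
  thus ?thesis using qle_iso[OF m(1), of e] qle_quo_map[of e Z] e(2) m(4) by metis
 qed
 show ?thesis
 proof (cases "isomorphic (quo_obj Z) z")
  case True
  then obtain i where i: "iso i" "dom i = quo_obj Z" "cod i = z" by (auto simp: isomorphic_iff)
  have e0: "surj (i o quo_map Z)" using surj_comp[OF m(1) iso_surj[OF i(1)]] i m by simp
  obtain k where k: "arr k" "dom k = z" "cod k = quo_obj Z" "k o i = ide (quo_obj Z)" "iso k"
   using isoE[OF i(1)] i by metis
  have "bij_betw (\<lambda>f. f o (i o quo_map Z)) (Aut z) {e \<in> Srj y z. quo_class e = Z}"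
  proof (rule bij_betw_imageI)
   show "inj_on (\<lambda>f. f o (i o quo_map Z)) (Aut z)"
    by (rule inj_onI, rule surj_epi[OF e0]) (use i m in \<open>auto simp: AutG_carrier\<close>)
   show "(\<lambda>f. f o (i o quo_map Z)) ` Aut z = {e \<in> Srj y z. quo_class e = Z}"
   proof (intro equalityI subsetI)
    fix e assume "e \<in> (\<lambda>f. f o (i o quo_map Z)) ` Aut z"
    then obtain f where f: "iso f" "dom f = z" "cod f = z" "e = f o (i o quo_map Z)" by (auto simp: AutG_carrier)
    have fi: "iso (f o i)" by (rule iso_comp) (use f i in simp_all)
    have e: "e = (f o i) o quo_map Z" using f i m by simp
    have es: "surj e" unfolding e by (rule surj_comp[OF m(1) iso_surj[OF fi]]) (use f i m in simp)
    obtain j where j: "arr j" "dom j = z" "cod j = quo_obj Z" "j o (f o i) = ide (quo_obj Z)"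
     using isoE[OF fi] f i by (metis comp_arr(2,3) iso_arr)
    have "j o ((f o i) o quo_map Z) = quo_map Z"
     using reassoc[OF j(4), of "quo_map Z"] j(1-3) f(1-3) i m by simp
    hence "j o e = quo_map Z" unfolding e .
    hence "qle e (quo_map Z)" unfolding qle_def using j f i m by (intro bexI[of _ j]) simp_all
    moreover have "qle (quo_map Z) e" unfolding qle_def e using f i m by (intro bexI[of _ "f o i"]) simp_all
    ultimately have "quo_class e = Z" using quo_class_eq_iff[OF es m(1)] m(3) by simp
    thus "e \<in> {e \<in> Srj y z. quo_class e = Z}" using es f i m by (simp add: Srj_def)
   next
    fix e assume "e \<in> {e \<in> Srj y z. quo_class e = Z}"
    then obtain j where j: "iso j" "dom j = quo_obj Z" "cod j = z" "j o quo_map Z = e" using iso by blast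
    have "k o (i o quo_map Z) = quo_map Z" using reassoc[OF k(4), of "quo_map Z"] k(1-3) i m by simp
    hence "(j o k) o (i o quo_map Z) = e" using j k(1-3) i m by simp
    moreover have "j o k \<in> Aut z" using iso_comp[OF k(5) j(1)] j k by (simp add: AutG_carrier)
    ultimately show "e \<in> (\<lambda>f. f o (i o quo_map Z)) ` Aut z" by blast
   qed
  qed
  thus ?thesis using True bij_betw_same_card by fastforce
 next
  case False
  hence "{e \<in> Srj y z. quo_class e = Z} = {}" using iso by (auto simp: isomorphic_iff)
  thus ?thesis using False by (metis card.empty)
 qed
qed

end

section \<open>Comparison of the two traces\<close>

locale char0_setting = malcev_setting C \<delta>
 for C :: "('o, 'm, 'e) cat_scheme" (structure) and \<delta> :: "'m \<Rightarrow> 'k :: field_char_0"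
begin

text \<open>Representatives of the isomorphism classes of subquotients. That \<open>x\<close>
  itself, and not merely an isomorphic object, belongs to \<open>S\<close> lets the sum
  \<open>Psi\<close> be split at \<open>z = x\<close>.\<close>

definition transversal :: "'o set \<Rightarrow> 'o \<Rightarrow> bool" where
 "transversal S x \<longleftrightarrow> finite S \<and> x \<in> S \<and> (\<forall>s\<in>S. subquotient s x) \<and>
   (\<forall>z. subquotient z x \<longrightarrow> (\<exists>!s. s \<in> S \<and> isomorphic z s))"

lemma transversal_exists:
 assumes x: "ob x"
 obtains S where "transversal S x"
proof -
 let ?T = "(\<lambda>(y, Z). quo_obj Z) ` (SIGMA y:Sub x. Quo (dom (incl y)))"
 have fin: "finite ?T" using x by (intro finite_imageI finite_SigmaI) auto
 have T: "\<exists>s\<in>?T. isomorphic z s" if z: "subquotient z x" for z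
 proof -
  obtain m e where m: "mono m" "cod m = x" "surj e" "dom e = dom m" "cod e = z"
   using z unfolding subquotient_def by blast
  define y where "y = sub_class m"
  have y: "y \<in> Sub x" using m by (simp add: y_def)
  obtain h where h: "iso h" "dom h = dom m" "cod h = dom (incl y)" using incl_sub_class[OF m(1), folded y_def] by metis
  obtain k where k: "arr k" "dom k = cod h" "cod k = dom h" "iso k" by (rule isoE[OF h(1)])
  have e: "surj (e o k)" "dom (e o k) = dom (incl y)" "cod (e o k) = z"
   using surj_comp[OF iso_surj[OF k(4)] m(3)] k h m by simp_all
  have Z: "quo_class (e o k) \<in> Quo (dom (incl y))" using e by simp
  note q = quo_map_facts[OF Z]
  obtain i where "iso i" "dom i = cod (e o k)" "cod i = cod (quo_map (quo_class (e o k)))"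
   using qle_iso[OF e(1) q(1)] qle_quo_map[OF e(1) refl] by metis
  hence "isomorphic z (quo_obj (quo_class (e o k)))" unfolding isomorphic_iff using e(3) q(4) by auto
  thus ?thesis using y Z by force
 qed
 have Tsub: "subquotient s x" if s: "s \<in> ?T" for s
 proof -
  obtain y Z where "y \<in> Sub x" "Z \<in> Quo (dom (incl y))" "s = quo_obj Z" using s by auto
  thus ?thesis using subquotientI[of "incl y" x "quo_map Z" s] incl_facts[of y x] quo_map_facts[of Z "dom (incl y)"] by simp
 qed
 \<comment> \<open>The choice prefers \<open>x\<close>, so that \<open>x\<close> represents its own
   class; otherwise it depends only on the isomorphism class of \<open>z\<close>.\<close>
 define c where "c z = (if isomorphic z x then x else SOME s. s \<in> ?T \<and> isomorphic z s)" for z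
 have c: "isomorphic z (c z)" "c z \<in> insert x ?T" if "subquotient z x" for z
  using someI_ex[of "\<lambda>s. s \<in> ?T \<and> isomorphic z s"] T[OF that] unfolding c_def by auto
 have ceq: "c z = c w" if "isomorphic z w" for z w
 proof -
  have "isomorphic z = isomorphic w"
   by (rule ext) (use isomorphic_trans[OF that] isomorphic_trans[OF isomorphic_sym[OF that]] in blast)
  thus ?thesis unfolding c_def by simp
 qed
 let ?S = "c ` {z. subquotient z x}"
 have "transversal ?S x"
  unfolding transversal_def
 proof (intro conjI allI impI ballI)
  show "finite ?S" by (rule finite_subset[of _ "insert x ?T"]) (use c fin in auto)
  show "x \<in> ?S" using isomorphic_refl[OF x] subquotient_refl[OF x] c_def[of x] by (auto intro!: image_eqI[of _ _ x])
  show "subquotient s x" if "s \<in> ?S" for s using that c(2) Tsub subquotient_refl[OF x] by auto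
  fix z assume z: "subquotient z x"
  show "\<exists>!s. s \<in> ?S \<and> isomorphic z s"
  proof (rule ex1I[of _ "c z"])
   show "c z \<in> ?S \<and> isomorphic z (c z)" using z c by auto
   fix s assume "s \<in> ?S \<and> isomorphic z s"
   then obtain w where w: "s = c w" "subquotient w x" "isomorphic z (c w)" by auto
   thus "s = c z" using ceq[OF isomorphic_trans[OF w(3) isomorphic_sym[OF c(1)[OF w(2)]]]] by simp
  qed
 qed
 thus ?thesis by (rule that)
qed

text \<open>As \<open>e\<close> is epi, at most one \<open>h\<close> satisfies the equation, and
  there is one exactly if the class of \<open>e\<close> is fixed by \<open>k\<close>; its value of
  \<open>phi\<close> depends on that class only.\<close>

lemma phi_surj_sum:
 assumes k: "k \<in> Aut y" and e: "e \<in> Srj y z" and z: "ob z"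
 shows "(\<Sum>h\<in>Aut z. if e o k = h o e then phi z h else 0) =
  (if quo_class e \<in> Quo_fix y k then phi (quo_obj (quo_class e)) (induced k (quo_class e)) else 0)"
proof -
 have es: "surj e" "dom e = y" "cod e = z" "arr e" using e by (auto simp: Srj_def)
 show ?thesis
 proof (cases "quo_class e \<in> Quo_fix y k")
  case True
  then obtain h where h: "h \<in> Aut z" "h o e = e o k"
   unfolding quo_fix_class[OF es(1,2) k] stab_def using es by (auto simp: AutG_carrier)
  have "h' = h" if "h' \<in> Aut z" "e o k = h' o e" for h'
   by (rule surj_epi[OF es(1)]) (use that h es in \<open>auto simp: AutG_carrier\<close>)
  hence "e o k = h' o e \<longleftrightarrow> h' = h" if "h' \<in> Aut z" for h'
   using that h(2) by metis
  hence "(\<Sum>h'\<in>Aut z. if e o k = h' o e then phi z h' else 0) =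
   (\<Sum>h'\<in>Aut z. if h' = h then phi z h' else 0)"
   by (intro sum.cong refl) simp
  also have "... = phi z h" using h(1) z by simp
  also have "... = phi (quo_obj (quo_class e)) (induced k (quo_class e))"
  proof -
   note m = quo_map_facts[OF Quo_fix_Quo[OF True]]
   show ?thesis using phi_quo[OF es(1-3) k h] phi_quo[OF m(1,2,4) k induced(1,2)[OF True k]] m(3) by simp
  qed
  finally show ?thesis using True by simp
 next
  case False
  hence "\<not> (e o k = h o e)" if "h \<in> Aut z" for h
   using that es unfolding quo_fix_class[OF es(1,2) k] stab_def AutG_carrier by metis
  thus ?thesis using False by simp
 qed
qed

text \<open>Grouped by class, the surjections onto \<open>z\<close> give \<open>card (Aut z)\<close>
  times the contribution of each quotient isomorphic to \<open>z\<close>. The factor cancels, the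
  sum over \<open>S\<close> meets each quotient once, and \<open>phi_sum\<close> evaluates what
  remains.\<close>

lemma surj_count:
 assumes k: "k \<in> Aut y" and S: "finite S" "S \<subseteq> Obj C"
  and rep: "\<And>Z. Z \<in> Quo y ==> \<exists>!s. s \<in> S \<and> isomorphic (quo_obj Z) s"
 shows "(\<Sum>z\<in>S. inverse (of_nat (card (Aut z))) *
   (\<Sum>h\<in>Aut z. phi z h * (\<Sum>e\<in>Srj y z. if e o k = h o e then 1 else 0))) =
  (if k = ide y then omg y else 0)"
proof -
 have O: "ob y" using ivt[OF k] by simp
 define G where "G Z = (if Z \<in> Quo_fix y k then phi (quo_obj Z) (induced k Z) else 0)" for Z
 let ?I = "\<lambda>Z z. isomorphic (quo_obj Z) z"
 have inner: "(\<Sum>h\<in>Aut z. if e o k = h o e then phi z h else 0) = G (quo_class e)"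
  if "e \<in> Srj y z" "ob z" for e z
  using phi_surj_sum[OF k that] by (simp add: G_def)
 have outer: "(\<Sum>h\<in>Aut z. phi z h * (\<Sum>e\<in>Srj y z. if e o k = h o e then 1 else 0)) =
  of_nat (card (Aut z)) * (\<Sum>Z\<in>Quo y. if ?I Z z then G Z else 0)" if z: "ob z" for z
 proof -
  have "(\<Sum>h\<in>Aut z. phi z h * (\<Sum>e\<in>Srj y z. if e o k = h o e then 1 else 0)) =
   (\<Sum>h\<in>Aut z. \<Sum>e\<in>Srj y z. if e o k = h o e then phi z h else 0)"
   by (simp add: sum_distrib_left if_distrib cong: if_cong)
  also have "... = (\<Sum>e\<in>Srj y z. \<Sum>h\<in>Aut z. if e o k = h o e then phi z h else 0)" by (rule sum.swap)
  also have "... = (\<Sum>e\<in>Srj y z. G (quo_class e))" using inner z by (intro sum.cong refl) blast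
  also have "... = (\<Sum>Z\<in>Quo y. \<Sum>e\<in>{e \<in> Srj y z. quo_class e = Z}. G (quo_class e))"
   by (rule sum.group[symmetric, OF finite_Srj[OF O z] finite_Quo[OF O]]) (auto simp: Srj_def)
  also have "... = (\<Sum>Z\<in>Quo y. of_nat (card {e \<in> Srj y z. quo_class e = Z}) * G Z)" by simp
  also have "... = (\<Sum>Z\<in>Quo y. if ?I Z z then of_nat (card (Aut z)) * G Z else 0)"
   using isotypic_count[OF _ z] by (intro sum.cong refl) simp
  finally show ?thesis by (simp add: sum_distrib_left if_distrib cong: if_cong)
 qed
 have A: "of_nat (card (Aut z)) \<noteq> (0::'k)" if "ob z" for z
 proof -
  have "ide z \<in> Aut z" using that by (simp add: AutG_carrier)
  thus ?thesis using that by (auto simp: card_eq_0_iff)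
 qed
 have "(\<Sum>z\<in>S. inverse (of_nat (card (Aut z))) *
   (\<Sum>h\<in>Aut z. phi z h * (\<Sum>e\<in>Srj y z. if e o k = h o e then 1 else 0))) =
  (\<Sum>z\<in>S. \<Sum>Z\<in>Quo y. if ?I Z z then G Z else 0)"
  by (rule sum.cong[OF refl], subst outer) (use S A in auto)
 also have "... = (\<Sum>Z\<in>Quo y. \<Sum>z\<in>S. if ?I Z z then G Z else 0)" by (rule sum.swap)
 also have "... = (\<Sum>Z\<in>Quo y. G Z)"
 proof (rule sum.cong[OF refl])
  fix Z assume "Z \<in> Quo y"
  then obtain s where s: "s \<in> S" "?I Z s" "\<And>t. t \<in> S ==> ?I Z t ==> t = s" using rep by metis
  have "?I Z z \<longleftrightarrow> z = s" if "z \<in> S" for z using s(2) s(3)[OF that] by metis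
  hence "(\<Sum>z\<in>S. if ?I Z z then G Z else 0) = (\<Sum>z\<in>S. if z = s then G Z else 0)"
   by (intro sum.cong refl) simp
  thus "(\<Sum>z\<in>S. if ?I Z z then G Z else 0) = G Z" using s(1) S(1) by simp
 qed
 also have "... = (\<Sum>Z\<in>Quo_fix y k. phi (quo_obj Z) (induced k Z))"
  unfolding G_def using finite_Quo[OF O] by (subst sum.inter_restrict[symmetric]) (auto simp: Quo_fix_def intro: sum.cong)
 finally show ?thesis unfolding phi_sum[OF k] .
qed

text \<open>\<open>theta z a h\<close> is the trace of \<open>a\<close>, composed with the action of \<open>h\<close>, on the span of the relations in \<open>Q z x\<close>,
 so that \<open>Psi\<close> is the trace that \<open>a\<close> would have if \<open>phi z\<close> were the character of \<open>[z]\<^sup>0\<close>.\<close>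

definition Psi :: "'o set \<Rightarrow> ('o, 'm, 'k) rel_arr \<Rightarrow> 'k" where
 "Psi S a = (\<Sum>z\<in>S. inverse (of_nat (card (Aut z))) * (\<Sum>h\<in>Aut z. phi z h * theta z a h))"

lemma Psi_lin:
 assumes "a \<in> hom x x" "b \<in> hom x x" "S \<subseteq> Obj C"
 shows "Psi S (pls a b) = Psi S a + Psi S b" "Psi S (scl k a) = k * Psi S a"
proof -
 have "theta z (pls a b) h = theta z a h + theta z b h" "theta z (scl k a) h = k * theta z a h" if "z \<in> S" for z h
  using theta_lin[OF assms(1,2)] that assms(3) by auto
 thus "Psi S (pls a b) = Psi S a + Psi S b" "Psi S (scl k a) = k * Psi S a"
  unfolding Psi_def by (simp_all add: distrib_left sum.distrib sum_distrib_left mult_ac)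
qed

lemma Psi_cyclic: "a \<in> hom x x' ==> b \<in> hom x' x ==> Psi S (b oo a) = Psi S (a oo b)"
 unfolding Psi_def using theta_cyclic by simp

text \<open>A subobject y contributes only if \<open>g\<close> restricts to an automorphism k of it,
  and then, by \<open>surj_count\<close>, contributes \<omega>_y if k is the identity and 0
  otherwise. The y fixed pointwise are those inside the equalizer of the identity and
  \<open>g\<close>, so \<open>omega_sum\<close> gives its degree, which is the trace.\<close>

lemma Psi_br:
 assumes S: "transversal S w" and x: "subquotient x w" and g: "g \<in> Aut x"
 shows "Psi S (br g) = cat_trace L (br g)"
proof -
 note ig = ivt[OF g]
 have SO: "finite S" "S \<subseteq> Obj C" using S subquotient_obj by (auto simp: transversal_def)
 let ?c = "\<lambda>z y h e. \<exists>k\<in>Aut (dom (incl y)). incl y o k = g o incl y \<and> e o k = h o e"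
 let ?T = "\<lambda>y. \<Sum>z\<in>S. inverse (of_nat (card (Aut z))) *
   (\<Sum>h\<in>Aut z. phi z h * (\<Sum>e\<in>Srj (dom (incl y)) z. if ?c z y h e then 1 else 0))"
 have "Psi S (br g) = (\<Sum>z\<in>S. \<Sum>y\<in>Sub x. inverse (of_nat (card (Aut z))) *
   (\<Sum>h\<in>Aut z. phi z h * (\<Sum>e\<in>Srj (dom (incl y)) z. if ?c z y h e then 1 else 0)))"
  unfolding Psi_def by (rule sum.cong[OF refl]) (simp add: theta_br[OF g] sum_distrib_left sum.swap[of _ "Sub x"])
 also have "... = (\<Sum>y\<in>Sub x. ?T y)" by (rule sum.swap)
 also have "... = (\<Sum>y\<in>Sub x. if g o incl y = incl y then omg (dom (incl y)) else 0)"
 proof (rule sum.cong[OF refl])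
  fix y assume y: "y \<in> Sub x"
  note i = incl_facts[OF y]
  let ?Y = "dom (incl y)"
  have Y: "ob ?Y" using i by auto
  show "?T y = (if g o incl y = incl y then omg ?Y else 0)"
  proof (cases "\<exists>k\<in>Aut ?Y. incl y o k = g o incl y")
   case False
   hence "g o incl y \<noteq> incl y" using i Y by (auto simp: AutG_carrier dest!: bspec[of _ _ "ide ?Y"])
   moreover have "?T y = 0" using False by (intro sum.neutral ballI) auto
   ultimately show ?thesis by simp
  next
   case True
   then obtain k where k: "k \<in> Aut ?Y" "incl y o k = g o incl y" by blast
   note ik = ivt[OF k(1)]
   have un: "k' = k" if "k' \<in> Aut ?Y" "incl y o k' = g o incl y" for k'
    by (rule monoD[OF i(1)]) (use that k ivt(8-10)[OF that(1)] ik in auto)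
   have c: "?c z y h e \<longleftrightarrow> e o k = h o e" for z h e using un k by blast
   have rep: "\<exists>!s. s \<in> S \<and> isomorphic (quo_obj Z) s" if Z: "Z \<in> Quo ?Y" for Z
   proof -
    have "subquotient (quo_obj Z) x" using subquotientI[OF i(1,2) quo_map_facts(1,2)[OF Z]] quo_map_facts(4)[OF Z] by simp
    thus ?thesis using S subquotient_trans[OF _ x] unfolding transversal_def by blast
   qed
   have "?T y = (if k = ide ?Y then omg ?Y else 0)"
    unfolding c by (rule surj_count[OF k(1) SO rep])
   moreover have "k = ide ?Y \<longleftrightarrow> g o incl y = incl y"
    using un[of "ide ?Y"] k(2) i Y by (auto simp: AutG_carrier)
   ultimately show ?thesis by simp
  qed
 qed
 also have "... = cat_trace L (br g)"
 proof -
  obtain m where m: "is_equalizer (ide x) g m" using equalizer_exists[of "ide x" g] ig by auto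
  have mm: "mono m" "cod m = x" "m = g o m" using m ig unfolding is_equalizer_def by auto
  have "g o incl y = incl y \<longleftrightarrow> factors_through (incl y) m" if y: "y \<in> Sub x" for y
  proof
   assume "factors_through (incl y) m"
   then obtain h where h: "arr h" "dom h = dom (incl y)" "cod h = dom m" "m o h = incl y" by (rule factors_throughE)
   have "g o (m o h) = m o h" by (rule reassoc[OF mm(3)[symmetric]]) (use mm(1,2) h ig in simp_all)
   thus "g o incl y = incl y" unfolding h(4) .
  qed (use m ig incl_facts[OF y] in \<open>simp add: is_equalizer_def\<close>)
  hence "(\<Sum>y\<in>Sub x. if g o incl y = incl y then omg (dom (incl y)) else 0) =
   (\<Sum>y\<in>{y \<in> Sub x. factors_through (incl y) m}. omg (dom (incl y)))"
   using ig by (subst sum.inter_filter) (auto intro: sum.cong)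
  also have "... = cat_trace L (sp (ide x) g)"
   using omega_sum[OF mm(1,2)] trace_sp[of "ide x" g x m] m ig by simp
  finally show ?thesis using br_sp[of g] ig by simp
 qed
 finally show ?thesis .
qed

lemma trace_eq_Psi:
 assumes S: "transversal S w" and x: "subquotient x w" and a: "a \<in> hom x x"
 shows "cat_trace L a = Psi S a"
 using x a
proof (induction "card (Sub (prd x x))" arbitrary: x a rule: less_induct)
 case less
 interpret T: tensor_category L by (rule T0_tensor_category)
 have SO: "S \<subseteq> Obj C" using S subquotient_obj by (auto simp: transversal_def)
 have O: "ob x" using less.prems subquotient_obj by blast
 have b: "cat_trace L (basis x x r) = Psi S (basis x x r)" if r: "r \<in> Sub (prd x x)" for r
 proof -
  \<comment> \<open>The relation factors as [x] -> [v] -> [x]; composed in the other order, the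
    factors give an endomorphism of [v], to which the induction applies if the count for
    \<open>v\<close> is smaller.\<close>
  obtain m1 e1 m2 e2 p q where gs: "mono m1" "cod m1 = x" "surj e1" "dom e1 = dom m1"
   "mono m2" "cod m2 = x" "surj e2" "dom e2 = dom m2" "cod e1 = cod e2"
   "is_pullback e1 e2 p q" "m1 o p = l1 x x r" "m2 o q = l2 x x r"
   using goursat[OF r O O] by metis
  define v where "v = cod e1"
  have A: "arr m1" "arr e1" "arr m2" "arr e2" using gs by auto
  have eq: "basis x x r = sp e2 m2 oo sp m1 e1"
   using sp_comp[of m1 e1 e2 m2 p q] A gs basis_legs[OF r O O] by simp
  have h: "sp m1 e1 \<in> hom x v" "sp e2 m2 \<in> hom v x"
   using A gs by (auto intro!: sp_HomI simp: v_def)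
  show ?thesis
  proof (cases "card (Sub (prd v v)) < card (Sub (prd x x))")
   case True
   have "subquotient v w"
    using subquotient_trans[OF subquotientI[OF gs(1-4)] less.prems(1)] by (simp add: v_def)
   hence "cat_trace L (sp m1 e1 oo sp e2 m2) = Psi S (sp m1 e1 oo sp e2 m2)"
    by (rule less.hyps[OF True _ T0_comp_Hom[OF h(2,1)]])
   thus ?thesis unfolding eq using T.trace_cyclic[OF h] Psi_cyclic[OF h] by simp
  next
   case False
   \<comment> \<open>Without a drop in the count all four Goursat maps are isomorphisms, so the
     relation is the graph of an automorphism.\<close>
   hence iso: "iso m1" "iso e1" "iso m2" "iso e2"
    using subquotient_card(2)[OF gs(1,3,4)] subquotient_card(2)[OF gs(5,7,8)] gs(2,6,9) by (simp_all add: v_def)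
   have inv: "\<exists>g. iso g \<and> dom g = cod f \<and> cod g = cod f' \<and> sp f f' = br g"
    if f: "iso f" "iso f'" "dom f = dom f'" for f f'
   proof -
    obtain j where j: "arr j" "dom j = cod f" "cod j = dom f" "j o f = ide (dom f)" "iso j"
     by (rule isoE[OF f(1)])
    have "(f' o j) o f = f'" using j(1-4) f by simp
    hence "sp f f' = sp (ide (cod f) o f) ((f' o j) o f)" using f by simp
    also have "... = sp (ide (cod f)) (f' o j)" by (rule sp_iso[OF f(1)]) (use f j in simp_all)
    also have "... = br (f' o j)" using br_sp[of "f' o j"] f j by simp
    finally show ?thesis using iso_comp[OF j(5) f(2)] j f by (intro exI[of _ "f' o j"]) simp
   qed
   obtain g1 where g1: "iso g1" "dom g1 = x" "cod g1 = v" "sp m1 e1 = br g1"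
    using inv[OF iso(1,2)] gs(2,4) by (auto simp: v_def)
   obtain g2 where g2: "iso g2" "dom g2 = v" "cod g2 = x" "sp e2 m2 = br g2"
    using inv[OF iso(4,3)] gs(6,8,9) by (auto simp: v_def)
   have "basis x x r = (br (g2 o g1) :: ('o, 'm, 'k) rel_arr)" unfolding eq g1(4) g2(4) using br_comp[of g1 g2] g1 g2 by simp
   moreover have "g2 o g1 \<in> Aut x" using iso_comp[OF g1(1) g2(1)] g1 g2 by (simp add: AutG_carrier)
   ultimately show ?thesis using Psi_br[OF S less.prems(1)] by simp
  qed
 qed
 have lin0: "cat_trace L (zr x x) = Psi S (zr x x)"
 proof -
  have z: "zr x x \<in> hom x x" using O by (simp add: T0_simps)
  show ?thesis using T.trace_zero O Psi_lin(2)[OF z z SO, of 0] zero_scale[OF z] by simp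
 qed
 from less.prems(2) show ?case
 proof (induction rule: T0_span_induct)
  case (Span f g)
  obtain r u where r: "r \<in> Sub (prd x x)" "sp f g = scl (\<delta> u) (basis x x r)"
   using sp_image[of f g x x] Span by metis
  show ?case unfolding r(2) using T.trace_scale[OF basis_Hom[OF O O r(1)]] Psi_lin(2)[OF basis_Hom[OF O O r(1)] basis_Hom[OF O O r(1)] SO] b[OF r(1)] by simp
 next
  case (Plus a b)
  thus ?case using T.trace_plus[OF Plus(1,2)] Psi_lin(1)[OF Plus(1,2) SO] by simp
 next
  case (Scale k a)
  thus ?case using T.trace_scale[OF Scale(1)] Psi_lin(2)[OF Scale(1,1) SO] by simp
 qed (rule lin0)
qed

end

section \<open>The trace on \<open>[x]\<^sup>0\<close>\<close>

context char0_setting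
begin

text \<open>A member of \<open>Q x z\<close> would make \<open>x\<close> a subquotient of
  \<open>z\<close>, while \<open>z\<close> is one of \<open>x\<close>; the counts then agree and
  force \<open>z\<close> to be isomorphic to \<open>x\<close>.\<close>

lemma Q_proper:
 assumes "proper_subquotient z x"
 shows "Q x z = {}"
proof (rule ccontr)
 assume "Q x z \<noteq> {}"
 then obtain r where r: "r \<in> Q x z" by blast
 obtain m e where m: "mono m" "cod m = x" "surj e" "dom e = dom m" "cod e = z"
  using assms unfolding proper_subquotient_def subquotient_def by blast
 have O: "ob x" "ob z" using m by auto
 note l = leg_arr[OF Q_Sub[OF r] O]
 have s: "surj (l1 x z r)" "mono (l2 x z r)" using r by (auto simp: Q_def)
 have "card (Sub (prd x x)) \<le> card (Sub (prd z z))"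
  using subquotient_card(1)[OF s(2,1)] l by simp
 hence i: "iso m" "iso e" using subquotient_card(2)[OF m(1,3,4)] m by simp_all
 have "isomorphic (dom m) x" "isomorphic (dom m) z" using i m by (auto simp: isomorphic_iff)
 hence "isomorphic z x" using isomorphic_sym isomorphic_trans by blast
 thus False using assms by (simp add: proper_subquotient_def)
qed

text \<open>A subobject of \<open>x\<close> that surjects onto \<open>x\<close> is the whole of
  \<open>x\<close>, by an isomorphism. So the sum runs over \<open>card (Aut x)\<close>
  isomorphisms, all of the same class, and each contributes \<open>phi x g\<close>.\<close>

lemma theta_self:
 assumes g: "g \<in> Aut x"
 shows "(\<Sum>h\<in>Aut x. phi x h * theta x (br g) h) = of_nat (card (Aut x)) * phi x g"
proof -
 note ig = ivt[OF g]
 have gi: "iso g" using g by (simp add: AutG_carrier)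
 have O: "ob x" using ig by simp
 let ?t = "sub_top x"
 define i where "i = incl ?t"
 define Y where "Y = dom i"
 have tS: "?t \<in> Sub x" using O by simp
 note it = incl_facts[OF tS, folded i_def]
 have ii: "iso i" using it sub_class_top_iff[of i x] by simp
 obtain j where j: "arr j" "dom j = x" "cod j = Y" "j o i = ide Y" "i o j = ide x" "iso j"
  using isoE[OF ii] it by (metis Y_def)
 have iY: "arr i" "dom i = Y" "cod i = x" "ob Y" using it by (auto simp: Y_def)
 \<comment> \<open>The chosen representative \<open>i\<close> of the top subobject is an
   isomorphism, in general not the identity; \<open>k\<close> is \<open>g\<close> transported along
   it.\<close>
 define k where "k = j o (g o i)"
 have k: "k \<in> Aut Y"
  unfolding k_def AutG_carrier using iso_comp[OF iso_comp[OF ii gi] j(6)] ig iY j(1-3) by simp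
 have ik: "i o k = g o i" unfolding k_def using reassoc[OF j(5), of "g o i"] ig iY j(1-3) by simp
 let ?c = "\<lambda>y h e. \<exists>k\<in>Aut (dom (incl y)). incl y o k = g o incl y \<and> e o k = h o e"
 have un: "k' = k" if "k' \<in> Aut Y" "i o k' = g o i" for k'
  by (rule monoD[OF it(1)]) (use that ik ivt(8-10)[OF that(1)] ivt(8-10)[OF k] iY in auto)
 have isoS: "iso e" if e: "e \<in> Srj Y x" for e
  using subquotient_card(2)[OF it(1), of e] e iY by (auto simp: Srj_def)
 have none: "Srj (dom (incl y)) x = {}" if y: "y \<in> Sub x" "y \<noteq> ?t" for y
 proof (rule ccontr)
  assume "Srj (dom (incl y)) x \<noteq> {}"
  then obtain e where e: "surj e" "dom e = dom (incl y)" "cod e = x" by (auto simp: Srj_def)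
  note iy = incl_facts[OF y(1)]
  have "iso (incl y)" using subquotient_card(2)[OF iy(1) e(1,2)] e iy by simp
  thus False using sub_class_top_iff[of "incl y" x] iy y(2) by simp
 qed
 have th: "theta x (br g) h = (\<Sum>e\<in>Srj Y x. if e o k = h o e then 1 else 0)" if h: "h \<in> Aut x" for h
 proof -
  have "theta x (br g) h = (\<Sum>e\<in>Srj (dom (incl ?t)) x. if ?c ?t h e then 1 else 0)"
   unfolding theta_br[OF g h] using tS O none by (subst sum.remove[of _ ?t]) auto
  moreover have "?c ?t h e \<longleftrightarrow> e o k = h o e" for e
   unfolding i_def[symmetric] Y_def[symmetric] using un k ik by blast
  ultimately show ?thesis unfolding i_def[symmetric] Y_def[symmetric] by simp
 qed
 have cls: "quo_class e = quo_class i" if e: "e \<in> Srj Y x" for e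
 proof -
  have ei: "iso e" "dom e = Y" "cod e = x" using isoS[OF e] e by (auto simp: Srj_def)
  obtain f where f: "arr f" "dom f = x" "cod f = Y" "f o e = ide Y" using isoE[OF ei(1)] ei by metis
  have "(i o f) o e = i" "(e o j) o i = e" using f ei iY j(1-4) by simp_all
  hence "qle e i" "qle i e" unfolding qle_def using f ei iY j(1-3) by (auto intro: bexI[of _ "i o f"] bexI[of _ "e o j"])
  thus ?thesis using quo_class_eq_iff ei ii by simp
 qed
 have iS: "i \<in> Srj Y x" using ii iY by (simp add: Srj_def)
 define G where "G = (if quo_class i \<in> Quo_fix Y k then phi (quo_obj (quo_class i)) (induced k (quo_class i)) else 0)"
 have inner: "(\<Sum>h\<in>Aut x. if e o k = h o e then phi x h else 0) = G" if e: "e \<in> Srj Y x" for e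
  unfolding phi_surj_sum[OF k e O] cls[OF e] G_def ..
 have "phi x g = (\<Sum>h\<in>Aut x. if h = g then phi x h else 0)" using g O by simp
 also have "... = (\<Sum>h\<in>Aut x. if i o k = h o i then phi x h else 0)"
 proof (rule sum.cong[OF refl])
  fix h assume h: "h \<in> Aut x"
  have "i o k = h o i \<longleftrightarrow> h = g"
   unfolding ik using surj_epi[OF iso_surj[OF ii], of g h] ivt(8-10)[OF h] ig iY by auto
  thus "(if h = g then phi x h else 0) = (if i o k = h o i then phi x h else 0)" by simp
 qed
 also have "... = G" by (rule inner[OF iS])
 finally have G: "phi x g = G" .
 have "(\<Sum>h\<in>Aut x. phi x h * theta x (br g) h) =
  (\<Sum>h\<in>Aut x. \<Sum>e\<in>Srj Y x. if e o k = h o e then phi x h else 0)"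
  by (rule sum.cong[OF refl]) (simp add: th sum_distrib_left if_distrib cong: if_cong)
 also have "... = (\<Sum>e\<in>Srj Y x. G)"
  by (subst sum.swap) (simp add: inner)
 also have "card (Srj Y x) = card (Aut x)"
 proof -
  have Z: "quo_class i \<in> Quo Y" using ii iY by simp
  note q = quo_map_facts[OF Z]
  obtain h where "iso h" "dom h = cod (quo_map (quo_class i))" "cod h = cod i"
   using qle_iso[OF q(1) iso_surj[OF ii]] qle_quo_map[OF iso_surj[OF ii] refl] by metis
  hence "isomorphic (quo_obj (quo_class i)) x" using q(4) iY by (auto simp: isomorphic_iff)
  moreover have "{e \<in> Srj Y x. quo_class e = quo_class i} = Srj Y x" using cls by blast
  ultimately show ?thesis using isotypic_count[OF Z O] by simp
 qed
 hence "(\<Sum>e\<in>Srj Y x. G) = of_nat (card (Aut x)) * phi x g" using G by simp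
 finally show ?thesis .
qed

text \<open>\<open>E\<close> is the idempotent of [x]^0 and \<open>N\<close> that of [x]^1. In
  \<open>Psi\<close> the terms with \<open>z \<noteq> x\<close> vanish because \<open>E\<close>
  kills every morphism from a proper subquotient; in the term \<open>z = x\<close> it is
  \<open>N\<close> that contributes nothing, so \<open>E\<close> may be replaced by the identity
  there.\<close>

lemma trace_complement:
 assumes g: "g \<in> Aut x" and E: "E \<in> hom x x" and N: "N \<in> hom x x" and EN: "pls N E = br (ide x)"
  and kill: "\<And>z f. proper_subquotient z x ==> f \<in> hom z x ==> E oo f = zr z x"
  and Nsum: "N = lin_category.fsum L x x n (\<lambda>k. B k oo A k)"
  and AB: "\<And>k. k < n ==> proper_subquotient (w k) x \<and> A k \<in> hom x (w k) \<and> B k \<in> hom (w k) x"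
 shows "cat_trace L (br g oo E) = phi x g"
proof -
 interpret T: tensor_category L by (rule T0_tensor_category)
 note ig = ivt[OF g]
 have O: "ob x" using ig by simp
 have bg: "br g \<in> hom x x" using ig by (auto intro: br_Hom)
 obtain S where S: "transversal S x" by (rule transversal_exists[OF O])
 have Sf: "finite S" "x \<in> S" "\<And>z. z \<in> S ==> ob z" using S subquotient_obj by (auto simp: transversal_def)
 have Nbg: "N oo br g \<in> hom x x" "E oo br g \<in> hom x x" using T0_comp_Hom[OF bg N] T0_comp_Hom[OF bg E] .
 have z0: "theta z (zr x x) h = 0" if "ob z" for z h
 proof -
  have zh: "zr x x \<in> hom x x" using O by (simp add: T0_simps)
  show ?thesis using theta_lin(2)[OF zh zh that, of 0 h] zero_scale[OF zh] by simp
 qed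
 \<comment> \<open>The members of \<open>Q z x\<close> are themselves morphisms from [z] to [x],
   which \<open>E\<close> kills even after \<open>br g\<close>.\<close>
 have proper: "theta z (E oo br g) h = 0" if z: "z \<in> S" "z \<noteq> x" for z h
 proof -
  have pz: "proper_subquotient z x"
   using S z subquotient_refl[OF O] isomorphic_refl Sf unfolding transversal_def proper_subquotient_def by metis
  have f: "fst (E oo br g) = x" using Nbg(2) by (auto simp: T0_Hom)
  have "(E oo br g) oo basis z x m = zr z x" if m: "m \<in> Q z x" for m
  proof -
   note mh = basis_Hom[OF Sf(3)[OF z(1)] O Q_Sub[OF m]]
   show ?thesis using T0_assoc[OF mh bg E] kill[OF pz T0_comp_Hom[OF mh bg]] by simp
  qed
  thus ?thesis unfolding theta_def f by (simp add: T0_simps)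
 qed
 \<comment> \<open>Cyclicity turns each summand of \<open>N\<close> into an endomorphism of [w l]
   for a proper subquotient \<open>w l\<close>, where \<open>Q x (w l)\<close> is empty.\<close>
 have N0: "theta x (N oo br g) h = 0" if h: "h \<in> Aut x" for h
 proof -
  have BA: "B k oo A k \<in> hom x x" if "k < n" for k using AB[OF that] T0_comp_Hom by blast
  have F: "(B k oo A k) oo br g \<in> hom x x" if "k < n" for k
   by (rule T0_comp_Hom[OF bg BA[OF that]])
  have "N oo br g = T.fsum x x n (\<lambda>k. (B k oo A k) oo br g)"
   unfolding Nsum by (rule T.fsum_comp) (use bg O BA in simp_all)
  moreover have "theta x (T.fsum x x l (\<lambda>k. (B k oo A k) oo br g)) h = 0" if "l \<le> n" for l
   using that
  proof (induction l)
   case 0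
   thus ?case using z0[OF O] by (simp add: T.fsum_0)
  next
   case (Suc l)
   note ab = AB[of l] and Fl = F[of l]
   have f: "T.fsum x x l (\<lambda>k. (B k oo A k) oo br g) \<in> hom x x"
    by (rule T.fsum_hom) (use O F Suc in auto)
   have Ag: "A l oo br g \<in> hom x (w l)" using ab bg T0_comp_Hom Suc by auto
   have "theta x ((B l oo A l) oo br g) h = theta x ((A l oo br g) oo B l) h"
    using T0_assoc[OF bg, of "A l" "w l" "B l" x] theta_cyclic[OF Ag _ h, of "B l"] ab Suc by simp
   also have "... = 0"
   proof -
    have "fst ((A l oo br g) oo B l) = w l" using T0_comp_Hom[OF _ Ag, of "B l" "w l"] ab Suc by (auto simp: T0_Hom)
    thus ?thesis using Q_proper[of "w l" x] ab Suc unfolding theta_def by simp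
   qed
   finally have "theta x ((B l oo A l) oo br g) h = 0" .
   moreover have "T.fsum x x (Suc l) (\<lambda>k. (B k oo A k) oo br g) =
    pls (T.fsum x x l (\<lambda>k. (B k oo A k) oo br g)) ((B l oo A l) oo br g)"
    by (rule T.fsum_Suc) (use O F Suc in auto)
   ultimately show ?case using theta_lin(1)[OF f Fl O] Suc by simp
  qed
  ultimately show ?thesis by simp
 qed
 have "pls N E oo br g = br g" unfolding EN by (rule T0_ident(2)[OF bg])
 hence "pls (N oo br g) (E oo br g) = br g" using T0_comp_plus_left[OF bg N E] by simp
 hence Ex: "theta x (E oo br g) h = theta x (br g) h" if "h \<in> Aut x" for h
  using theta_lin(1)[OF Nbg O, of h] N0[OF that] by simp
 have A0: "of_nat (card (Aut x)) \<noteq> (0::'k)"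
  using g O by (auto simp: card_eq_0_iff)
 have "cat_trace L (br g oo E) = cat_trace L (E oo br g)" by (rule T.trace_cyclic[OF E bg])
 also have "... = Psi S (E oo br g)" by (rule trace_eq_Psi[OF S subquotient_refl[OF O] Nbg(2)])
 also have "... = inverse (of_nat (card (Aut x))) * (\<Sum>h\<in>Aut x. phi x h * theta x (E oo br g) h)"
  unfolding Psi_def using Sf proper by (subst sum.remove[OF Sf(1,2)]) simp
 also have "... = phi x g" using theta_self[OF g] A0 by (simp add: Ex)
 finally show ?thesis .
qed

text \<open>Carries \<open>trace_complement\<close> through the two completions: arrows between
  objects \<open>Tsum\<close> are matrices over \<open>T0\<close>, so the idempotents of [x]^1 and
  [x]^0 become the entries \<open>N\<close> and \<open>E\<close> of 1 x 1 matrices.\<close>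

lemma x0_trace:
 assumes x0: "is_x0 C \<delta> x Z j q" and g: "g \<in> Aut x"
 shows "cat_trace (TT C \<delta>) (Comp (TT C \<delta>) q (Comp (TT C \<delta>) (Tbr C \<delta> g) j)) = phi x g"
  "Comp (TT C \<delta>) q (Comp (TT C \<delta>) (Tbr C \<delta> g) j) \<in> Hom (TT C \<delta>) Z Z"
proof -
 interpret T: tensor_category L by (rule T0_tensor_category)
 interpret A: tensor_category "add_compl L" by (rule T.add_tensor_category)
 let ?A = "add_compl L" and ?K = "TT C \<delta>"
 have KD: "?K = kar_compl ?A" by (simp add: TT_def)
 interpret K: lin_category ?K unfolding KD by (rule A.kar_lin_category)
 note ig = ivt[OF g]
 have O: "ob x" "set [x] \<subseteq> Obj L" using ig by simp_all
 have kobj: "Tsum C \<delta> zs \<in> kar_objs ?A" "fst (Tsum C \<delta> zs) = zs" "snd (Tsum C \<delta> zs) = Ident ?A zs" if "set zs \<subseteq> Obj L" for zs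
 proof -
  have "zs \<in> Obj ?A" using that T.Obj_AL by simp
  thus "Tsum C \<delta> zs \<in> kar_objs ?A" "fst (Tsum C \<delta> zs) = zs" "snd (Tsum C \<delta> zs) = Ident ?A zs"
   using A.ident_hom[of zs] A.comp_ident[OF A.ident_hom[of zs]] by (simp_all add: Tsum_def A.kar_objs_iff)
 qed
 have KH: "f \<in> Hom ?K (Tsum C \<delta> zs) (Tsum C \<delta> ys) \<longleftrightarrow>
   (\<exists>F. f = (Tsum C \<delta> zs, mk zs ys F, Tsum C \<delta> ys) \<and> T.ents zs ys F)"
  if s: "set zs \<subseteq> Obj L" "set ys \<subseteq> Obj L" for f zs ys
 proof -
  have "f \<in> Hom ?K (Tsum C \<delta> zs) (Tsum C \<delta> ys) \<longleftrightarrow> (\<exists>F. f = (Tsum C \<delta> zs, F, Tsum C \<delta> ys) \<and> F \<in> Hom ?A zs ys)"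
   unfolding KD A.kar_Hom kobj(2,3)[OF s(1)] kobj(2,3)[OF s(2)] mem_Collect_eq
   using kobj(1)[OF s(1)] kobj(1)[OF s(2)] A.comp_ident[of _ zs ys] A.ident_comp[of _ zs ys] by metis
  thus ?thesis unfolding T.add_Hom by blast
 qed
 obtain Y i p where jq: "is_summand ?K (Tob C \<delta> x) Z j q" and x1: "is_x1 C \<delta> x Y i p"
  and sum1: "Plus ?K (Comp ?K i p) (Comp ?K j q) = Ident ?K (Tob C \<delta> x)"
  using x0 unfolding is_x0_def by blast
 have ip: "is_summand ?K (Tob C \<delta> x) Y i p" using x1 by (simp add: is_x1_def)
 let ?X = "Tob C \<delta> x"
 have h: "j \<in> Hom ?K Z ?X" "q \<in> Hom ?K ?X Z" "i \<in> Hom ?K Y ?X" "p \<in> Hom ?K ?X Y"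
  "Comp ?K q j = Ident ?K Z" "Comp ?K p i = Ident ?K Y"
  using jq ip by (auto simp: is_summand_def)
 have XO: "?X \<in> Obj ?K"
 proof -
  have "j \<in> Arr ?K" "Cod ?K j = ?X" using h(1) by (simp_all add: Hom_def)
  thus ?thesis using K.cod_obj by metis
 qed
 define E' where "E' = Comp ?K j q"
 have E'h: "E' \<in> Hom ?K ?X ?X" unfolding E'_def by (rule K.comp_hom[OF h(2,1)])
 have iph: "Comp ?K i p \<in> Hom ?K ?X ?X" by (rule K.comp_hom[OF h(4,3)])
 \<comment> \<open>Since i p i = i, composing the decomposition of the identity with
   \<open>i\<close> gives i + E' i = i, from which \<open>i\<close> is cancelled by adding its
   negative.\<close>
 have E'i: "Comp ?K E' i = Zero ?K Y ?X"
 proof -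
  let ?u = "Comp ?K E' i" and ?m = "Scale ?K (-1) i"
  note uh = K.comp_hom[OF h(3) E'h] and mh = K.scale_hom[OF h(3), of "-1"]
  have "Comp ?K (Plus ?K (Comp ?K i p) E') i = i"
   using sum1 K.ident_comp[OF h(3)] by (simp add: E'_def)
  hence "Plus ?K (Comp ?K (Comp ?K i p) i) ?u = i" using K.comp_plus_left[OF h(3) iph E'h] by simp
  moreover have "Comp ?K (Comp ?K i p) i = i"
   using K.comp_assoc[OF h(3,4,3)] h(6) K.comp_ident[OF h(3)] by simp
  ultimately have e: "Plus ?K i ?u = i" by simp
  have z: "Plus ?K ?m i = Zero ?K Y ?X"
   using K.plus_scale[OF h(3), of "-1" 1] K.scale_one[OF h(3)] K.scale_zero[OF h(3)] by simp
  have "Plus ?K (Plus ?K ?m i) ?u = Plus ?K ?m i" using K.plus_assoc[OF mh h(3) uh] e by simp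
  thus ?thesis unfolding z using K.zero_plus[OF uh] by simp
 qed
 obtain F where E'F: "E' = (?X, mk [x] [x] F, ?X)" "T.ents [x] [x] F"
  using E'h KH[OF O(2) O(2)] unfolding Tob_def by blast
 define E where "E = F 0 0"
 have E: "E \<in> hom x x" using T.entsD(1)[OF E'F(2), of 0 0] by (simp add: E_def)
 obtain zs j' q' where zs: "\<forall>z\<in>set zs. proper_subquotient z x" and jq': "is_summand ?K (Tsum C \<delta> zs) Y j' q'"
  using x1 unfolding is_x1_def by blast
 have zO: "set zs \<subseteq> Obj L" using zs subquotient_obj by (auto simp: proper_subquotient_def)
 have h': "j' \<in> Hom ?K Y (Tsum C \<delta> zs)" "q' \<in> Hom ?K (Tsum C \<delta> zs) Y" "Comp ?K q' j' = Ident ?K Y"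
  using jq' by (auto simp: is_summand_def)
 note bh = K.comp_hom[OF h'(2) h(3)] and ah = K.comp_hom[OF h(4) h'(1)]
 obtain B where B: "Comp ?K i q' = (Tsum C \<delta> zs, mk zs [x] B, ?X)" "T.ents zs [x] B"
  using bh KH[OF zO O(2)] unfolding Tob_def by blast
 obtain A where A: "Comp ?K j' p = (?X, mk [x] zs A, Tsum C \<delta> zs)" "T.ents [x] zs A"
  using ah KH[OF O(2) zO] unfolding Tob_def by blast
 \<comment> \<open>As [x]^1 is a summand of the sum over \<open>zs\<close>, its idempotent factors
   through that sum; the matrix product is a sum of composites through the single proper
   subquotients.\<close>
 define N where "N = T.fsum x x (length zs) (\<lambda>k. B 0 k oo A k 0)"
 have "Comp ?K i p = Comp ?K (Comp ?K i q') (Comp ?K j' p)"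
  using K.comp_assoc[OF h(4) h'(1) bh] K.comp_assoc[OF h'(1,2) h(3)] h'(3) K.comp_ident[OF h(3)] by simp
 also have "... = (?X, mk [x] [x] (\<lambda>k i. T.fsum ([x] ! i) ([x] ! k) (length zs) (\<lambda>j. B k j oo A j i)), ?X)"
  unfolding A(1) B(1) unfolding KD A.kar_simps T.add_Comp ..
 finally have ipN: "Comp ?K i p = (?X, mk [x] [x] (\<lambda>k i. T.fsum ([x] ! i) ([x] ! k) (length zs) (\<lambda>j. B k j oo A j i)), ?X)" .
 have AB: "proper_subquotient (zs ! k) x \<and> A k 0 \<in> hom x (zs ! k) \<and> B 0 k \<in> hom (zs ! k) x" if "k < length zs" for k
  using zs that T.entsD(1)[OF A(2), of 0 k] T.entsD(1)[OF B(2), of k 0] by simp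
 have BA: "B 0 k oo A k 0 \<in> hom x x" if "k < length zs" for k using AB[OF that] T0_comp_Hom by blast
 have Nh: "N \<in> hom x x"
  unfolding N_def by (rule T.fsum_hom) (use O(1) BA in simp_all)
 have EN: "pls N E = br (ide x)"
 proof -
  have "Plus ?K (Comp ?K i p) E' = (?X, mk [x] [x] (\<lambda>j i. if i = j then idt ([x] ! i) else zr ([x] ! i) ([x] ! j)), ?X)"
   using sum1 kobj(3)[OF O(2)] unfolding E'_def[symmetric] unfolding KD A.kar_simps Tob_def T.add_Ident by simp
  hence "mk [x] [x] (\<lambda>j i. pls (T.fsum ([x] ! i) ([x] ! j) (length zs) (\<lambda>k. B j k oo A k i)) (F j i)) =
   mk [x] [x] (\<lambda>j i. if i = j then idt ([x] ! i) else zr ([x] ! i) ([x] ! j))"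
   unfolding ipN E'F(1) unfolding KD A.kar_simps T.add_Plus by simp
  thus ?thesis unfolding T.mk_eq_iff by (simp add: N_def E_def)
 qed
 \<comment> \<open>Such an \<open>f\<close> factors through [x]^1, which \<open>E'\<close>
   annihilates.\<close>
 have kill: "E oo f = zr z x" if z: "proper_subquotient z x" and f: "f \<in> hom z x" for z f
 proof -
  have zO: "set [z] \<subseteq> Obj L" using z subquotient_obj by (auto simp: proper_subquotient_def)
  let ?f = "(Tob C \<delta> z, mk [z] [x] (\<lambda>_ _. f), ?X)"
  have fe: "T.ents [z] [x] (\<lambda>_ _. f)" by (rule T.entsI) (use zO O f in auto)
  have fh: "?f \<in> Hom ?K (Tob C \<delta> z) ?X" using KH[OF zO O(2)] fe unfolding Tob_def by blast
  hence "Defs.factors_through ?K ?f i" using x1 z unfolding is_x1_def by blast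
  then obtain u where u: "u \<in> Hom ?K (Tob C \<delta> z) Y" "?f = Comp ?K i u"
   using fh h(3) unfolding factors_through_def by (auto simp: Hom_def)
  have "Comp ?K E' ?f = Zero ?K (Tob C \<delta> z) ?X"
   unfolding u(2) using K.comp_assoc[OF u(1) h(3) E'h] E'i K.comp_zero(2)[OF u(1) XO] by simp
  hence "mk [z] [x] (\<lambda>k i. T.fsum ([z] ! i) ([x] ! k) (length [x]) (\<lambda>j. F k j oo f)) = mk [z] [x] (\<lambda>j i. zr ([z] ! i) ([x] ! j))"
   unfolding E'F(1) unfolding KD A.kar_simps T.add_Comp kobj(2)[OF zO, folded Tob_def] kobj(2)[OF O(2), folded Tob_def] T.add_Zero by simp
  hence "T.fsum z x 1 (\<lambda>j. F 0 j oo f) = zr z x" unfolding T.mk_eq_iff by simp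
  moreover have "T.fsum z x 1 (\<lambda>j. F 0 j oo f) = F 0 0 oo f"
   by (rule T.fsum_single) (use zO O f E T0_comp_Hom in \<open>auto simp: E_def\<close>)
  ultimately show ?thesis by (simp add: E_def)
 qed
 have trE: "cat_trace L (br g oo E) = phi x g"
  by (rule trace_complement[OF g E Nh EN kill N_def AB])
 have bg: "br g \<in> hom x x" using ig by (auto intro: br_Hom)
 have be: "T.ents [x] [x] (\<lambda>_ _. br g)" by (rule T.entsI) (use O bg in auto)
 have TB: "Tbr C \<delta> g = (?X, mk [x] [x] (\<lambda>_ _. br g), ?X)"
  unfolding Tbr_def mk_def using ig by (auto intro!: eq_matI)
 have gh: "Tbr C \<delta> g \<in> Hom ?K ?X ?X" unfolding TB using KH[OF O(2) O(2)] be unfolding Tob_def by blast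
 note gjh = K.comp_hom[OF h(1) gh]
 show "Comp ?K q (Comp ?K (Tbr C \<delta> g) j) \<in> Hom ?K Z Z" by (rule K.comp_hom[OF gjh h(2)])
 have "cat_trace ?K (Comp ?K q (Comp ?K (Tbr C \<delta> g) j)) = cat_trace ?K (Comp ?K (Comp ?K (Tbr C \<delta> g) j) q)"
  using A.kar_trace_cyclic gjh h(2) unfolding KD by blast
 also have "Comp ?K (Comp ?K (Tbr C \<delta> g) j) q = Comp ?K (Tbr C \<delta> g) E'"
  unfolding E'_def by (rule K.comp_assoc[OF h(2,1) gh, symmetric])
 also have "... = (?X, mk [x] [x] (\<lambda>k i. T.fsum ([x] ! i) ([x] ! k) (length [x]) (\<lambda>j. br g oo F j i)), ?X)"
  unfolding TB E'F(1) unfolding KD A.kar_simps T.add_Comp ..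
 also have "cat_trace ?K ... = cat_trace ?A (mk [x] [x] (\<lambda>k i. T.fsum ([x] ! i) ([x] ! k) (length [x]) (\<lambda>j. br g oo F j i)))"
  unfolding KD
 proof (rule A.kar_trace)
  show "?X \<in> kar_objs ?A" using kobj(1)[OF O(2)] by (simp add: Tob_def)
  have "Comp ?K (Tbr C \<delta> g) E' \<in> Hom ?K ?X ?X" by (rule K.comp_hom[OF E'h gh])
  thus "(?X, mk [x] [x] (\<lambda>k i. T.fsum ([x] ! i) ([x] ! k) (length [x]) (\<lambda>j. br g oo F j i)), ?X) \<in> Hom (kar_compl ?A) ?X ?X"
   unfolding TB E'F(1) unfolding KD A.kar_simps T.add_Comp .
 qed
 also have "... = cat_trace L (T.fsum x x 1 (\<lambda>j. br g oo F j 0))"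
  using T.add_trace[OF T.ents_comp[OF E'F(2) be]] by simp
 also have "T.fsum x x 1 (\<lambda>j. br g oo F j 0) = br g oo E"
  using T.fsum_single[of x x 0 1 "\<lambda>j. br g oo F j 0"] O(1) T0_comp_Hom[OF E bg] by (simp add: E_def)
 finally show "cat_trace ?K (Comp ?K q (Comp ?K (Tbr C \<delta> g) j)) = phi x g" using trE by simp
qed

end

section \<open>Traces and isotypic decompositions\<close>

lemma (in lin_category) lsum_additive:
 fixes F :: "'m \<Rightarrow> 'c :: comm_monoid_add"
 assumes "ob x" "ob y" "set fs \<subseteq> hom x y" "F (zr x y) = 0"
  and "\<And>f g. f \<in> hom x y ==> g \<in> hom x y ==> F (pls f g) = F f + F g"
 shows "F (lsum L x y fs) = sum_list (map F fs)"
 using assms(3)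
proof (induction fs)
 case Nil
 thus ?case using assms(4) by (simp add: lsum_def)
next
 case (Cons f fs)
 have "lsum L x y (f # fs) = pls f (lsum L x y fs)" by (simp add: lsum_def)
 thus ?case using Cons assms(5)[of f "lsum L x y fs"] lsum_hom[OF assms(1,2), of fs] by simp
qed

context tensor_category
begin

text \<open>The identity of \<open>Z\<close> is the sum of the idempotents of all copies. Cyclicity
  turns the part of one copy into the trace of \<pi> (act g) \<iota>, of which orthogonality leaves
  a diagonal entry of the representing matrix times the dimension; the diagonal entries add up to
  the character.\<close>

lemma isotypic_trace:
 assumes dec: "isotypic_decomposition KL G act Z \<chi>s n \<rho> W \<iota> \<pi>" and g: "g \<in> carrier G" "act g \<in> Hom KL Z Z"
 shows "cat_trace KL (act g) = (\<Sum>\<chi>\<in>set \<chi>s. \<chi> g * cat_dim KL (W \<chi>))"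
proof -
 interpret K: lin_category KL by (rule kar_lin_category)
 have d: "distinct \<chi>s"
  and irr: "\<And>\<chi>. \<chi> \<in> set \<chi>s ==> is_irrep G (n \<chi>) (\<rho> \<chi>) \<and> rep_char G (\<rho> \<chi>) = \<chi> \<and> W \<chi> \<in> Obj KL"
  and hom: "\<And>\<chi> a. \<chi> \<in> set \<chi>s ==> a < n \<chi> ==> \<iota> \<chi> a \<in> Hom KL (W \<chi>) Z \<and> \<pi> \<chi> a \<in> Hom KL Z (W \<chi>)"
  and orth: "\<And>\<chi> \<psi> a b. \<chi> \<in> set \<chi>s ==> \<psi> \<in> set \<chi>s ==> a < n \<chi> ==> b < n \<psi> ==>
   Comp KL (\<pi> \<chi> a) (\<iota> \<psi> b) = (if \<chi> = \<psi> \<and> a = b then Ident KL (W \<chi>) else Zero KL (W \<psi>) (W \<chi>))"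
  and idl: "lsum KL Z Z (concat (map (\<lambda>\<chi>. map (\<lambda>a. Comp KL (\<iota> \<chi> a) (\<pi> \<chi> a)) [0..<n \<chi>]) \<chi>s)) = Ident KL Z"
  and acts: "\<And>\<chi> a. \<chi> \<in> set \<chi>s ==> a < n \<chi> ==>
   Comp KL (act g) (\<iota> \<chi> a) = lsum KL (W \<chi>) Z (map (\<lambda>b. Scale KL (\<rho> \<chi> g $$ (b, a)) (\<iota> \<chi> b)) [0..<n \<chi>])"
  using dec g(1) unfolding isotypic_decomposition_def by blast+
 have ZO: "Z \<in> Obj KL" using g(2) by (auto simp: kar_Hom kar_simps)
 have entry: "cat_trace KL (Comp KL (act g) (Comp KL (\<iota> \<chi> a) (\<pi> \<chi> a))) = \<rho> \<chi> g $$ (a, a) * cat_dim KL (W \<chi>)"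
  if c: "\<chi> \<in> set \<chi>s" "a < n \<chi>" for \<chi> a
 proof -
  note h = conjunct1[OF hom[OF c]] conjunct2[OF hom[OF c]] and WO = conjunct2[OF conjunct2[OF irr[OF c(1)]]]
  let ?F = "\<lambda>f. cat_trace KL (Comp KL (\<pi> \<chi> a) f)"
  have sc: "?F (Scale KL k (\<iota> \<chi> b)) = (if a = b then k * cat_dim KL (W \<chi>) else 0)" if b: "b < n \<chi>" for k b
  proof -
   note hb = conjunct1[OF hom[OF c(1) b]]
   have "?F (Scale KL k (\<iota> \<chi> b)) = k * ?F (\<iota> \<chi> b)"
    unfolding K.comp_scale_right[OF hb h(2)] by (rule kar_trace_lin(2)[OF K.comp_hom[OF hb h(2)]])
   also have "?F (\<iota> \<chi> b) = (if a = b then cat_dim KL (W \<chi>) else 0)"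
    unfolding orth[OF c(1,1,2) b] using kar_trace_lin(3)[OF K.ident_hom[OF WO]] by (simp add: cat_dim_def)
   finally show ?thesis by simp
  qed
  have "Comp KL (act g) (Comp KL (\<iota> \<chi> a) (\<pi> \<chi> a)) = Comp KL (Comp KL (act g) (\<iota> \<chi> a)) (\<pi> \<chi> a)"
   by (rule K.comp_assoc[OF h(2,1) g(2)])
  hence "cat_trace KL (Comp KL (act g) (Comp KL (\<iota> \<chi> a) (\<pi> \<chi> a))) = ?F (Comp KL (act g) (\<iota> \<chi> a))"
   using kar_trace_cyclic[OF h(2) K.comp_hom[OF h(1) g(2)]] by simp
  also have "... = sum_list (map ?F (map (\<lambda>b. Scale KL (\<rho> \<chi> g $$ (b, a)) (\<iota> \<chi> b)) [0..<n \<chi>]))"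
   unfolding acts[OF c]
  proof (rule K.lsum_additive[where F = ?F, OF WO ZO])
   show "set (map (\<lambda>b. Scale KL (\<rho> \<chi> g $$ (b, a)) (\<iota> \<chi> b)) [0..<n \<chi>]) \<subseteq> Hom KL (W \<chi>) Z"
   proof -
    have "Scale KL (\<rho> \<chi> g $$ (b, a)) (\<iota> \<chi> b) \<in> Hom KL (W \<chi>) Z" if "b < n \<chi>" for b
     by (rule K.scale_hom) (rule conjunct1[OF hom[OF c(1) that]])
    thus ?thesis by auto
   qed
   show "?F (Zero KL (W \<chi>) Z) = 0"
    using K.comp_zero(1)[OF h(2) WO] kar_trace_lin(3)[OF K.ident_hom[OF WO]] by simp
   fix u v assume uv: "u \<in> Hom KL (W \<chi>) Z" "v \<in> Hom KL (W \<chi>) Z"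
   show "?F (Plus KL u v) = ?F u + ?F v"
    unfolding K.comp_plus_right[OF uv h(2)]
    by (rule kar_trace_lin(1)[OF K.comp_hom[OF uv(1) h(2)] K.comp_hom[OF uv(2) h(2)]])
  qed
  also have "... = (\<Sum>b<n \<chi>. if a = b then \<rho> \<chi> g $$ (b, a) * cat_dim KL (W \<chi>) else 0)"
   using sc by (simp add: interv_sum_list_conv_sum_set_nat atLeast0LessThan)
  finally show ?thesis using c(2) by simp
 qed
 have "cat_trace KL (act g) = cat_trace KL (Comp KL (act g) (Ident KL Z))" using K.comp_ident[OF g(2)] by simp
 also have "... = sum_list (map (\<lambda>f. cat_trace KL (Comp KL (act g) f))
   (concat (map (\<lambda>\<chi>. map (\<lambda>a. Comp KL (\<iota> \<chi> a) (\<pi> \<chi> a)) [0..<n \<chi>]) \<chi>s)))"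
  unfolding idl[symmetric]
 proof (rule K.lsum_additive[where F = "\<lambda>f. cat_trace KL (Comp KL (act g) f)", OF ZO ZO])
  show "set (concat (map (\<lambda>\<chi>. map (\<lambda>a. Comp KL (\<iota> \<chi> a) (\<pi> \<chi> a)) [0..<n \<chi>]) \<chi>s)) \<subseteq> Hom KL Z Z"
  proof -
   have "Comp KL (\<iota> \<chi> a) (\<pi> \<chi> a) \<in> Hom KL Z Z" if "\<chi> \<in> set \<chi>s" "a < n \<chi>" for \<chi> a
    using hom[OF that] K.comp_hom by blast
   thus ?thesis by auto
  qed
  show "cat_trace KL (Comp KL (act g) (Zero KL Z Z)) = 0"
   using K.comp_zero(1)[OF g(2) ZO] kar_trace_lin(3)[OF g(2)] by simp
  fix u v assume uv: "u \<in> Hom KL Z Z" "v \<in> Hom KL Z Z"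
  show "cat_trace KL (Comp KL (act g) (Plus KL u v)) = cat_trace KL (Comp KL (act g) u) + cat_trace KL (Comp KL (act g) v)"
   unfolding K.comp_plus_right[OF uv g(2)]
   by (rule kar_trace_lin(1)[OF K.comp_hom[OF uv(1) g(2)] K.comp_hom[OF uv(2) g(2)]])
 qed
 also have "... = (\<Sum>\<chi>\<leftarrow>\<chi>s. \<Sum>a<n \<chi>. cat_trace KL (Comp KL (act g) (Comp KL (\<iota> \<chi> a) (\<pi> \<chi> a))))"
  by (induction \<chi>s) (simp_all add: interv_sum_list_conv_sum_set_nat atLeast0LessThan comp_def)
 also have "... = (\<Sum>\<chi>\<in>set \<chi>s. \<Sum>a<n \<chi>. cat_trace KL (Comp KL (act g) (Comp KL (\<iota> \<chi> a) (\<pi> \<chi> a))))"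
  by (rule sum_list_distinct_conv_sum_set[OF d])
 also have "... = (\<Sum>\<chi>\<in>set \<chi>s. \<chi> g * cat_dim KL (W \<chi>))"
 proof (rule sum.cong[OF refl])
  fix \<chi> assume c: "\<chi> \<in> set \<chi>s"
  have r: "\<rho> \<chi> g \<in> carrier_mat (n \<chi>) (n \<chi>)" using irr[OF c] g(1) by (auto simp: is_irrep_def is_rep_def)
  have "\<chi> g = rep_char G (\<rho> \<chi>) g" using irr[OF c] by simp
  also have "... = (\<Sum>a<n \<chi>. \<rho> \<chi> g $$ (a, a))" using r g(1) by (simp add: rep_char_def)
  finally show "(\<Sum>a<n \<chi>. cat_trace KL (Comp KL (act g) (Comp KL (\<iota> \<chi> a) (\<pi> \<chi> a)))) = \<chi> g * cat_dim KL (W \<chi>)"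
   using entry[OF c] by (simp add: sum_distrib_right)
 qed
 finally show ?thesis .
qed

end

section \<open>Orthogonality of characters\<close>

text \<open>Entrywise and with explicit dimensions, so that the shape of the sum does not depend on
  the index set.\<close>

definition msum :: "'g set \<Rightarrow> nat \<Rightarrow> nat \<Rightarrow> ('g \<Rightarrow> 'k :: field mat) \<Rightarrow> 'k mat" where
 "msum S n m F = mat n m (\<lambda>(i, j). \<Sum>g\<in>S. F g $$ (i, j))"

lemma msum_carrier [simp]: "msum S n m F \<in> carrier_mat n m"
 by (simp add: msum_def)

lemma mult_entry:
 assumes "A \<in> carrier_mat n k" "B \<in> carrier_mat k m" "i < n" "j < m"
 shows "(A * B) $$ (i, j) = (\<Sum>l<k. A $$ (i, l) * B $$ (l, j))"
 using assms by (auto simp: scalar_prod_def atLeast0LessThan)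

lemma mult_msum:
 assumes A: "A \<in> carrier_mat k n" and F: "\<And>g. g \<in> S ==> F g \<in> carrier_mat n m"
 shows "A * msum S n m F = msum S k m (\<lambda>g. A * F g)"
proof (rule eq_matI)
 fix i j assume "i < dim_row (msum S k m (\<lambda>g. A * F g))" "j < dim_col (msum S k m (\<lambda>g. A * F g))"
 hence ij: "i < k" "j < m" by (simp_all add: msum_def)
 have "(A * msum S n m F) $$ (i, j) = (\<Sum>l<n. \<Sum>g\<in>S. A $$ (i, l) * F g $$ (l, j))"
  using mult_entry[OF A msum_carrier ij] ij by (simp add: msum_def sum_distrib_left)
 also have "... = (\<Sum>g\<in>S. (A * F g) $$ (i, j))"
  by (subst sum.swap) (simp add: mult_entry[OF A F ij])
 finally show "(A * msum S n m F) $$ (i, j) = msum S k m (\<lambda>g. A * F g) $$ (i, j)" using ij by (simp add: msum_def)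
qed (use A in \<open>auto simp: msum_def\<close>)

lemma msum_mult:
 assumes A: "A \<in> carrier_mat m k" and F: "\<And>g. g \<in> S ==> F g \<in> carrier_mat n m"
 shows "msum S n m F * A = msum S n k (\<lambda>g. F g * A)"
proof (rule eq_matI)
 fix i j assume "i < dim_row (msum S n k (\<lambda>g. F g * A))" "j < dim_col (msum S n k (\<lambda>g. F g * A))"
 hence ij: "i < n" "j < k" by (simp_all add: msum_def)
 have "(msum S n m F * A) $$ (i, j) = (\<Sum>l<m. \<Sum>g\<in>S. F g $$ (i, l) * A $$ (l, j))"
  using mult_entry[OF msum_carrier A ij] ij by (simp add: msum_def sum_distrib_right)
 also have "... = (\<Sum>g\<in>S. (F g * A) $$ (i, j))"
  by (subst sum.swap) (simp add: mult_entry[OF F A ij])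
 finally show "(msum S n m F * A) $$ (i, j) = msum S n k (\<lambda>g. F g * A) $$ (i, j)" using ij by (simp add: msum_def)
qed (use A in \<open>auto simp: msum_def\<close>)

definition mtr :: "'k :: field mat \<Rightarrow> 'k" where
 "mtr A = (\<Sum>i<dim_row A. A $$ (i, i))"

lemma mtr_comm:
 assumes "A \<in> carrier_mat n m" "B \<in> carrier_mat m n"
 shows "mtr (A * B) = mtr (B * A)"
proof -
 have "mtr (A * B) = (\<Sum>i<n. \<Sum>l<m. A $$ (i, l) * B $$ (l, i))"
  unfolding mtr_def using mult_entry[OF assms] assms by simp
 also have "... = (\<Sum>l<m. \<Sum>i<n. B $$ (l, i) * A $$ (i, l))"
  by (subst sum.swap) (simp add: mult.commute)
 also have "... = mtr (B * A)"
  unfolding mtr_def using mult_entry[OF assms(2,1)] assms by simp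
 finally show ?thesis .
qed

section \<open>Intertwiners and Schur's lemma\<close>

definition intertwiner :: "('g, 'b) monoid_scheme \<Rightarrow> ('g \<Rightarrow> 'k :: field mat) \<Rightarrow> ('g \<Rightarrow> 'k mat) \<Rightarrow> 'k mat \<Rightarrow> bool" where
 "intertwiner G \<rho> \<sigma> T \<longleftrightarrow> (\<forall>g\<in>carrier G. \<rho> g * T = T * \<sigma> g)"

lemma is_repD:
 assumes "is_rep G n \<rho>"
 shows "g \<in> carrier G ==> \<rho> g \<in> carrier_mat n n" "\<rho> \<one>\<^bsub>G\<^esub> = 1\<^sub>m n"
  "g \<in> carrier G ==> h \<in> carrier G ==> \<rho> (g \<otimes>\<^bsub>G\<^esub> h) = \<rho> g * \<rho> h"
 using assms by (auto simp: is_rep_def)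

text \<open>Left multiplication by \<open>h\<close> permutes the summands and passes to the right
  factor as \<open>\<sigma> h\<close>.\<close>

lemma (in group) average_intertwiner:
 assumes \<rho>: "is_rep G n \<rho>" and \<sigma>: "is_rep G m \<sigma>" and X: "X \<in> carrier_mat n m"
 shows "intertwiner G \<rho> \<sigma> (msum (carrier G) n m (\<lambda>g. \<rho> g * X * \<sigma> (inv g)))"
 unfolding intertwiner_def
proof
 fix h assume h: "h \<in> carrier G"
 note r = is_repD[OF \<rho>] and s = is_repD[OF \<sigma>]
 let ?F = "\<lambda>g. \<rho> g * X * \<sigma> (inv g)"
 have F: "?F g \<in> carrier_mat n m" if "g \<in> carrier G" for g using r(1)[OF that] s(1)[OF inv_closed[OF that]] X by auto
 have e: "\<rho> h * ?F g = ?F (h \<otimes> g) * \<sigma> h" if g: "g \<in> carrier G" for g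
 proof -
  have "\<sigma> (inv (h \<otimes> g)) * \<sigma> h = \<sigma> (inv g)"
   using s(3)[of "inv (h \<otimes> g)" h] g h by (simp add: inv_mult_group m_assoc)
  have c: "\<rho> h \<in> carrier_mat n n" "\<rho> g \<in> carrier_mat n n" "\<sigma> h \<in> carrier_mat m m" "\<sigma> (inv g) \<in> carrier_mat m m"
   "\<sigma> (inv (h \<otimes> g)) \<in> carrier_mat m m" "\<rho> (h \<otimes> g) * X \<in> carrier_mat n m" "\<rho> g * X \<in> carrier_mat n m"
   using r(1) s(1) g h by (auto intro: mult_carrier_mat[OF _ X])
  have "?F (h \<otimes> g) * \<sigma> h = \<rho> (h \<otimes> g) * X * \<sigma> (inv g)"
   using assoc_mult_mat[OF c(6,5,3)] \<open>\<sigma> (inv (h \<otimes> g)) * \<sigma> h = \<sigma> (inv g)\<close> by simp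
  also have "... = \<rho> h * ?F g"
   using assoc_mult_mat[OF c(1,2) X] assoc_mult_mat[OF c(1,7,4)] r(3)[OF h g] by simp
  finally show ?thesis by simp
 qed
 have "\<rho> h * msum (carrier G) n m ?F = msum (carrier G) n m (\<lambda>g. \<rho> h * ?F g)"
  by (rule mult_msum[OF r(1)[OF h] F])
 also have "... = msum (carrier G) n m (\<lambda>g. ?F (h \<otimes> g) * \<sigma> h)"
  unfolding msum_def using e by (auto intro!: cong_mat sum.cong)
 also have "... = msum (carrier G) n m (\<lambda>g. ?F g * \<sigma> h)"
 proof -
  have "bij_betw (\<lambda>g. h \<otimes> g) (carrier G) (carrier G)"
   by (rule bij_betw_byWitness[where f' = "\<lambda>g. inv h \<otimes> g"]) (use h in \<open>auto simp: m_assoc[symmetric]\<close>)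
  from sum.reindex_bij_betw[OF this] show ?thesis unfolding msum_def by (auto intro!: cong_mat)
 qed
 also have "... = msum (carrier G) n m ?F * \<sigma> h" by (rule msum_mult[OF s(1)[OF h] F, symmetric])
 finally show "\<rho> h * msum (carrier G) n m ?F = msum (carrier G) n m ?F * \<sigma> h" .
qed

lemma mult_mat_vec_sub:
 fixes T :: "'k :: field mat"
 assumes "T \<in> carrier_mat n m"
 shows "is_subspace m {v \<in> carrier_vec m. T *\<^sub>v v = 0\<^sub>v n}" "is_subspace n {T *\<^sub>v v | v. v \<in> carrier_vec m}"
proof -
 show "is_subspace m {v \<in> carrier_vec m. T *\<^sub>v v = 0\<^sub>v n}"
  unfolding is_subspace_def using assms by (auto simp: mult_add_distrib_mat_vec[of _ n m] mult_mat_vec[of _ n m])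
 show "is_subspace n {T *\<^sub>v v | v. v \<in> carrier_vec m}"
  unfolding is_subspace_def
 proof (intro conjI ballI allI)
  show "0\<^sub>v n \<in> {T *\<^sub>v v | v. v \<in> carrier_vec m}" using assms by (auto intro!: exI[of _ "0\<^sub>v m"])
  fix u assume "u \<in> {T *\<^sub>v v | v. v \<in> carrier_vec m}"
  then obtain v where v: "v \<in> carrier_vec m" "u = T *\<^sub>v v" by blast
  show "k \<cdot>\<^sub>v u \<in> {T *\<^sub>v v | v. v \<in> carrier_vec m}" for k
   using v assms by (auto intro!: exI[of _ "k \<cdot>\<^sub>v v"] simp: mult_mat_vec[of _ n m])
  fix u' assume "u' \<in> {T *\<^sub>v v | v. v \<in> carrier_vec m}"
  then obtain v' where v': "v' \<in> carrier_vec m" "u' = T *\<^sub>v v'" by blast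
  show "u + u' \<in> {T *\<^sub>v v | v. v \<in> carrier_vec m}"
   using v v' assms by (auto intro!: exI[of _ "v + v'"] simp: mult_add_distrib_mat_vec[of _ n m])
 qed (use assms in auto)
qed

lemma mat_eq_vecI:
 fixes A B :: "'k :: field mat"
 assumes "A \<in> carrier_mat n m" "B \<in> carrier_mat n m" "\<And>v. v \<in> carrier_vec m ==> A *\<^sub>v v = B *\<^sub>v v"
 shows "A = B"
proof (rule eq_matI)
 fix i j assume "i < dim_row B" "j < dim_col B"
 hence ij: "i < n" "j < m" using assms by auto
 have "(D *\<^sub>v unit_vec m j) $ i = D $$ (i, j)" if "D \<in> carrier_mat n m" for D :: "'k mat"
  using that ij by simp
 thus "A $$ (i, j) = B $$ (i, j)" using assms(3)[of "unit_vec m j"] assms(1,2) by (metis unit_vec_carrier)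
qed (use assms in auto)

text \<open>Schur's lemma in the form needed here: kernel and image of \<open>T\<close> are
  invariant, so \<open>T\<close> is invertible and conjugates one representation into the
  other.\<close>

lemma irrep_intertwiner:
 fixes T :: "'k :: field mat"
 assumes \<rho>: "is_irrep G n \<rho>" and \<sigma>: "is_irrep G m \<sigma>" and T: "T \<in> carrier_mat n m" "intertwiner G \<rho> \<sigma> T" "T \<noteq> 0\<^sub>m n m"
  and g: "g \<in> carrier G"
 shows "mtr (\<rho> g) = mtr (\<sigma> g)"
proof -
 have r: "is_rep G n \<rho>" "is_rep G m \<sigma>" using \<rho> \<sigma> by (auto simp: is_irrep_def)
 note rc = is_repD(1)[OF r(1)] and sc = is_repD(1)[OF r(2)]
 have it: "\<rho> h *\<^sub>v (T *\<^sub>v v) = T *\<^sub>v (\<sigma> h *\<^sub>v v)" if "h \<in> carrier G" "v \<in> carrier_vec m" for h v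
  using assoc_mult_mat_vec[OF rc[OF that(1)] T(1) that(2)] assoc_mult_mat_vec[OF T(1) sc[OF that(1)] that(2)] T(2) that
  by (simp add: intertwiner_def)
 have nz: "\<exists>v\<in>carrier_vec m. T *\<^sub>v v \<noteq> 0\<^sub>v n"
 proof (rule ccontr)
  assume "\<not> ?thesis"
  hence "T = 0\<^sub>m n m" using T(1) by (intro mat_eq_vecI[of _ n m]) auto
  thus False using T(3) by simp
 qed
 let ?K = "{v \<in> carrier_vec m. T *\<^sub>v v = 0\<^sub>v n}" and ?I = "{T *\<^sub>v v | v. v \<in> carrier_vec m}"
 have "\<forall>h\<in>carrier G. \<forall>u\<in>?K. \<sigma> h *\<^sub>v u \<in> ?K"
 proof (intro ballI)
  fix h u assume hu: "h \<in> carrier G" "u \<in> ?K"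
  have "T *\<^sub>v (\<sigma> h *\<^sub>v u) = \<rho> h *\<^sub>v 0\<^sub>v n" using it[of h u] hu by simp
  thus "\<sigma> h *\<^sub>v u \<in> ?K" using rc[OF hu(1)] sc[OF hu(1)] hu by auto
 qed
 hence "?K = {0\<^sub>v m} \<or> ?K = carrier_vec m" using \<sigma> mult_mat_vec_sub(1)[OF T(1)] unfolding is_irrep_def by blast
 hence K: "?K = {0\<^sub>v m}" using nz by blast
 have "\<forall>h\<in>carrier G. \<forall>u\<in>?I. \<rho> h *\<^sub>v u \<in> ?I"
 proof (intro ballI)
  fix h u assume h: "h \<in> carrier G" and "u \<in> ?I"
  then obtain v where v: "v \<in> carrier_vec m" "u = T *\<^sub>v v" by blast
  show "\<rho> h *\<^sub>v u \<in> ?I" using it[OF h v(1)] v(2) mult_mat_vec_carrier[OF sc[OF h] v(1)] by blast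
 qed
 hence "?I = {0\<^sub>v n} \<or> ?I = carrier_vec n" using \<rho> mult_mat_vec_sub(2)[OF T(1)] unfolding is_irrep_def by blast
 hence I: "?I = carrier_vec n" using nz by blast
 have "\<exists>v. v \<in> carrier_vec m \<and> T *\<^sub>v v = unit_vec n i" for i
 proof -
  have "unit_vec n i \<in> ?I" unfolding I by simp
  thus ?thesis by auto
 qed
 then obtain f where f: "\<And>i. f i \<in> carrier_vec m \<and> T *\<^sub>v f i = unit_vec n i" by metis
 \<comment> \<open>The columns of \<open>S\<close> are preimages of the unit vectors, so
   \<open>S\<close> is a right inverse of \<open>T\<close>; injectivity of \<open>T\<close> makes it
   two-sided.\<close>
 define S where "S = mat m n (\<lambda>(i, j). f j $ i)"
 have S: "S \<in> carrier_mat m n" by (simp add: S_def)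
 have TS: "T * S = 1\<^sub>m n"
 proof (rule eq_matI)
  fix i j assume "i < dim_row (1\<^sub>m n)" "j < dim_col (1\<^sub>m n)"
  hence ij: "i < n" "j < n" by auto
  have "col S j = f j" using ij f[of j] by (auto simp: S_def)
  hence "(T * S) $$ (i, j) = (T *\<^sub>v f j) $ i" using ij S T(1) by simp
  thus "(T * S) $$ (i, j) = 1\<^sub>m n $$ (i, j)" using f[of j] ij by simp
 qed (use S T in auto)
 have ST: "S * T = 1\<^sub>m m"
 proof (rule mat_eq_vecI)
  fix v :: "'k vec" assume v: "v \<in> carrier_vec m"
  let ?w = "S *\<^sub>v (T *\<^sub>v v) - v"
  have Tv: "T *\<^sub>v v \<in> carrier_vec n" "S *\<^sub>v (T *\<^sub>v v) \<in> carrier_vec m" using T(1) S v by (meson mult_mat_vec_carrier)+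
  have "T *\<^sub>v ?w = T *\<^sub>v (S *\<^sub>v (T *\<^sub>v v)) - T *\<^sub>v v" by (rule mult_minus_distrib_mat_vec[OF T(1) Tv(2) v])
  also have "T *\<^sub>v (S *\<^sub>v (T *\<^sub>v v)) = T *\<^sub>v v"
   using assoc_mult_mat_vec[OF T(1) S Tv(1)] TS Tv(1) by simp
  also have "T *\<^sub>v v - T *\<^sub>v v = 0\<^sub>v n" using Tv(1) by simp
  finally have "?w \<in> ?K" using Tv(2) v by simp
  hence "?w = 0\<^sub>v m" unfolding K by simp
  hence "S *\<^sub>v (T *\<^sub>v v) = v" using Tv(2) v S by (auto simp: vec_eq_iff)
  thus "S * T *\<^sub>v v = 1\<^sub>m m *\<^sub>v v" using assoc_mult_mat_vec[OF S T(1) v] v by simp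
 qed (use S T in auto)
 have "mtr (\<rho> g) = mtr ((\<rho> g * T) * S)" using rc[OF g] T(1) S TS by (simp add: assoc_mult_mat[of _ n n _ m _ n])
 also have "\<rho> g * T = T * \<sigma> g" using T(2) g by (simp add: intertwiner_def)
 also have "mtr ((T * \<sigma> g) * S) = mtr (S * (T * \<sigma> g))" by (rule mtr_comm[of _ n m]) (use T(1) S sc[OF g] in auto)
 also have "S * (T * \<sigma> g) = \<sigma> g" using assoc_mult_mat[OF S T(1) sc[OF g]] ST sc[OF g] by simp
 finally show ?thesis .
qed

text \<open>An eigenvalue exists over an algebraically closed field, and its eigenspace is invariant
  and nonzero, hence everything.\<close>

lemma irrep_scalar:
 fixes \<rho> :: "'g \<Rightarrow> 'k :: alg_closed_field mat"
 assumes \<rho>: "is_irrep G n \<rho>" and T: "T \<in> carrier_mat n n" "intertwiner G \<rho> \<rho> T"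
 obtains c where "T = c \<cdot>\<^sub>m 1\<^sub>m n"
proof -
 have r: "is_rep G n \<rho>" "n > 0" using \<rho> by (auto simp: is_irrep_def)
 note rc = is_repD(1)[OF r(1)]
 obtain c where "poly (char_poly T) c = 0"
  using alg_closed_imp_poly_has_root[of "char_poly T"] degree_monic_char_poly[OF T(1)] r(2) by auto
 hence "eigenvalue T c" using eigenvalue_root_char_poly[OF T(1)] by simp
 then obtain v where v: "v \<in> carrier_vec n" "v \<noteq> 0\<^sub>v n" "T *\<^sub>v v = c \<cdot>\<^sub>v v"
  using T(1) by (auto simp: eigenvalue_def eigenvector_def)
 let ?U = "{v \<in> carrier_vec n. T *\<^sub>v v = c \<cdot>\<^sub>v v}"
 have "is_subspace n ?U"
  unfolding is_subspace_def using T(1)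
  by (auto simp: mult_add_distrib_mat_vec[of _ n n] mult_mat_vec[of _ n n] smult_add_distrib_vec smult_smult_assoc mult.commute)
 moreover have "\<forall>h\<in>carrier G. \<forall>u\<in>?U. \<rho> h *\<^sub>v u \<in> ?U"
 proof (intro ballI)
  fix h u assume hu: "h \<in> carrier G" "u \<in> ?U"
  have "T *\<^sub>v (\<rho> h *\<^sub>v u) = \<rho> h *\<^sub>v (T *\<^sub>v u)"
   using assoc_mult_mat_vec[OF rc[OF hu(1)] T(1), of u] assoc_mult_mat_vec[OF T(1) rc[OF hu(1)], of u] T(2) hu
   by (simp add: intertwiner_def)
  thus "\<rho> h *\<^sub>v u \<in> ?U" using rc[OF hu(1)] hu by (auto simp: mult_mat_vec[of _ n n])
 qed
 ultimately have "?U = {0\<^sub>v n} \<or> ?U = carrier_vec n" using \<rho> unfolding is_irrep_def by blast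
 hence U: "?U = carrier_vec n" using v by blast
 have "T = c \<cdot>\<^sub>m 1\<^sub>m n"
 proof (rule mat_eq_vecI[OF T(1)])
  fix u :: "'k vec" assume u: "u \<in> carrier_vec n"
  hence "T *\<^sub>v u = c \<cdot>\<^sub>v u" using U by blast
  also have "... = (c \<cdot>\<^sub>m 1\<^sub>m n) *\<^sub>v u" using u by (intro eq_vecI) auto
  finally show "T *\<^sub>v u = (c \<cdot>\<^sub>m 1\<^sub>m n) *\<^sub>v u" .
 qed simp
 thus ?thesis by (rule that)
qed

text \<open>Around a matrix unit a product of matrices splits into a product of two entries, so
  averaging matrix units produces the sums of products of matrix coefficients.\<close>

lemma mult_unit_entry:
 assumes "A \<in> carrier_mat n n" "B \<in> carrier_mat m m" "i < n" "l < m" "j < n" "k < m"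
 shows "(A * mat n m (\<lambda>(a, b). if a = j \<and> b = k then 1 else 0) * B) $$ (i, l) = A $$ (i, j) * (B $$ (k, l) :: 'k :: field)"
proof -
 let ?X = "mat n m (\<lambda>(a, b). if a = j \<and> b = k then 1 else (0::'k))"
 have AX: "(A * ?X) $$ (i, b) = (if b = k then A $$ (i, j) else 0)" if "b < m" for b
 proof -
  have "(A * ?X) $$ (i, b) = (\<Sum>a<n. A $$ (i, a) * ?X $$ (a, b))" by (rule mult_entry[OF assms(1) _ assms(3) that]) simp
  also have "... = (\<Sum>a<n. if a = j then (if b = k then A $$ (i, j) else 0) else 0)"
   by (rule sum.cong[OF refl]) (use that in auto)
  finally show ?thesis using assms(5) by simp
 qed
 have "(A * ?X * B) $$ (i, l) = (\<Sum>b<m. (A * ?X) $$ (i, b) * B $$ (b, l))"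
  by (rule mult_entry[OF _ assms(2-4)]) (use assms(1) in auto)
 also have "... = (\<Sum>b<m. if b = k then A $$ (i, j) * B $$ (k, l) else 0)"
  by (rule sum.cong[OF refl]) (use AX in auto)
 finally show ?thesis using assms(6) by simp
qed

text \<open>The sum is a sum of entries of averaged matrix units. For different characters these
  averages vanish by Schur's lemma; for equal characters \<open>\<sigma>\<close> is replaced by
  \<open>\<rho>\<close>, so that no equivalence between the two has to be constructed, and the
  averages are scalar.\<close>

lemma (in group) character_orthogonality:
 fixes \<rho> \<sigma> :: "'a \<Rightarrow> 'k :: {alg_closed_field, field_char_0} mat"
 assumes fin: "finite (carrier G)" and \<rho>: "is_irrep G n \<rho>" and \<sigma>: "is_irrep G m \<sigma>"
 shows "(\<Sum>g\<in>carrier G. rep_char G \<rho> g * rep_char G \<sigma> (inv g)) =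
  (if rep_char G \<rho> = rep_char G \<sigma> then of_nat (card (carrier G)) else 0)"
proof -
 have char: "rep_char G \<tau> g = mtr (\<tau> g)" if "g \<in> carrier G" for \<tau> :: "'a \<Rightarrow> 'k mat" and g
  using that by (simp add: rep_char_def mtr_def)
 let ?E = "\<lambda>n m j k. mat n m (\<lambda>(a, b). if a = j \<and> b = k then 1 else (0::'k))"
 let ?T = "\<lambda>n m \<rho> \<sigma> j k. msum (carrier G) n m (\<lambda>g. \<rho> g * ?E n m j k * \<sigma> (inv g))"
 have entries: "(\<Sum>g\<in>carrier G. \<rho> g $$ (i, j) * \<sigma> (inv g) $$ (k, l)) = ?T n m \<rho> \<sigma> j k $$ (i, l)"
  if "is_rep G n \<rho>" "is_rep G m \<sigma>" "i < n" "j < n" "k < m" "l < m" for n m \<rho> \<sigma> i j k l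
  using mult_unit_entry[OF is_repD(1)[OF that(1)] is_repD(1)[OF that(2) inv_closed] that(3,6,4,5)] that(3-6)
  by (simp add: msum_def)
 have expand: "(\<Sum>g\<in>carrier G. rep_char G \<rho> g * rep_char G \<sigma> (inv g)) = (\<Sum>i<n. \<Sum>k<m. ?T n m \<rho> \<sigma> i k $$ (i, k))"
  if r: "is_rep G n \<rho>" "is_rep G m \<sigma>" for n m \<rho> \<sigma>
 proof -
  have "(\<Sum>g\<in>carrier G. rep_char G \<rho> g * rep_char G \<sigma> (inv g)) =
   (\<Sum>g\<in>carrier G. \<Sum>i<n. \<Sum>k<m. \<rho> g $$ (i, i) * \<sigma> (inv g) $$ (k, k))"
  proof (rule sum.cong[OF refl])
   fix g assume g: "g \<in> carrier G"
   show "rep_char G \<rho> g * rep_char G \<sigma> (inv g) = (\<Sum>i<n. \<Sum>k<m. \<rho> g $$ (i, i) * \<sigma> (inv g) $$ (k, k))"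
    using char[OF g] char[OF inv_closed[OF g]] is_repD(1)[OF r(1) g] is_repD(1)[OF r(2) inv_closed[OF g]]
    by (simp add: mtr_def sum_product)
  qed
  also have "... = (\<Sum>i<n. \<Sum>k<m. \<Sum>g\<in>carrier G. \<rho> g $$ (i, i) * \<sigma> (inv g) $$ (k, k))"
   by (subst sum.swap) (intro sum.cong refl sum.swap)
  also have "... = (\<Sum>i<n. \<Sum>k<m. ?T n m \<rho> \<sigma> i k $$ (i, k))"
   by (intro sum.cong refl) (simp add: entries[OF r])
  finally show ?thesis .
 qed
 have r: "is_rep G n \<rho>" "is_rep G m \<sigma>" "n > 0" using \<rho> \<sigma> by (auto simp: is_irrep_def)
 show ?thesis
 proof (cases "rep_char G \<rho> = rep_char G \<sigma>")
  case False
  have "rep_char G \<rho> = rep_char G \<sigma>" if "\<And>g. g \<in> carrier G ==> mtr (\<rho> g) = mtr (\<sigma> g)"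
   using that by (auto simp: rep_char_def mtr_def fun_eq_iff)
  hence "?T n m \<rho> \<sigma> j k = 0\<^sub>m n m" if "j < n" "k < m" for j k
   using irrep_intertwiner[OF \<rho> \<sigma> _ average_intertwiner[OF r(1,2), of "?E n m j k"]] False by fastforce
  thus ?thesis using expand[OF r(1,2)] False by simp
 next
  case True
  have T: "?T n n \<rho> \<rho> j k = (if j = k then of_nat (card (carrier G)) / of_nat n else 0) \<cdot>\<^sub>m 1\<^sub>m n" if jk: "j < n" "k < n" for j k
  proof -
   obtain c where c: "?T n n \<rho> \<rho> j k = c \<cdot>\<^sub>m 1\<^sub>m n"
    using irrep_scalar[OF \<rho> msum_carrier average_intertwiner[OF r(1,1), of "?E n n j k"]] by auto
   \<comment> \<open>The scalar is read off from the trace: \<open>\<rho> (inv g) * \<rho> g\<close>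
     is the identity, so \<open>n\<close> times the scalar is the group order if
     \<open>j = k\<close> and zero otherwise.\<close>
   have "of_nat n * c = (\<Sum>i<n. ?T n n \<rho> \<rho> j k $$ (i, i))" unfolding c by simp
   also have "... = (\<Sum>i<n. \<Sum>g\<in>carrier G. \<rho> (inv g) $$ (k, i) * \<rho> g $$ (i, j))"
    by (intro sum.cong refl) (simp add: entries[OF r(1,1) _ jk, symmetric] mult.commute)
   also have "... = (\<Sum>g\<in>carrier G. \<Sum>i<n. \<rho> (inv g) $$ (k, i) * \<rho> g $$ (i, j))" by (rule sum.swap)
   also have "... = (\<Sum>g\<in>carrier G. if j = k then 1 else 0)"
   proof (rule sum.cong[OF refl])
    fix g assume g: "g \<in> carrier G"
    have "(\<Sum>i<n. \<rho> (inv g) $$ (k, i) * \<rho> g $$ (i, j)) = (\<rho> (inv g) * \<rho> g) $$ (k, j)"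
     by (rule mult_entry[symmetric]) (use is_repD(1)[OF r(1)] g jk in auto)
    also have "\<rho> (inv g) * \<rho> g = 1\<^sub>m n" using is_repD(2,3)[OF r(1)] g by (metis inv_closed l_inv)
    finally show "(\<Sum>i<n. \<rho> (inv g) $$ (k, i) * \<rho> g $$ (i, j)) = (if j = k then 1 else 0)" using jk by auto
   qed
   finally have "of_nat n * c = (if j = k then of_nat (card (carrier G)) else 0)" by simp
   hence "c = (if j = k then of_nat (card (carrier G)) / of_nat n else 0)"
    using r(3) by (auto simp: field_simps split: if_splits)
   thus ?thesis using c by simp
  qed
  have "(\<Sum>g\<in>carrier G. rep_char G \<rho> g * rep_char G \<rho> (inv g)) = (\<Sum>i<n. \<Sum>k<n. ?T n n \<rho> \<rho> i k $$ (i, k))"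
   by (rule expand[OF r(1,1)])
  also have "... = (\<Sum>i<n. \<Sum>k<n. if i = k then of_nat (card (carrier G)) / of_nat n else 0)"
   by (intro sum.cong refl) (subst T, auto)
  also have "... = of_nat (card (carrier G))" using r(3) by simp
  finally show ?thesis using True by simp
 qed
qed

section \<open>The dimension formula\<close>

theorem theorem1p2:
 fixes A :: "('o, 'm) cat"
  and \<delta> :: "'m \<Rightarrow> 'k :: {alg_closed_field, field_char_0}"
  and x :: 'o
  and \<chi> :: "'m \<Rightarrow> 'k"
  and V :: "('o, 'm, 'k) T_obj"
 assumes "category A"
  and "finitely_complete A"
  and "regular_cat A"
  and "subobject_finite A"
  and "exact_cat A"
  and "malcev_cat A"
  and "no_proper_subobject A (term_obj A)"
  and "degree_function A \<delta>"
  and "nondegenerate A \<delta>"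
  and "x \<in> Obj A"
  and "\<chi> \<in> irr_chars (AutG A x)"
  and "is_x0_chi A \<delta> x \<chi> V"
 shows "cat_dim (TT A \<delta>) V = char_pairing (AutG A x) (chi_x0 A \<delta> x) \<chi>"
proof -
 interpret char0_setting A \<delta>
  using assms(1-8)
  by (intro char0_setting.intro malcev_setting.intro malcev_setting_axioms.intro tensor_setting.intro
    tensor_setting_axioms.intro regular_category.intro regular_category_axioms.intro
    finlim_category.intro finlim_category_axioms.intro)
 interpret T: tensor_category L by (rule T0_tensor_category)
 interpret AT: tensor_category "add_compl L" by (rule T.add_tensor_category)
 interpret G: group "AutG A x" by (rule AutG_group[OF assms(10)])
 let ?G = "carrier (AutG A x)"
 obtain Z j q \<chi>s n \<rho> W \<iota> \<pi> where x0: "is_x0 A \<delta> x Z j q"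
  and dec: "isotypic_decomposition (TT A \<delta>) (AutG A x) (\<lambda>g. Comp (TT A \<delta>) q (Comp (TT A \<delta>) (Tbr A \<delta> g) j)) Z \<chi>s n \<rho> W \<iota> \<pi>"
  and V: "V = W \<chi>"
  using assms(12) unfolding is_x0_chi_def by blast
 have irr: "set \<chi>s = irr_chars (AutG A x)"
  "\<And>\<psi>. \<psi> \<in> set \<chi>s \<Longrightarrow> is_irrep (AutG A x) (n \<psi>) (\<rho> \<psi>) \<and> rep_char (AutG A x) (\<rho> \<psi>) = \<psi>"
  using dec unfolding isotypic_decomposition_def by blast+
 have \<chi>: "\<chi> \<in> set \<chi>s" using assms(11) irr(1) by simp
 have fin: "finite ?G" using assms(10) by simp
 \<comment> \<open>The trace of \<open>g\<close> on [x]^0, computed from \<open>phi\<close> and from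
   the isotypic decomposition: \<open>phi x\<close> is a combination of irreducible characters with
   the dimensions as coefficients.\<close>
 have tr: "phi x g = (\<Sum>\<psi>\<in>set \<chi>s. \<psi> g * cat_dim (TT A \<delta>) (W \<psi>))" if g: "g \<in> ?G" for g
  using AT.isotypic_trace[OF dec[unfolded TT_def] g] x0_trace[OF x0 g] unfolding TT_def by simp
 have orth: "(\<Sum>g\<in>?G. \<psi> g * \<chi> (inv\<^bsub>AutG A x\<^esub> g)) = (if \<psi> = \<chi> then of_nat (card ?G) else 0)" if "\<psi> \<in> set \<chi>s" for \<psi>
  using G.character_orthogonality[OF fin, of "n \<psi>" "\<rho> \<psi>" "n \<chi>" "\<rho> \<chi>"] irr(2)[OF that] irr(2)[OF \<chi>] by simp
 have bij: "bij_betw (\<lambda>g. inv\<^bsub>AutG A x\<^esub> g) ?G ?G"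
  by (rule bij_betw_byWitness[where f' = "\<lambda>g. inv\<^bsub>AutG A x\<^esub> g"]) auto
 have "(\<Sum>g\<in>?G. \<chi> g * chi_x0 A \<delta> x g) = (\<Sum>g\<in>?G. \<chi> g * phi x g)"
  by (rule sum.cong[OF refl]) (simp add: phi_chi)
 \<comment> \<open>Passing to inverses and using \<open>phi_inv\<close> moves the inverse onto
   \<chi> alone, as \<open>orth\<close> requires.\<close>
 also have "... = (\<Sum>g\<in>?G. \<chi> (inv\<^bsub>AutG A x\<^esub> g) * phi x (inv\<^bsub>AutG A x\<^esub> g))"
  by (rule sum.reindex_bij_betw[OF bij, symmetric])
 also have "... = (\<Sum>g\<in>?G. \<Sum>\<psi>\<in>set \<chi>s. cat_dim (TT A \<delta>) (W \<psi>) * (\<psi> g * \<chi> (inv\<^bsub>AutG A x\<^esub> g)))"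
  by (rule sum.cong[OF refl]) (simp add: phi_inv ivt(4) tr sum_distrib_left mult_ac)
 also have "... = (\<Sum>\<psi>\<in>set \<chi>s. cat_dim (TT A \<delta>) (W \<psi>) * (\<Sum>g\<in>?G. \<psi> g * \<chi> (inv\<^bsub>AutG A x\<^esub> g)))"
  by (subst sum.swap) (simp add: sum_distrib_left)
 also have "... = (\<Sum>\<psi>\<in>set \<chi>s. if \<psi> = \<chi> then cat_dim (TT A \<delta>) (W \<psi>) * of_nat (card ?G) else 0)"
  by (rule sum.cong[OF refl]) (simp add: orth)
 also have "... = cat_dim (TT A \<delta>) V * of_nat (card ?G)" using \<chi> V by simp
 finally have s: "(\<Sum>g\<in>?G. \<chi> g * chi_x0 A \<delta> x g) = cat_dim (TT A \<delta>) V * of_nat (card ?G)" .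
 have "of_nat (card ?G) \<noteq> (0::'k)" using fin G.one_closed by (auto simp: card_eq_0_iff)
 thus ?thesis unfolding char_pairing_def s by simp
qed

end
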